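(* Let $(Y,S)$ be a finitely generated multiplicative topological dynamical system, and let $(X,T)$ be a nilsystem. If either $(X,T)$ is aperiodic or $(Y,S)$ is aperiodic, then $(X,T)$ and $(Y,S)$ are disjoint.
   Context: $\mathbb{N}=\{1,2,3,\ldots\}$; $C(X)$ denotes the continuous complex-valued functions on $X$. An additive topological dynamical system is a pair $(X,T)$ with $X$ a compact metric space and $T\colon X\to X$ continuous. A multiplicative topological dynamical system is a pair $(Y,S)$ where $Y$ is a compact metric space and $S=(S_n)_{n\in\mathbb{N}}$ is an action of $(\mathbb{N},\cdot)$ on $Y$ by continuous maps, i.e. $S_{nm}=S_n\circ S_m$ for all $n,m$. It is finitely generated if there are finitely many continuous maps $R_1,\ldots,R_d\colon Y\to Y$ with $S_p\in\{R_1,\ldots,R_d\}$ for all primes $p$. Nilsystem: $X=G/\Gamma$, where $G$ is a nilpotent Lie group and $\Gamma$ is a discrete co-compact subgroup of $G$, and $T(x)=ax$ (left multiplication) for a fixed $a\in G$. Two bounded functions $a,b\colon\mathbb{N}\to\mathbb{C}$ are asymptotically uncorrelated if $$\lim_{N\to\infty}\left(\frac1N\sum_{n=1}^N a(n)\overline{b(n)}-\Big(\frac1N\sum_{n=1}^N a(n)\Big)\Big(\frac1N\sum_{n=1}^N\overline{b(n)}\Big)\right)=0.$$ $(X,T)$ and $(Y,S)$ are disjoint if for all $x\in X$, $f\in C(X)$, $y\in Y$, $g\in C(Y)$ the sequences $a(n)=f(T^nx)$ and $b(n)=g(S_ny)$ are asymptotically uncorrelated. A function $P\colon\mathbb{N}\to\mathbb{C}$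 is periodic if there is $m\in\mathbb{N}$ with $P(n+m)=P(n)$ for all $n\in\mathbb{N}$. $(X,T)$ is aperiodic if for every periodic $P$, every $f\in C(X)$ and every $x\in X$, the sequences $P(n)$ and $f(T^nx)$ are asymptotically uncorrelated. $(Y,S)$ is aperiodic if for every periodic $P$, every $g\in C(Y)$ and every $y\in Y$, the sequences $P(n)$ and $g(S_ny)$ are asymptotically uncorrelated. *)

theory Defs
  imports
    "HOL-Analysis.Analysis"
    "HOL-Algebra.Generated_Groups"
    "HOL-Algebra.Left_Coset"
    "HOL-Computational_Algebra.Primes"
begin

section \<open>Smooth manifolds\<close>

text \<open>
  Points of \<open>\<real>\<^sup>n\<close> are functions \<open>nat \<Rightarrow> real\<close> vanishing at all indices \<open>\<ge> n\<close>, as in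
  \<^const>\<open>Euclidean_space\<close>. This keeps the dimension a natural number and admits \<open>n = 0\<close>,
  which a type-indexed \<open>real ^ 'n\<close> does not.

  \<open>C_k_on n k U f\<close>: on the open set \<open>U\<close> of \<open>\<real>\<^sup>n\<close> all partial derivatives of \<open>f\<close> of order
  at most \<open>k\<close> exist and are continuous.
\<close>

primrec C_k_on :: "nat \<Rightarrow> nat \<Rightarrow> (nat \<Rightarrow> real) set \<Rightarrow> ((nat \<Rightarrow> real) \<Rightarrow> real) \<Rightarrow> bool" where
  "C_k_on n 0 U f \<longleftrightarrow> continuous_map (subtopology (Euclidean_space n) U) euclideanreal f"
| "C_k_on n (Suc k) U f \<longleftrightarrow>
     continuous_map (subtopology (Euclidean_space n) U) euclideanreal f \<and>
     (\<forall>i<n. \<exists>g. (\<forall>x\<in>U. ((\<lambda>t. f (x(i := t))) has_real_derivative g x) (at (x i))) \<and>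
                C_k_on n k U g)"

definition smooth_between ::
    "nat \<Rightarrow> nat \<Rightarrow> (nat \<Rightarrow> real) set \<Rightarrow> ((nat \<Rightarrow> real) \<Rightarrow> (nat \<Rightarrow> real)) \<Rightarrow> bool" where
  "smooth_between n m U f \<longleftrightarrow> (\<forall>j<m. \<forall>k. C_k_on n k U (\<lambda>x. f x j))"

type_synonym 'a chart = "'a set \<times> ('a \<Rightarrow> nat \<Rightarrow> real)"

definition is_chart :: "'a topology \<Rightarrow> nat \<Rightarrow> 'a chart \<Rightarrow> bool" where
  "is_chart M n = (\<lambda>(U, \<phi>).
     openin M U \<and> openin (Euclidean_space n) (\<phi> ` U) \<and>
     homeomorphic_map (subtopology M U) (subtopology (Euclidean_space n) (\<phi> ` U)) \<phi>)"

definition smooth_atlas :: "'a topology \<Rightarrow> nat \<Rightarrow> 'a chart set \<Rightarrow> bool" where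
  "smooth_atlas M n A \<longleftrightarrow>
     (\<forall>c\<in>A. is_chart M n c) \<and>
     (\<Union>(U, \<phi>)\<in>A. U) = topspace M \<and>
     (\<forall>(U, \<phi>)\<in>A. \<forall>(V, \<psi>)\<in>A. smooth_between n n (\<phi> ` (U \<inter> V)) (\<psi> \<circ> inv_into U \<phi>))"

definition second_countable_space :: "'a topology \<Rightarrow> bool" where
  "second_countable_space M \<longleftrightarrow>
     (\<exists>\<B>. countable \<B> \<and> (\<forall>V\<in>\<B>. openin M V) \<and>
          (\<forall>U x. openin M U \<and> x \<in> U \<longrightarrow> (\<exists>V\<in>\<B>. x \<in> V \<and> V \<subseteq> U)))"

text \<open>
  The atlas need not be maximal; smoothness of maps depends only on the maximal atlas it
  generates.
\<close>

definition smooth_manifold :: "'a topology \<Rightarrow> nat \<Rightarrow> 'a chart set \<Rightarrow> bool" where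
  "smooth_manifold M n A \<longleftrightarrow>
     Hausdorff_space M \<and> second_countable_space M \<and> smooth_atlas M n A"

definition smooth_map ::
    "'a topology \<Rightarrow> nat \<Rightarrow> 'a chart set \<Rightarrow> 'b topology \<Rightarrow> nat \<Rightarrow> 'b chart set \<Rightarrow> ('a \<Rightarrow> 'b) \<Rightarrow> bool"
  where
  "smooth_map M n A N m B f \<longleftrightarrow>
     continuous_map M N f \<and>
     (\<forall>(U, \<phi>)\<in>A. \<forall>(V, \<psi>)\<in>B.
        smooth_between n m (\<phi> ` {x \<in> U. f x \<in> V}) (\<psi> \<circ> f \<circ> inv_into U \<phi>))"

text \<open>
  \<open>\<real>\<^sup>n \<times> \<real>\<^sup>m\<close> is identified with \<open>\<real>\<^sup>n\<^sup>+\<^sup>m\<close> by concatenating coordinates.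
\<close>

definition prod_chart :: "nat \<Rightarrow> 'a chart \<Rightarrow> 'b chart \<Rightarrow> ('a \<times> 'b) chart" where
  "prod_chart n = (\<lambda>(U, \<phi>) (V, \<psi>).
     (U \<times> V, \<lambda>(x, y) i. if i < n then \<phi> x i else \<psi> y (i - n)))"

definition prod_atlas :: "nat \<Rightarrow> 'a chart set \<Rightarrow> 'b chart set \<Rightarrow> ('a \<times> 'b) chart set" where
  "prod_atlas n A B = {prod_chart n c d | c d. c \<in> A \<and> d \<in> B}"


section \<open>Nilpotent Lie groups and nilsystems\<close>

definition lie_group :: "'g monoid \<Rightarrow> 'g topology \<Rightarrow> nat \<Rightarrow> 'g chart set \<Rightarrow> bool" where
  "lie_group G M n A \<longleftrightarrow>
     group G \<and> topspace M = carrier G \<and> smooth_manifold M n A \<and>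
     smooth_map (prod_topology M M) (n + n) (prod_atlas n A A) M n A
       (\<lambda>(x, y). x \<otimes>\<^bsub>G\<^esub> y) \<and>
     smooth_map M n A M n A (\<lambda>x. inv\<^bsub>G\<^esub> x)"

primrec lower_central_series :: "('a, 'b) monoid_scheme \<Rightarrow> nat \<Rightarrow> 'a set" where
  "lower_central_series G 0 = carrier G"
| "lower_central_series G (Suc k) =
     generate G (\<Union>g\<in>carrier G. \<Union>h\<in>lower_central_series G k.
       {g \<otimes>\<^bsub>G\<^esub> h \<otimes>\<^bsub>G\<^esub> inv\<^bsub>G\<^esub> g \<otimes>\<^bsub>G\<^esub> inv\<^bsub>G\<^esub> h})"

definition nilpotent_group :: "('a, 'b) monoid_scheme \<Rightarrow> bool" where
  "nilpotent_group G \<longleftrightarrow> group G \<and> (\<exists>k. lower_central_series G k = {\<one>\<^bsub>G\<^esub>})"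

text \<open>
  \<open>X\<close> is the set of left cosets \<open>g\<Gamma>\<close> with the quotient topology, which the
  \<^const>\<open>quotient_map\<close> clause determines uniquely.
\<close>

definition nilsystem :: "'g set topology \<Rightarrow> ('g set \<Rightarrow> 'g set) \<Rightarrow> bool" where
  "nilsystem X T \<longleftrightarrow>
     (\<exists>(G :: 'g monoid) M n A \<Gamma> a.
        lie_group G M n A \<and> nilpotent_group G \<and>
        subgroup \<Gamma> G \<and> subtopology M \<Gamma> = discrete_topology \<Gamma> \<and>
        topspace X = lcosets\<^bsub>G\<^esub> \<Gamma> \<and>
        quotient_map M X (\<lambda>g. g <#\<^bsub>G\<^esub> \<Gamma>) \<and>
        compact_space X \<and>
        a \<in> carrier G \<and> (\<forall>x\<in>topspace X. T x = a <#\<^bsub>G\<^esub> x))"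


section \<open>Multiplicative systems, disjointness and aperiodicity\<close>

text \<open>
  Sequences indexed by \<open>{1, 2, 3, \<dots>}\<close> are functions on \<^typ>\<open>nat\<close> whose value at \<open>0\<close> is
  never used. Compact metric spaces enter only through their topology.
\<close>

definition multiplicative_tds :: "'y topology \<Rightarrow> (nat \<Rightarrow> 'y \<Rightarrow> 'y) \<Rightarrow> bool" where
  "multiplicative_tds Y S \<longleftrightarrow>
     compact_space Y \<and> metrizable_space Y \<and>
     (\<forall>n\<ge>1. continuous_map Y Y (S n)) \<and>
     (\<forall>n\<ge>1. \<forall>m\<ge>1. \<forall>y\<in>topspace Y. S (n * m) y = S n (S m y))"

definition finitely_generated :: "'y topology \<Rightarrow> (nat \<Rightarrow> 'y \<Rightarrow> 'y) \<Rightarrow> bool" where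
  "finitely_generated Y S \<longleftrightarrow>
     (\<exists>R. finite R \<and> (\<forall>r\<in>R. continuous_map Y Y r) \<and>
          (\<forall>p::nat. prime p \<longrightarrow> (\<exists>r\<in>R. \<forall>y\<in>topspace Y. S p y = r y)))"

definition asymptotically_uncorrelated :: "(nat \<Rightarrow> complex) \<Rightarrow> (nat \<Rightarrow> complex) \<Rightarrow> bool" where
  "asymptotically_uncorrelated a b \<longleftrightarrow>
     (\<lambda>N. (1 / of_nat N) * (\<Sum>n=1..N. a n * cnj (b n)) -
          ((1 / of_nat N) * (\<Sum>n=1..N. a n)) * ((1 / of_nat N) * (\<Sum>n=1..N. cnj (b n))))
       \<longlonglongrightarrow> 0"

definition disjoint_systems ::
    "'x topology \<Rightarrow> ('x \<Rightarrow> 'x) \<Rightarrow> 'y topology \<Rightarrow> (nat \<Rightarrow> 'y \<Rightarrow> 'y) \<Rightarrow> bool" where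
  "disjoint_systems X T Y S \<longleftrightarrow>
     (\<forall>x\<in>topspace X. \<forall>f. continuous_map X euclidean f \<longrightarrow>
       (\<forall>y\<in>topspace Y. \<forall>g. continuous_map Y euclidean g \<longrightarrow>
         asymptotically_uncorrelated (\<lambda>n. f ((T ^^ n) x)) (\<lambda>n. g (S n y))))"

definition periodic_sequence :: "(nat \<Rightarrow> complex) \<Rightarrow> bool" where
  "periodic_sequence P \<longleftrightarrow> (\<exists>m\<ge>1. \<forall>n\<ge>1. P (n + m) = P n)"

definition additive_aperiodic :: "'x topology \<Rightarrow> ('x \<Rightarrow> 'x) \<Rightarrow> bool" where
  "additive_aperiodic X T \<longleftrightarrow>
     (\<forall>P. periodic_sequence P \<longrightarrow>
       (\<forall>f. continuous_map X euclidean f \<longrightarrow>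
         (\<forall>x\<in>topspace X. asymptotically_uncorrelated P (\<lambda>n. f ((T ^^ n) x)))))"

definition multiplicative_aperiodic :: "'y topology \<Rightarrow> (nat \<Rightarrow> 'y \<Rightarrow> 'y) \<Rightarrow> bool" where
  "multiplicative_aperiodic Y S \<longleftrightarrow>
     (\<forall>P. periodic_sequence P \<longrightarrow>
       (\<forall>g. continuous_map Y euclidean g \<longrightarrow>
         (\<forall>y\<in>topspace Y. asymptotically_uncorrelated P (\<lambda>n. g (S n y)))))"

end

theory Submission
  imports Defs "HOL-Computational_Algebra.Squarefree"
begin

text \<open>
  Katai's criterion: if \<open>c\<close> is bounded and the averages of \<open>c (p n) cnj (c (q n))\<close> tend to \<open>0\<close> for all
  distinct primes \<open>p\<close>, \<open>q\<close>, then \<open>c\<close> is uncorrelated with every bounded \<open>b\<close> for which the sequences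
  \<open>n \<mapsto> b (p n)\<close>, \<open>p\<close> prime, form a finite family. Both \<open>b n = g (S n y)\<close> and periodic sequences are of
  this kind. So it suffices to approximate \<open>f (T^n x)\<close> uniformly by a periodic sequence \<open>P\<close> plus finitely many
  such \<open>c\<close>: if \<open>(Y, S)\<close> is aperiodic, \<open>P\<close> is uncorrelated with \<open>b\<close>; if \<open>(X, T)\<close> is aperiodic, \<open>P\<close> has small
  variance.

  For the approximation, pass to a minimal closed cocompact subgroup \<open>H\<close> containing the translation \<open>\<tau>\<close>. It
  exists because in a Lie group the consecutive differences of a decreasing chain of closed subgroups stay away
  from the identity. By minimality \<open>\<tau>\<close> and any neighbourhood of the identity generate \<open>H\<close>, while \<open>\<tau>\<close>, the
  commutator subgroup and \<open>\<Gamma>\<close> generate a dense subgroup. Going up the lower central series, decompose \<open>f\<close> into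
  eigenfunctions of its last nontrivial term \<open>L j\<close>, using the characters of totally bounded abelian groups, which
  are found by maximising a quadratic functional over positive definite functions. An eigenfunction whose
  character \<open>\<omega>\<close> is trivial lives one level lower. If \<open>\<omega>\<close> is nontrivial and \<open>j \<ge> 1\<close>, then so is the
  character \<open>\<omega>^(p^(j+1)) cnj \<omega>^(q^(j+1))\<close>, because \<open>\<omega>\<close> cannot have finite order, and the van der Corput
  inequality and induction on \<open>j\<close> give the correlation condition of Katai's criterion.
\<close>

subsection \<open>Multiplicative correlations\<close>

text \<open>\<open>G\<close> may be disconnected and \<open>\<tau>\<close> need not act ergodically,
  so at any level a nontrivial character could be trivial near the identity, or of finite order. In
  the minimal subgroup this is confined to level 0, where finite order yields periodic sequences; at
  higher levels a character that is trivial near the identity is trivial. Instead of Haar measure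
  there is von Neumann's mean. A term of the lower central series modulo the next one acts on the
  function at hand as an abelian group that is totally bounded for a sup-norm pseudometric; no
  completion is formed, so characters have to be produced by an extremal problem on a set of
  functions that is compact for pointwise convergence. The exponents \<open>p^(j+1)\<close> come
  from dilating a point of the square by \<open>(g^(p^j), g^(q^j))\<close> with \<open>g\<close> of
  level \<open>j - 1\<close>: exchanging this with the translation by
  \<open>(\<tau>^p, \<tau>^q)\<close> costs the powers \<open>p^(j+1)\<close> and
  \<open>q^(j+1)\<close> of \<open>[\<tau>, g]\<close>. Thus a condition of the same form recurs at
  every level.\<close>

lemma sum_multiples:
 fixes u :: "nat => 'a::comm_semiring_1"
 assumes "d > 0"
 shows "(\<Sum>n=1..N. of_bool (d dvd n) * u n) = (\<Sum>m=1..N div d. u (d * m))"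
proof -
 have "(\<Sum>n=1..N. of_bool (d dvd n) * u n) = (\<Sum>n\<in>{n\<in>{1..N}. d dvd n}. u n)"
  by (intro sum.mono_neutral_cong_right) auto
 also have "\<dots> = (\<Sum>m=1..N div d. u (d * m))"
 proof (rule sum.reindex_bij_betw[symmetric, of "%m. d * m"], rule bij_betwI[where g="%n. n div d"])
  show "(%m. d * m) \<in> {1..N div d} \<rightarrow> {n \<in> {1..N}. d dvd n}"
  proof (rule funcsetI)
   fix m assume "m \<in> {1..N div d}"
   then have m: "Suc 0 <= m" "m <= N div d" by auto
   have "d * m <= d * (N div d)" using m by simp
   also have "\<dots> <= N" by simp
   finally show "d * m \<in> {n \<in> {1..N}. d dvd n}" using m assms by (simp add: Suc_le_eq)
  qed
  show "(%n. n div d) \<in> {n \<in> {1..N}. d dvd n} \<rightarrow> {1..N div d}"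
   using assms by (auto simp: less_eq_div_iff_mult_less_eq mult.commute Suc_le_eq elim!: dvdE)
 qed (use assms in auto)
 finally show ?thesis .
qed

lemma real_div_bounds:
 assumes "d > 0"
 shows "real (N div d) <= real N / real d" "real N / real d - 1 <= real (N div d)"
proof -
 show "real (N div d) <= real N / real d" by (rule of_nat_div_le_of_nat)
 have "real N = real d * real (N div d) + real (N mod d)"
  by (metis mult_div_mod_eq of_nat_add of_nat_mult)
 moreover have "real (N mod d) <= real d" using assms by (simp add: less_imp_le)
 ultimately show "real N / real d - 1 <= real (N div d)" using assms by (simp add: field_simps)
qed

section \<open>Divergence of the sum of prime reciprocals and the Turan-Kubilius inequality\<close>

text \<open>Erdos's argument. If the sum converges, the primes from some \<open>m\<close> on have
  tail below \<open>1/2\<close>, so at most half of the \<open>n <= N\<close> have a prime factor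
  \<open>>= m\<close>. The others are a squarefree number with prime factors below \<open>m\<close>
  times a square, and there are too few of these.\<close>

lemma sum_prime_reciprocals_unbounded:
 "\<exists>P. finite P \<and> (\<forall>p\<in>P. prime p) \<and> K <= (\<Sum>p\<in>P. 1 / real p)"
proof (rule ccontr)
 assume neg: "\<not> ?thesis"
 let ?f = "%n. of_bool (prime n) / real n"
 have neg': "(\<Sum>p\<in>P. 1 / real p) < K" if "finite P" "\<And>p. p \<in> P ==> prime p" for P :: "nat set"
  using neg that by (meson not_le)
 have bd: "(\<Sum>n<N. ?f n) <= K" for N
 proof -
  have "(\<Sum>n<N. ?f n) = (\<Sum>p\<in>{p\<in>{..<N}. prime p}. 1 / real p)"
   by (intro sum.mono_neutral_cong_right) auto
  moreover have "(\<Sum>p\<in>{p\<in>{..<N}. prime p}. 1 / real p) < K"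
   by (rule neg') auto
  ultimately show ?thesis by simp
 qed
 have "summable ?f"
  by (rule summableI_nonneg_bounded[OF _ bd]) auto
 then obtain m where m: "\<And>i j. i >= m ==> norm (sum ?f {i..<j}) < 1/2"
  unfolding summable_Cauchy by (metis half_gt_zero_iff zero_less_one)
 \<comment> \<open>\<open>N\<close> is the square of \<open>2^(m+2)\<close>: at most
   \<open>2^m\<close> squarefree parts and \<open>2^(m+2)\<close> square parts leave
   \<open>N / 4\<close> numbers.\<close>
 define N where "N = (4::nat) ^ (m + 2)"
 define R where "R = {n\<in>{1..N}. \<forall>p. prime p --> p dvd n --> p < m}"
 define D where "D = (%p. {n\<in>{1..N}. p dvd n})"
 have cD: "card (D p) = N div p" if "p > 0" for p
 proof -
  have "card (D p) = (\<Sum>n=1..N. of_bool (p dvd n) * 1)"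
   unfolding D_def card_eq_sum by (intro sum.mono_neutral_cong_left) auto
  also have "\<dots> = N div p" using that by (subst sum_multiples) auto
  finally show ?thesis .
 qed
 have cover: "{1..N} \<subseteq> R \<union> (\<Union>p\<in>{p\<in>{m..<N+1}. prime p}. D p)"
 proof
  fix n assume n: "n \<in> {1..N}"
  show "n \<in> R \<union> (\<Union>p\<in>{p\<in>{m..<N+1}. prime p}. D p)"
  proof (cases "n \<in> R")
   case False
   then obtain p where p: "prime p" "p dvd n" "\<not> p < m" using n unfolding R_def by auto
   then have "p <= N" using n by (meson atLeastAtMost_iff dvd_imp_le le_trans less_le_trans zero_less_one)
   then show ?thesis using p n unfolding D_def by auto
  qed auto
 qed
 have "real (card (\<Union>p\<in>{p\<in>{m..<N+1}. prime p}. D p)) <= (\<Sum>p\<in>{p\<in>{m..<N+1}. prime p}. real (card (D p)))"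
  unfolding of_nat_sum[symmetric] of_nat_le_iff by (rule card_UN_le) auto
 also have "\<dots> <= (\<Sum>p\<in>{p\<in>{m..<N+1}. prime p}. real N * ?f p)"
  by (intro sum_mono) (auto simp: cD prime_gt_0_nat intro!: order.trans[OF real_div_bounds(1)])
 also have "\<dots> = (\<Sum>p\<in>{m..<N+1}. real N * ?f p)"
  by (intro sum.mono_neutral_left) auto
 also have "\<dots> = real N * (\<Sum>p\<in>{m..<N+1}. ?f p)" by (rule sum_distrib_left[symmetric])
 also have "\<dots> <= real N * (1/2)"
  using m[of m "N+1"] by (intro mult_left_mono) (auto simp: abs_less_iff)
 finally have c1: "real (card (\<Union>p\<in>{p\<in>{m..<N+1}. prime p}. D p)) <= real N / 2" by simp
 have c2: "card R <= card (Pow {..<m} \<times> {1..2^(m+2)::nat})"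
 proof (rule card_inj_on_le)
  show "inj_on (%n. (prime_factors (squarefree_part n), square_part n)) R"
  proof (rule inj_onI)
   fix x y assume xy: "x \<in> R" "y \<in> R"
    and e: "(prime_factors (squarefree_part x), square_part x) = (prime_factors (squarefree_part y), square_part y)"
   have "squarefree_part x = squarefree_part y"
   proof (rule multiplicity_eq_nat)
    fix p :: nat assume p: "prime p"
    have "multiplicity p (squarefree_part z) = of_bool (p \<in> prime_factors (squarefree_part z))" for z :: nat
    proof -
     have "multiplicity p (squarefree_part z) <= Suc 0" by (rule prime_multiplicity_squarefree_part_le_Suc_0[OF p])
     moreover have "p \<in> prime_factors (squarefree_part z) \<longleftrightarrow> multiplicity p (squarefree_part z) > 0"
      using p by (auto simp: prime_factors_multiplicity)
     ultimately show ?thesis by auto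
    qed
    then show "multiplicity p (squarefree_part x) = multiplicity p (squarefree_part y)" using e by auto
   qed (auto intro: Nat.gr0I)
   then show "x = y" using e squarefree_decompose[of x] squarefree_decompose[of y] by simp
  qed
  show "(%n. (prime_factors (squarefree_part n), square_part n)) ` R \<subseteq> Pow {..<m} \<times> {1..2 ^ (m + 2)}"
  proof (clarsimp simp: image_subset_iff, intro conjI)
   fix n assume n: "n \<in> R"
   have sd: "squarefree_part n dvd n" by (metis dvd_triv_left squarefree_decompose)
   show "prime_factors (squarefree_part n) \<subseteq> {..<m}"
    using n sd unfolding R_def by (auto simp: in_prime_factors_iff intro: dvd_trans)
   have "square_part n ~= 0" using n unfolding R_def by auto
   then show "Suc 0 <= square_part n" by arith
   have "square_part n ^ 2 <= n" using n unfolding R_def by (intro dvd_imp_le) auto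
   also have "n <= (2 ^ (m+2)) ^ 2" using n unfolding R_def N_def by (simp flip: power_mult add: power_mult[of 2 2] mult.commute[of _ 2])
   finally show "square_part n <= 4 * 2 ^ m"
    using power2_nat_le_eq_le[of "square_part n" "2^(m+2)"] by simp
  qed
 qed auto
 have c3: "real (card R) <= real N / 4"
 proof -
  have "real (card R) <= real (2 ^ m * 2 ^ (m+2))" using c2 by (simp add: card_Pow card_cartesian_product del: of_nat_mult)
  also have "\<dots> = real N / 4"
   using power_mult_distrib[of 2 "2::real" m] unfolding N_def by simp
  finally show ?thesis .
 qed
 have "real N = real (card {1..N})" by simp
 also have "\<dots> <= real (card (R \<union> (\<Union>p\<in>{p\<in>{m..<N+1}. prime p}. D p)))"
  unfolding of_nat_le_iff by (rule card_mono[OF _ cover]) (auto simp: R_def D_def)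
 also have "\<dots> <= real (card R) + real (card (\<Union>p\<in>{p\<in>{m..<N+1}. prime p}. D p))"
  by (metis card_Un_le of_nat_add of_nat_mono)
 also have "\<dots> <= real N / 4 + real N / 2" using c1 c3 by simp
 finally have "real N <= 0" by simp
 moreover have "N > 0" unfolding N_def by simp
 ultimately show False by simp
qed

text \<open>Katai's criterion needs a single family of primes along which the dilates of
  \<open>b\<close> coincide, with reciprocal sums as large as desired. If every class had bounded
  sums, adding the bounds would bound the sum over all primes; overlaps between classes do no
  harm.\<close>

lemma prime_class_reciprocals_unbounded:
 assumes "finite I" and "\<And>p. prime p ==> \<exists>i\<in>I. Q i p"
 obtains i where "i \<in> I"
  "\<And>K. \<exists>P. finite P \<and> (\<forall>p\<in>P. prime p \<and> Q i p) \<and> K <= (\<Sum>p\<in>P. 1 / real p)"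
proof (rule ccontr)
 assume nt: "\<not> thesis"
 have "\<forall>i\<in>I. \<exists>K. \<forall>P. finite P \<and> (\<forall>p\<in>P. prime p \<and> Q i p) --> (\<Sum>p\<in>P. 1 / real p) < K"
  using nt that by (meson not_le)
 then obtain K where K: "\<And>i P. i \<in> I ==> finite P ==> (\<And>p. p \<in> P ==> prime p \<and> Q i p) ==> (\<Sum>p\<in>P. 1 / real p) < K i"
  by metis
 obtain P :: "nat set" where P: "finite P" "\<forall>p\<in>P. prime p" "(\<Sum>i\<in>I. \<bar>K i\<bar>) + 1 <= (\<Sum>p\<in>P. 1 / real p)"
  using sum_prime_reciprocals_unbounded by blast
 have "(\<Sum>p\<in>P. 1 / real p) <= (\<Sum>p\<in>(\<Union>i\<in>I. {p\<in>P. Q i p}). 1 / real p)"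
  using assms P by (intro sum_mono2) auto
 also have "\<dots> <= (\<Sum>i\<in>I. \<Sum>p\<in>{p\<in>P. Q i p}. 1 / real p)"
 proof -
  have "finite J ==> (\<Sum>p\<in>(\<Union>i\<in>J. {p\<in>P. Q i p}). 1 / real p) <= (\<Sum>i\<in>J. \<Sum>p\<in>{p\<in>P. Q i p}. 1 / real p)" for J
  proof (induction J rule: finite_induct)
   case (insert j J)
   have "(\<Sum>p\<in>(\<Union>i\<in>insert j J. {p\<in>P. Q i p}). 1 / real p)
    <= (\<Sum>p\<in>{p\<in>P. Q j p}. 1 / real p) + (\<Sum>p\<in>(\<Union>i\<in>J. {p\<in>P. Q i p}). 1 / real p)"
    using P insert.hyps by (simp, subst sum.union_inter[symmetric]) (auto intro!: sum_nonneg)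
   then show ?case using insert by auto
  qed auto
  then show ?thesis using assms by blast
 qed
 also have "\<dots> <= (\<Sum>i\<in>I. \<bar>K i\<bar>)"
  using P by (intro sum_mono order.trans[OF less_imp_le[OF K] abs_ge_self]) auto
 finally show False using P by simp
qed

text \<open>Divisibility by distinct primes is nearly independent: the second moment of the number
  of divisors in \<open>P\<close> is at most \<open>N * (A\<^sup>2 + A)\<close>, while rounding
  costs only \<open>card P\<close> in the first moment. This is the Turan-Kubilius inequality for a
  finite set of primes.\<close>

lemma turan_kubilius:
 fixes P :: "nat set"
 assumes P: "finite P" "\<And>p. p \<in> P ==> prime p"
 defines "(A :: real) \<equiv> (\<Sum>p\<in>P. 1 / real p)"
 shows "(\<Sum>n=1..N. ((\<Sum>p\<in>P. of_bool (p dvd n)) - A)\<^sup>2) <= real N * A + 2 * A * real (card P)"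
proof -
 let ?w = "%n. \<Sum>p\<in>P. (of_bool (p dvd n) :: real)"
 have cnt: "(\<Sum>n=1..N. (of_bool (d dvd n) :: real)) = real (N div d)" if "d > 0" for d
  using sum_multiples[OF that, of "%_. 1::real" N] by simp
 have pos: "p > 0" if "p \<in> P" for p using P(2)[OF that] prime_gt_0_nat by blast
 have A0: "A >= 0" unfolding A_def by (intro sum_nonneg) auto
 have w1: "(\<Sum>n=1..N. ?w n) >= real N * A - real (card P)"
 proof -
  have "real N * A - real (card P) = (\<Sum>p\<in>P. real N / p - 1)"
   unfolding A_def by (simp add: sum_subtractf sum_distrib_left)
  also have "\<dots> <= (\<Sum>p\<in>P. real (N div p))" by (intro sum_mono real_div_bounds pos)
  also have "\<dots> = (\<Sum>p\<in>P. \<Sum>n=1..N. of_bool (p dvd n))" by (intro sum.cong refl cnt[symmetric] pos)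
  also have "\<dots> = (\<Sum>n=1..N. ?w n)" by (rule sum.swap)
  finally show ?thesis .
 qed
 have w2: "(\<Sum>n=1..N. (?w n)\<^sup>2) <= real N * A\<^sup>2 + real N * A"
 proof -
  have "(\<Sum>n=1..N. (?w n)\<^sup>2) = (\<Sum>n=1..N. \<Sum>p\<in>P. \<Sum>q\<in>P. of_bool (p dvd n) * of_bool (q dvd n))"
   by (simp add: power2_eq_square sum_product)
  also have "\<dots> = (\<Sum>p\<in>P. \<Sum>n=1..N. \<Sum>q\<in>P. of_bool (p dvd n) * of_bool (q dvd n))"
   by (rule sum.swap)
  also have "\<dots> = (\<Sum>p\<in>P. \<Sum>q\<in>P. \<Sum>n=1..N. of_bool (p dvd n) * of_bool (q dvd n))"
   by (intro sum.cong refl sum.swap)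
  also have "\<dots> <= (\<Sum>p\<in>P. \<Sum>q\<in>P. real N / (p * q) + (if q = p then real N / p else 0))"
  proof (intro sum_mono)
   fix p q assume pq: "p \<in> P" "q \<in> P"
   show "(\<Sum>n=1..N. of_bool (p dvd n) * of_bool (q dvd n)) <= real N / (p * q) + (if q = p then real N / p else 0)"
   proof (cases "q = p")
    case True
    have "(\<Sum>n=1..N. of_bool (p dvd n) * of_bool (q dvd n)) = (\<Sum>n=1..N. (of_bool (p dvd n) :: real))"
     using True by (intro sum.cong) auto
    also have "\<dots> <= real N / p" using cnt[OF pos[OF pq(1)]] real_div_bounds(1)[OF pos[OF pq(1)]] by simp
    finally show ?thesis using True by (simp add: add_increasing)
   next
    case False
    have "(of_bool (p dvd n) * of_bool (q dvd n) :: real) = of_bool (p * q dvd n)" for n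
    proof -
     have "coprime p q" using False P(2) pq primes_coprime by metis
     then have "p * q dvd n \<longleftrightarrow> p dvd n \<and> q dvd n" by (metis divides_mult dvd_mult_left dvd_mult_right)
     then show ?thesis by auto
    qed
    then have "(\<Sum>n=1..N. (of_bool (p dvd n) * of_bool (q dvd n) :: real)) = (\<Sum>n=1..N. of_bool (p * q dvd n))"
     by (simp only:)
    also have "\<dots> = real (N div (p * q))"
     using pos[OF pq(1)] pos[OF pq(2)] by (intro cnt) simp
    also have "\<dots> <= real N / (p * q)" using real_div_bounds(1)[of "p*q" N] pos[OF pq(1)] pos[OF pq(2)] by simp
    finally show ?thesis using False by simp
   qed
  qed
  also have "\<dots> = (\<Sum>p\<in>P. \<Sum>q\<in>P. real N / (p * q)) + (\<Sum>p\<in>P. real N / p)"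
   by (simp add: sum.distrib P(1))
  also have "(\<Sum>p\<in>P. \<Sum>q\<in>P. real N / (p * q)) = real N * A\<^sup>2"
   unfolding A_def power2_eq_square sum_product by (simp add: sum_distrib_left mult.assoc)
  also have "(\<Sum>p\<in>P. real N / p) = real N * A"
   unfolding A_def sum_distrib_left by simp
  finally show ?thesis .
 qed
 have "(\<Sum>n=1..N. (?w n - A)\<^sup>2) = (\<Sum>n=1..N. (?w n)\<^sup>2) - 2 * A * (\<Sum>n=1..N. ?w n) + real N * A\<^sup>2"
  by (simp add: power2_diff sum.distrib sum_subtractf sum_distrib_left sum_distrib_right mult_ac)
 also have "\<dots> <= (real N * A\<^sup>2 + real N * A) - 2 * A * (real N * A - real (card P)) + real N * A\<^sup>2"
  using w2 mult_left_mono[OF w1, of "2 * A"] A0 by linarith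
 also have "\<dots> = real N * A + 2 * A * real (card P)" by (simp add: algebra_simps power2_eq_square)
 finally show ?thesis .
qed

section \<open>Averages and Katai's criterion\<close>

definition average :: "(nat => complex) => nat => complex" where
 "average u N = (1 / of_nat N) * (\<Sum>n=1..N. u n)"

lemma sum_norm_le_sqrt:
 fixes x y :: "nat => complex"
 assumes "\<And>n. n \<in> {1..N} ==> norm (y n) <= C" "C >= 0"
 shows "norm (\<Sum>n=1..N. x n * y n) <= C * sqrt (real N * (\<Sum>n=1..N. (norm (x n))\<^sup>2))"
proof -
 have "norm (\<Sum>n=1..N. x n * y n) <= (\<Sum>n=1..N. C * norm (x n))"
  using assms by (intro order.trans[OF norm_sum] sum_mono) (simp add: norm_mult mult.commute[of C] mult_left_mono)
 also have "\<dots> = C * (\<Sum>n=1..N. norm (x n))" by (simp add: sum_distrib_left)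
 also have "(\<Sum>n=1..N. norm (x n)) <= sqrt (real N * (\<Sum>n=1..N. (norm (x n))\<^sup>2))"
  using Cauchy_Schwarz_ineq_sum[of "%_. 1" "%n. norm (x n)" "{1..N}"]
  by (intro real_le_rsqrt) simp
 finally show ?thesis using assms(2) by (simp add: mult_left_mono)
qed

text \<open>\<open>A\<close> times the sum is replaced by the sum weighted with the number of primes
  of \<open>P\<close> that divide \<open>n\<close>, with an error given by
  \<open>turan_kubilius\<close>. In the weighted sum put \<open>n = p * m\<close>: then
  \<open>b\<close> contributes \<open>b' m\<close>, whatever \<open>p\<close> is, and Cauchy-Schwarz
  over \<open>m\<close> removes it and leaves correlations of \<open>c\<close> along two
  primes.\<close>

lemma katai_finite:
 fixes b b' c :: "nat => complex" and P :: "nat set"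
 assumes P: "finite P" "\<And>p. p \<in> P ==> prime p"
  and bp: "\<And>p n. p \<in> P ==> n >= 1 ==> b (p * n) = b' n"
  and bd: "\<And>n. n >= 1 ==> norm (b n) <= C" "\<And>n. n >= 1 ==> norm (b' n) <= C"
   "\<And>n. n >= 1 ==> norm (c n) <= C" "C >= 0"
  and off: "\<And>p q M. p \<in> P ==> q \<in> P ==> p ~= q ==> M <= N ==>
   norm (\<Sum>m=1..M. c (p * m) * cnj (c (q * m))) <= E"
  and E0: "E >= 0"
 defines "(A :: real) \<equiv> (\<Sum>p\<in>P. 1 / real p)"
 shows "A * norm (\<Sum>n=1..N. c n * cnj (b n)) \<le>
  C\<^sup>2 * sqrt (real N * (real N * A + 2 * A * real (card P))) +
  C * sqrt (real N * (real N * A * C\<^sup>2 + (real (card P))\<^sup>2 * E))"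
proof -
 let ?w = "%n. \<Sum>p\<in>P. (of_bool (p dvd n) :: real)"
 have A0: "A >= 0" unfolding A_def by (intro sum_nonneg) auto
 have of_real_of_bool: "of_real (of_bool x) = (of_bool x :: complex)" for x by (cases x) auto
 have pos: "p > 0" if "p \<in> P" for p using P(2)[OF that] prime_gt_0_nat by blast
 have one: "norm (\<Sum>n=1..N. of_real (?w n - A) * (c n * cnj (b n))) <= C\<^sup>2 * sqrt (real N * (real N * A + 2 * A * real (card P)))"
 proof -
  have "norm (\<Sum>n=1..N. of_real (?w n - A) * (c n * cnj (b n)))
   <= C\<^sup>2 * sqrt (real N * (\<Sum>n=1..N. (norm (of_real (?w n - A) :: complex))\<^sup>2))"
   by (rule sum_norm_le_sqrt) (auto simp: norm_mult power2_eq_square bd intro!: mult_mono)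
  also have "\<dots> <= C\<^sup>2 * sqrt (real N * (real N * A + 2 * A * real (card P)))"
   using turan_kubilius[OF P, of N] unfolding A_def norm_of_real power2_abs
   by (intro mult_left_mono real_sqrt_le_mono) auto
  finally show ?thesis .
 qed
 \<comment> \<open>The sum over \<open>p\<close> for fixed \<open>m\<close>; the indicator keeps
   \<open>p * m <= N\<close>.\<close>
 define s where "s = (%m. \<Sum>p\<in>P. of_bool (m <= N div p) * c (p * m))"
 have two: "(\<Sum>n=1..N. of_real (?w n) * (c n * cnj (b n))) = (\<Sum>m=1..N. s m * cnj (b' m))"
 proof -
  have "(\<Sum>n=1..N. of_real (?w n) * (c n * cnj (b n))) = (\<Sum>p\<in>P. \<Sum>n=1..N. of_bool (p dvd n) * (c n * cnj (b n)))"
   by (subst sum.swap) (simp add: sum_distrib_right of_real_of_bool)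
  also have "\<dots> = (\<Sum>p\<in>P. \<Sum>m=1..N div p. c (p * m) * cnj (b (p * m)))"
   by (intro sum.cong refl sum_multiples pos)
  also have "\<dots> = (\<Sum>p\<in>P. \<Sum>m=1..N. of_bool (m <= N div p) * c (p * m) * cnj (b' m))"
   by (intro sum.cong refl sum.mono_neutral_cong_left) (auto simp: bp intro: order.trans[OF _ div_le_dividend])
  also have "\<dots> = (\<Sum>m=1..N. s m * cnj (b' m))"
   unfolding s_def by (subst sum.swap) (simp add: sum_distrib_right)
  finally show ?thesis .
 qed
 have three: "(\<Sum>m=1..N. (norm (s m))\<^sup>2) <= real N * A * C\<^sup>2 + (real (card P))\<^sup>2 * E"
 proof -
  have "of_real (\<Sum>m=1..N. (norm (s m))\<^sup>2) = (\<Sum>m=1..N. s m * cnj (s m))"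
   by (simp only: complex_norm_square of_real_sum)
  also have "\<dots> = (\<Sum>m=1..N. \<Sum>p\<in>P. \<Sum>q\<in>P. (of_bool (m <= N div p) * of_bool (m <= N div q)) * (c (p * m) * cnj (c (q * m))))"
   unfolding s_def cnj_sum sum_product by (intro sum.cong refl) (auto)
  also have "\<dots> = (\<Sum>p\<in>P. \<Sum>m=1..N. \<Sum>q\<in>P. (of_bool (m <= N div p) * of_bool (m <= N div q)) * (c (p * m) * cnj (c (q * m))))"
   by (rule sum.swap)
  also have "\<dots> = (\<Sum>p\<in>P. \<Sum>q\<in>P. \<Sum>m=1..N. (of_bool (m <= N div p) * of_bool (m <= N div q)) * (c (p * m) * cnj (c (q * m))))"
   by (intro sum.cong refl sum.swap)
  also have "\<dots> = (\<Sum>p\<in>P. \<Sum>q\<in>P. \<Sum>m=1..min (N div p) (N div q). c (p * m) * cnj (c (q * m)))"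
  proof (rule sum.cong[OF refl], rule sum.cong[OF refl], rule sum.mono_neutral_cong_right)
   fix p q
   have "min (N div p) (N div q) <= N" by (meson div_le_dividend min.coboundedI1)
   then show "{1..min (N div p) (N div q)} \<subseteq> {1..N}" by auto
  qed auto
  finally have eq: "of_real (\<Sum>m=1..N. (norm (s m))\<^sup>2) = \<dots>" .
  have "(\<Sum>m=1..N. (norm (s m))\<^sup>2) = norm (of_real (\<Sum>m=1..N. (norm (s m))\<^sup>2) :: complex)"
   by (simp add: sum_nonneg del: of_real_sum)
  also have "\<dots> <= (\<Sum>p\<in>P. \<Sum>q\<in>P. (if q = p then real N / p * C\<^sup>2 else 0) + E)"
   unfolding eq
  proof (rule order.trans[OF norm_sum], rule sum_mono, rule order.trans[OF norm_sum], rule sum_mono)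
   fix p q assume pq: "p \<in> P" "q \<in> P"
   show "norm (\<Sum>m=1..min (N div p) (N div q). c (p * m) * cnj (c (q * m))) <= (if q = p then real N / p * C\<^sup>2 else 0) + E"
   proof (cases "q = p")
    case True
    have "norm (\<Sum>m=1..N div p. c (p * m) * cnj (c (p * m))) <= (\<Sum>m=1..N div p. C\<^sup>2)"
     using pos[OF pq(1)] by (intro order.trans[OF norm_sum] sum_mono)
      (auto simp: norm_mult power2_eq_square intro!: mult_mono bd)
    also have "\<dots> <= real N / p * C\<^sup>2"
     using mult_right_mono[OF real_div_bounds(1)[OF pos[OF pq(1)], of N], of "C\<^sup>2"] by simp
    finally show ?thesis using True E0 by simp
   next
    case False
    then show ?thesis using off[of p q "min (N div p) (N div q)"] pq
     by (auto intro: order.trans[OF _ div_le_dividend] simp: min.coboundedI1)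
   qed
  qed
  also have "\<dots> = real N * A * C\<^sup>2 + (real (card P))\<^sup>2 * E"
   unfolding A_def by (simp add: sum.distrib P(1) sum_distrib_left sum_distrib_right power2_eq_square)
  finally show ?thesis .
 qed
 have four: "norm (\<Sum>n=1..N. of_real (?w n) * (c n * cnj (b n))) <= C * sqrt (real N * (real N * A * C\<^sup>2 + (real (card P))\<^sup>2 * E))"
 proof -
  have "norm (\<Sum>n=1..N. of_real (?w n) * (c n * cnj (b n))) <= C * sqrt (real N * (\<Sum>m=1..N. (norm (s m))\<^sup>2))"
   unfolding two by (rule sum_norm_le_sqrt) (auto simp: bd)
  also have "\<dots> <= C * sqrt (real N * (real N * A * C\<^sup>2 + (real (card P))\<^sup>2 * E))"
   using three bd by (intro mult_left_mono real_sqrt_le_mono) auto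
  finally show ?thesis .
 qed
 have "A * norm (\<Sum>n=1..N. c n * cnj (b n)) = norm (of_real A * (\<Sum>n=1..N. c n * cnj (b n)))"
  using A0 by (simp add: norm_mult)
 also have "of_real A * (\<Sum>n=1..N. c n * cnj (b n)) =
   (\<Sum>n=1..N. of_real (?w n) * (c n * cnj (b n))) - (\<Sum>n=1..N. of_real (?w n - A) * (c n * cnj (b n)))"
  by (simp add: sum_distrib_left algebra_simps flip: sum_subtractf)
 also have "norm \<dots> <= C * sqrt (real N * (real N * A * C\<^sup>2 + (real (card P))\<^sup>2 * E)) + C\<^sup>2 * sqrt (real N * (real N * A + 2 * A * real (card P)))"
  using one four norm_triangle_ineq4 by (meson add_mono order.trans)
 finally show ?thesis by simp
qed

theorem katai_criterion:
 fixes b c :: "nat => complex"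
 assumes B: "finite B" "\<And>p. prime p ==> \<exists>b'\<in>B. \<forall>n\<ge>1. b (p * n) = b' n"
  and bd: "\<And>b' n. b' \<in> insert b B ==> n >= 1 ==> norm (b' n) <= C"
  and c: "\<And>n. n >= 1 ==> norm (c n) <= C"
  and orth: "\<And>p q. prime p ==> prime q ==> p ~= q ==>
   average (%n. c (p * n) * cnj (c (q * n))) \<longlonglongrightarrow> 0"
 shows "average (%n. c n * cnj (b n)) \<longlonglongrightarrow> 0"
proof (rule LIMSEQ_I)
 fix r :: real assume r: "r > 0"
 obtain b' where b': "b' \<in> B" and
  cls: "\<And>K. \<exists>P. finite P \<and> (\<forall>p\<in>P. prime p \<and> (\<forall>n\<ge>1. b (p * n) = b' n)) \<and> K <= (\<Sum>p\<in>P. 1 / real p)"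
  using prime_class_reciprocals_unbounded[OF B(1), of "%b' p. \<forall>n\<ge>1. b (p * n) = b' n"] B(2) by metis
 define D where "D = max C 1"
 have D: "D >= 1" "C <= D" unfolding D_def by auto
 \<comment> \<open>The final bound is \<open>2 * sqrt 2 * D\<^sup>2 / sqrt A\<close>; this lower
   bound on \<open>A\<close> makes it at most \<open>r / sqrt 2\<close>.\<close>
 obtain P where P: "finite P" "\<And>p. p \<in> P ==> prime p" "\<And>p n. p \<in> P ==> n >= 1 ==> b (p * n) = b' n"
  and K: "max 1 ((4 * D\<^sup>2 / r)\<^sup>2) <= (\<Sum>p\<in>P. 1 / real p)"
  using cls by metis
 define A where "A = (\<Sum>p\<in>P. 1 / real p)"
 have A: "A >= 1" "A >= (4 * D\<^sup>2 / r)\<^sup>2" using K unfolding A_def by auto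
 define k where "k = real (card P)"
 have k: "k >= 1" unfolding k_def using A(1) P(1) unfolding A_def
  by (metis card_gt_0_iff less_one not_le of_nat_1 of_nat_le_iff sum.empty Suc_leI One_nat_def zero_less_one)
 \<comment> \<open>There are at most \<open>k\<^sup>2\<close> off-diagonal pairs; this
   \<open>d\<close> lets them contribute at most \<open>N / 2\<close>, and \<open>N0\<close> below
   leaves the other \<open>N / 2\<close> for the range up to \<open>M0\<close>, where only the
   trivial bound is available.\<close>
 define d where "d = 1 / (2 * k\<^sup>2)"
 have d: "d > 0" unfolding d_def using k by simp
 have "\<exists>M0. \<forall>p\<in>P. \<forall>q\<in>P. p ~= q --> (\<forall>M\<ge>M0. norm (average (%n. c (p * n) * cnj (c (q * n))) M) < d)"
 proof -
  have "\<forall>p\<in>P. \<forall>q\<in>P. \<exists>M0. p ~= q --> (\<forall>M\<ge>M0. norm (average (%n. c (p * n) * cnj (c (q * n))) M) < d)"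
  proof (intro ballI)
   fix p q assume "p \<in> P" "q \<in> P"
   then have "p ~= q ==> average (%n. c (p * n) * cnj (c (q * n))) \<longlonglongrightarrow> 0" using orth P(2) by blast
   from LIMSEQ_D[OF this d]
   show "\<exists>M0. p ~= q --> (\<forall>M\<ge>M0. norm (average (%n. c (p * n) * cnj (c (q * n))) M) < d)"
    by auto
  qed
  then obtain f where f: "\<And>p q M. p \<in> P ==> q \<in> P ==> p ~= q ==> M >= f p q ==> norm (average (%n. c (p * n) * cnj (c (q * n))) M) < d"
   by metis
  show ?thesis
  proof (intro exI ballI impI allI)
   fix p q M assume *: "p \<in> P" "q \<in> P" "p ~= q" and M: "(\<Sum>p\<in>P. \<Sum>q\<in>P. f p q) <= M"
   have "f p q <= (\<Sum>q\<in>P. f p q)" using * P(1) by (intro member_le_sum) auto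
   also have "\<dots> <= (\<Sum>p\<in>P. \<Sum>q\<in>P. f p q)" using * P(1) by (intro member_le_sum) auto
   finally show "norm (average (%n. c (p * n) * cnj (c (q * n))) M) < d" using f[OF *] M by simp
  qed
 qed
 then obtain M0 where M0: "\<And>p q M. p \<in> P ==> q \<in> P ==> p ~= q ==> M >= M0 ==> norm (average (%n. c (p * n) * cnj (c (q * n))) M) < d"
  by blast
 define N0 where "N0 = nat \<lceil>max (2 * k) (2 * k\<^sup>2 * M0 * D\<^sup>2)\<rceil> + 1"
 show "\<exists>no. \<forall>n\<ge>no. norm (average (%n. c n * cnj (b n)) n - 0) < r"
 proof (intro exI allI impI)
  fix N assume N: "N >= N0"
  have N1: "real N >= 2 * k" "real N >= 2 * k\<^sup>2 * M0 * D\<^sup>2" "N >= 1"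
   using N unfolding N0_def by linarith+
  have off: "norm (\<Sum>m=1..M. c (p * m) * cnj (c (q * m))) <= d * N + M0 * D\<^sup>2" if *: "p \<in> P" "q \<in> P" "p ~= q" "M <= N" for p q M
  proof (cases "M >= M0")
   case True
   show ?thesis
   proof (cases "M = 0")
    case False
    have "norm (\<Sum>m=1..M. c (p * m) * cnj (c (q * m))) = M * norm (average (%n. c (p * n) * cnj (c (q * n))) M)"
     using False unfolding average_def by (simp add: norm_mult norm_divide)
    also have "\<dots> <= N * d" using M0[OF *(1-3) True] *(4) by (intro mult_mono) auto
    finally show ?thesis by (simp add: mult.commute add_increasing2)
   qed (use d in simp)
  next
   case False
   have "norm (\<Sum>m=1..M. c (p * m) * cnj (c (q * m))) <= (\<Sum>m=1..M. D\<^sup>2)"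
   proof (intro order.trans[OF norm_sum] sum_mono)
    fix m assume "m \<in> {1..M}"
    then have "p * m >= 1" "q * m >= 1" using P(2)[OF *(1)] P(2)[OF *(2)] by (auto simp: Suc_le_eq prime_gt_0_nat)
    then show "norm (c (p * m) * cnj (c (q * m))) <= D\<^sup>2"
     using c D by (auto simp: norm_mult power2_eq_square intro!: mult_mono order.trans[OF c])
   qed
   also have "\<dots> <= M0 * D\<^sup>2" using False by (simp add: mult_right_mono)
   finally show ?thesis using d by (simp add: add_increasing)
  qed
  have "A * norm (\<Sum>n=1..N. c n * cnj (b n)) \<le>
   D\<^sup>2 * sqrt (real N * (real N * A + 2 * A * real (card P))) +
   D * sqrt (real N * (real N * A * D\<^sup>2 + (real (card P))\<^sup>2 * (d * N + M0 * D\<^sup>2)))"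
   unfolding A_def
   by (rule katai_finite[where b'=b'])
    (use P off d D in \<open>auto intro!: order.trans[OF bd D(2)] order.trans[OF c D(2)] simp: b'\<close>)
  also have "\<dots> <= D\<^sup>2 * sqrt (real N * (real N * A + real N * A)) +
   D * sqrt (real N * (real N * A * D\<^sup>2 + real N * A * D\<^sup>2))"
  proof -
   have "2 * A * real (card P) <= real N * A" using N1(1) A(1) unfolding k_def by (simp add: mult_right_mono)
   moreover have "(real (card P))\<^sup>2 * (d * N + M0 * D\<^sup>2) <= real N * A * D\<^sup>2"
   proof -
    have "(real (card P))\<^sup>2 * (d * N + M0 * D\<^sup>2) = N / 2 + k\<^sup>2 * M0 * D\<^sup>2"
     unfolding d_def k_def[symmetric] using k by (simp add: k_def[symmetric] field_simps)
    also have "\<dots> <= real N * 1" using N1(2) by simp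
    also have "\<dots> <= real N * (A * D\<^sup>2)" using A D
     by (intro mult_left_mono) (auto intro!: mult_ge1_I simp: one_le_power)
    finally show ?thesis by (simp add: mult.assoc)
   qed
   ultimately show ?thesis using D A by (intro add_mono mult_left_mono real_sqrt_le_mono) auto
  qed
  also have "\<dots> = 2 * D\<^sup>2 * sqrt 2 * real N * sqrt A"
  proof -
   have "sqrt (real N * (real N * A + real N * A)) = real N * sqrt 2 * sqrt A"
    using A by (simp add: real_sqrt_mult flip: distrib_left)
   moreover have "sqrt (real N * (real N * A * D\<^sup>2 + real N * A * D\<^sup>2)) = real N * sqrt 2 * sqrt A * D"
   proof -
    have "real N * (real N * A * D\<^sup>2 + real N * A * D\<^sup>2) = (real N)\<^sup>2 * 2 * A * D\<^sup>2" by (simp add: power2_eq_square algebra_simps)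
    then show ?thesis using D by (simp add: real_sqrt_mult)
   qed
   ultimately show ?thesis by (simp add: power2_eq_square algebra_simps)
  qed
  finally have main: "A * norm (\<Sum>n=1..N. c n * cnj (b n)) <= 2 * D\<^sup>2 * sqrt 2 * real N * sqrt A" .
  have sA: "sqrt A > 0" "A = sqrt A * sqrt A" using A by auto
  have "sqrt A * norm (\<Sum>n=1..N. c n * cnj (b n)) <= 2 * D\<^sup>2 * sqrt 2 * real N"
  proof -
   have "sqrt A * (sqrt A * norm (\<Sum>n=1..N. c n * cnj (b n))) = A * norm (\<Sum>n=1..N. c n * cnj (b n))"
    using A(1) by (simp flip: mult.assoc)
   also have "\<dots> <= sqrt A * (2 * D\<^sup>2 * sqrt 2 * real N)" using main by (simp add: mult_ac)
   finally show ?thesis using sA(1) by simp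
  qed
  moreover have "sqrt A >= 4 * D\<^sup>2 / r" using A(2) by (rule real_le_rsqrt)
  ultimately have "4 * D\<^sup>2 / r * norm (\<Sum>n=1..N. c n * cnj (b n)) <= 2 * D\<^sup>2 * sqrt 2 * real N"
   by (meson mult_right_mono norm_ge_zero order.trans)
  then have "2 * norm (\<Sum>n=1..N. c n * cnj (b n)) <= sqrt 2 * real N * r"
   using D r by (simp add: field_simps power2_eq_square)
  also have "\<dots> < 2 * real N * r" using N1 r sqrt2_less_2 by (intro mult_strict_right_mono) auto
  finally show "norm (average (%n. c n * cnj (b n)) N - 0) < r"
   using N1 unfolding average_def by (simp add: norm_mult norm_divide field_simps)
 qed
qed

subsection \<open>Invariant means on totally bounded abelian groups\<close>

lemma sum_list_swap:
 fixes f :: "'a => 'b => 'c::comm_monoid_add"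
 shows "(\<Sum>x\<leftarrow>xs. \<Sum>y\<leftarrow>ys. f x y) = (\<Sum>y\<leftarrow>ys. \<Sum>x\<leftarrow>xs. f x y)"
 by (induction xs) (simp_all add: sum_list_addf)

lemma norm_sum_list_le:
 fixes f :: "'a => 'b::real_normed_vector"
 assumes "\<And>x. x \<in> set xs ==> norm (f x) <= e"
 shows "norm (\<Sum>x\<leftarrow>xs. f x) <= real (length xs) * e"
 using assms
proof (induction xs)
 case (Cons x xs)
 have "norm (\<Sum>x\<leftarrow>x # xs. f x) <= norm (f x) + norm (\<Sum>x\<leftarrow>xs. f x)" by (simp add: norm_triangle_ineq)
 also have "\<dots> <= e + real (length xs) * e" using Cons by (intro add_mono) auto
 finally show ?case by (simp add: algebra_simps)
qed simp

lemma sum_list_divide: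
 fixes f :: "'a => 'b::field"
 shows "(\<Sum>x\<leftarrow>xs. f x / k) = (\<Sum>x\<leftarrow>xs. f x) / k"
 by (induction xs) (simp_all add: add_divide_distrib)

section \<open>Uniformly continuous functions on a totally bounded abelian group\<close>

text \<open>\<open>D (a \<otimes> inv b)\<close> is a translation-invariant pseudometric, and
  \<open>TB\<close> makes the group totally bounded for it. Its completion would be a compact
  abelian group; the uniformly continuous functions below are the traces of the continuous functions
  there.\<close>

locale tb_group = comm_group A for A (structure) +
 fixes D :: "'a => real"
 assumes D_one [simp]: "D \<one> = 0"
  and D_inv: "a \<in> carrier A ==> D (inv a) = D a"
  and D_mult: "a \<in> carrier A ==> b \<in> carrier A ==> D (a \<otimes> b) <= D a + D b"
  and TB: "e > 0 ==> \<exists>C. finite C \<and> C \<subseteq> carrier A \<and> (\<forall>a\<in>carrier A. \<exists>c\<in>C. D (a \<otimes> inv c) < e)"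
begin

text \<open>\<open>modulus\<close> is the meta-level form of \<open>close\<close>: once obtained, it
  applies as a rule without unpacking quantifiers.\<close>

abbreviation (input) modulus :: "('a => complex) => real => real => prop" where
 "modulus F d e \<equiv> (\<And>a b. a \<in> carrier A ==> b \<in> carrier A ==> D (a \<otimes> inv b) < d ==> norm (F a - F b) < e)"

abbreviation (input) close :: "('a => complex) => real => real => bool" where
 "close F d e \<equiv> (\<forall>a\<in>carrier A. \<forall>b\<in>carrier A. D (a \<otimes> inv b) < d --> norm (F a - F b) < e)"

abbreviation (input) modulus2 :: "('a => 'a => complex) => real => real => prop" where
 "modulus2 F d e \<equiv> (\<And>a a' b b'. a \<in> carrier A ==> a' \<in> carrier A ==> b \<in> carrier A ==> b' \<in> carrier A ==>
   D (a \<otimes> inv a') < d ==> D (b \<otimes> inv b') < d ==> norm (F a b - F a' b') < e)"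

abbreviation (input) close2 :: "('a => 'a => complex) => real => real => bool" where
 "close2 F d e \<equiv> (\<forall>a\<in>carrier A. \<forall>a'\<in>carrier A. \<forall>b\<in>carrier A. \<forall>b'\<in>carrier A.
   D (a \<otimes> inv a') < d --> D (b \<otimes> inv b') < d --> norm (F a b - F a' b') < e)"

definition uc :: "('a => complex) => bool" where
 "uc F \<longleftrightarrow> (\<forall>e>0. \<exists>d>0. close F d e)"

lemma ucI:
 assumes "\<And>e. e > 0 ==> \<exists>d>0. close F d e"
 shows "uc F"
 using assms unfolding uc_def by blast

lemma ucE:
 assumes "uc F" "e > 0"
 obtains d where "d > 0" "PROP modulus F d e"
proof -
 obtain d where "d > 0 \<and> (close F d e)"
  using mp[OF spec[OF assms(1)[unfolded uc_def]] assms(2)] by (rule exE)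
 then show thesis using that[of d] by simp
qed

lemma uc_bounded:
 assumes "uc F"
 obtains B where "B > 0" "\<And>a. a \<in> carrier A ==> norm (F a) <= B"
proof -
 obtain d where d: "d > 0" "PROP modulus F d 1"
  using ucE[OF assms, of 1] by auto
 obtain C where C: "finite C" "C \<subseteq> carrier A" "\<forall>a\<in>carrier A. \<exists>c\<in>C. D (a \<otimes> inv c) < d"
  using TB[OF d(1)] by blast
 show thesis
 proof (rule that[of "1 + (\<Sum>c\<in>C. norm (F c))"])
  show "1 + (\<Sum>c\<in>C. norm (F c)) > 0" by (simp add: add_pos_nonneg sum_nonneg)
  fix a assume a: "a \<in> carrier A"
  then obtain c where c: "c \<in> C" "D (a \<otimes> inv c) < d" using C by blast
  have "norm (F a) <= norm (F a - F c) + norm (F c)" by (metis diff_add_cancel norm_triangle_ineq)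
  moreover have "norm (F a - F c) < 1" using d(2) a c C by blast
  moreover have "norm (F c) <= (\<Sum>c\<in>C. norm (F c))" using c C by (intro member_le_sum) auto
  ultimately show "norm (F a) <= 1 + (\<Sum>c\<in>C. norm (F c))" by simp
 qed
qed

lemma uc_const [simp]: "uc (%_. c)"
 by (rule ucI) (auto intro: exI[of _ 1])

lemma uc_cong: "(\<And>a. a \<in> carrier A ==> F a = G a) ==> uc F \<longleftrightarrow> uc G"
 unfolding uc_def by auto

lemma uc_add:
 assumes "uc F" "uc G" shows "uc (%a. F a + G a)"
proof (rule ucI)
 fix e :: real assume e: "e > 0"
 obtain d1 where d1: "d1 > 0" "PROP modulus F d1 (e/2)"
  using ucE[OF assms(1), of "e/2"] e by auto
 obtain d2 where d2: "d2 > 0" "PROP modulus G d2 (e/2)"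
  using ucE[OF assms(2), of "e/2"] e by auto
 have "norm ((F a + G a) - (F b + G b)) < e" if "a \<in> carrier A" "b \<in> carrier A" "D (a \<otimes> inv b) < min d1 d2" for a b
  using d1(2)[of a b] d2(2)[of a b] that norm_triangle_ineq[of "F a - F b" "G a - G b"] by (simp add: algebra_simps)
 then show "\<exists>d>0. close (%a. (F a + G a)) d e"
  using d1(1) d2(1) by (intro exI[of _ "min d1 d2"]) auto
qed

lemma uc_mult:
 assumes "uc F" "uc G" shows "uc (%a. F a * G a)"
proof (rule ucI)
 fix e :: real assume e: "e > 0"
 obtain B where B: "B > 0" "\<And>a. a \<in> carrier A ==> norm (F a) <= B" using uc_bounded[OF assms(1)] by blast
 obtain B' where B': "B' > 0" "\<And>a. a \<in> carrier A ==> norm (G a) <= B'" using uc_bounded[OF assms(2)] by blast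
 obtain d1 where d1: "d1 > 0" "PROP modulus F d1 (e/(2*B'))"
  using ucE[OF assms(1), of "e/(2*B')"] e B' by auto
 obtain d2 where d2: "d2 > 0" "PROP modulus G d2 (e/(2*B))"
  using ucE[OF assms(2), of "e/(2*B)"] e B by auto
 have "norm (F a * G a - F b * G b) < e" if *: "a \<in> carrier A" "b \<in> carrier A" "D (a \<otimes> inv b) < min d1 d2" for a b
 proof -
  have "F a * G a - F b * G b = (F a - F b) * G a + F b * (G a - G b)" by (simp add: algebra_simps)
  then have "norm (F a * G a - F b * G b) <= norm (F a - F b) * norm (G a) + norm (F b) * norm (G a - G b)"
   by (metis norm_mult norm_triangle_ineq)
  also have "\<dots> <= norm (F a - F b) * B' + B * norm (G a - G b)"
   using * B B' by (intro add_mono mult_left_mono mult_right_mono) auto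
  also have "\<dots> < e/(2*B') * B' + B * (e/(2*B))"
   using d1(2)[of a b] d2(2)[of a b] * B(1) B'(1) by (intro add_strict_mono mult_strict_left_mono mult_strict_right_mono) auto
  also have "\<dots> = e" using B(1) B'(1) by simp
  finally show ?thesis .
 qed
 then show "\<exists>d>0. close (%a. F a * G a) d e"
  using d1(1) d2(1) by (intro exI[of _ "min d1 d2"]) auto
qed

lemma uc_cnj: "uc F ==> uc (%a. cnj (F a))"
 unfolding uc_def by (simp flip: complex_cnj_diff)

lemma uc_diff: "uc F ==> uc G ==> uc (%a. F a - G a)"
 using uc_add[of F "%a. (-1) * G a"] uc_mult[of "%_. -1" G] by simp

lemma uc_sum:
 assumes "\<And>i. i \<in> I ==> uc (F i)"
 shows "uc (%a. \<Sum>i\<in>I. F i a)"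
 using assms by (induction I rule: infinite_finite_induct) (auto intro: uc_add)

lemma uc_sum_list:
 assumes "\<And>i. i \<in> set I ==> uc (F i)"
 shows "uc (%a. \<Sum>i\<leftarrow>I. F i a)"
 using assms by (induction I) (auto intro: uc_add)

lemma translate_div: "c \<in> carrier A ==> a \<in> carrier A ==> b \<in> carrier A ==> (c \<otimes> a) \<otimes> inv (c \<otimes> b) = a \<otimes> inv b"
proof -
 assume *: "c \<in> carrier A" "a \<in> carrier A" "b \<in> carrier A"
 then have "(c \<otimes> a) \<otimes> inv (c \<otimes> b) = (c \<otimes> inv c) \<otimes> (a \<otimes> inv b)"
  by (simp only: inv_mult m_closed inv_closed m_ac)
 then show ?thesis using * by simp
qed

lemma uc_translate:
 assumes "uc F" "c \<in> carrier A" shows "uc (%a. F (c \<otimes> a))"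
proof (rule ucI)
 fix e :: real assume "e > 0"
 then obtain d where d: "d > 0" "PROP modulus F d e"
  using ucE[OF assms(1)] by blast
 then show "\<exists>d>0. close (%a. F (c \<otimes> a)) d e"
  using assms(2) by (intro exI[of _ d]) (auto simp: translate_div)
qed

section \<open>Averages over translates and the invariant mean\<close>

text \<open>Translates are listed with repetition, so that multiplicities act as weights and an
  average of averages is again an average, along \<open>products\<close>.\<close>

definition avg :: "'a list => ('a => complex) => 'a => complex" where
 "avg cs F a = (\<Sum>c\<leftarrow>cs. F (c \<otimes> a)) / of_nat (length cs)"

definition points :: "'a list => bool" where
 "points cs \<longleftrightarrow> cs ~= [] \<and> set cs \<subseteq> carrier A"

definition products :: "'a list => 'a list => 'a list" where
 "products cs ds = [d \<otimes> c. c \<leftarrow> cs, d \<leftarrow> ds]"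

lemma points_products: "points cs ==> points ds ==> points (products cs ds)"
 unfolding points_def products_def by (cases cs; cases ds) auto

lemma length_products: "length (products cs ds) = length cs * length ds"
 unfolding products_def by (induction cs) auto

lemma avg_products:
 assumes "points cs" "points ds" "a \<in> carrier A"
 shows "avg (products cs ds) F a = avg cs (avg ds F) a"
proof -
 have "set cs \<subseteq> carrier A ==> (\<Sum>c\<leftarrow>products cs ds. F (c \<otimes> a)) = (\<Sum>c\<leftarrow>cs. \<Sum>d\<leftarrow>ds. F (d \<otimes> (c \<otimes> a)))"
  unfolding products_def
 proof (induction cs)
  case (Cons c cs)
  have "(\<Sum>d\<leftarrow>ds. F (d \<otimes> c \<otimes> a)) = (\<Sum>d\<leftarrow>ds. F (d \<otimes> (c \<otimes> a)))"
   using Cons.prems assms by (intro arg_cong[where f=sum_list] map_cong) (auto simp: points_def m_assoc subset_iff)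
  then show ?case using Cons by (simp add: o_def)
 qed simp
 then have "avg (products cs ds) F a = (\<Sum>c\<leftarrow>cs. \<Sum>d\<leftarrow>ds. F (d \<otimes> (c \<otimes> a))) / (of_nat (length cs) * of_nat (length ds))"
  using assms unfolding avg_def by (simp add: points_def length_products)
 also have "\<dots> = avg cs (avg ds F) a"
  unfolding avg_def sum_list_divide by (simp add: mult.commute)
 finally show ?thesis .
qed

lemma avg_comm:
 assumes "points cs" "points ds" "a \<in> carrier A"
 shows "avg cs (avg ds F) a = avg ds (avg cs F) a"
proof -
 have "(\<Sum>c\<leftarrow>cs. \<Sum>d\<leftarrow>ds. F (d \<otimes> (c \<otimes> a))) = (\<Sum>c\<leftarrow>cs. \<Sum>d\<leftarrow>ds. F (c \<otimes> (d \<otimes> a)))"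
  using assms by (intro arg_cong[where f=sum_list] map_cong refl) (auto simp: points_def subset_iff m_lcomm)
 also have "\<dots> = (\<Sum>d\<leftarrow>ds. \<Sum>c\<leftarrow>cs. F (c \<otimes> (d \<otimes> a)))" by (rule sum_list_swap)
 finally show ?thesis
  unfolding avg_def divide_inverse sum_list_mult_const by (simp add: mult_ac)
qed

lemma norm_avg_diff_le:
 assumes "points cs" "a \<in> carrier A" "\<And>b. b \<in> carrier A ==> norm (F b - m) <= e"
 shows "norm (avg cs F a - m) <= e"
proof -
 have l: "length cs > 0" using assms by (simp add: points_def)
 have "avg cs F a - m = (\<Sum>c\<leftarrow>cs. F (c \<otimes> a) - m) / of_nat (length cs)"
  using l unfolding avg_def by (simp add: sum_list_subtractf sum_list_triv field_simps)
 moreover have "norm (\<Sum>c\<leftarrow>cs. F (c \<otimes> a) - m) <= length cs * e"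
  using assms by (intro norm_sum_list_le) (auto simp: points_def)
 ultimately show ?thesis using l by (simp add: norm_divide divide_le_eq mult.commute)
qed

definition near :: "'a list => ('a => complex) => complex => real => bool" where
 "near cs F m e \<longleftrightarrow> points cs \<and> (\<forall>a\<in>carrier A. norm (avg cs F a - m) <= e)"

text \<open>Further averaging keeps closeness to a constant, in either order since averages commute.
  This lets one list serve finitely many functions, and it makes the constant unique.\<close>

lemma near_products:
 assumes "near cs F m e" "points ds"
 shows "near (products ds cs) F m e" "near (products cs ds) F m e"
proof -
 have *: "norm (avg ds (avg cs F) a - m) <= e" if "a \<in> carrier A" for a
  by (rule norm_avg_diff_le) (use assms that in \<open>auto simp: near_def\<close>)
 show "near (products ds cs) F m e" "near (products cs ds) F m e"
  using assms * avg_comm[of cs ds] unfolding near_def by (simp_all add: points_products avg_products)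
qed

lemma near_common:
 assumes "finite I" "\<And>i. i \<in> I ==> \<exists>cs. near cs (F i) (m i) e"
 shows "\<exists>cs. points cs \<and> (\<forall>i\<in>I. near cs (F i) (m i) e)"
 using assms
proof (induction I rule: finite_induct)
 case empty
 then show ?case by (intro exI[of _ "[\<one>]"]) (auto simp: points_def)
next
 case (insert j I)
 then obtain cs where "points cs" "\<forall>i\<in>I. near cs (F i) (m i) e" by auto
 moreover obtain ds where "near ds (F j) (m j) e" using insert.prems by blast
 moreover from this have "points ds" by (simp add: near_def)
 ultimately show ?case
  by (intro exI[of _ "products cs ds"]) (auto intro: near_products points_products)
qed

lemma near_unique:
 assumes "near cs F m e" "near ds F n e'" shows "norm (m - n) <= e + e'"
proof -
 have "near (products cs ds) F m e" "near (products cs ds) F n e'"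
  using assms near_products by (auto simp: near_def)
 then have "norm (avg (products cs ds) F \<one> - m) <= e" "norm (avg (products cs ds) F \<one> - n) <= e'"
  by (auto simp: near_def)
 then show ?thesis using norm_triangle_ineq4[of "avg (products cs ds) F \<one> - n" "avg (products cs ds) F \<one> - m"] by simp
qed

text \<open>Von Neumann's mean of an almost periodic function. For uniformly continuous functions
  existence is \<open>mean_near\<close>.\<close>

definition mean :: "('a => complex) => complex" where
 "mean F = (THE m. \<forall>e>0. \<exists>cs. near cs F m e)"

lemma mean_eqI:
 assumes "\<And>e. e > 0 ==> \<exists>cs. near cs F m e" shows "mean F = m"
 unfolding mean_def
proof (rule the_equality)
 show "\<forall>e>0. \<exists>cs. near cs F m e" using assms by blast
 fix n assume n: "\<forall>e>0. \<exists>cs. near cs F n e"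
 have "norm (n - m) <= 0 + e" if e: "e > 0" for e
 proof -
  obtain cs ds where "near cs F n (e/2)" "near ds F m (e/2)" using n assms e by (meson half_gt_zero)
  from near_unique[OF this] show ?thesis by simp
 qed
 then have "norm (n - m) <= 0" by (rule field_le_epsilon)
 then show "n = m" by simp
qed

text \<open>Average over a net \<open>C\<close>. Given \<open>a\<close> and \<open>b\<close>, the
  point \<open>c1 \<otimes> a\<close> is close to \<open>c' \<otimes> b\<close> for some
  \<open>c'\<close> in \<open>C\<close>; exchanging \<open>c1\<close> and \<open>c'\<close> in the
  second average pairs these two, so one of the \<open>card C\<close> differences is below
  \<open>e\<close> and the excess \<open>w\<close> shrinks by the factor
  \<open>1 - 1 / card C\<close>. The list does not depend on \<open>F\<close>, which allows
  iteration.\<close>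

lemma oscillation_contract:
 assumes "d > 0" "e > 0"
 obtains cs where "points cs"
  "\<And>F w. (PROP modulus F d e) ==>
    (\<And>a b. a \<in> carrier A ==> b \<in> carrier A ==> norm (F a - F b) <= e + w) ==>
    (\<forall>a\<in>carrier A. \<forall>b\<in>carrier A. norm (avg cs F a - avg cs F b) <= e + (1 - 1 / length cs) * w)"
proof -
 obtain C where C: "finite C" "C \<subseteq> carrier A" "\<forall>a\<in>carrier A. \<exists>c\<in>C. D (a \<otimes> inv c) < d"
  using TB[OF assms(1)] by blast
 obtain cs where cs: "set cs = C" "distinct cs" using finite_distinct_list[OF C(1)] by blast
 obtain c1 where c1: "c1 \<in> C" using C(3) by blast
 have lc: "length cs = card C" using distinct_card[OF cs(2)] cs(1) by simp
 have cC: "card C > 0" using c1 C(1) by (auto simp: card_gt_0_iff)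
 show thesis
 proof (rule that[of cs], goal_cases)
  case 1
  then show ?case using cs C c1 by (auto simp: points_def)
 next
  case (2 F w)
  show ?case
  proof (intro ballI)
   fix a b assume ab: "a \<in> carrier A" "b \<in> carrier A"
   have "c1 \<otimes> a \<otimes> inv b \<in> carrier A" using ab c1 C by auto
   then obtain c' where c': "c' \<in> C" "D (c1 \<otimes> a \<otimes> inv b \<otimes> inv c') < d" using C by blast
   have cc: "c1 \<in> carrier A" "c' \<in> carrier A" using c1 c' C by auto
   have "c1 \<otimes> a \<otimes> inv b \<otimes> inv c' = (c1 \<otimes> a) \<otimes> inv (c' \<otimes> b)"
    using ab cc by (simp add: inv_mult_group m_assoc)
   then have close: "norm (F (c1 \<otimes> a) - F (c' \<otimes> b)) < e" using c'(2) ab cc by (intro 2(1)) auto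
   let ?t = "Transposition.transpose c1 c'"
   have "(\<Sum>c\<in>C. F (c \<otimes> b)) = (\<Sum>c\<in>C. F (?t c \<otimes> b))"
    using c1 c' by (intro sum.reindex_bij_betw[symmetric] ) (auto intro: bij_betw_transpose_iff)
   then have "norm ((\<Sum>c\<in>C. F (c \<otimes> a)) - (\<Sum>c\<in>C. F (c \<otimes> b))) = norm (\<Sum>c\<in>C. F (c \<otimes> a) - F (?t c \<otimes> b))"
    by (simp add: sum_subtractf)
   also have "\<dots> <= (\<Sum>c\<in>C. if c = c1 then e else e + w)"
   proof (rule sum_norm_le)
    fix c assume c: "c \<in> C"
    have "?t c \<in> carrier A" using c cc C by (auto simp: Transposition.transpose_def)
    then show "norm (F (c \<otimes> a) - F (?t c \<otimes> b)) <= (if c = c1 then e else e + w)"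
     using close 2(2) ab c C by (auto)
   qed
   also have "\<dots> = e + (real (card C) - 1) * (e + w)"
    using c1 C(1) cC by (simp add: sum.remove[of C c1] of_nat_diff)
   finally have "norm ((\<Sum>c\<in>C. F (c \<otimes> a)) - (\<Sum>c\<in>C. F (c \<otimes> b))) <= e + (real (card C) - 1) * (e + w)" .
   moreover have "avg cs F a - avg cs F b = ((\<Sum>c\<in>C. F (c \<otimes> a)) - (\<Sum>c\<in>C. F (c \<otimes> b))) / of_nat (card C)"
    unfolding avg_def lc using cs by (simp add: sum.distinct_set_conv_list[symmetric] diff_divide_distrib)
   ultimately have "norm (avg cs F a - avg cs F b) <= (e + (real (card C) - 1) * (e + w)) / card C"
    by (simp add: norm_divide divide_right_mono)
   also have "\<dots> = e + (1 - 1 / length cs) * w"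
    using cC unfolding lc by (simp add: field_simps)
   finally show "norm (avg cs F a - avg cs F b) <= e + (1 - 1 / length cs) * w" .
  qed
 qed
qed

text \<open>Iterates \<open>oscillation_contract\<close> with one and the same list: averaging keeps
  the modulus of continuity of \<open>F\<close>, so the hypotheses hold again at each round.\<close>

lemma oscillation_small:
 assumes "uc F" "e > 0"
 shows "\<exists>cs. points cs \<and> (\<forall>a\<in>carrier A. \<forall>b\<in>carrier A. norm (avg cs F a - avg cs F b) <= e)"
proof -
 obtain B where B: "B > 0" "\<And>a. a \<in> carrier A ==> norm (F a) <= B" using uc_bounded[OF assms(1)] by blast
 obtain d where d: "d > 0" "PROP modulus F d (e/2)"
  using ucE[OF assms(1), of "e/2"] assms(2) by auto
 obtain cs where cs: "points cs" "\<And>F w. (PROP modulus F d (e/2)) ==>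
    (\<And>a b. a \<in> carrier A ==> b \<in> carrier A ==> norm (F a - F b) <= e/2 + w) ==>
    (\<forall>a\<in>carrier A. \<forall>b\<in>carrier A. norm (avg cs F a - avg cs F b) <= e/2 + (1 - 1 / length cs) * w)"
  using oscillation_contract[OF d(1), of "e/2"] assms(2) by (metis half_gt_zero)
 define q where "q = 1 - 1 / real (length cs)"
 have l: "length cs > 0" using cs(1) by (simp add: points_def)
 have modulus: "norm (avg ds F a - avg ds F b) < e/2" if "points ds" "a \<in> carrier A" "b \<in> carrier A" "D (a \<otimes> inv b) < d" for ds a b
 proof -
  have l: "length ds > 0" using that by (simp add: points_def)
  \<comment> \<open>The maximum over the finite list keeps the inequality strict.\<close>
  define m where "m = Max ((%c. norm (F (c \<otimes> a) - F (c \<otimes> b))) ` set ds)"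
  have "m < e/2" unfolding m_def using that d(2) by (subst Max_less_iff) (auto simp: points_def translate_div subset_iff)
  have "norm (\<Sum>c\<leftarrow>ds. F (c \<otimes> a) - F (c \<otimes> b)) <= length ds * m"
   unfolding m_def by (intro norm_sum_list_le Max_ge) auto
  moreover have "avg ds F a - avg ds F b = (\<Sum>c\<leftarrow>ds. F (c \<otimes> a) - F (c \<otimes> b)) / of_nat (length ds)"
   unfolding avg_def by (simp add: sum_list_subtractf diff_divide_distrib)
  ultimately have "norm (avg ds F a - avg ds F b) <= m" using l by (simp add: norm_divide divide_le_eq mult.commute)
  then show ?thesis using \<open>m < e/2\<close> by simp
 qed
 have ex: "\<exists>ds. points ds \<and> (\<forall>a\<in>carrier A. \<forall>b\<in>carrier A. norm (avg ds F a - avg ds F b) <= e/2 + q ^ n * (2 * B))" for n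
 proof (induction n)
  case 0
  have "norm (avg [\<one>] F a - avg [\<one>] F b) <= e/2 + 2 * B" if "a \<in> carrier A" "b \<in> carrier A" for a b
   using B(2)[OF that(1)] B(2)[OF that(2)] norm_triangle_ineq4[of "F a" "F b"] assms(2) that by (simp add: avg_def)
  then show ?case by (intro exI[of _ "[\<one>]"]) (auto simp: points_def)
 next
  case (Suc n)
  then obtain ds where ds: "points ds" "\<And>a b. a \<in> carrier A ==> b \<in> carrier A ==> norm (avg ds F a - avg ds F b) <= e/2 + q ^ n * (2 * B)" by blast
  have "\<forall>a\<in>carrier A. \<forall>b\<in>carrier A. norm (avg cs (avg ds F) a - avg cs (avg ds F) b) <= e/2 + q * (q ^ n * (2 * B))"
   using cs(2)[of "avg ds F", OF modulus[OF ds(1)] ds(2)] unfolding q_def by simp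
  then show ?case using cs(1) ds(1)
   by (intro exI[of _ "products cs ds"]) (auto simp: points_products avg_products mult.assoc)
 qed
 have q: "0 <= q" "q < 1" unfolding q_def using l by (auto simp: Suc_leI)
 then have "(%n. q ^ n * (2 * B)) \<longlonglongrightarrow> 0 * (2 * B)" by (intro tendsto_mult LIMSEQ_realpow_zero tendsto_const)
 then have "\<forall>\<^sub>F n in sequentially. q ^ n * (2 * B) < e/2" using assms(2) by (intro order_tendstoD(2)[where y="0*(2*B)"]) auto
 then obtain n where "q ^ n * (2 * B) < e/2" by (auto simp: eventually_sequentially)
 then have "e/2 + q ^ n * (2 * B) <= e" by linarith
 with ex[of n] show ?thesis by (meson order.trans)
qed

lemma mean_near:
 assumes "uc F" "e > 0" shows "\<exists>cs. near cs F (mean F) e"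
proof -
 obtain cs where cs: "\<And>n::nat. points (cs n)"
  "\<And>n a b. a \<in> carrier A ==> b \<in> carrier A ==> norm (avg (cs n) F a - avg (cs n) F b) <= inverse (Suc n)"
 proof -
  have "\<forall>n. \<exists>cs. points cs \<and> (\<forall>a\<in>carrier A. \<forall>b\<in>carrier A. norm (avg cs F a - avg cs F b) <= inverse (Suc n))"
   by (intro allI oscillation_small assms(1)) simp
  then show thesis using that by (elim choice[THEN exE]) blast
 qed
 define x where "x = (%n. avg (cs n) F \<one>)"
 have nr: "near (cs n) F (x n) (inverse (Suc n))" for n
  unfolding near_def x_def using cs by blast
 have "Cauchy x"
 proof (rule CauchyI')
  fix e :: real assume "e > 0"
  then obtain M where M: "inverse (real (Suc M)) < e/2" using reals_Archimedean[of "e/2"] by auto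
  have "dist (x m) (x n) < e" if "m >= M" "n > m" for m n
  proof -
   have "norm (x m - x n) <= inverse (Suc m) + inverse (Suc n)" by (rule near_unique[OF nr nr])
   also have "\<dots> <= inverse (Suc M) + inverse (Suc M)" using that by (intro add_mono le_imp_inverse_le) auto
   finally show ?thesis using M by (simp add: dist_norm)
  qed
  then show "\<exists>M. \<forall>m\<ge>M. \<forall>n>m. dist (x m) (x n) < e" by blast
 qed
 then obtain m where m: "x \<longlonglongrightarrow> m" using Cauchy_convergent_iff convergent_def by blast
 have lim: "\<exists>cs. near cs F m e" if e: "e > 0" for e
 proof -
  have "\<forall>\<^sub>F n in sequentially. dist (x n) m < e/2" using tendstoD[OF m, of "e/2"] e by simp
  moreover have "\<forall>\<^sub>F n in sequentially. inverse (real (Suc n)) < e/2"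
   using e LIMSEQ_inverse_real_of_nat by (intro order_tendstoD) auto
  ultimately have "\<forall>\<^sub>F n in sequentially. dist (x n) m < e/2 \<and> inverse (real (Suc n)) < e/2" by (rule eventually_conj)
  then obtain n where n: "dist (x n) m < e/2" "inverse (real (Suc n)) < e/2" by (auto simp: eventually_sequentially)
  have "norm (avg (cs n) F a - m) <= e" if "a \<in> carrier A" for a
   using nr[of n] that n norm_triangle_ineq[of "avg (cs n) F a - x n" "x n - m"] unfolding near_def by (force simp: dist_norm)
  then show ?thesis using cs(1) unfolding near_def by blast
 qed
 then show ?thesis using mean_eqI[OF lim] assms(2) by metis
qed

lemma mean_near_finite:
 assumes "finite I" "\<And>i. i \<in> I ==> uc (F i)" "e > 0"
 obtains cs where "points cs" "\<And>i. i \<in> I ==> near cs (F i) (mean (F i)) e"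
 using near_common[of I F "%i. mean (F i)" e] assms mean_near by blast

lemma mean_near2:
 assumes "uc F" "uc G" "e > 0"
 obtains cs where "near cs F (mean F) e" "near cs G (mean G) e"
proof -
 obtain cs ds where "near cs F (mean F) e" "near ds G (mean G) e" using mean_near assms by metis
 then show thesis using that[of "products cs ds"] near_products near_def by auto
qed

lemma avg_cong: "points cs ==> a \<in> carrier A ==> (\<And>b. b \<in> carrier A ==> F b = G b) ==> avg cs F a = avg cs G a"
 unfolding avg_def points_def by (intro arg_cong2[where f="(/)"] arg_cong[where f=sum_list] map_cong refl) auto

lemma mean_cong:
 assumes "\<And>a. a \<in> carrier A ==> F a = G a" shows "mean F = mean G"
proof -
 have "near cs F m e \<longleftrightarrow> near cs G m e" for cs m e
  unfolding near_def using avg_cong[of cs _ F G] assms by auto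
 then show ?thesis unfolding mean_def by simp
qed

lemma mean_const [simp]: "mean (%_. c) = c"
 by (rule mean_eqI, rule exI[of _ "[\<one>]"]) (auto simp: near_def points_def avg_def)

lemma mean_add:
 assumes "uc F" "uc G" shows "mean (%a. F a + G a) = mean F + mean G"
proof (rule mean_eqI)
 fix e :: real assume "e > 0"
 obtain cs where cs: "near cs F (mean F) (e/2)" "near cs G (mean G) (e/2)"
  using mean_near2[OF assms, of "e/2"] \<open>e > 0\<close> by (metis half_gt_zero)
 have "norm (avg cs (%a. F a + G a) a - (mean F + mean G)) <= e" if a: "a \<in> carrier A" for a
 proof -
  have "avg cs (%a. F a + G a) a = avg cs F a + avg cs G a" unfolding avg_def by (simp add: sum_list_addf add_divide_distrib)
  then show ?thesis using cs a norm_triangle_ineq[of "avg cs F a - mean F" "avg cs G a - mean G"] unfolding near_def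
   by (force simp: algebra_simps)
 qed
 then show "\<exists>cs. near cs (%a. F a + G a) (mean F + mean G) e" using cs unfolding near_def by blast
qed

lemma mean_scale:
 assumes "uc F" shows "mean (%a. c * F a) = c * mean F"
proof (rule mean_eqI)
 fix e :: real assume "e > 0"
 then obtain cs where cs: "near cs F (mean F) (e / (1 + norm c))"
  using mean_near[OF assms, of "e / (1 + norm c)"] by (auto simp: add_pos_nonneg)
 have "norm (avg cs (%a. c * F a) a - c * mean F) <= e" if a: "a \<in> carrier A" for a
 proof -
  have "avg cs (%a. c * F a) a = c * avg cs F a" unfolding avg_def by (simp add: sum_list_const_mult)
  then have "norm (avg cs (%a. c * F a) a - c * mean F) = norm c * norm (avg cs F a - mean F)" by (metis norm_mult right_diff_distrib')
  also have "\<dots> <= (1 + norm c) * (e / (1 + norm c))" using cs a unfolding near_def by (intro mult_mono) auto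
  also have "\<dots> = e" by (simp add: add_nonneg_eq_0_iff)
  finally show ?thesis .
 qed
 then show "\<exists>cs. near cs (%a. c * F a) (c * mean F) e" using cs unfolding near_def by blast
qed

lemma mean_diff: "uc F ==> uc G ==> mean (%a. F a - G a) = mean F - mean G"
 using mean_add[of F "%a. (-1) * G a"] mean_scale[of G "-1"] uc_mult[of "%_. -1" G] by simp

lemma mean_sum:
 assumes "\<And>i. i \<in> I ==> uc (F i)"
 shows "mean (%a. \<Sum>i\<in>I. F i a) = (\<Sum>i\<in>I. mean (F i))"
 using assms by (induction I rule: infinite_finite_induct) (auto simp: mean_add uc_sum)

lemma mean_sum_list:
 assumes "\<And>i. i \<in> set I ==> uc (F i)"
 shows "mean (%a. \<Sum>i\<leftarrow>I. F i a) = (\<Sum>i\<leftarrow>I. mean (F i))"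
 using assms by (induction I) (auto simp: mean_add uc_sum_list)

lemma mean_cnj:
 assumes "uc F" shows "mean (%a. cnj (F a)) = cnj (mean F)"
proof (rule mean_eqI)
 fix e :: real assume "e > 0"
 then obtain cs where cs: "near cs F (mean F) e" using mean_near[OF assms] by blast
 have "sum_list (map (%c. cnj (F (c \<otimes> a))) ds) = cnj (sum_list (map (%c. F (c \<otimes> a)) ds))" for ds a
  by (induction ds) auto
 then have "avg cs (%a. cnj (F a)) a - cnj (mean F) = cnj (avg cs F a - mean F)" for a
  by (simp add: avg_def)
 then have "norm (avg cs (%a. cnj (F a)) a - cnj (mean F)) = norm (avg cs F a - mean F)" for a
  by (metis complex_mod_cnj)
 then show "\<exists>cs. near cs (%a. cnj (F a)) (cnj (mean F)) e" using cs unfolding near_def by auto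
qed

lemma mean_translate:
 assumes "uc F" "c \<in> carrier A" shows "mean (%a. F (c \<otimes> a)) = mean F"
proof (rule mean_eqI)
 fix e :: real assume "e > 0"
 then obtain cs where cs: "near cs F (mean F) e" using mean_near[OF assms(1)] by blast
 have "avg cs (%a. F (c \<otimes> a)) a = avg cs F (c \<otimes> a)" if "a \<in> carrier A" for a
  using cs assms that unfolding avg_def near_def points_def
  by (intro arg_cong2[where f="(/)"] arg_cong[where f=sum_list] map_cong refl arg_cong[where f=F]) (auto simp: m_lcomm subset_iff)
 then show "\<exists>cs. near cs (%a. F (c \<otimes> a)) (mean F) e" using cs assms(2) unfolding near_def by auto
qed

lemma mean_inv:
 assumes "uc F" shows "mean (%a. F (inv a)) = mean F"
proof (rule mean_eqI)
 fix e :: real assume "e > 0"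
 then obtain cs where cs: "near cs F (mean F) e" using mean_near[OF assms(1)] by blast
 let ?ds = "map (%c. inv c) cs"
 have "avg ?ds (%a. F (inv a)) a = avg cs F (inv a)" if "a \<in> carrier A" for a
  using cs assms that unfolding avg_def near_def points_def map_map o_def length_map
  by (intro arg_cong2[where f="(/)"] arg_cong[where f=sum_list] map_cong refl arg_cong[where f=F]) (auto simp: inv_mult subset_iff)
 moreover have "points ?ds" using cs by (auto simp: near_def points_def)
 ultimately show "\<exists>cs. near cs (%a. F (inv a)) (mean F) e" using cs unfolding near_def by (intro exI[of _ ?ds]) auto
qed

lemma norm_mean_diff_le:
 assumes "uc F" "\<And>a. a \<in> carrier A ==> norm (F a - m) <= B" shows "norm (mean F - m) <= B"
proof (rule field_le_epsilon)
 fix e :: real assume "e > 0"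
 then obtain cs where cs: "near cs F (mean F) e" using mean_near[OF assms(1)] by blast
 then have "norm (avg cs F \<one> - mean F) <= e" "norm (avg cs F \<one> - m) <= B"
  using norm_avg_diff_le[of cs \<one> F m B] assms(2) by (auto simp: near_def)
 then show "norm (mean F - m) <= B + e" using norm_triangle_ineq4[of "avg cs F \<one> - m" "avg cs F \<one> - mean F"] by simp
qed

lemma norm_mean_le:
 assumes "uc F" "\<And>a. a \<in> carrier A ==> norm (F a) <= B" shows "norm (mean F) <= B"
 using norm_mean_diff_le[of F 0 B] assms by simp

lemma mean_real:
 assumes "uc F" "\<And>a. a \<in> carrier A ==> Im (F a) = 0" shows "Im (mean F) = 0"
proof -
 have "mean (%a. cnj (F a)) = mean F"
  by (rule mean_cong) (simp add: complex_eq_iff assms(2))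
 then have "cnj (mean F) = mean F" using mean_cnj[OF assms(1)] by simp
 then show ?thesis by (metis complex_cnj cnj.sel(2) equal_neg_zero)
qed

lemma mean_nonneg:
 assumes "uc F" "\<And>a. a \<in> carrier A ==> 0 <= Re (F a)" shows "0 <= Re (mean F)"
proof (rule field_le_epsilon)
 fix e :: real assume "e > 0"
 then obtain cs where cs: "near cs F (mean F) e" using mean_near[OF assms(1)] by blast
 have "set ds \<subseteq> carrier A ==> 0 <= Re (\<Sum>c\<leftarrow>ds. F (c \<otimes> \<one>))" for ds
  by (induction ds) (auto simp: assms(2))
 then have "0 <= Re (avg cs F \<one>)" using cs unfolding avg_def near_def points_def by (simp add: Re_divide_of_nat)
 moreover have "norm (avg cs F \<one> - mean F) <= e" using cs by (auto simp: near_def)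
 ultimately show "0 <= Re (mean F) + e" using abs_Re_le_cmod[of "avg cs F \<one> - mean F"] by simp
qed

lemma mean_mono:
 assumes "uc F" "uc G" "\<And>a. a \<in> carrier A ==> Re (F a) <= Re (G a)"
 shows "Re (mean F) <= Re (mean G)"
 using mean_nonneg[of "%a. G a - F a"] assms by (simp add: mean_diff uc_diff)

text \<open>Finitely many translates of the part of \<open>F\<close> near the identity cover the
  group: their sum is at least \<open>Re (F \<one>) / 2\<close> everywhere, and its mean is
  \<open>card C\<close> times that of \<open>F\<close>.\<close>

lemma mean_pos:
 assumes "uc F" "\<And>a. a \<in> carrier A ==> 0 <= Re (F a)" "0 < Re (F \<one>)" shows "0 < Re (mean F)"
proof -
 obtain d where d: "d > 0" "PROP modulus F d (Re (F \<one>) / 2)"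
  using ucE[OF assms(1), of "Re (F \<one>) / 2"] assms(3) by auto
 obtain C where C: "finite C" "C \<subseteq> carrier A" "\<forall>a\<in>carrier A. \<exists>c\<in>C. D (a \<otimes> inv c) < d"
  using TB[OF d(1)] by blast
 have u: "uc (%a. F (inv c \<otimes> a))" if "c \<in> C" for c using that C assms(1) by (intro uc_translate) auto
 have "Re (F \<one>) / 2 = Re (mean (%_. of_real (Re (F \<one>) / 2)))" by simp
 also have "\<dots> <= Re (mean (%a. \<Sum>c\<in>C. F (inv c \<otimes> a)))"
 proof (rule mean_mono)
  show "uc (%a. \<Sum>c\<in>C. F (inv c \<otimes> a))" by (intro uc_sum u)
  fix a assume a: "a \<in> carrier A"
  then obtain c where c: "c \<in> C" "D (a \<otimes> inv c) < d" using C by blast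
  have cc: "c \<in> carrier A" using c C by blast
  have "norm (F (inv c \<otimes> a) - F \<one>) < Re (F \<one>) / 2"
   using c cc a by (intro d(2)) (auto simp: m_comm)
  then have "Re (F \<one>) / 2 <= Re (F (inv c \<otimes> a))"
   using abs_Re_le_cmod[of "F (inv c \<otimes> a) - F \<one>"] by simp
  also have "\<dots> <= (\<Sum>c\<in>C. Re (F (inv c \<otimes> a)))"
   using c C a by (intro member_le_sum) (auto intro!: assms(2))
  finally show "Re (of_real (Re (F \<one>) / 2)) <= Re (\<Sum>c\<in>C. F (inv c \<otimes> a))" by simp
 qed simp
 also have "mean (%a. \<Sum>c\<in>C. F (inv c \<otimes> a)) = (\<Sum>c\<in>C. mean F)"
 proof -
  have "mean (%a. F (inv c \<otimes> a)) = mean F" if "c \<in> C" for c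
   using that C assms(1) by (intro mean_translate) auto
  then show ?thesis using u by (simp add: mean_sum)
 qed
 also have "Re \<dots> = card C * Re (mean F)" by simp
 finally have "0 < card C * Re (mean F)" using assms(3) by simp
 then show ?thesis by (simp add: zero_less_mult_iff)
qed

section \<open>Functions of two variables and the exchange of means\<close>

definition uc2 :: "('a => 'a => complex) => bool" where
 "uc2 F \<longleftrightarrow> (\<forall>e>0. \<exists>d>0. close2 F d e)"

lemma uc2E:
 assumes "uc2 F" "e > 0"
 obtains d where "d > 0" "PROP modulus2 F d e"
proof -
 obtain d where "d > 0 \<and> (close2 F d e)"
  using mp[OF spec[OF assms(1)[unfolded uc2_def]] assms(2)] by (rule exE)
 then show thesis using that[of d] by simp
qed

lemma uc2_flip: "uc2 F ==> uc2 (%a b. F b a)"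
 unfolding uc2_def
proof (intro allI impI, goal_cases)
 case (1 e)
 then obtain d where "d > 0" "close2 F d e"
  by (elim allE[of _ e] impE exE conjE)
 then show ?case by (intro exI[of _ d]) simp
qed

lemma uc2_snd:
 assumes "uc2 F" "a \<in> carrier A" shows "uc (F a)"
proof (rule ucI)
 fix e :: real assume "e > 0"
 then obtain d where "d > 0" "PROP modulus2 F d e"
  using uc2E[OF assms(1)] by blast
 then show "\<exists>d>0. \<forall>x\<in>carrier A. \<forall>b\<in>carrier A. D (x \<otimes> inv b) < d --> norm (F a x - F a b) < e"
  using assms(2) by (intro exI[of _ d]) auto
qed

lemma uc_mean_snd:
 assumes "uc2 F" shows "uc (%a. mean (F a))"
proof (rule ucI)
 fix e :: real assume e: "e > 0"
 then obtain d where d: "d > 0" "PROP modulus2 F d (e/2)"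
  using uc2E[OF assms, of "e/2"] by auto
 have "norm (mean (F a) - mean (F b)) < e" if "a \<in> carrier A" "b \<in> carrier A" "D (a \<otimes> inv b) < d" for a b
 proof -
  have "norm (mean (%x. F a x - F b x)) <= e/2"
   using that d assms by (intro norm_mean_le uc_diff uc2_snd) (auto intro!: less_imp_le)
  then show ?thesis using that e assms by (simp add: mean_diff uc2_snd)
 qed
 then show "\<exists>d>0. close (%a. mean (F a)) d e"
  using d(1) by blast
qed

text \<open>A list that works for the finitely many rows \<open>F c\<close> with \<open>c\<close> in
  a \<open>d\<close>-net works for every row, since each row is uniformly within \<open>e\<close> of
  one of these; this costs \<open>3 * e\<close>. The same list is made to handle both iterated means
  as well.\<close>

lemma double_near:
 assumes "uc2 F" "e0 > 0"
 obtains cs where "points cs" "\<And>x. x \<in> carrier A ==> norm (avg cs (F x) \<one> - mean (F x)) <= e0"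
  "near cs (%a. mean (F a)) (mean (%a. mean (F a))) e0" "near cs (%b. mean (%a. F a b)) (mean (%b. mean (%a. F a b))) e0"
proof -
 let ?M = "%a. mean (F a)" and ?G = "%b. mean (%a. F a b)"
 define e where "e = e0 / 3"
 have e: "e > 0" "3 * e = e0" using assms(2) by (simp_all add: e_def)
 obtain d where d: "d > 0" "PROP modulus2 F d e" using uc2E[OF assms(1) e(1)] by blast
 obtain C where C: "finite C" "C \<subseteq> carrier A" "\<forall>a\<in>carrier A. \<exists>c\<in>C. D (a \<otimes> inv c) < d" using TB[OF d(1)] by blast
 obtain cs1 where cs1: "points cs1" "\<And>c. c \<in> C ==> near cs1 (F c) (mean (F c)) e"
  using mean_near_finite[of C F e] C(1,2) uc2_snd[OF assms(1)] e by (metis subsetD)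
 have uG: "uc ?G" by (rule uc_mean_snd[OF uc2_flip[OF assms(1)]])
 obtain cs2 where cs2: "near cs2 ?G (mean ?G) (3 * e)" "near cs2 ?M (mean ?M) (3 * e)" using mean_near2[OF uG uc_mean_snd[OF assms(1)], of "3 * e"] e by auto
 define cs where "cs = products cs1 cs2"
 have cs: "points cs" "\<And>c. c \<in> C ==> near cs (F c) (mean (F c)) e" "near cs ?M (mean ?M) (3 * e)" "near cs ?G (mean ?G) (3 * e)"
  unfolding cs_def using cs1 cs2 near_products points_products by (auto simp: near_def)
 have inner: "norm (avg cs (F x) \<one> - mean (F x)) <= 3 * e" if x: "x \<in> carrier A" for x
 proof -
  obtain c where c: "c \<in> C" "D (x \<otimes> inv c) < d" using C(3) x by blast
  have cc: "c \<in> carrier A" using c C(2) by blast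
  have close: "norm (F x b - F c b) <= e" if "b \<in> carrier A" for b
   using d(2)[of x c b b] x cc that c(2) d(1) by simp
  have "norm (avg cs (%y. F x y - F c y) \<one> - 0) <= e" by (rule norm_avg_diff_le[OF cs(1)]) (simp_all add: close)
  moreover have "avg cs (%y. F x y - F c y) \<one> = avg cs (F x) \<one> - avg cs (F c) \<one>"
   unfolding avg_def by (simp add: sum_list_subtractf diff_divide_distrib)
  moreover have "norm (mean (%y. F x y - F c y)) <= e" using x cc by (intro norm_mean_le uc_diff uc2_snd[OF assms(1)] close)
  moreover have "mean (%y. F x y - F c y) = mean (F x) - mean (F c)" using x cc by (intro mean_diff uc2_snd[OF assms(1)])
  moreover have "norm (avg cs (F c) \<one> - mean (F c)) <= e" using cs(2)[OF c(1)] by (simp add: near_def)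
  moreover have "avg cs (F x) \<one> - mean (F x) = (avg cs (F x) \<one> - avg cs (F c) \<one>) + (avg cs (F c) \<one> - mean (F c)) - (mean (F x) - mean (F c))" by simp
  ultimately show ?thesis
   using norm_triangle_ineq4[of "(avg cs (F x) \<one> - avg cs (F c) \<one>) + (avg cs (F c) \<one> - mean (F c))" "mean (F x) - mean (F c)"]
    norm_triangle_ineq[of "avg cs (F x) \<one> - avg cs (F c) \<one>" "avg cs (F c) \<one> - mean (F c)"] by simp
 qed
 show thesis using that[OF cs(1)] inner cs(3,4) unfolding e(2) by blast
qed

text \<open>Fubini: the inner means are replaced, uniformly in the row, by one finite average, and a
  finite average commutes with \<open>mean\<close>.\<close>

lemma mean_swap:
 assumes "uc2 F" shows "mean (%a. mean (F a)) = mean (%b. mean (%a. F a b))"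
proof -
 let ?G = "%b. mean (%a. F a b)"
 have uF: "uc (%a. F a b)" if "b \<in> carrier A" for b using uc2_snd[OF uc2_flip[OF assms] that] .
 have "norm (mean (%a. mean (F a)) - mean ?G) <= 0 + e" if e: "e > 0" for e
 proof -
  obtain cs where cs: "points cs" "\<And>x. x \<in> carrier A ==> norm (avg cs (F x) \<one> - mean (F x)) <= e/2" "near cs ?G (mean ?G) (e/2)"
   using double_near[OF assms, of "e/2"] e by auto
  have csA: "b \<in> carrier A" if "b \<in> set cs" for b using cs(1) that unfolding points_def by blast
  have av: "avg cs H \<one> = (1 / of_nat (length cs)) * (\<Sum>b\<leftarrow>cs. H b)" for H
  proof -
   have "map (%b. H (b \<otimes> \<one>)) cs = map H cs" using csA by simp
   from arg_cong[OF this, of sum_list] show ?thesis unfolding avg_def by simp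
  qed
  have uS: "uc (%a. \<Sum>b\<leftarrow>cs. F a b)" by (intro uc_sum_list uF csA)
  have uA: "uc (%a. avg cs (F a) \<one>)" unfolding av by (intro uc_mult uc_const uS)
  have "mean (%a. avg cs (F a) \<one>) = avg cs ?G \<one>"
   unfolding av by (subst mean_scale[OF uS], subst mean_sum_list) (simp_all add: uF csA)
  then have "norm (avg cs ?G \<one> - mean (%a. mean (F a))) <= e/2"
   using norm_mean_le[OF uc_diff[OF uA uc_mean_snd[OF assms]] cs(2)] by (simp add: mean_diff[OF uA uc_mean_snd[OF assms]])
  moreover have "norm (avg cs ?G \<one> - mean ?G) <= e/2" using cs(3) by (simp add: near_def)
  ultimately show ?thesis using norm_triangle_ineq4[of "avg cs ?G \<one> - mean ?G" "avg cs ?G \<one> - mean (%a. mean (F a))"] by simp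
 qed
 then have "norm (mean (%a. mean (F a)) - mean ?G) <= 0" by (rule field_le_epsilon)
 then show ?thesis by simp
qed

end

subsection \<open>Positive definite functions and characters\<close>

lemma comm_group_DirProd:
 assumes "comm_group G" "comm_group H" shows "comm_group (G \<times>\<times> H)"
proof -
 interpret G: comm_group G by fact
 interpret H: comm_group H by fact
 show ?thesis
  by (rule group.group_comm_groupI[OF DirProd_group[OF G.is_group H.is_group]])
   (auto simp: G.m_comm H.m_comm)
qed

context tb_group
begin

lemma tb_group_DirProd: "tb_group (A \<times>\<times> A) (\<lambda>(a, b). D a + D b)"
proof -
 interpret P: comm_group "A \<times>\<times> A"
  using comm_group_DirProd[OF comm_group_axioms comm_group_axioms] .
 show ?thesis
 proof (unfold_locales, goal_cases)
  case (2 a) then show ?case by (cases a) (simp add: D_inv)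
 next
  case (3 a b) then show ?case
   using D_mult[of "fst a" "fst b"] D_mult[of "snd a" "snd b"] by (cases a; cases b) simp
 next
  case (4 e)
  then obtain C where C: "finite C" "C \<subseteq> carrier A" "\<forall>a\<in>carrier A. \<exists>c\<in>C. D (a \<otimes> inv c) < e/2"
   using TB[of "e/2"] by auto
  have "\<exists>c\<in>C \<times> C. (case a \<otimes>\<^bsub>A \<times>\<times> A\<^esub> inv\<^bsub>A \<times>\<times> A\<^esub> c of (a, b) => D a + D b) < e" if "a \<in> carrier (A \<times>\<times> A)" for a
  proof -
   obtain x y where xy: "a = (x, y)" "x \<in> carrier A" "y \<in> carrier A" using \<open>a \<in> carrier (A \<times>\<times> A)\<close> by auto
   obtain c c' where "c \<in> C" "D (x \<otimes> inv c) < e/2" "c' \<in> C" "D (y \<otimes> inv c') < e/2" using C xy by metis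
   then show ?thesis using C xy by (intro bexI[of _ "(c, c')"]) (auto simp: subset_iff)
  qed
  then show ?case using C by (intro exI[of _ "C \<times> C"]) auto
 qed simp
qed

lemma D_nonneg: "a \<in> carrier A ==> 0 <= D a"
 using D_mult[of a "inv a"] by (simp add: D_inv)

text \<open>Through this, closure under sums and products carries over from one variable to
  two.\<close>

lemma uc2_iff: "uc2 F \<longleftrightarrow> tb_group.uc (A \<times>\<times> A) (\<lambda>(a, b). D a + D b) (\<lambda>(a, b). F a b)"
proof -
 interpret P: tb_group "A \<times>\<times> A" "\<lambda>(a, b). D a + D b" by (rule tb_group_DirProd)
 show ?thesis
 proof
  assume F: "uc2 F"
  show "P.uc (\<lambda>(a, b). F a b)"
  proof (rule P.ucI)
   fix e :: real assume "e > 0"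
   with F obtain d where d: "d > 0" "PROP modulus2 F d e" using uc2E by metis
   show "\<exists>d>0. \<forall>a\<in>carrier (A \<times>\<times> A). \<forall>b\<in>carrier (A \<times>\<times> A).
    (case a \<otimes>\<^bsub>A \<times>\<times> A\<^esub> inv\<^bsub>A \<times>\<times> A\<^esub> b of (a, b) => D a + D b) < d --> norm ((case a of (a, b) => F a b) - (case b of (a, b) => F a b)) < e"
   proof (intro exI[of _ d] conjI ballI impI)
    fix p q assume pq: "p \<in> carrier (A \<times>\<times> A)" "q \<in> carrier (A \<times>\<times> A)"
     "(case p \<otimes>\<^bsub>A \<times>\<times> A\<^esub> inv\<^bsub>A \<times>\<times> A\<^esub> q of (a, b) => D a + D b) < d"
    obtain a b a' b' where e: "p = (a, b)" "q = (a', b')" by (cases p; cases q)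
    have "D (a \<otimes> inv a') < d" "D (b \<otimes> inv b') < d"
     using pq e D_nonneg[of "a \<otimes> inv a'"] D_nonneg[of "b \<otimes> inv b'"] by auto
    then show "norm ((case p of (a, b) => F a b) - (case q of (a, b) => F a b)) < e"
     using pq(1,2) unfolding e by (simp add: d(2))
   qed (fact d(1))
  qed
 next
  assume F: "P.uc (\<lambda>(a, b). F a b)"
  show "uc2 F" unfolding uc2_def
  proof (intro allI impI)
   fix e :: real assume "e > 0"
   from P.ucE[OF F this] obtain d where d: "d > 0" "\<And>a b. a \<in> carrier (A \<times>\<times> A) ==> b \<in> carrier (A \<times>\<times> A) ==>
    (case a \<otimes>\<^bsub>A \<times>\<times> A\<^esub> inv\<^bsub>A \<times>\<times> A\<^esub> b of (a, b) => D a + D b) < d ==> norm ((case a of (a, b) => F a b) - (case b of (a, b) => F a b)) < e" by blast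
   show "\<exists>d>0. close2 F d e"
   proof (intro exI[of _ "d/2"] conjI ballI impI)
    fix a a' b b' assume *: "a \<in> carrier A" "a' \<in> carrier A" "b \<in> carrier A" "b' \<in> carrier A"
     "D (a \<otimes> inv a') < d/2" "D (b \<otimes> inv b') < d/2"
    show "norm (F a b - F a' b') < e" using d(2)[of "(a, b)" "(a', b')"] * by simp
   qed (use d in simp)
  qed
 qed
qed

lemma uc2_add: "uc2 F ==> uc2 G ==> uc2 (%a b. F a b + G a b)"
 and uc2_mult: "uc2 F ==> uc2 G ==> uc2 (%a b. F a b * G a b)"
 and uc2_cnj: "uc2 F ==> uc2 (%a b. cnj (F a b))"
proof -
 interpret P: tb_group "A \<times>\<times> A" "\<lambda>(a, b). D a + D b" by (rule tb_group_DirProd)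
 show "uc2 F ==> uc2 G ==> uc2 (%a b. F a b + G a b)"
  using P.uc_add[of "\<lambda>(a, b). F a b" "\<lambda>(a, b). G a b"] unfolding uc2_iff by (simp add: case_prod_unfold)
 show "uc2 F ==> uc2 G ==> uc2 (%a b. F a b * G a b)"
  using P.uc_mult[of "\<lambda>(a, b). F a b" "\<lambda>(a, b). G a b"] unfolding uc2_iff by (simp add: case_prod_unfold)
 show "uc2 F ==> uc2 (%a b. cnj (F a b))"
  using P.uc_cnj[of "\<lambda>(a, b). F a b"] unfolding uc2_iff by (simp add: case_prod_unfold)
qed

lemma uc2_const [simp]: "uc2 (%a b. c)"
 unfolding uc2_def by (auto intro: exI[of _ 1])

lemma uc2_fst_only: "uc F ==> uc2 (%a b. F a)"
 unfolding uc_def uc2_def by metis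

lemma uc2_snd_only: "uc F ==> uc2 (%a b. F b)"
 using uc2_flip[OF uc2_fst_only] .

lemma uc2_comp_mult:
 assumes "uc F" shows "uc2 (%a b. F (a \<otimes> b))"
 unfolding uc2_def
proof (intro allI impI)
 fix e :: real assume "e > 0"
 from ucE[OF assms this] obtain d where d: "d > 0" "PROP modulus F d e" by blast
 show "\<exists>d>0. \<forall>a\<in>carrier A. \<forall>a'\<in>carrier A. \<forall>b\<in>carrier A. \<forall>b'\<in>carrier A.
     D (a \<otimes> inv a') < d --> D (b \<otimes> inv b') < d --> norm (F (a \<otimes> b) - F (a' \<otimes> b')) < e"
 proof (intro exI[of _ "d/2"] conjI ballI impI)
  fix a a' b b' assume *: "a \<in> carrier A" "a' \<in> carrier A" "b \<in> carrier A" "b' \<in> carrier A"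
   "D (a \<otimes> inv a') < d/2" "D (b \<otimes> inv b') < d/2"
  have "(a \<otimes> b) \<otimes> inv (a' \<otimes> b') = (a \<otimes> inv a') \<otimes> (b \<otimes> inv b')" using * by (simp add: inv_mult m_ac)
  then have "D ((a \<otimes> b) \<otimes> inv (a' \<otimes> b')) < d" using D_mult[of "a \<otimes> inv a'" "b \<otimes> inv b'"] * by simp
  then show "norm (F (a \<otimes> b) - F (a' \<otimes> b')) < e" using d(2) * by simp
 qed (use d in simp)
qed

lemma uc2_inv_fst:
 assumes "uc2 F" shows "uc2 (%a b. F (inv a) b)"
proof -
 have "D (inv a \<otimes> inv (inv b)) = D (a \<otimes> inv b)" if "a \<in> carrier A" "b \<in> carrier A" for a b
  using D_inv[of "a \<otimes> inv b"] that by (simp add: inv_mult)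
 then show ?thesis using assms unfolding uc2_def by (metis inv_closed)
qed

lemma uc2_comp_div: "uc F ==> uc2 (%a b. F (a \<otimes> inv b))"
 using uc2_flip[OF uc2_inv_fst[OF uc2_flip[OF uc2_comp_mult]]] .

lemma uc2_sum_list: "(\<And>i. i \<in> set I ==> uc2 (F i)) ==> uc2 (%a b. \<Sum>i\<leftarrow>I. F i a b)"
 by (induction I) (auto intro: uc2_add)

section \<open>Positive definite functions\<close>

text \<open>The sesquilinear form of \<open>g\<close> on finitely supported measures; a measure is a
  list of pairs of weight and point.\<close>

definition form :: "('a => complex) => (complex \<times> 'a) list => (complex \<times> 'a) list => complex" where
 "form g ps qs = (\<Sum>p\<leftarrow>ps. \<Sum>q\<leftarrow>qs. fst p * cnj (fst q) * g (snd p \<otimes> inv (snd q)))"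

definition pd :: "('a => complex) => bool" where
 "pd g \<longleftrightarrow> (\<forall>ps. snd ` set ps \<subseteq> carrier A --> Im (form g ps ps) = 0 \<and> 0 <= Re (form g ps ps))"

lemma pdD: "pd g ==> snd ` set ps \<subseteq> carrier A ==> Im (form g ps ps) = 0" "pd g ==> snd ` set ps \<subseteq> carrier A ==> 0 <= Re (form g ps ps)"
 unfolding pd_def by blast+

lemma pd_one: assumes "pd g" shows "Im (g \<one>) = 0" "0 <= Re (g \<one>)"
 using pdD[OF assms, of "[(1, \<one>)]"] by (simp_all add: form_def)

lemma pd_hermitian:
 assumes "pd g" "a \<in> carrier A" shows "g (inv a) = cnj (g a)"
proof -
 have "Im (g a + g (inv a)) = 0"
  using pdD(1)[OF assms(1), of "[(1, a), (1, \<one>)]"] assms(2) pd_one[OF assms(1)] by (simp add: form_def)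
 moreover have "Re (g a - g (inv a)) = 0"
  using pdD(1)[OF assms(1), of "[(\<i>, a), (1, \<one>)]"] assms(2) pd_one[OF assms(1)] by (simp add: form_def)
 ultimately show ?thesis by (simp add: complex_eq_iff)
qed

lemma pd_bound:
 assumes "pd g" "a \<in> carrier A" shows "norm (g a) <= Re (g \<one>)"
proof -
 \<comment> \<open>The phase that makes \<open>w * g a\<close> nonpositive: for
   \<open>g a ~= 0\<close> the form at weight \<open>w\<close> in \<open>a\<close> and weight
   \<open>1\<close> in \<open>\<one>\<close> has real part
   \<open>2 * Re (g \<one>) - 2 * norm (g a)\<close>.\<close>
 define w where "w = - cnj (sgn (g a))"
 have w: "w * g a = - of_real (norm (g a))" "w * cnj w = of_bool (g a ~= 0)"
  unfolding w_def sgn_eq by (auto simp: complex_norm_square[symmetric] power2_eq_square divide_simps mult.commute)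
 have "form g [(w, a), (1, \<one>)] [(w, a), (1, \<one>)] = (w * cnj w) * g \<one> + w * g a + cnj (w * g a) + g \<one>"
  using assms by (simp add: form_def pd_hermitian algebra_simps)
 then have "Re (form g [(w, a), (1, \<one>)] [(w, a), (1, \<one>)]) <= 2 * Re (g \<one>) - 2 * norm (g a)"
  unfolding w using pd_one[OF assms(1)] by auto
 then show ?thesis using pdD(2)[OF assms(1), of "[(w, a), (1, \<one>)]"] assms(2) by simp
qed

lemma pd_divide:
 assumes "pd g" "c >= 0" shows "pd (%a. g a / of_real c)"
proof -
 have "form (%a. g a / of_real c) ps qs = form g ps qs / of_real c" for ps qs
  unfolding form_def by (simp add: sum_list_divide)
 then show ?thesis using assms unfolding pd_def by auto
qed

lemma form_cong:
 assumes "\<And>a. a \<in> carrier A ==> f a = g a" "snd ` set ps \<subseteq> carrier A" "snd ` set qs \<subseteq> carrier A"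
 shows "form f ps qs = form g ps qs"
 unfolding form_def using assms by (intro arg_cong[where f=sum_list] map_cong refl) (auto simp: image_subset_iff)

lemma pd_cong: "(\<And>a. a \<in> carrier A ==> f a = g a) ==> pd f \<longleftrightarrow> pd g"
 unfolding pd_def using form_cong[of f g] by auto

lemma form_append:
 "form g (ps @ ps') qs = form g ps qs + form g ps' qs"
 "form g ps (qs @ qs') = form g ps qs + form g ps qs'"
 unfolding form_def by (simp_all add: sum_list_addf)

text \<open>The form of \<open>?q\<close> at a measure is the form of \<open>g\<close> at the sum of
  that measure and its shift by \<open>c\<close>, the shift being weighted by
  \<open>z\<close>.\<close>

lemma pd_modulate:
 assumes "pd g" "c \<in> carrier A" "norm z = 1"
 shows "pd (%a. 2 * g a + z * g (c \<otimes> a) + cnj z * g (inv c \<otimes> a))" (is "pd ?q")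
 unfolding pd_def
proof (intro allI impI)
 fix ps :: "(complex \<times> 'a) list" assume ps: "snd ` set ps \<subseteq> carrier A"
 let ?ps = "map (%p. (z * fst p, c \<otimes> snd p)) ps"
 have zz: "z * cnj z = 1" using assms(3) by (simp add: complex_norm_square[symmetric])
 have 1: "form g ?ps ?ps = form g ps ps"
  unfolding form_def map_map o_def
 proof (intro arg_cong[where f=sum_list] map_cong refl)
  fix p q assume "p \<in> set ps" "q \<in> set ps"
  then have "g (snd (z * fst p, c \<otimes> snd p) \<otimes> inv snd (z * fst q, c \<otimes> snd q)) = g (snd p \<otimes> inv snd q)"
   using ps assms(2) by (auto simp: translate_div image_subset_iff)
  moreover have "z * fst p * cnj (z * fst q) = (z * cnj z) * (fst p * cnj (fst q))" by simp
  ultimately show "fst (z * fst p, c \<otimes> snd p) * cnj (fst (z * fst q, c \<otimes> snd q)) * g (snd (z * fst p, c \<otimes> snd p) \<otimes> inv snd (z * fst q, c \<otimes> snd q)) =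
   fst p * cnj (fst q) * g (snd p \<otimes> inv snd q)" using zz by simp
 qed
 have 2: "form g ?ps ps = form (%a. z * g (c \<otimes> a)) ps ps"
  unfolding form_def map_map o_def using ps assms(2)
  by (intro arg_cong[where f=sum_list] map_cong refl) (auto simp: m_assoc image_subset_iff)
 have 3: "form g ps ?ps = form (%a. cnj z * g (inv c \<otimes> a)) ps ps"
  unfolding form_def map_map o_def using ps assms(2)
  by (intro arg_cong[where f=sum_list] map_cong refl) (auto simp: m_ac inv_mult image_subset_iff)
 have "form ?q ps ps = form g (ps @ ?ps) (ps @ ?ps)"
  unfolding form_append 1 2 3 by (simp add: form_def sum_list_addf[symmetric] algebra_simps)
 moreover have "snd ` set (ps @ ?ps) \<subseteq> carrier A" using ps assms(2) by auto
 ultimately show "Im (form ?q ps ps) = 0 \<and> 0 <= Re (form ?q ps ps)" using pdD[OF assms(1)] by simp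
qed

text \<open>If \<open>norm (g c) = 1\<close>, the measure with weights \<open>1\<close> at
  \<open>c\<close> and \<open>- g c\<close> at \<open>\<one>\<close> is null for the form, hence
  orthogonal to every point mass. The third weight \<open>- w\<close>, at \<open>inv d\<close>,
  turns this into the form value \<open>- (norm w)\<^sup>2\<close>.\<close>

lemma pd_unimodular_mult:
 assumes "pd g" "g \<one> = 1" "c \<in> carrier A" "d \<in> carrier A" "norm (g c) = 1"
 shows "g (c \<otimes> d) = g c * g d"
proof -
 define w where "w = g (c \<otimes> d) - g c * g d"
 have cc: "g c * cnj (g c) = 1" using assms(5) by (simp add: complex_norm_square[symmetric])
 have e: "inv d \<otimes> inv c = inv (c \<otimes> d)" "d \<otimes> c = c \<otimes> d" using assms by (auto simp: inv_mult_group m_comm)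
 let ?ps = "[(- g c, \<one>), (1, c), (- w, inv d)]"
 have "form g ?ps ?ps = g c * cnj (g c) - g c * cnj (g c) + g c * cnj w * g d
   - cnj (g c) * g c + 1 - cnj w * g (c \<otimes> d)
   + w * cnj (g c) * cnj (g d) - w * cnj (g (c \<otimes> d)) + w * cnj w"
  using assms e by (simp add: form_def pd_hermitian)
 also have "\<dots> = (1 - g c * cnj (g c)) - cnj w * w - w * cnj w + w * cnj w" unfolding w_def by (simp add: algebra_simps)
 also have "\<dots> = - (w * cnj w)" unfolding cc by simp
 finally have "Re (form g ?ps ?ps) = - (norm w)\<^sup>2" by (simp add: complex_norm_square[symmetric])
 then have "w = 0" using pdD(2)[OF assms(1), of ?ps] assms by simp
 then show ?thesis unfolding w_def by simp
qed

text \<open>The hypothesis concerns one list used in both variables, which is what positive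
  definiteness can supply; \<open>double_near\<close> approximates the iterated mean by such
  averages.\<close>

lemma pd_limit_avg:
 assumes "uc2 F" "\<And>cs. points cs ==> avg cs (%x. avg cs (F x) \<one>) \<one> \<in> \<real>\<^sub>\<ge>\<^sub>0"
 shows "mean (%x. mean (F x)) \<in> \<real>\<^sub>\<ge>\<^sub>0"
proof -
 have "mean (%x. mean (F x)) \<in> closure \<real>\<^sub>\<ge>\<^sub>0"
 proof (subst closure_approachable, intro allI impI)
  fix e :: real assume "e > 0"
  then obtain cs where cs: "points cs" "\<And>x. x \<in> carrier A ==> norm (avg cs (F x) \<one> - mean (F x)) <= e/4"
   "near cs (%a. mean (F a)) (mean (%a. mean (F a))) (e/4)" using double_near[OF assms(1), of "e/4"] by auto
  have "norm (avg cs (%x. avg cs (F x) \<one> - mean (F x)) \<one> - 0) <= e/4"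
   by (rule norm_avg_diff_le[OF cs(1)]) (use cs(2) in auto)
  moreover have "avg cs (%x. avg cs (F x) \<one> - mean (F x)) \<one> = avg cs (%x. avg cs (F x) \<one>) \<one> - avg cs (%x. mean (F x)) \<one>"
   by (subst (1 3 4) avg_def) (simp add: sum_list_subtractf diff_divide_distrib)
  moreover have "norm (avg cs (%x. mean (F x)) \<one> - mean (%a. mean (F a))) <= e/4" using cs(3) by (simp add: near_def)
  ultimately have "norm (avg cs (%x. avg cs (F x) \<one>) \<one> - mean (%a. mean (F a))) <= e/2"
   using norm_triangle_ineq[of "avg cs (%x. avg cs (F x) \<one>) \<one> - avg cs (%x. mean (F x)) \<one>" "avg cs (%x. mean (F x)) \<one> - mean (%a. mean (F a))"] by simp
  then show "\<exists>y\<in>\<real>\<^sub>\<ge>\<^sub>0. dist y (mean (%x. mean (F x))) < e"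
   using assms(2) cs(1) \<open>e > 0\<close> by (intro bexI[of _ "avg cs (%x. avg cs (F x) \<one>) \<one>"]) (auto simp: dist_norm)
 qed
 then show ?thesis using closed_nonneg_Reals_complex by (simp add: closure_closed)
qed

lemma pd_nonneg: "pd g ==> snd ` set ps \<subseteq> carrier A ==> form g ps ps \<in> \<real>\<^sub>\<ge>\<^sub>0"
 using pdD by (simp add: complex_nonneg_Reals_iff)

text \<open>The quadratic form of a positive definite function at the measure that is the
 point mass \<open>t\<close> at the identity plus the density \<open>u\<close>.\<close>

lemma pd_mean_form:
 assumes "pd g" "uc g" "uc u"
 shows "(cnj t * t) * g \<one> + cnj t * mean (%x. u x * g x) + t * cnj (mean (%x. u x * g x)) +
  mean (%x. mean (%y. u x * cnj (u y) * g (x \<otimes> inv y))) \<in> \<real>\<^sub>\<ge>\<^sub>0"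
proof -
 define F where "F = (%x y. (cnj t * t) * g \<one> + cnj t * (u x * g x) + t * cnj (u y * g y) + u x * cnj (u y) * g (x \<otimes> inv y))"
 have [intro]: "uc (%x. u x * g x)" using assms by (intro uc_mult)
 have u2: "uc2 (%x y. u x * cnj (u y) * g (x \<otimes> inv y))"
  using assms by (intro uc2_mult uc2_fst_only uc2_snd_only[where F="%y. cnj (u y)"] uc_cnj uc2_comp_div)
 have F2: "uc2 F" unfolding F_def using assms u2
  by (intro uc2_add uc2_const uc2_fst_only[where F="%x. cnj t * (u x * g x)"] uc2_snd_only[where F="%y. t * cnj (u y * g y)"] uc_mult uc_cnj uc_const)
 have "mean (%x. mean (F x)) \<in> \<real>\<^sub>\<ge>\<^sub>0"
 proof (rule pd_limit_avg[OF F2])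
  fix cs assume cs: "points cs"
  define n where "n = (of_nat (length cs) :: complex)"
  have n: "n ~= 0" "cnj n = n" "(\<Sum>x\<leftarrow>cs. k) = n * k" for k using cs unfolding n_def points_def by (auto simp: sum_list_triv)
  \<comment> \<open>The density \<open>u\<close> becomes the weights \<open>u x / n\<close> at the
    points of the list.\<close>
  let ?ps = "map (%x. (u x / n, x)) cs"
  have cc: "x \<in> carrier A" if "x \<in> set cs" for x using that cs unfolding points_def by auto
  have "avg cs (%x. avg cs (F x) \<one>) \<one> = (\<Sum>x\<leftarrow>cs. \<Sum>y\<leftarrow>cs. F (x \<otimes> \<one>) (y \<otimes> \<one>)) / n / n"
   unfolding avg_def n_def sum_list_divide ..
  also have "(\<Sum>x\<leftarrow>cs. \<Sum>y\<leftarrow>cs. F (x \<otimes> \<one>) (y \<otimes> \<one>)) = (\<Sum>x\<leftarrow>cs. \<Sum>y\<leftarrow>cs. F x y)"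
   by (intro arg_cong[where f=sum_list] map_cong refl) (auto simp: cc)
  also have "\<dots> = n * n * ((cnj t * t) * g \<one>) + n * (cnj t * (\<Sum>x\<leftarrow>cs. u x * g x)) + n * (t * (\<Sum>y\<leftarrow>cs. cnj (u y * g y))) +
    (\<Sum>x\<leftarrow>cs. \<Sum>y\<leftarrow>cs. u x * cnj (u y) * g (x \<otimes> inv y))"
   unfolding F_def sum_list_addf sum_list_const_mult[symmetric] n by (simp add: mult_ac)
  also have "\<dots> / n / n = (cnj t * t) * g \<one> + cnj t * (\<Sum>x\<leftarrow>cs. u x * g x) / n + t * (\<Sum>y\<leftarrow>cs. cnj (u y * g y)) / n +
    (\<Sum>x\<leftarrow>cs. \<Sum>y\<leftarrow>cs. u x * cnj (u y) * g (x \<otimes> inv y)) / n / n"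
   using n(1) by (simp add: field_simps)
  also have "\<dots> = form g ((t, \<one>) # ?ps) ((t, \<one>) # ?ps)"
  proof -
   have "form g ((t, \<one>) # ?ps) ((t, \<one>) # ?ps) = (t * cnj t) * g (\<one> \<otimes> inv \<one>) + (\<Sum>y\<leftarrow>cs. t * (cnj (u y) / n) * g (\<one> \<otimes> inv y))
    + (\<Sum>x\<leftarrow>cs. (u x / n) * cnj t * g (x \<otimes> inv \<one>) + (\<Sum>y\<leftarrow>cs. (u x / n) * (cnj (u y) / n) * g (x \<otimes> inv y)))"
    by (simp add: form_def o_def n)
   also have "(\<Sum>y\<leftarrow>cs. t * (cnj (u y) / n) * g (\<one> \<otimes> inv y)) = (\<Sum>y\<leftarrow>cs. t * cnj (u y * g y) / n)"
    by (intro arg_cong[where f=sum_list] map_cong refl) (auto simp: cc pd_hermitian[OF assms(1)])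
   also have "(\<Sum>x\<leftarrow>cs. (u x / n) * cnj t * g (x \<otimes> inv \<one>) + (\<Sum>y\<leftarrow>cs. (u x / n) * (cnj (u y) / n) * g (x \<otimes> inv y)))
     = (\<Sum>x\<leftarrow>cs. cnj t * (u x * g x) / n + (\<Sum>y\<leftarrow>cs. u x * cnj (u y) * g (x \<otimes> inv y) / n) / n)"
    by (intro arg_cong[where f=sum_list] map_cong refl) (auto simp: cc sum_list_divide[symmetric])
   finally show ?thesis by (simp add: sum_list_addf sum_list_divide sum_list_const_mult)
  qed
  also have "\<dots> \<in> \<real>\<^sub>\<ge>\<^sub>0" using cc by (intro pd_nonneg[OF assms(1)]) auto
  finally show "avg cs (%x. avg cs (F x) \<one>) \<one> \<in> \<real>\<^sub>\<ge>\<^sub>0" .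
 qed
 moreover have "mean (%x. mean (F x)) = (cnj t * t) * g \<one> + cnj t * mean (%x. u x * g x) + t * cnj (mean (%x. u x * g x)) +
  mean (%x. mean (%y. u x * cnj (u y) * g (x \<otimes> inv y)))"
 proof -
  have "mean (F x) = ((cnj t * t) * g \<one> + t * cnj (mean (%x. u x * g x))) + cnj t * (u x * g x) +
   mean (%y. u x * cnj (u y) * g (x \<otimes> inv y))" if x: "x \<in> carrier A" for x
  proof -
   have mc: "mean (%y. cnj (u y) * cnj (g y)) = cnj (mean (%x. u x * g x))"
    using mean_cnj[of "%x. u x * g x"] assms by (simp add: uc_mult)
   have *: "uc (%y. t * cnj (u y * g y))" "uc (%y. cnj (u y * g y))" using assms by (auto intro!: uc_mult uc_cnj)
   show ?thesis unfolding F_def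
    by (subst mean_add mean_scale, (intro uc_add uc_const * uc2_snd[OF u2 x])+)+ (simp add: mc)
  qed
  then have "mean (%x. mean (F x)) = mean (%x. ((cnj t * t) * g \<one> + t * cnj (mean (%x. u x * g x))) + cnj t * (u x * g x) +
   mean (%y. u x * cnj (u y) * g (x \<otimes> inv y)))" by (rule mean_cong)
  also have "\<dots> = ((cnj t * t) * g \<one> + t * cnj (mean (%x. u x * g x))) + cnj t * mean (%x. u x * g x) +
   mean (%x. mean (%y. u x * cnj (u y) * g (x \<otimes> inv y)))"
   using uc_mean_snd[OF u2] assms by (simp add: mean_add mean_scale uc_add uc_mult)
  finally show ?thesis by (simp add: algebra_simps)
 qed
 ultimately show ?thesis by simp
qed

section \<open>Smoothing by an autocorrelation\<close>

text \<open>For hermitian \<open>h\<close> this is the convolution of \<open>h\<close> and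
  \<open>g\<close>, written without inverses.\<close>

definition smooth :: "('a => complex) => ('a => complex) => 'a => complex" where
 "smooth h g b = mean (%a. cnj (h a) * g (a \<otimes> b))"

lemma uc_smooth: "uc h ==> uc g ==> uc (smooth h g)"
 unfolding smooth_def
 by (rule uc_mean_snd[OF uc2_mult[OF uc2_snd_only uc2_flip[OF uc2_comp_mult]]]) (auto intro: uc_cnj)

definition autocorr :: "('a => complex) => 'a => complex" where
 "autocorr r a = mean (%x. r (a \<otimes> x) * cnj (r x))"

lemma uc2_autocorr: "uc r ==> uc2 (%a x. r (a \<otimes> x) * cnj (r x))"
 by (intro uc2_mult uc2_comp_mult uc2_snd_only uc_cnj)

lemma uc_autocorr: "uc r ==> uc (autocorr r)"
 unfolding autocorr_def by (rule uc_mean_snd[OF uc2_autocorr])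

text \<open>The form at \<open>ps\<close> is the mean square of \<open>v\<close>, a combination of
  translates of \<open>r\<close>.\<close>

lemma pd_autocorr:
 assumes "uc r" shows "pd (autocorr r)"
 unfolding pd_def
proof (intro allI impI)
 fix ps :: "(complex \<times> 'a) list" assume ps: "snd ` set ps \<subseteq> carrier A"
 define v where "v = (%x. \<Sum>p\<leftarrow>ps. fst p * r (snd p \<otimes> x))"
 have cv: "cnj (v x) = (\<Sum>p\<leftarrow>ps. cnj (fst p) * cnj (r (snd p \<otimes> x)))" for x
  unfolding v_def by (induction ps) auto
 have ur: "uc (%x. r (snd p \<otimes> x))" if "p \<in> set ps" for p using that ps assms by (intro uc_translate) auto
 have u: "uc v" unfolding v_def using ur by (intro uc_sum_list uc_mult) auto
 have "form (autocorr r) ps ps = (\<Sum>p\<leftarrow>ps. \<Sum>q\<leftarrow>ps. mean (%x. (fst p * r (snd p \<otimes> x)) * (cnj (fst q) * cnj (r (snd q \<otimes> x)))))"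
  unfolding form_def
 proof (intro arg_cong[where f=sum_list] map_cong refl)
  fix p q assume pq: "p \<in> set ps" "q \<in> set ps"
  have "autocorr r (snd p \<otimes> inv snd q) = mean (%x. r (snd p \<otimes> inv snd q \<otimes> (snd q \<otimes> x)) * cnj (r (snd q \<otimes> x)))"
   unfolding autocorr_def using pq ps assms by (intro mean_translate[symmetric] uc2_snd[OF uc2_autocorr]) auto
  also have "\<dots> = mean (%x. r (snd p \<otimes> x) * cnj (r (snd q \<otimes> x)))"
  proof (rule mean_cong)
   fix x assume "x \<in> carrier A"
   then have "snd p \<otimes> inv snd q \<otimes> (snd q \<otimes> x) = snd p \<otimes> x" using pq ps by (auto simp: image_subset_iff m_assoc inv_solve_left')
   then show "r (snd p \<otimes> inv snd q \<otimes> (snd q \<otimes> x)) * cnj (r (snd q \<otimes> x)) = r (snd p \<otimes> x) * cnj (r (snd q \<otimes> x))" by simp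
  qed
  finally have "fst p * cnj (fst q) * autocorr r (snd p \<otimes> inv snd q) = fst p * cnj (fst q) * mean (%x. r (snd p \<otimes> x) * cnj (r (snd q \<otimes> x)))" by simp
  also have "\<dots> = mean (%x. fst p * cnj (fst q) * (r (snd p \<otimes> x) * cnj (r (snd q \<otimes> x))))"
   using ur pq by (intro mean_scale[symmetric] uc_mult uc_cnj) auto
  finally show "fst p * cnj (fst q) * autocorr r (snd p \<otimes> inv snd q) = mean (%x. (fst p * r (snd p \<otimes> x)) * (cnj (fst q) * cnj (r (snd q \<otimes> x))))"
   by (simp add: mult_ac)
 qed
 also have "\<dots> = mean (%x. \<Sum>p\<leftarrow>ps. \<Sum>q\<leftarrow>ps. (fst p * r (snd p \<otimes> x)) * (cnj (fst q) * cnj (r (snd q \<otimes> x))))"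
 proof -
  have "uc (%x. (fst p * r (snd p \<otimes> x)) * (cnj (fst q) * cnj (r (snd q \<otimes> x))))" if "p \<in> set ps" "q \<in> set ps" for p q
   using ur that by (intro uc_mult uc_cnj) auto
  then show ?thesis by (simp add: mean_sum_list uc_sum_list cong: map_cong)
 qed
 also have "\<dots> = mean (%x. v x * cnj (v x))"
  unfolding cv unfolding v_def by (simp add: sum_list_const_mult sum_list_mult_const)
 finally have eq: "form (autocorr r) ps ps = mean (%x. v x * cnj (v x))" .
 have uv: "uc (%x. v x * cnj (v x))" using u by (intro uc_mult uc_cnj)
 show "Im (form (autocorr r) ps ps) = 0 \<and> 0 <= Re (form (autocorr r) ps ps)"
  unfolding eq using mean_real[OF uv] mean_nonneg[OF uv] by (simp add: complex_norm_square[symmetric])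
qed

text \<open>Fubini and the substitution \<open>y = a \<otimes> x\<close> bring the weights
  \<open>r x\<close> and \<open>cnj (r y)\<close> into the shape of a form of
  \<open>g\<close>.\<close>

lemma smooth_autocorr_eq:
 assumes "uc r" "uc g" "c \<in> carrier A"
 shows "smooth (autocorr r) g c = mean (%x. mean (%y. r x * cnj (r y) * g (inv x \<otimes> y \<otimes> c)))"
proof -
 define F where "F = (%a x. cnj (r (a \<otimes> x) * cnj (r x)) * g (c \<otimes> a))"
 have u2: "uc2 F" unfolding F_def
  by (intro uc2_mult uc2_cnj uc2_autocorr uc2_fst_only uc_translate assms)
 have "smooth (autocorr r) g c = mean (%a. mean (F a))"
  unfolding smooth_def
 proof (rule mean_cong)
  fix a assume a: "a \<in> carrier A"
  have u: "uc (%x. r (a \<otimes> x) * cnj (r x))" by (rule uc2_snd[OF uc2_autocorr[OF assms(1)] a])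
  have "mean (F a) = g (c \<otimes> a) * mean (%x. cnj (r (a \<otimes> x) * cnj (r x)))"
   unfolding F_def using mean_scale[OF uc_cnj[OF u], of "g (c \<otimes> a)"] by (simp only: mult.commute)
  also have "mean (%x. cnj (r (a \<otimes> x) * cnj (r x))) = cnj (autocorr r a)"
   unfolding autocorr_def by (rule mean_cnj[OF u])
  finally show "cnj (autocorr r a) * g (a \<otimes> c) = mean (F a)" using a assms(3) by (simp add: m_comm)
 qed
 also have "\<dots> = mean (%x. mean (%a. F a x))" by (rule mean_swap[OF u2])
 also have "\<dots> = mean (%x. mean (%y. r x * cnj (r y) * g (inv x \<otimes> y \<otimes> c)))"
 proof (rule mean_cong)
  fix x assume x: "x \<in> carrier A"
  have "mean (%a. F a x) = mean (%y. F (inv x \<otimes> y) x)"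
   using x by (intro mean_translate[symmetric] uc2_snd[OF uc2_flip[OF u2]]) auto
  also have "\<dots> = mean (%y. r x * cnj (r y) * g (inv x \<otimes> y \<otimes> c))"
  proof (rule mean_cong)
   fix y assume y: "y \<in> carrier A"
   have "inv x \<otimes> y \<otimes> x = y" using x y by (simp add: m_comm[of "inv x" y] m_assoc)
   then show "F (inv x \<otimes> y) x = r x * cnj (r y) * g (inv x \<otimes> y \<otimes> c)"
    using x y assms(3) unfolding F_def by (simp add: m_comm[of c])
  qed
  finally show "mean (%a. F a x) = mean (%y. r x * cnj (r y) * g (inv x \<otimes> y \<otimes> c))" .
 qed
 finally show ?thesis .
qed

lemma pd_smooth:
 assumes "uc r" "uc g" "pd g" shows "pd (smooth (autocorr r) g)"
 unfolding pd_def
proof (intro allI impI)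
 fix ps :: "(complex \<times> 'a) list" assume ps: "snd ` set ps \<subseteq> carrier A"
 define G where "G = (%c x y. r x * cnj (r y) * g (inv x \<otimes> y \<otimes> c))"
 have uG: "uc2 (G c)" if "c \<in> carrier A" for c
 proof -
  have "uc2 (%x y. r x * cnj (r y) * g (c \<otimes> (inv x \<otimes> y)))"
   using that assms by (intro uc2_mult uc2_fst_only uc2_snd_only[where F="%y. cnj (r y)"] uc_cnj uc2_inv_fst[OF uc2_comp_mult[OF uc_translate]])
  moreover have "uc2 (%x y. r x * cnj (r y) * g (c \<otimes> (inv x \<otimes> y))) \<longleftrightarrow> uc2 (G c)"
   unfolding uc2_def G_def using that by (simp add: m_comm cong: ball_cong)
  ultimately show ?thesis by simp
 qed
 define F where "F = (%x y. \<Sum>p\<leftarrow>ps. \<Sum>q\<leftarrow>ps. fst p * cnj (fst q) * G (snd p \<otimes> inv snd q) x y)"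
 have pq: "snd p \<otimes> inv snd q \<in> carrier A" if "p \<in> set ps" "q \<in> set ps" for p q using that ps by auto
 have uF: "uc2 F" unfolding F_def using pq by (intro uc2_sum_list uc2_mult[where F="%a b. _"] uG uc2_const)
 have "form (smooth (autocorr r) g) ps ps = (\<Sum>p\<leftarrow>ps. \<Sum>q\<leftarrow>ps. mean (%x. mean (%y. fst p * cnj (fst q) * G (snd p \<otimes> inv snd q) x y)))"
  unfolding form_def
 proof (intro arg_cong[where f=sum_list] map_cong refl)
  fix p q assume *: "p \<in> set ps" "q \<in> set ps"
  show "fst p * cnj (fst q) * smooth (autocorr r) g (snd p \<otimes> inv snd q) = mean (%x. mean (%y. fst p * cnj (fst q) * G (snd p \<otimes> inv snd q) x y))"
  proof -
   let ?c = "snd p \<otimes> inv snd q"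
   have "smooth (autocorr r) g ?c = mean (%x. mean (G ?c x))"
    unfolding smooth_autocorr_eq[OF assms(1,2) pq[OF *]] G_def ..
   moreover have "mean (%x. mean (%y. fst p * cnj (fst q) * G ?c x y)) = mean (%x. fst p * cnj (fst q) * mean (G ?c x))"
    by (intro mean_cong mean_scale uc2_snd[OF uG[OF pq[OF *]]])
   moreover have "\<dots> = fst p * cnj (fst q) * mean (%x. mean (G ?c x))"
    by (rule mean_scale[OF uc_mean_snd[OF uG[OF pq[OF *]]]])
   ultimately show ?thesis by simp
  qed
 qed
 also have "\<dots> = mean (%x. mean (F x))"
 proof -
  have u: "uc2 (%x y. fst p * cnj (fst q) * G (snd p \<otimes> inv snd q) x y)" if "p \<in> set ps" "q \<in> set ps" for p q
   using that pq by (intro uc2_mult[where F="%a b. _"] uG uc2_const)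
  have "mean (F x) = (\<Sum>p\<leftarrow>ps. \<Sum>q\<leftarrow>ps. mean (%y. fst p * cnj (fst q) * G (snd p \<otimes> inv snd q) x y))" if "x \<in> carrier A" for x
   unfolding F_def using uc2_snd[OF u that] by (simp add: mean_sum_list uc_sum_list cong: map_cong)
  then have "mean (%x. mean (F x)) = mean (%x. \<Sum>p\<leftarrow>ps. \<Sum>q\<leftarrow>ps. mean (%y. fst p * cnj (fst q) * G (snd p \<otimes> inv snd q) x y))"
   by (rule mean_cong)
  then show ?thesis using uc_mean_snd[OF u] by (simp add: mean_sum_list uc_sum_list cong: map_cong)
 qed
 also have "\<dots> \<in> \<real>\<^sub>\<ge>\<^sub>0"
 proof (rule pd_limit_avg[OF uF])
  fix cs assume cs: "points cs"
  define n where "n = (of_nat (length cs) :: complex)"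
  have n: "cnj n = n" unfolding n_def by simp
  have cc: "x \<in> carrier A" if "x \<in> set cs" for x using that cs unfolding points_def by auto
  \<comment> \<open>Before the limit, the form of the smoothed function is the form of
    \<open>g\<close> at the measure \<open>ps\<close>, spread out by the weights
    \<open>r x / n\<close> at \<open>inv x\<close>.\<close>
  let ?qs = "concat (map (%x. map (%p. (r x * fst p / n, inv x \<otimes> snd p)) ps) cs)"
  have cl: "(\<Sum>q\<leftarrow>?qs. f q) = (\<Sum>x\<leftarrow>cs. \<Sum>p\<leftarrow>ps. f (r x * fst p / n, inv x \<otimes> snd p))" for f :: "_ => complex"
   by (induction cs) (simp_all add: o_def)
  have "avg cs (%x. avg cs (F x) \<one>) \<one> = (\<Sum>x\<leftarrow>cs. \<Sum>y\<leftarrow>cs. F (x \<otimes> \<one>) (y \<otimes> \<one>) / n / n)"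
   unfolding avg_def n_def sum_list_divide ..
  also have "\<dots> = (\<Sum>x\<leftarrow>cs. \<Sum>y\<leftarrow>cs. \<Sum>p\<leftarrow>ps. \<Sum>q\<leftarrow>ps. (r x * fst p / n) * cnj (r y * fst q / n) * g ((inv x \<otimes> snd p) \<otimes> inv (inv y \<otimes> snd q)))"
   unfolding F_def sum_list_divide[symmetric]
  proof (intro arg_cong[where f=sum_list] map_cong refl)
   fix x y p q assume *: "x \<in> set cs" "y \<in> set cs" "p \<in> set ps" "q \<in> set ps"
   then have c: "x \<in> carrier A" "y \<in> carrier A" "snd p \<in> carrier A" "snd q \<in> carrier A" using cc ps by auto
   have "inv x \<otimes> y \<otimes> (snd p \<otimes> inv snd q) = (inv x \<otimes> snd p) \<otimes> inv (inv y \<otimes> snd q)"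
    using c by (simp add: inv_mult m_ac)
   then show "fst p * cnj (fst q) * G (snd p \<otimes> inv snd q) (x \<otimes> \<one>) (y \<otimes> \<one>) / n / n =
     (r x * fst p / n) * cnj (r y * fst q / n) * g ((inv x \<otimes> snd p) \<otimes> inv (inv y \<otimes> snd q))"
    using c unfolding G_def by (simp add: n)
  qed
  also have "\<dots> = form g ?qs ?qs"
   unfolding form_def cl fst_conv snd_conv
   by (rule arg_cong[where f=sum_list], rule map_cong, rule refl, rule sum_list_swap)
  also have "\<dots> \<in> \<real>\<^sub>\<ge>\<^sub>0" using cc ps by (intro pd_nonneg[OF assms(3)]) auto
  finally show "avg cs (%x. avg cs (F x) \<one>) \<one> \<in> \<real>\<^sub>\<ge>\<^sub>0" .
 qed
 finally show "Im (form (smooth (autocorr r) g) ps ps) = 0 \<and> 0 <= Re (form (smooth (autocorr r) g) ps ps)"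
  by (simp add: complex_nonneg_Reals_iff)
qed

end

lemma closed_nonneg_form:
 fixes f :: "'b => ('a => complex) => complex"
 shows "(\<And>x. x \<in> set xs ==> continuous_on UNIV (f x)) ==> continuous_on UNIV (%g. \<Sum>x\<leftarrow>xs. f x g)"
 by (induction xs) (auto intro: continuous_on_add)

lemma compact_bounded_functions: "compact {g :: 'a => complex. \<forall>a. norm (g a) <= 1}"
proof -
 have "compactin (product_topology (%_. euclidean) UNIV) (PiE UNIV (%_::'a. cball (0::complex) 1))"
  by (simp add: compactin_PiE)
 moreover have "PiE UNIV (%_::'a. cball (0::complex) 1) = {g. \<forall>a. norm (g a) <= 1}" by auto
 ultimately show ?thesis by (simp add: euclidean_product_topology)
qed

section \<open>An extremal problem that yields a character\<close>

text \<open>For a character \<open>g\<close>, \<open>J g\<close> is the squared modulus of the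
  coefficient \<open>mean (%a. r a * cnj (g a))\<close>. So a character that correlates well with
  \<open>r\<close> is sought by maximising \<open>J\<close> over the normalised positive definite
  functions.\<close>

locale autocorrelation = tb_group +
 fixes r :: "'a => complex"
 assumes uc_r: "uc r" and r_nonzero: "0 < Re (autocorr r \<one>)"
begin

abbreviation "h \<equiv> autocorr r"
abbreviation "S \<equiv> smooth h"
abbreviation "J g \<equiv> Re (S g \<one>)"

definition normalised :: "('a => complex) => bool" where
 "normalised g \<longleftrightarrow> uc g \<and> pd g \<and> g \<one> = 1"

lemma normalisedD: assumes "normalised g" shows "uc g" "pd g" "g \<one> = 1" "a \<in> carrier A ==> norm (g a) <= 1"
 using assms pd_bound[of g a] unfolding normalised_def by auto

lemma uc_h: "uc h" and pd_h: "pd h" and h_inv: "a \<in> carrier A ==> h (inv a) = cnj (h a)"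
 using uc_autocorr[OF uc_r] pd_autocorr[OF uc_r] pd_hermitian by auto

lemma h_one: "h \<one> = of_real (Re (h \<one>))"
 using pd_one[OF pd_h] by (simp add: complex_eq_iff)

lemma uc_S: "uc g ==> uc (S g)" and pd_S: "uc g ==> pd g ==> pd (S g)"
 using uc_smooth[OF uc_h] pd_smooth[OF uc_r] by auto

lemma S_one: "uc g ==> pd g ==> S g \<one> = of_real (J g)" "uc g ==> pd g ==> 0 <= J g"
 using pd_one[OF pd_S] by (simp_all add: complex_eq_iff)

lemma S_one_eq: "S g \<one> = mean (%a. cnj (h a) * g a)"
 unfolding smooth_def by (rule mean_cong) simp

text \<open>Cauchy-Schwarz for the form of \<open>g\<close>, at the measure with density
  \<open>cnj h\<close> and a point mass. It ensures that smoothing followed by normalising does not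
  decrease \<open>J\<close>.\<close>

lemma J_smooth:
 assumes "uc g" "pd g" "g \<one> = 1" shows "(J g)\<^sup>2 <= J (S g)"
proof -
 define F where "F = (%x y. cnj (h x) * cnj (cnj (h y)) * g (x \<otimes> inv y))"
 have uF: "uc2 F" unfolding F_def using assms uc_h
  by (intro uc2_mult uc2_fst_only[where F="%x. cnj (h x)"] uc2_snd_only[where F="%y. cnj (cnj (h y))"] uc_cnj uc2_comp_div)
 have "mean (%x. mean (F x)) = S (S g) \<one>"
 proof -
  have "mean (%x. mean (F x)) = mean (%y. mean (%x. F x y))" by (rule mean_swap[OF uF])
  also have "\<dots> = mean (%y. mean (%x. F x (inv y)))" by (rule mean_inv[symmetric]) (rule uc_mean_snd[OF uc2_flip[OF uF]])
  also have "\<dots> = mean (%y. cnj (h y) * S g y)"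
  proof (rule mean_cong)
   fix y assume y: "y \<in> carrier A"
   have "mean (%x. F x (inv y)) = mean (%x. cnj (h y) * (cnj (h x) * g (x \<otimes> y)))"
    unfolding F_def by (rule mean_cong) (use y in \<open>simp add: h_inv mult_ac\<close>)
   also have "\<dots> = cnj (h y) * S g y" unfolding smooth_def
   proof (rule mean_scale)
    have "uc2 (%y x. cnj (h x) * g (x \<otimes> y))" using assms uc_h by (intro uc2_mult uc2_snd_only[where F="%x. cnj (h x)"] uc2_flip[OF uc2_comp_mult] uc_cnj)
    then show "uc (%x. cnj (h x) * g (x \<otimes> y))" using y by (rule uc2_snd)
   qed
   finally show "mean (%x. F x (inv y)) = cnj (h y) * S g y" .
  qed
  finally show ?thesis by (simp add: S_one_eq)
 qed
 then have K: "mean (%x. mean (%y. cnj (h x) * cnj (cnj (h y)) * g (x \<otimes> inv y))) = of_real (J (S g))"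
  unfolding F_def using S_one[OF uc_S pd_S] assms by simp
 have m: "mean (%x. cnj (h x) * g x) = of_real (J g)" using S_one(1) assms by (simp add: S_one_eq)
 \<comment> \<open>The point mass for which the quadratic expression in \<open>t\<close> is
   least.\<close>
 let ?t = "- of_real (J g) :: complex"
 have "(cnj ?t * ?t) * g \<one> + cnj ?t * of_real (J g) + ?t * cnj (of_real (J g)) + of_real (J (S g)) \<in> \<real>\<^sub>\<ge>\<^sub>0"
  using pd_mean_form[OF assms(2,1) uc_cnj[OF uc_h], of ?t] unfolding K m .
 then have "of_real (J (S g) - (J g)\<^sup>2) \<in> (\<real>\<^sub>\<ge>\<^sub>0 :: complex set)"
  using assms(3) by (simp add: power2_eq_square algebra_simps)
 then show ?thesis by (simp del: of_real_diff)
qed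

text \<open>Written as a convolution, \<open>S g\<close> varies no faster than \<open>h\<close>,
  whatever \<open>g\<close> is. This is the source of compactness.\<close>

lemma S_lipschitz:
 assumes g: "uc g" "\<And>a. a \<in> carrier A ==> norm (g a) <= 1" and ab: "a \<in> carrier A" "b \<in> carrier A"
  and w: "\<And>x. x \<in> carrier A ==> norm (h (a \<otimes> x) - h (b \<otimes> x)) <= w"
 shows "norm (S g a - S g b) <= w"
proof -
 have u: "uc (%y. h (a \<otimes> inv y) * g y)" if "a \<in> carrier A" for a
  using uc2_snd[OF uc2_comp_div[OF uc_h] that] g by (rule_tac uc_mult)
 have S: "S g a = mean (%y. h (a \<otimes> inv y) * g y)" if a: "a \<in> carrier A" for a
 proof -
  have "uc2 (%y x. cnj (h x) * g (x \<otimes> y))" using g uc_h by (intro uc2_mult uc2_snd_only[where F="%x. cnj (h x)"] uc2_flip[OF uc2_comp_mult] uc_cnj)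
  then have "uc (%x. cnj (h x) * g (x \<otimes> a))" using a by (rule uc2_snd)
  then have "S g a = mean (%y. cnj (h (inv a \<otimes> y)) * g (inv a \<otimes> y \<otimes> a))"
   unfolding smooth_def using a by (intro mean_translate[symmetric]) auto
  also have "\<dots> = mean (%y. h (a \<otimes> inv y) * g y)"
  proof (rule mean_cong)
   fix y assume y: "y \<in> carrier A"
   have "inv (inv a \<otimes> y) = a \<otimes> inv y" "inv a \<otimes> y \<otimes> a = y" using a y by (simp_all add: inv_mult m_comm[of "inv a" y] m_comm[of "inv y" a] m_assoc)
   then show "cnj (h (inv a \<otimes> y)) * g (inv a \<otimes> y \<otimes> a) = h (a \<otimes> inv y) * g y"
    using h_inv[of "inv a \<otimes> y"] a y by simp
  qed
  finally show ?thesis .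
 qed
 have "S g a - S g b = mean (%y. h (a \<otimes> inv y) * g y - h (b \<otimes> inv y) * g y)"
  unfolding S[OF ab(1)] S[OF ab(2)] using u ab by (simp add: mean_diff)
 also have "norm \<dots> <= w"
 proof (intro norm_mean_le uc_diff u ab)
  fix y assume y: "y \<in> carrier A"
  have "norm ((h (a \<otimes> inv y) - h (b \<otimes> inv y)) * g y) <= w * 1"
   unfolding norm_mult using y w[of "inv y"] g(2)[OF y] by (intro mult_mono) (auto intro: order.trans[OF norm_ge_zero])
  then show "norm (h (a \<otimes> inv y) * g y - h (b \<otimes> inv y) * g y) <= w" by (simp add: left_diff_distrib)
 qed
 finally show ?thesis .
qed

text \<open>The last clause bounds the oscillation of \<open>g\<close> by that of \<open>h\<close>;
  it survives pointwise limits and makes the set equicontinuous. The bound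
  \<open>norm (g a) <= 1\<close> also covers points outside the carrier, so that Tychonoff's theorem
  applies.\<close>

definition E :: "real => ('a => complex) set" where
 "E l = {g. pd g \<and> g \<one> = 1 \<and> (\<forall>a. norm (g a) <= 1) \<and>
   (\<forall>a b w. a \<in> carrier A \<and> b \<in> carrier A \<and> (\<forall>x\<in>carrier A. norm (h (a \<otimes> x) - h (b \<otimes> x)) <= w) --> norm (g a - g b) <= w / l)}"

lemma closed_E: "closed (E l)" and compact_E: "compact (E l)"
proof -
 have c: "continuous_on UNIV (%g::'a => complex. g a)" for a by simp
 have cf: "continuous_on UNIV (%g::'a => complex. form g ps ps)" for ps
  unfolding form_def by (intro closed_nonneg_form continuous_on_mult continuous_on_const c)
 have 1: "closed {g. pd g}" unfolding pd_def
  by (intro closed_Collect_all closed_Collect_imp closed_Collect_conj closed_Collect_eq closed_Collect_le open_Collect_const continuous_intros cf)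
 have 2: "closed {g::'a => complex. \<forall>a b w. a \<in> carrier A \<and> b \<in> carrier A \<and> (\<forall>x\<in>carrier A. norm (h (a \<otimes> x) - h (b \<otimes> x)) <= w) --> norm (g a - g b) <= w / l}"
  by (intro closed_Collect_all closed_Collect_imp open_Collect_const closed_Collect_le continuous_intros c)
 have 3: "closed {g::'a => complex. g \<one> = 1}" by (intro closed_Collect_eq c continuous_intros)
 have 4: "closed {g::'a => complex. \<forall>a. norm (g a) <= 1}"
  by (intro closed_Collect_all closed_Collect_le continuous_intros c)
 have eq: "E l = {g. \<forall>a. norm (g a) <= 1} \<inter> ({g. pd g} \<inter> {g. g \<one> = 1} \<inter> {g. \<forall>a b w. a \<in> carrier A \<and> b \<in> carrier A \<and> (\<forall>x\<in>carrier A. norm (h (a \<otimes> x) - h (b \<otimes> x)) <= w) --> norm (g a - g b) <= w / l})"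
  unfolding E_def by blast
 show "closed (E l)" unfolding eq using 1 2 3 4 by (intro closed_Int)
 show "compact (E l)" unfolding eq using 1 2 3 by (intro compact_Int_closed compact_bounded_functions closed_Int)
qed

lemma E_equicontinuous:
 assumes "l > 0" "e > 0"
 obtains d where "d > 0" "\<And>g a b. g \<in> E l ==> a \<in> carrier A ==> b \<in> carrier A ==> D (a \<otimes> inv b) < d ==> norm (g a - g b) < e"
proof -
 obtain d where d: "d > 0" "PROP modulus h d (e * l / 2)"
  using ucE[OF uc_h, of "e * l / 2"] assms by auto
 show thesis
 proof (rule that[OF d(1)])
  fix g a b assume *: "g \<in> E l" "a \<in> carrier A" "b \<in> carrier A" "D (a \<otimes> inv b) < d"
  have "norm (h (a \<otimes> x) - h (b \<otimes> x)) <= e * l / 2" if x: "x \<in> carrier A" for x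
   using d(2)[of "a \<otimes> x" "b \<otimes> x"] * x by (simp add: m_comm[of _ x] translate_div)
  then have "norm (g a - g b) <= e * l / 2 / l" using * unfolding E_def by blast
  then show "norm (g a - g b) < e" using assms by simp
 qed
qed

lemma E_normalised: "g \<in> E l ==> l > 0 ==> normalised g"
 unfolding normalised_def
proof (intro conjI ucI)
 fix e :: real assume g: "g \<in> E l" "l > 0" and "e > 0"
 then obtain d where "d > 0" "PROP modulus g d e"
  using E_equicontinuous[OF g(2) \<open>e > 0\<close>] by metis
 then show "\<exists>d>0. close g d e" by blast
qed (auto simp: E_def)

text \<open>By equicontinuity, functions in \<open>E l\<close> that are close on a finite net are
  close everywhere. So a functional that is Lipschitz for the sup norm is continuous for the
  pointwise topology.\<close>

lemma continuous_on_E: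
 assumes "l > 0" "C > 0" and lip: "\<And>f g w. f \<in> E l ==> g \<in> E l ==> (\<And>a. a \<in> carrier A ==> norm (f a - g a) <= w) ==> \<bar>\<Theta> f - \<Theta> g\<bar> <= C * w"
 shows "continuous_on (E l) (\<Theta> :: ('a => complex) => real)"
 unfolding continuous_on_def
proof (intro ballI tendstoI)
 fix g and e :: real assume g: "g \<in> E l" and e: "e > 0"
 define e' where "e' = e / (6 * C)"
 have e': "e' > 0" using e assms by (simp add: e'_def)
 obtain d where d: "d > 0" "\<And>g a b. g \<in> E l ==> a \<in> carrier A ==> b \<in> carrier A ==> D (a \<otimes> inv b) < d ==> norm (g a - g b) < e'"
  using E_equicontinuous[OF assms(1) e'] by blast
 obtain N where N: "finite N" "N \<subseteq> carrier A" "\<forall>a\<in>carrier A. \<exists>c\<in>N. D (a \<otimes> inv c) < d"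
  using TB[OF d(1)] by blast
 have "\<forall>\<^sub>F f in at g within E l. \<forall>c\<in>N. dist (f c) (g c) < e'"
 proof (rule eventually_ball_finite[OF N(1)], rule ballI)
  fix c
  have "((%f. f c) \<longlongrightarrow> g c) (at g within E l)"
   using continuous_on_subset[OF continuous_on_product_coordinates subset_UNIV, of "E l" c] g by (simp add: continuous_on_def)
  then show "\<forall>\<^sub>F f in at g within E l. dist (f c) (g c) < e'" using e' by (rule tendstoD)
 qed
 moreover have "\<forall>\<^sub>F f in at g within E l. f \<in> E l" by (simp add: eventually_at_filter)
 ultimately show "\<forall>\<^sub>F f in at g within E l. dist (\<Theta> f) (\<Theta> g) < e"
 proof eventually_elim
  case (elim f)
  have "norm (f a - g a) <= 3 * e'" if a: "a \<in> carrier A" for a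
  proof -
   obtain c where c: "c \<in> N" "D (a \<otimes> inv c) < d" using N a by blast
   have cc: "c \<in> carrier A" using c N by blast
   have "norm (f a - f c) < e'" "norm (g a - g c) < e'" "norm (f c - g c) < e'"
    using d(2)[OF _ a cc c(2)] elim g c by (auto simp: dist_norm)
   moreover have "f a - g a = ((f a - f c) + (f c - g c)) - (g a - g c)" by simp
   ultimately show ?thesis
    using norm_triangle_ineq4[of "(f a - f c) + (f c - g c)" "g a - g c"] norm_triangle_ineq[of "f a - f c" "f c - g c"] by simp
  qed
  then have "\<bar>\<Theta> f - \<Theta> g\<bar> <= C * (3 * e')" using elim g by (intro lip) auto
  also have "\<dots> = e / 2" using assms by (simp add: e'_def)
  finally show ?case using e by (simp add: dist_real_def)
 qed
qed

lemma uc_hg: "uc g ==> uc (%a. cnj (h a) * g a)"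
 using uc_h by (intro uc_mult uc_cnj)

lemma continuous_J: assumes "l > 0" shows "continuous_on (E l) J"
proof -
 obtain B where B: "B > 0" "\<And>a. a \<in> carrier A ==> norm (h a) <= B" using uc_bounded[OF uc_h] by blast
 show ?thesis
 proof (rule continuous_on_E[OF assms B(1)])
  fix f g w assume fg: "f \<in> E l" "g \<in> E l" and w: "\<And>a. a \<in> carrier A ==> norm (f a - g a) <= w"
  have u: "uc f" "uc g" using fg E_normalised assms normalisedD by blast+
  have "S f \<one> - S g \<one> = mean (%a. cnj (h a) * f a - cnj (h a) * g a)"
   unfolding S_one_eq using u by (simp add: mean_diff uc_hg)
  also have "norm \<dots> <= B * w"
  proof (intro norm_mean_le uc_diff uc_hg u)
   fix a assume a: "a \<in> carrier A"
   have "norm (cnj (h a) * (f a - g a)) <= B * w" unfolding norm_mult using a B w[OF a] by (intro mult_mono) auto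
   then show "norm (cnj (h a) * f a - cnj (h a) * g a) <= B * w" by (simp add: algebra_simps)
  qed
  finally show "\<bar>J f - J g\<bar> <= B * w" using abs_Re_le_cmod[of "S f \<one> - S g \<one>"] by simp
 qed
qed

lemma continuous_energy: assumes "l > 0" shows "continuous_on (E l) (%g. Re (mean (%a. g a * cnj (g a))))"
proof (rule continuous_on_E[OF assms, of 2])
 fix f g w assume fg: "f \<in> E l" "g \<in> E l" and w: "\<And>a. a \<in> carrier A ==> norm (f a - g a) <= w"
 have u: "uc (%a. f a * cnj (f a))" "uc (%a. g a * cnj (g a))"
  using normalisedD(1)[OF E_normalised[OF _ assms]] fg by (simp_all add: uc_mult uc_cnj)
 have "norm (mean (%a. f a * cnj (f a) - g a * cnj (g a))) <= 2 * w"
 proof (intro norm_mean_le uc_diff u)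
  fix a assume a: "a \<in> carrier A"
  have b: "norm (f a) <= 1" "norm (g a) <= 1" using fg by (auto simp: E_def)
  have "norm (f a * cnj (f a) - g a * cnj (g a)) = norm ((f a - g a) * cnj (f a) + g a * cnj (f a - g a))" by (simp add: algebra_simps)
  also have "\<dots> <= norm (f a - g a) * norm (f a) + norm (g a) * norm (f a - g a)"
   by (metis norm_mult complex_mod_cnj norm_triangle_ineq)
  also have "\<dots> <= w * 1 + 1 * w" using w[OF a] b by (intro add_mono mult_mono) (auto intro: order.trans[OF norm_ge_zero])
  finally show "norm (f a * cnj (f a) - g a * cnj (g a)) <= 2 * w" by simp
 qed
 then show "\<bar>Re (mean (%a. f a * cnj (f a))) - Re (mean (%a. g a * cnj (g a)))\<bar> <= 2 * w"
  using abs_Re_le_cmod[of "mean (%a. f a * cnj (f a) - g a * cnj (g a))"] u by (simp add: mean_diff)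
qed simp

definition normalise :: "('a => complex) => 'a => complex" where
 "normalise g a = (if a \<in> carrier A then g a / g \<one> else 0)"

lemma normalise:
 assumes "uc g" "pd g" "Re (g \<one>) > 0"
 shows "normalised (normalise g)" "norm (normalise g a) <= 1" "b \<in> carrier A ==> S (normalise g) b = S g b / g \<one>"
  "J (normalise g) = J g / Re (g \<one>)"
proof -
 have g1: "g \<one> = of_real (Re (g \<one>))" using pd_one[OF assms(2)] by (simp add: complex_eq_iff)
 have e: "normalise g a = g a / of_real (Re (g \<one>))" if "a \<in> carrier A" for a
  using that g1 by (simp add: normalise_def)
 have "pd (normalise g)" using pd_divide[OF assms(2), of "Re (g \<one>)"] assms(3) pd_cong[of "normalise g"] e by simp
 moreover have "uc (normalise g)" using uc_mult[OF assms(1) uc_const, of "inverse (of_real (Re (g \<one>)))"] uc_cong[of "normalise g"] e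
  by (simp add: divide_inverse)
 moreover have "normalise g \<one> = 1" using assms(3) by (auto simp: normalise_def)
 ultimately show "normalised (normalise g)" by (simp add: normalised_def)
 from normalisedD(4)[OF this] show "norm (normalise g a) <= 1" by (cases "a \<in> carrier A") (auto simp: normalise_def)
 have S: "S (normalise g) b = S g b / g \<one>" if b: "b \<in> carrier A" for b
 proof -
  have "uc2 (%y x. cnj (h x) * g (x \<otimes> y))" using assms uc_h by (intro uc2_mult uc2_snd_only[where F="%x. cnj (h x)"] uc2_flip[OF uc2_comp_mult] uc_cnj)
  then have u: "uc (%x. cnj (h x) * g (x \<otimes> b))" using b by (rule uc2_snd)
  have "S (normalise g) b = mean (%x. inverse (g \<one>) * (cnj (h x) * g (x \<otimes> b)))"
   unfolding smooth_def by (rule mean_cong) (simp add: normalise_def b divide_inverse mult_ac)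
  then show ?thesis unfolding mean_scale[OF u] smooth_def by (simp add: divide_inverse)
 qed
 then show "b \<in> carrier A ==> S (normalise g) b = S g b / g \<one>" .
 show "J (normalise g) = J g / Re (g \<one>)" unfolding S[OF one_closed] by (subst g1) (simp only: Re_divide_of_real)
qed

lemma normalise_in_E:
 assumes g: "uc g" "pd g" "Re (g \<one>) > 0" and l: "l > 0"
  and w: "\<And>a b w. a \<in> carrier A ==> b \<in> carrier A ==> (\<And>x. x \<in> carrier A ==> norm (h (a \<otimes> x) - h (b \<otimes> x)) <= w) ==>
   norm (normalise g a - normalise g b) <= w / l"
 shows "normalise g \<in> E l"
 using normalise(1,2)[OF g] w unfolding E_def normalised_def by simp

text \<open>Smoothing brings a competitor into the compact set without loss, so the supremum may be
  sought there.\<close>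

lemma smooth_in_E:
 assumes g: "normalised g" and l: "0 < l" "l <= J g"
 shows "normalise (S g) \<in> E l" "J g <= J (normalise (S g))"
proof -
 note n = normalisedD[OF g]
 have p: "Re (S g \<one>) > 0" using l by simp
 show "normalise (S g) \<in> E l"
 proof (rule normalise_in_E[OF uc_S[OF n(1)] pd_S[OF n(1,2)] p l(1)])
  fix a b w assume *: "a \<in> carrier A" "b \<in> carrier A" "\<And>x. x \<in> carrier A ==> norm (h (a \<otimes> x) - h (b \<otimes> x)) <= w"
  have L: "norm (S g a - S g b) <= w" by (rule S_lipschitz) (use n * in auto)
  have "norm (normalise (S g) a - normalise (S g) b) = norm (S g a - S g b) / J g"
   using * p S_one(1)[OF n(1,2)] by (simp add: normalise_def norm_divide diff_divide_distrib[symmetric]) (metis abs_of_pos norm_of_real)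
  also have "\<dots> <= w / l" using L l by (intro frac_le) (auto intro: order.trans[OF norm_ge_zero])
  finally show "norm (normalise (S g) a - normalise (S g) b) <= w / l" .
 qed
 have "J g <= J (S g) / J g" using J_smooth[OF n(1,2,3)] p by (simp add: field_simps power2_eq_square)
 then show "J g <= J (normalise (S g))" using normalise(4)[OF uc_S[OF n(1)] pd_S[OF n(1,2)] p] by simp
qed

definition rate :: real where "rate = Sup (J ` {g. normalised g})"

lemma J_bdd: "bdd_above (J ` {g. normalised g})"
proof -
 obtain B where B: "B > 0" "\<And>a. a \<in> carrier A ==> norm (h a) <= B" using uc_bounded[OF uc_h] by blast
 have "J g <= B" if g: "normalised g" for g
 proof -
  have "norm (S g \<one>) <= B" unfolding S_one_eq
  proof (intro norm_mean_le uc_hg normalisedD[OF g])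
   fix a assume a: "a \<in> carrier A"
   have "norm (cnj (h a) * g a) <= B * 1" unfolding norm_mult using B a normalisedD(4)[OF g a] by (intro mult_mono) auto
   then show "norm (cnj (h a) * g a) <= B" by simp
  qed
  then show ?thesis using abs_Re_le_cmod[of "S g \<one>"] by simp
 qed
 then show ?thesis by (auto intro!: bdd_aboveI[of _ B])
qed

lemma J_le_rate: "normalised g ==> J g <= rate"
 unfolding rate_def using J_bdd by (intro cSUP_upper) auto

lemma J_le_rate_pd:
 assumes "uc g" "pd g" shows "J g <= rate * Re (g \<one>)"
proof (cases "Re (g \<one>) > 0")
 case True
 then show ?thesis using J_le_rate[OF normalise(1)[OF assms]] normalise(4)[OF assms] by (simp add: field_simps)
next
 case False
 then have z: "g a = 0" if "a \<in> carrier A" for a using pd_bound[OF assms(2) that] by (metis norm_le_zero_iff not_less order.trans)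
 then have "S g \<one> = mean (%_. 0)" unfolding S_one_eq by (intro mean_cong) simp
 then show ?thesis using z[OF one_closed] by simp
qed

text \<open>Tests \<open>J\<close> with \<open>h\<close> itself, divided by its value at
  \<open>\<one>\<close>. This lower bound on the maximum becomes the lower bound on the coefficient
  in \<open>character_exists\<close>.\<close>

lemma energy_ratio_le_rate: "Re (mean (%a. h a * cnj (h a))) / Re (h \<one>) <= rate"
proof -
 have "J h = Re (mean (%a. h a * cnj (h a)))" by (simp add: S_one_eq mult.commute)
 then show ?thesis using J_le_rate_pd[OF uc_h pd_h] r_nonzero by (simp add: field_simps)
qed

lemma rate_pos: "0 < rate"
proof -
 have u: "uc (%a. h a * cnj (h a))" using uc_h by (intro uc_mult uc_cnj)
 have "0 < Re (mean (%a. h a * cnj (h a)))"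
 proof (rule mean_pos[OF u])
  have "h \<one> * cnj (h \<one>) = of_real ((Re (h \<one>))\<^sup>2)"
   by (subst (1 2) h_one) (simp add: power2_eq_square)
  then show "0 < Re (h \<one> * cnj (h \<one>))" using r_nonzero by simp
 qed (simp add: complex_mult_cnj)
 then have "0 < Re (mean (%a. h a * cnj (h a))) / Re (h \<one>)" using r_nonzero by simp
 then show ?thesis using energy_ratio_le_rate by linarith
qed

lemma J_attained:
 obtains g where "g \<in> E (rate/2)" "J g = rate"
proof -
 have l: "rate/2 > 0" using rate_pos by simp
 have ex: "\<exists>g\<in>E (rate/2). y < J g" if y: "y < rate" for y
 proof -
  \<comment> \<open>Exceeding \<open>rate/2\<close> is what puts the smoothed competitor into
    \<open>E (rate/2)\<close>.\<close>
  have "max y (rate/2) < rate" using y rate_pos by simp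
  then obtain g where g: "normalised g" "max y (rate/2) < J g"
   unfolding rate_def using less_cSUP_iff[OF _ J_bdd] normalise(1)[OF uc_h pd_h r_nonzero] by blast
  then show ?thesis using smooth_in_E[OF g(1) l] by (intro bexI[of _ "normalise (S g)"]) auto
 qed
 have "E (rate/2) ~= {}" using ex[of "rate - 1"] by auto
 then obtain g where g: "g \<in> E (rate/2)" "\<And>f. f \<in> E (rate/2) ==> J f <= J g"
  using continuous_attains_sup[OF compact_E _ continuous_J[OF l]] by blast
 have "J g >= rate" using ex[of "J g"] g(2) by force
 then show thesis using that[OF g(1)] J_le_rate[OF E_normalised[OF g(1) l]] by simp
qed

lemma S_translate:
 assumes "uc g" "c \<in> carrier A" "b \<in> carrier A" shows "S (%a. g (c \<otimes> a)) b = S g (c \<otimes> b)"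
 unfolding smooth_def by (rule mean_cong) (use assms in \<open>simp add: m_lcomm\<close>)

lemma uc_S_integrand: "uc g ==> b \<in> carrier A ==> uc (%x. cnj (h x) * g (x \<otimes> b))"
proof -
 assume "uc g" "b \<in> carrier A"
 then have "uc2 (%y x. cnj (h x) * g (x \<otimes> y))" using uc_h by (intro uc2_mult uc2_snd_only[where F="%x. cnj (h x)"] uc2_flip[OF uc2_comp_mult] uc_cnj)
 then show ?thesis using \<open>b \<in> carrier A\<close> by (rule uc2_snd)
qed

definition modulated :: "('a => complex) => complex => 'a => 'a => complex" where
 "modulated g z c a = 2 * g a + z * g (c \<otimes> a) + cnj z * g (inv c \<otimes> a)"

lemma modulated:
 assumes g: "normalised g" and c: "c \<in> carrier A" and z: "norm z = 1"
 shows "uc (modulated g z c)" "pd (modulated g z c)" "modulated g z c \<one> = of_real (2 + 2 * Re (z * g c))"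
  "b \<in> carrier A ==> S (modulated g z c) b = 2 * S g b + z * S g (c \<otimes> b) + cnj z * S g (inv c \<otimes> b)"
proof -
 note n = normalisedD[OF g]
 show "uc (modulated g z c)" unfolding modulated_def using n c by (intro uc_add uc_mult uc_const uc_translate) auto
 show "pd (modulated g z c)" unfolding modulated_def using pd_modulate[OF n(2) c z] .
 show "modulated g z c \<one> = of_real (2 + 2 * Re (z * g c))"
  using c n(3) pd_hermitian[OF n(2) c] by (simp add: modulated_def complex_eq_iff)
 assume b: "b \<in> carrier A"
 have u: "uc (%x. cnj (h x) * g (x \<otimes> b))" "uc (%x. cnj (h x) * g (c \<otimes> (x \<otimes> b)))" "uc (%x. cnj (h x) * g (inv c \<otimes> (x \<otimes> b)))"
  using uc_S_integrand[of _ b] n(1) c b by (auto intro: uc_translate)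
 have "S (modulated g z c) b = mean (%x. 2 * (cnj (h x) * g (x \<otimes> b)) + z * (cnj (h x) * g (c \<otimes> (x \<otimes> b))) + cnj z * (cnj (h x) * g (inv c \<otimes> (x \<otimes> b))))"
  unfolding smooth_def modulated_def by (rule mean_cong) (simp add: algebra_simps)
 also have "\<dots> = 2 * mean (%x. cnj (h x) * g (x \<otimes> b)) + z * mean (%x. cnj (h x) * g (c \<otimes> (x \<otimes> b))) + cnj z * mean (%x. cnj (h x) * g (inv c \<otimes> (x \<otimes> b)))"
  using u by (simp add: mean_add mean_scale uc_add uc_mult)
 also have "\<dots> = 2 * S g b + z * S g (c \<otimes> b) + cnj z * S g (inv c \<otimes> b)"
  using S_translate[OF n(1) c b] S_translate[OF n(1) inv_closed[OF c] b] by (simp add: smooth_def)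
 finally show "S (modulated g z c) b = 2 * S g b + z * S g (c \<otimes> b) + cnj z * S g (inv c \<otimes> b)" .
qed

text \<open>First variation of \<open>J\<close> at a maximiser, in the direction of the translates by \<open>c\<close>.\<close>

lemma maximiser_eigen:
 assumes g: "normalised g" "J g = rate" and c: "c \<in> carrier A"
 shows "S g c = of_real rate * g c"
proof -
 note n = normalisedD[OF g(1)]
 define w where "w = S g c - of_real rate * g c"
 have *: "Re (z * w) <= 0" if z: "norm z = 1" for z
 proof -
  \<comment> \<open>The modulate is positive definite, hence bounded by \<open>rate\<close>; the
    terms \<open>2 * rate\<close> cancel and \<open>Re (z * w) <= 0\<close> remains for every phase
    \<open>z\<close>, which forces \<open>w = 0\<close>.\<close>
  have "J (modulated g z c) <= rate * Re (modulated g z c \<one>)"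
   by (rule J_le_rate_pd[OF modulated(1,2)[OF g(1) c z]])
  moreover have "S g (inv c) = cnj (S g c)" using pd_hermitian[OF pd_S[OF n(1,2)] c] .
  then have "J (modulated g z c) = 2 * rate + 2 * Re (z * S g c)"
   using modulated(4)[OF g(1) c z one_closed] c g(2) by simp
  ultimately show ?thesis unfolding modulated(3)[OF g(1) c z] w_def by (simp add: algebra_simps)
 qed
 have "w = 0"
 proof (rule ccontr)
  assume w: "w ~= 0"
  have "cnj (sgn w) * w = (w * cnj w) / of_real (norm w)" by (simp add: sgn_eq)
  also have "\<dots> = of_real (norm w)" using w by (simp add: complex_norm_square[symmetric] power2_eq_square)
  finally have "Re (cnj (sgn w) * w) = norm w" by simp
  then show False using *[of "cnj (sgn w)"] w by (simp add: norm_sgn)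
 qed
 then show ?thesis by (simp add: w_def)
qed

text \<open>Summed over the four roots, \<open>z\<close>, \<open>cnj z\<close> and
  \<open>z\<^sup>2\<close> vanish, and with them all cross terms.\<close>

lemma norm_fourth_roots:
 fixes u v w :: complex
 shows "(\<Sum>z\<in>{1, -1, \<i>, -\<i>}. (norm (2 * u + z * v + cnj z * w))\<^sup>2) = 16 * (norm u)\<^sup>2 + 4 * (norm v)\<^sup>2 + 4 * (norm w)\<^sup>2"
proof -
 have "(\<Sum>z\<in>{1, -1, \<i>, -\<i>}. f z) = f 1 + f (-1) + f \<i> + f (-\<i>)" for f :: "complex => real"
  by (simp add: complex_eq_iff)
 then show ?thesis by (simp add: cmod_power2) (simp add: power2_eq_square algebra_simps)
qed

text \<open>Among the maximisers of \<open>J\<close> the one of greatest energy is unimodular: the second variation,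
 averaged over the four directions \<open>1, -1, \<i>, -\<i>\<close>, leaves no room for \<open>norm (g c) < 1\<close>.\<close>

lemma unimodular_maximiser:
 obtains g where "normalised g" "\<And>c. c \<in> carrier A ==> norm (g c) = 1" "J g = rate"
proof -
 have l: "rate/2 > 0" using rate_pos by simp
 let ?K = "E (rate/2) \<inter> J -` {rate}"
 have "closed ?K" using continuous_J[OF l] closed_E by (intro continuous_closed_preimage) auto
 from compact_Int_closed[OF compact_E[of "rate/2"] this] have cK: "compact ?K" by simp
 have ne: "?K ~= {}"
  by (rule J_attained) auto
 define W where "W = (%g. Re (mean (%a. g a * cnj (g a))))"
 have "continuous_on ?K W" unfolding W_def using continuous_energy[OF l] by (rule continuous_on_subset) auto
 then obtain g where g: "g \<in> ?K" and max: "\<And>f. f \<in> ?K ==> W f <= W g"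
  using continuous_attains_sup[OF cK ne] by blast
 have gn: "normalised g" "J g = rate" using g E_normalised[OF _ l] by auto
 note n = normalisedD[OF gn(1)]
 have ug: "uc (%a. g a * cnj (g a))" using n by (intro uc_mult uc_cnj)
 have Wpos: "W g > 0" unfolding W_def
  by (rule mean_pos[OF ug]) (auto simp: complex_mult_cnj n(3))
 have "norm (g c) = 1" if c: "c \<in> carrier A" for c
 proof -
  let ?q = "%z. modulated g z c"
  have q: "Re (mean (%a. ?q z a * cnj (?q z a))) <= W g * (2 + 2 * Re (z * g c))\<^sup>2" if z: "norm z = 1" for z
  proof -
   note m = modulated[OF gn(1) c z]
   have uq: "uc (%a. ?q z a * cnj (?q z a))" using m(1) by (intro uc_mult uc_cnj)
   have r1: "Re (?q z \<one>) = 2 + 2 * Re (z * g c)" using m(3) by simp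
   show ?thesis
   proof (cases "Re (?q z \<one>) > 0")
    case True
    \<comment> \<open>A modulate of an eigenfunction of \<open>S\<close> is an eigenfunction, so its
      normalisation is again a maximiser of \<open>J\<close>; \<open>S_lipschitz\<close> together
      with the eigenvalue \<open>rate\<close> places it in \<open>E (rate/2)\<close>.\<close>
    have eig: "S (?q z) b = of_real rate * ?q z b" if b: "b \<in> carrier A" for b
     using m(4)[OF b] maximiser_eigen[OF gn] b c by (simp add: modulated_def algebra_simps)
    have "normalise (?q z) \<in> E (rate/2)"
    proof (rule normalise_in_E[OF m(1,2) True l])
     fix a b w assume *: "a \<in> carrier A" "b \<in> carrier A" "\<And>x. x \<in> carrier A ==> norm (h (a \<otimes> x) - h (b \<otimes> x)) <= w"
     note nn = normalise[OF m(1,2) True]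
     have "norm (S (normalise (?q z)) a - S (normalise (?q z)) b) <= w"
      by (rule S_lipschitz) (use nn(2) normalisedD[OF nn(1)] * in auto)
     moreover have "S (normalise (?q z)) x = of_real rate * normalise (?q z) x" if "x \<in> carrier A" for x
      using nn(3)[OF that] eig[OF that] that by (simp add: normalise_def)
     ultimately have "rate * norm (normalise (?q z) a - normalise (?q z) b) <= w"
      using * rate_pos by (simp add: right_diff_distrib[symmetric] norm_mult)
     then have "norm (normalise (?q z) a - normalise (?q z) b) <= w / rate" using rate_pos by (simp add: field_simps)
     also have "\<dots> <= w / (rate/2)" using rate_pos order.trans[OF norm_ge_zero *(3)[OF one_closed]] by (simp add: field_simps)
     finally show "norm (normalise (?q z) a - normalise (?q z) b) <= w / (rate/2)" .
    qed
    moreover have "J (normalise (?q z)) = rate"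
     using normalise(4)[OF m(1,2) True] eig[OF one_closed] True by simp
    ultimately have "W (normalise (?q z)) <= W g" by (intro max) auto
    moreover have "mean (%a. ?q z a * cnj (?q z a)) = of_real ((Re (?q z \<one>))\<^sup>2) * mean (%a. normalise (?q z) a * cnj (normalise (?q z) a))"
    proof (subst mean_scale[symmetric])
     show "uc (%a. normalise (?q z) a * cnj (normalise (?q z) a))"
      using normalisedD(1)[OF normalise(1)[OF m(1,2) True]] by (intro uc_mult uc_cnj)
     show "mean (%a. ?q z a * cnj (?q z a)) = mean (%a. of_real ((Re (?q z \<one>))\<^sup>2) * (normalise (?q z) a * cnj (normalise (?q z) a)))"
     proof (rule mean_cong)
      fix a assume a: "a \<in> carrier A"
      have "?q z a = of_real (Re (?q z \<one>)) * normalise (?q z) a"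
      proof -
       have "of_real (Re (?q z \<one>)) = ?q z \<one>" using m(3) by (metis Re_complex_of_real)
       moreover have "?q z \<one> ~= 0" using True by auto
       ultimately show ?thesis using a by (simp add: normalise_def)
      qed
      then show "?q z a * cnj (?q z a) = of_real ((Re (?q z \<one>))\<^sup>2) * (normalise (?q z) a * cnj (normalise (?q z) a))"
       by (simp only: complex_cnj_mult complex_cnj_complex_of_real power2_eq_square of_real_mult mult_ac)
     qed
    qed
    ultimately show ?thesis unfolding W_def r1[symmetric]
     by (simp del: of_real_power add: mult.commute[of "Re (mean (%a. g a * cnj (g a)))"] mult_left_mono)
   next
    case False
    then have "?q z a = 0" if "a \<in> carrier A" for a using pd_bound[OF m(2) that] by (metis norm_le_zero_iff not_less order.trans)
    then have "mean (%a. ?q z a * cnj (?q z a)) = mean (%_. 0)" by (intro mean_cong) simp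
    then show ?thesis using Wpos by simp
   qed
  qed
  let ?Z = "{1, -1, \<i>, -\<i>}"
  have uq: "uc (%a. ?q z a * cnj (?q z a))" if "z \<in> ?Z" for z
   using modulated(1)[OF gn(1) c, of z] that by (intro uc_mult uc_cnj) auto
  have uT: "uc (%a. g (x \<otimes> a) * cnj (g (x \<otimes> a)))" if "x \<in> carrier A" for x
   using uc_translate[OF ug that] .
  have mT: "mean (%a. g (x \<otimes> a) * cnj (g (x \<otimes> a))) = mean (%a. g a * cnj (g a))" if "x \<in> carrier A" for x
   using mean_translate[OF ug that] .
  \<comment> \<open>Summing \<open>q\<close> over the four roots compares \<open>24 * W g\<close>
    with \<open>W g * (16 + 8 * (norm (g c))\<^sup>2)\<close>, since translates of \<open>g\<close>
    have the same energy.\<close>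
  have "24 * W g = Re (16 * mean (%a. g a * cnj (g a)) + 4 * mean (%a. g (c \<otimes> a) * cnj (g (c \<otimes> a))) + 4 * mean (%a. g (inv c \<otimes> a) * cnj (g (inv c \<otimes> a))))"
   using mT[OF c] mT[OF inv_closed[OF c]] by (simp add: W_def)
  also have "\<dots> = Re (mean (%a. 16 * (g a * cnj (g a)) + 4 * (g (c \<otimes> a) * cnj (g (c \<otimes> a))) + 4 * (g (inv c \<otimes> a) * cnj (g (inv c \<otimes> a)))))"
   using ug uT[OF c] uT[OF inv_closed[OF c]]
   by (simp only: mean_add[OF uc_add[OF uc_mult[OF uc_const] uc_mult[OF uc_const]] uc_mult[OF uc_const]] mean_add[OF uc_mult[OF uc_const] uc_mult[OF uc_const]] mean_scale)
  also have "mean (%a. 16 * (g a * cnj (g a)) + 4 * (g (c \<otimes> a) * cnj (g (c \<otimes> a))) + 4 * (g (inv c \<otimes> a) * cnj (g (inv c \<otimes> a)))) = mean (%a. \<Sum>z\<in>?Z. ?q z a * cnj (?q z a))"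
  proof (rule mean_cong)
   fix a
   have "of_real (\<Sum>z\<in>?Z. (norm (?q z a))\<^sup>2) = (\<Sum>z\<in>?Z. ?q z a * cnj (?q z a))"
    by (simp only: of_real_sum complex_norm_square)
   then show "16 * (g a * cnj (g a)) + 4 * (g (c \<otimes> a) * cnj (g (c \<otimes> a))) + 4 * (g (inv c \<otimes> a) * cnj (g (inv c \<otimes> a))) = (\<Sum>z\<in>?Z. ?q z a * cnj (?q z a))"
    unfolding modulated_def norm_fourth_roots by (simp only: of_real_add of_real_mult complex_norm_square of_real_numeral)
  qed
  also have "\<dots> = (\<Sum>z\<in>?Z. mean (%a. ?q z a * cnj (?q z a)))" by (rule mean_sum[OF uq])
  also have "Re \<dots> = (\<Sum>z\<in>?Z. Re (mean (%a. ?q z a * cnj (?q z a))))" by (rule Re_sum)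
  also have "\<dots> <= (\<Sum>z\<in>?Z. W g * (2 + 2 * Re (z * g c))\<^sup>2)" by (intro sum_mono q) auto
  also have "\<dots> = W g * (\<Sum>z\<in>?Z. (2 + 2 * Re (z * g c))\<^sup>2)" by (simp only: sum_distrib_left)
  also have "(\<Sum>z\<in>?Z. (2 + 2 * Re (z * g c))\<^sup>2) = 16 + 8 * (norm (g c))\<^sup>2"
   by (subst cmod_power2) (simp add: complex_eq_iff power2_eq_square algebra_simps)
  finally have "1 <= (norm (g c))\<^sup>2" using Wpos by simp
  then have "1 <= norm (g c)" using power2_le_imp_le[of 1 "norm (g c)"] by simp
  then show ?thesis using n(4)[OF c] by simp
 qed
 then show thesis using that gn by blast
qed

text \<open>A unimodular maximiser is multiplicative by \<open>pd_unimodular_mult\<close>, and for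
  it \<open>rate\<close> equals the squared coefficient of \<open>r\<close>, which
  \<open>energy_ratio_le_rate\<close> bounds below.\<close>

theorem character_exists:
 obtains \<xi> where "uc \<xi>" "\<And>a b. a \<in> carrier A ==> b \<in> carrier A ==> \<xi> (a \<otimes> b) = \<xi> a * \<xi> b"
  "\<And>a. a \<in> carrier A ==> norm (\<xi> a) = 1"
  "Re (mean (%a. h a * cnj (h a))) <= (norm (mean (%a. r a * cnj (\<xi> a))))\<^sup>2 * Re (h \<one>)"
proof -
 obtain g where g: "normalised g" "\<And>c. c \<in> carrier A ==> norm (g c) = 1" "J g = rate"
  using unimodular_maximiser by blast
 note n = normalisedD[OF g(1)]
 have hom: "g (a \<otimes> b) = g a * g b" if "a \<in> carrier A" "b \<in> carrier A" for a b
  using pd_unimodular_mult[OF n(2,3) that g(2)[OF that(1)]] .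
 define m where "m = mean (%a. r a * cnj (g a))"
 have u: "uc (%a. r a * cnj (g a))" using uc_r n by (intro uc_mult uc_cnj)
 have "S g \<one> = mean (%x. mean (%y. r x * cnj (r y) * g (inv x \<otimes> y \<otimes> \<one>)))"
  by (rule smooth_autocorr_eq[OF uc_r n(1) one_closed])
 also have "\<dots> = mean (%x. cnj m * (r x * cnj (g x)))"
 proof (rule mean_cong)
  fix x assume x: "x \<in> carrier A"
  have "mean (%y. r x * cnj (r y) * g (inv x \<otimes> y \<otimes> \<one>)) = mean (%y. (r x * cnj (g x)) * cnj (r y * cnj (g y)))"
   by (rule mean_cong) (use x in \<open>simp add: hom pd_hermitian[OF n(2)]\<close>)
  also have "\<dots> = (r x * cnj (g x)) * cnj m" unfolding m_def mean_scale[OF uc_cnj[OF u]] mean_cnj[OF u] ..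
  finally show "mean (%y. r x * cnj (r y) * g (inv x \<otimes> y \<otimes> \<one>)) = cnj m * (r x * cnj (g x))" by (simp add: mult.commute)
 qed
 also have "\<dots> = cnj m * m" unfolding mean_scale[OF u] m_def ..
 also have "\<dots> = of_real ((norm m)\<^sup>2)" by (simp only: complex_norm_square mult.commute)
 finally have "rate = (norm m)\<^sup>2" using g(3) by simp
 then have "Re (mean (%a. h a * cnj (h a))) <= (norm m)\<^sup>2 * Re (h \<one>)"
  using energy_ratio_le_rate r_nonzero by (simp add: field_simps)
 then show thesis using that[OF n(1) hom g(2)] by (simp add: m_def)
qed

end

subsection \<open>Approximation by characters\<close>

context tb_group
begin

text \<open>The value \<open>0\<close> outside the carrier makes distinct characters differ inside
  it, so sets of characters carry no duplicates.\<close>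

definition char :: "('a => complex) => bool" where
 "char \<xi> \<longleftrightarrow> uc \<xi> \<and> (\<forall>a\<in>carrier A. \<forall>b\<in>carrier A. \<xi> (a \<otimes> b) = \<xi> a * \<xi> b) \<and>
   (\<forall>a\<in>carrier A. norm (\<xi> a) = 1) \<and> (\<forall>a. a \<notin> carrier A --> \<xi> a = 0)"

definition ip :: "('a => complex) => ('a => complex) => complex" where
 "ip f g = mean (%a. f a * cnj (g a))"

abbreviation energy :: "('a => complex) => real" where
 "energy f \<equiv> Re (ip f f)"

lemma charD: assumes "char \<xi>"
 shows "uc \<xi>" "a \<in> carrier A ==> b \<in> carrier A ==> \<xi> (a \<otimes> b) = \<xi> a * \<xi> b" "a \<in> carrier A ==> norm (\<xi> a) = 1"
  "a \<in> carrier A ==> \<xi> a * cnj (\<xi> a) = 1"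
 using assms unfolding char_def by (auto simp: complex_norm_square[symmetric])

lemma uc_ip: "uc f ==> uc g ==> uc (%a. f a * cnj (g a))"
 by (intro uc_mult uc_cnj)

lemma ip_diff: "uc f ==> uc g ==> uc h ==> ip (%a. f a - g a) h = ip f h - ip g h"
 unfolding ip_def left_diff_distrib by (intro mean_diff uc_ip)

lemma ip_scale: "uc f ==> uc h ==> ip (%a. c * f a) h = c * ip f h"
 unfolding ip_def mult.assoc by (intro mean_scale uc_ip)

lemma ip_cnj: "uc f ==> uc g ==> ip g f = cnj (ip f g)"
 using mean_cnj[OF uc_ip, of f g] by (simp add: ip_def mult.commute)

lemma ip_sum: "(\<And>i. i \<in> I ==> uc (f i)) ==> uc h ==> ip (%a. \<Sum>i\<in>I. c i * f i a) h = (\<Sum>i\<in>I. c i * ip (f i) h)"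
proof -
 assume u: "\<And>i. i \<in> I ==> uc (f i)" "uc h"
 have "ip (%a. \<Sum>i\<in>I. c i * f i a) h = mean (%a. \<Sum>i\<in>I. c i * (f i a * cnj (h a)))"
  by (simp add: ip_def sum_distrib_right mult.assoc)
 also have "\<dots> = (\<Sum>i\<in>I. c i * ip (f i) h)"
  using u by (simp add: mean_sum mean_scale uc_mult uc_ip ip_def cong: sum.cong)
 finally show ?thesis .
qed

lemma energy_nonneg: "uc f ==> 0 <= energy f" and ip_self: "uc f ==> ip f f = of_real (energy f)"
 using mean_nonneg[OF uc_ip, of f f] mean_real[OF uc_ip, of f f] unfolding ip_def
 by (simp_all add: complex_mult_cnj complex_eq_iff)

lemma energy_diff:
 assumes "uc f" "uc g" shows "energy (%a. f a - g a) = energy f - 2 * Re (ip f g) + energy g"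
proof -
 let ?F = "%a. f a - g a"
 have uF: "uc ?F" using assms by (rule uc_diff)
 have "ip ?F ?F = cnj (ip ?F f) - cnj (ip ?F g)"
  unfolding ip_diff[OF assms uF] ip_cnj[OF uF assms(1)] ip_cnj[OF uF assms(2)] ..
 then show ?thesis using assms ip_cnj[OF assms] by (simp add: ip_diff)
qed

text \<open>The energy of \<open>f - u * g\<close> is nonnegative for \<open>u\<close> of modulus
  \<open>s\<close> and suitable phase. In this form Cauchy-Schwarz needs no square roots, and
  \<open>s\<close> can be tuned at each use.\<close>

lemma ip_bound:
 assumes "uc f" "uc g" "s > 0" shows "2 * s * norm (ip f g) <= energy f + s\<^sup>2 * energy g"
proof -
 define u where "u = of_real s * sgn (ip f g)"
 have ug: "uc (%a. u * g a)" using assms by (intro uc_mult uc_const)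
 have "ip (%a. u * g a) (%a. u * g a) = u * cnj u * of_real (energy g)"
  unfolding ip_scale[OF assms(2) ug] ip_cnj[OF ug assms(2)] ip_scale[OF assms(2) assms(2)]
  by (subst ip_self[OF assms(2)]) simp
 then have "energy (%a. u * g a) = (norm u)\<^sup>2 * energy g"
  by (simp add: complex_norm_square[symmetric] del: of_real_power flip: of_real_mult)
 moreover have "(norm u)\<^sup>2 * energy g <= s\<^sup>2 * energy g"
  using assms energy_nonneg[OF assms(2)] by (intro mult_right_mono) (auto simp: u_def norm_mult norm_sgn)
 moreover have "Re (ip f (%a. u * g a)) = s * norm (ip f g)"
 proof -
  have "ip f (%a. u * g a) = cnj u * ip f g"
   using assms ip_cnj[of "%a. u * g a" f] ip_cnj[of g f] by (simp add: ip_scale uc_mult)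
  also have "cnj u * ip f g = of_real s * (cnj (ip f g) * ip f g / of_real (norm (ip f g)))" by (simp add: u_def sgn_eq)
  also have "cnj (ip f g) * ip f g = of_real (norm (ip f g)) * of_real (norm (ip f g))"
   using complex_norm_square[of "ip f g"] by (simp add: mult.commute power2_eq_square)
  finally show ?thesis by (cases "ip f g = 0") auto
 qed
 ultimately show ?thesis
  using energy_diff[OF assms(1), of "%a. u * g a"] energy_nonneg[of "%a. f a - u * g a"] assms by (simp add: uc_mult uc_diff)
qed

lemma norm_mean_le_mean:
 assumes "uc f" "uc g" "\<And>a. a \<in> carrier A ==> norm (f a) <= Re (g a)"
 shows "norm (mean f) <= Re (mean g)"
proof -
 define u where "u = cnj (sgn (mean f))"
 have "u * mean f = cnj (mean f) * mean f / of_real (norm (mean f))" by (simp add: u_def sgn_eq)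
 also have "cnj (mean f) * mean f = of_real (norm (mean f)) * of_real (norm (mean f))"
  using complex_norm_square[of "mean f"] by (simp add: mult.commute power2_eq_square)
 finally have "norm (mean f) = Re (u * mean f)" by (cases "mean f = 0") auto
 also have "\<dots> = Re (mean (%a. u * f a))" using assms by (simp add: mean_scale)
 also have "\<dots> <= Re (mean g)"
 proof (rule mean_mono)
  fix a assume "a \<in> carrier A"
  have "norm u <= 1" unfolding u_def by (simp add: norm_sgn)
  then have "norm (u * f a) <= norm (f a)" by (simp add: norm_mult mult_left_le_one_le)
  then show "Re (u * f a) <= Re (g a)" using assms(3)[OF \<open>a \<in> carrier A\<close>] complex_Re_le_cmod[of "u * f a"] by linarith
 qed (use assms in \<open>auto intro: uc_mult\<close>)
 finally show ?thesis .
qed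

lemma ip_translate:
 assumes "uc f" "char \<xi>" "c \<in> carrier A" shows "ip (%a. f (c \<otimes> a)) \<xi> = \<xi> c * ip f \<xi>"
proof -
 note x = charD[OF assms(2)]
 have "ip f \<xi> = mean (%a. f (c \<otimes> a) * cnj (\<xi> (c \<otimes> a)))"
  unfolding ip_def using assms x(1) by (intro mean_translate[symmetric] uc_ip)
 then have "\<xi> c * ip f \<xi> = mean (%a. \<xi> c * (f (c \<otimes> a) * cnj (\<xi> (c \<otimes> a))))"
  using assms x(1) by (simp add: mean_scale uc_ip uc_translate)
 also have "\<dots> = ip (%a. f (c \<otimes> a)) \<xi>" unfolding ip_def
 proof (rule mean_cong)
  fix a assume a: "a \<in> carrier A"
  have "\<xi> c * (f (c \<otimes> a) * cnj (\<xi> (c \<otimes> a))) = (\<xi> c * cnj (\<xi> c)) * (f (c \<otimes> a) * cnj (\<xi> a))"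
   using a assms(3) by (simp add: x(2))
  then show "\<xi> c * (f (c \<otimes> a) * cnj (\<xi> (c \<otimes> a))) = f (c \<otimes> a) * cnj (\<xi> a)" by (simp add: x(4)[OF assms(3)])
 qed
 finally show ?thesis ..
qed

lemma char_orthogonal:
 assumes "char \<xi>" "char \<eta>" shows "ip \<xi> \<eta> = of_bool (\<xi> = \<eta>)"
proof (cases "\<xi> = \<eta>")
 case True
 have "ip \<xi> \<xi> = mean (%_. 1)" unfolding ip_def by (intro mean_cong charD(4)[OF assms(1)])
 then show ?thesis using True by simp
next
 case False
 then obtain c where c: "\<xi> c ~= \<eta> c" by blast
 then have cc: "c \<in> carrier A" using assms unfolding char_def by metis
 have "\<eta> c * ip \<xi> \<eta> = ip (%a. \<xi> c * \<xi> a) \<eta>"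
  using ip_translate[OF charD(1)[OF assms(1)] assms(2) cc] charD(2)[OF assms(1) cc]
  unfolding ip_def by (metis (no_types, lifting) mean_cong)
 also have "\<dots> = \<xi> c * ip \<xi> \<eta>" by (intro ip_scale charD assms)
 finally show ?thesis using c False by simp
qed

definition proj :: "('a => complex) set => ('a => complex) => 'a => complex" where
 "proj X k a = (\<Sum>\<xi>\<in>X. ip k \<xi> * \<xi> a)"

context
 fixes X assumes X: "finite X" "\<And>\<xi>. \<xi> \<in> X ==> char \<xi>"
begin

lemma uc_proj: "uc (proj X k)"
 unfolding proj_def using X charD(1) by (intro uc_sum uc_mult uc_const) auto

lemma ip_proj:
 assumes "char \<eta>" shows "ip (proj X k) \<eta> = (if \<eta> \<in> X then ip k \<eta> else 0)"
proof -
 have "ip (proj X k) \<eta> = (\<Sum>\<xi>\<in>X. ip k \<xi> * ip \<xi> \<eta>)"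
  unfolding proj_def using X charD(1) assms by (intro ip_sum) auto
 also have "\<dots> = (\<Sum>\<xi>\<in>X. if \<xi> = \<eta> then ip k \<eta> else 0)"
  by (intro sum.cong refl) (auto simp: char_orthogonal X assms)
 finally show ?thesis using X(1) by simp
qed

lemma energy_proj:
 assumes "uc k" shows "energy (%a. k a - proj X k a) = energy k - (\<Sum>\<xi>\<in>X. (norm (ip k \<xi>))\<^sup>2)"
proof -
 have "ip (proj X k) g = (\<Sum>\<xi>\<in>X. ip k \<xi> * ip \<xi> g)" if "uc g" for g
  unfolding proj_def using X charD(1) that by (intro ip_sum) auto
 moreover have "ip \<xi> k = cnj (ip k \<xi>)" "ip \<xi> (proj X k) = cnj (ip k \<xi>)" if "\<xi> \<in> X" for \<xi>
  using ip_cnj[of k \<xi>] ip_cnj[of "proj X k" \<xi>] assms X(2)[OF that] charD(1) that by (simp_all add: uc_proj ip_proj)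
 ultimately have "ip (proj X k) k = of_real (\<Sum>\<xi>\<in>X. (norm (ip k \<xi>))\<^sup>2)" "ip (proj X k) (proj X k) = of_real (\<Sum>\<xi>\<in>X. (norm (ip k \<xi>))\<^sup>2)"
  using assms uc_proj by (simp_all only: of_real_sum complex_norm_square) (simp_all cong: sum.cong)
 then show ?thesis using energy_diff[OF assms uc_proj] ip_cnj[OF uc_proj assms, of k] by simp
qed

lemma bessel: "uc k ==> (\<Sum>\<xi>\<in>X. (norm (ip k \<xi>))\<^sup>2) <= energy k"
 using energy_proj[of k] energy_nonneg[of "%a. k a - proj X k a"] by (simp add: uc_diff uc_proj)

lemma proj_translate:
 assumes "uc k" "c \<in> carrier A" "a \<in> carrier A" shows "proj X (%a. k (c \<otimes> a)) a = proj X k (c \<otimes> a)"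
 unfolding proj_def using assms X charD(2) by (intro sum.cong refl) (simp add: ip_translate)

lemma proj_diff: "uc f ==> uc g ==> proj X (%a. f a - g a) a = proj X f a - proj X g a"
 unfolding proj_def sum_subtractf[symmetric] using X charD(1) by (intro sum.cong refl) (simp add: ip_diff left_diff_distrib)

text \<open>Projection commutes with translation, so \<open>r\<close> moves under \<open>c\<close>
  by \<open>f - proj X f\<close>, whose energy is at most that of \<open>f\<close>. What matters is
  that the bound does not depend on \<open>X\<close>.\<close>

lemma autocorr_residual:
 assumes k: "uc k" and e: "e > 0" and c: "c \<in> carrier A" and ke: "\<And>a. a \<in> carrier A ==> norm (k (c \<otimes> a) - k a) <= e"
 defines "r \<equiv> %a. k a - proj X k a"
 shows "2 * norm (autocorr r c - autocorr r \<one>) <= e * (1 + energy k)"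
proof -
 have ur: "uc r" unfolding r_def by (intro uc_diff k uc_proj)
 define f where "f = (%a. k (c \<otimes> a) - k a)"
 have uf: "uc f" unfolding f_def by (intro uc_diff uc_translate k c)
 have rf: "r (c \<otimes> a) - r a = f a - proj X f a" if "a \<in> carrier A" for a
  using that k c proj_translate[of k c a] proj_diff[of "%a. k (c \<otimes> a)" k a] uc_translate[OF k c] by (simp add: r_def f_def)
 have "autocorr r c - autocorr r \<one> = ip (%a. r (c \<otimes> a)) r - ip r r"
  unfolding autocorr_def ip_def by (simp cong: mean_cong)
 also have "\<dots> = ip (%a. r (c \<otimes> a) - r a) r" using ur c by (simp add: ip_diff uc_translate)
 also have "\<dots> = ip (%a. f a - proj X f a) r" unfolding ip_def by (rule mean_cong) (simp add: rf)
 finally have "2 * e * norm (autocorr r c - autocorr r \<one>) <= energy (%a. f a - proj X f a) + e\<^sup>2 * energy r"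
  using ip_bound[OF uc_diff[OF uf uc_proj] ur e] by simp
 also have "energy (%a. f a - proj X f a) <= energy f" unfolding energy_proj[OF uf] by (simp add: sum_nonneg)
 also have "energy f <= Re (mean (%_. of_real (e\<^sup>2)))" unfolding ip_def
 proof (rule mean_mono[OF uc_ip[OF uf uf] uc_const])
  fix a assume "a \<in> carrier A"
  then have "(norm (f a))\<^sup>2 <= e\<^sup>2" using ke e unfolding f_def by (intro power_mono) auto
  then show "Re (f a * cnj (f a)) <= Re (of_real (e\<^sup>2))" by (simp add: complex_norm_square[symmetric])
 qed
 also have "energy r <= energy k" unfolding r_def energy_proj[OF k] by (simp add: sum_nonneg)
 finally have "e * (2 * norm (autocorr r c - autocorr r \<one>)) <= e * (e * (1 + energy k))"
  using e by (simp add: power2_eq_square algebra_simps mult_left_mono)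
 then show ?thesis using e by simp
qed

end

text \<open>A tent function: in \<open>proj_dense\<close> it bounds the squared modulus of an
  autocorrelation from below, in \<open>character_expansion\<close> it is an approximate
  identity.\<close>

definition bump :: "real => 'a => complex" where
 "bump d a = of_real (max 0 (1 - D a / d))"

lemma bump:
 assumes "d > 0"
 shows "uc (bump d)" "0 < Re (mean (bump d))" "Im (mean (bump d)) = 0"
proof -
 show u: "uc (bump d)"
 proof (rule ucI)
  fix e :: real assume "e > 0"
  have "norm (bump d a - bump d b) < e" if "a \<in> carrier A" "b \<in> carrier A" "D (a \<otimes> inv b) < e * d" for a b
  proof -
   have "D a <= D (a \<otimes> inv b) + D b" using D_mult[of "a \<otimes> inv b" b] that by (simp add: m_assoc)
   moreover have "D (b \<otimes> inv a) = D (a \<otimes> inv b)" using D_inv[of "a \<otimes> inv b"] that by (simp add: inv_mult m_comm)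
   then have "D b <= D (a \<otimes> inv b) + D a" using D_mult[of "b \<otimes> inv a" a] that by (simp add: m_assoc)
   ultimately have "\<bar>D a - D b\<bar> < e * d" using that by linarith
   then have "\<bar>D a / d - D b / d\<bar> < e" using assms by (simp add: diff_divide_distrib[symmetric] divide_less_eq)
   then show ?thesis unfolding bump_def of_real_diff[symmetric] norm_of_real by linarith
  qed
  then show "\<exists>da>0. close (%a. bump d a) da e"
   using \<open>e > 0\<close> assms by (intro exI[of _ "e * d"]) auto
 qed
 show "0 < Re (mean (bump d))" by (rule mean_pos[OF u]) (auto simp: bump_def)
 show "Im (mean (bump d)) = 0" by (rule mean_real[OF u]) (auto simp: bump_def)
qed

text \<open>Let \<open>X\<close> capture almost as much of the energy of \<open>k\<close> as any
  finite set of characters can. If the residual \<open>r\<close> has energy at least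
  \<open>e\<close>, its autocorrelation has modulus at least \<open>e/2\<close> on a ball that does
  not depend on \<open>X\<close>, so \<open>character_exists\<close> provides a character with
  squared coefficient at least \<open>c / K\<close>; adding it to \<open>X\<close> beats the
  supremum.\<close>

theorem proj_dense:
 assumes k: "uc k" and e: "e > 0"
 obtains X where "finite X" "\<And>\<xi>. \<xi> \<in> X ==> char \<xi>" "energy (%a. k a - proj X k a) < e"
proof (rule ccontr)
 assume neg: "\<not> thesis"
 define K where "K = 1 + energy k"
 have K: "K > 0" unfolding K_def using energy_nonneg[OF k] by simp
 obtain d where d: "d > 0" "PROP modulus k d (e / K)"
  using ucE[OF k, of "e / K"] e K by auto
 define c where "c = (e / 2)\<^sup>2 * Re (mean (bump d))"
 have c: "c > 0" unfolding c_def using bump(2)[OF d(1)] e by simp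
 let ?s = "%X. \<Sum>\<xi>\<in>X. (norm (ip k \<xi>))\<^sup>2"
 let ?XX = "{X. finite X \<and> (\<forall>\<xi>\<in>X. char \<xi>)}"
 have bdd: "bdd_above (?s ` ?XX)" using bessel[OF _ _ k] by (intro bdd_aboveI[of _ "energy k"]) auto
 have "Sup (?s ` ?XX) - c / K < Sup (?s ` ?XX)" using c K by simp
 then obtain X where X: "finite X" "\<And>\<xi>. \<xi> \<in> X ==> char \<xi>" and near: "Sup (?s ` ?XX) - c / K < ?s X"
 proof -
  assume *: "Sup (?s ` ?XX) - c / K < Sup (?s ` ?XX)"
   and t: "\<And>X. finite X ==> (\<And>\<xi>. \<xi> \<in> X ==> char \<xi>) ==> Sup (?s ` ?XX) - c / K < ?s X ==> thesis"
  have "?XX ~= {}" by (auto intro: exI[of _ "{}"])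
  from less_cSUP_iff[OF this bdd] * show thesis using t by blast
 qed
 define r where "r = (%a. k a - proj X k a)"
 have ur: "uc r" unfolding r_def by (intro uc_diff k uc_proj X)
 have er: "e <= energy r" by (rule ccontr) (use neg that[OF X] in \<open>simp add: r_def\<close>)
 have h1: "autocorr r \<one> = ip r r" unfolding autocorr_def ip_def by (rule mean_cong) simp
 interpret autocorrelation A D r
  by unfold_locales (use ur er e h1 in auto)
 obtain \<xi> where \<xi>: "uc \<xi>" "\<And>a b. a \<in> carrier A ==> b \<in> carrier A ==> \<xi> (a \<otimes> b) = \<xi> a * \<xi> b"
  "\<And>a. a \<in> carrier A ==> norm (\<xi> a) = 1"
  and big: "Re (mean (%a. h a * cnj (h a))) <= (norm (mean (%a. r a * cnj (\<xi> a))))\<^sup>2 * Re (h \<one>)"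
  using character_exists by blast
 define \<eta> where "\<eta> = (%a. if a \<in> carrier A then \<xi> a else 0)"
 have \<eta>: "char \<eta>" unfolding char_def using \<xi> uc_cong[of \<xi> \<eta>] by (auto simp: \<eta>_def)
 have "mean (%a. r a * cnj (\<xi> a)) = ip r \<eta>" unfolding ip_def \<eta>_def by (rule mean_cong) simp
 \<comment> \<open>The residual is orthogonal to \<open>X\<close>, and a new character would raise
   the captured energy by its squared coefficient.\<close>
 moreover have P: "(norm (ip r \<eta>))\<^sup>2 < c / K"
 proof (cases "\<eta> \<in> X")
  case True
  then have "ip r \<eta> = 0" unfolding r_def using k \<eta> X by (simp add: ip_diff uc_proj charD(1) ip_proj)
  then show ?thesis using c K by simp
 next
  case False
  then have "ip r \<eta> = ip k \<eta>" unfolding r_def using k \<eta> X by (simp add: ip_diff uc_proj charD(1) ip_proj)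
  moreover have "?s (insert \<eta> X) <= Sup (?s ` ?XX)" using X \<eta> by (intro cSUP_upper bdd) auto
  ultimately show ?thesis using near False X(1) by simp
 qed
 moreover have "Re (h \<one>) <= K" unfolding h1 K_def using energy_proj[OF X k] by (simp add: r_def sum_nonneg add_increasing)
 moreover have "0 < Re (h \<one>)" by (rule r_nonzero)
 ultimately have "Re (mean (%a. h a * cnj (h a))) < c"
 proof -
  assume "mean (%a. r a * cnj (\<xi> a)) = ip r \<eta>" "Re (h \<one>) <= K"
  then have "Re (mean (%a. h a * cnj (h a))) <= (norm (ip r \<eta>))\<^sup>2 * K"
   using big mult_left_mono[of "Re (h \<one>)" K "(norm (ip r \<eta>))\<^sup>2"] by simp
  also have "\<dots> < c" using P K by (simp add: pos_less_divide_eq)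
  finally show ?thesis .
 qed
 moreover have "Re (mean (%a. of_real ((e / 2)\<^sup>2) * bump d a)) <= Re (mean (%a. h a * cnj (h a)))"
 proof (rule mean_mono)
  fix a assume a: "a \<in> carrier A"
  show "Re (of_real ((e / 2)\<^sup>2) * bump d a) <= Re (h a * cnj (h a))"
  proof (cases "D a < d")
   case True
   have "norm (k (a \<otimes> x) - k x) <= e / K" if "x \<in> carrier A" for x
    using d(2)[of "a \<otimes> x" x] a that True by (simp add: m_assoc)
   then have "2 * norm (h a - h \<one>) <= e / K * (1 + energy k)"
    unfolding r_def using a e K by (intro autocorr_residual X k) auto
   then have "norm (h a - h \<one>) <= e / 2" using K by (simp add: K_def)
   moreover have "e <= norm (h \<one>)" using er h1 complex_Re_le_cmod[of "h \<one>"] by simp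
   ultimately have "e / 2 <= norm (h a)" using norm_triangle_ineq2[of "h \<one>" "h a"] by (simp add: norm_minus_commute)
   then have "(e / 2)\<^sup>2 <= (norm (h a))\<^sup>2" using e by (intro power_mono) auto
   moreover have "Re (of_real ((e / 2)\<^sup>2) * bump d a) <= (e / 2)\<^sup>2 * 1"
    unfolding bump_def of_real_mult[symmetric] Re_complex_of_real using D_nonneg[OF a] d(1) by (intro mult_left_mono) auto
   ultimately show ?thesis by (simp add: complex_norm_square[symmetric])
  next
   case False
   then show ?thesis using d(1) by (simp add: bump_def complex_norm_square[symmetric])
  qed
 qed (auto intro!: uc_mult uc_cnj bump d uc_h)
 moreover have "Re (mean (%a. of_real ((e / 2)\<^sup>2) * bump d a)) = c"
  unfolding c_def mean_scale[OF bump(1)[OF d(1)]] by simp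
 ultimately show False by simp
qed

text \<open>\<open>k\<close> is a nonnegative kernel of mean \<open>1\<close> that vanishes unless
  \<open>D a < e/2\<close>; there \<open>\<Phi> w\<close> differs from its value at
  \<open>\<one>\<close> by less than \<open>e/2\<close>. Replacing \<open>k\<close> by a finite
  combination of characters gives coefficients that do not depend on \<open>w\<close>.\<close>

theorem character_expansion:
 assumes uc: "\<And>w. w \<in> W ==> uc (\<Phi> w)"
  and B: "\<And>w a. w \<in> W ==> a \<in> carrier A ==> norm (\<Phi> w a) <= B"
  and lip: "\<And>w a. w \<in> W ==> a \<in> carrier A ==> norm (\<Phi> w a - \<Phi> w \<one>) <= D a"
  and e: "e > 0"
 obtains X z where "finite X" "\<And>\<xi>. \<xi> \<in> X ==> char \<xi>"
  "\<And>w. w \<in> W ==> norm (\<Phi> w \<one> - (\<Sum>\<xi>\<in>X. z \<xi> * mean (%a. \<xi> a * \<Phi> w a))) <= e"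
proof -
 define m where "m = Re (mean (bump (e/2)))"
 have m: "m > 0" "mean (bump (e/2)) = of_real m" using bump[of "e/2"] e by (auto simp: m_def complex_eq_iff)
 define k where "k = (%a. of_real (inverse m) * bump (e/2) a)"
 have uk: "uc k" unfolding k_def using bump(1)[of "e/2"] e by (intro uc_mult uc_const) auto
 have mk: "mean k = 1" unfolding k_def using mean_scale[OF bump(1), of "e/2" "of_real (inverse m)"] e m by simp
 \<comment> \<open>With this \<open>s\<close> both terms on the right of \<open>ip_bound\<close> are
   at most \<open>s * e / 2\<close>.\<close>
 define s where "s = e / (2 * (1 + B\<^sup>2))"
 have s: "s > 0" unfolding s_def using e by (simp add: add_pos_nonneg)
 obtain X where X: "finite X" "\<And>\<xi>. \<xi> \<in> X ==> char \<xi>" and close: "energy (%a. k a - proj X k a) < s * e / 2"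
  using proj_dense[OF uk, of "s * e / 2"] s e by auto
 show thesis
 proof (rule that[OF X])
  fix w assume w: "w \<in> W"
  note u = uc[OF w]
  have 1: "norm (\<Phi> w \<one> - mean (%a. k a * \<Phi> w a)) <= e / 2"
  proof -
   have "\<Phi> w \<one> - mean (%a. k a * \<Phi> w a) = mean (%a. \<Phi> w \<one> * k a) - mean (%a. k a * \<Phi> w a)"
    unfolding mean_scale[OF uk] mk by simp
   also have "\<dots> = mean (%a. \<Phi> w \<one> * k a - k a * \<Phi> w a)" using uk u by (simp add: mean_diff uc_mult)
   also have "norm \<dots> <= Re (mean (%a. of_real (e/2) * k a))"
   proof (rule norm_mean_le_mean)
    fix a assume a: "a \<in> carrier A"
    have "\<Phi> w \<one> * k a - k a * \<Phi> w a = k a * (\<Phi> w \<one> - \<Phi> w a)" by (simp add: algebra_simps)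
    moreover have "norm (k a) = Re (k a)" unfolding k_def bump_def of_real_mult[symmetric] norm_of_real Re_complex_of_real using m by simp
    moreover have "norm (k a) * norm (\<Phi> w \<one> - \<Phi> w a) <= norm (k a) * (e/2)"
    proof (cases "D a < e/2")
     case True
     then show ?thesis using lip[OF w a] by (intro mult_left_mono) (auto simp: norm_minus_commute)
    next
     case False
     then have "k a = 0" using e by (simp add: k_def bump_def)
     then show ?thesis by simp
    qed
    ultimately show "norm (\<Phi> w \<one> * k a - k a * \<Phi> w a) <= Re (of_real (e/2) * k a)" by (simp add: norm_mult mult.commute)
   qed (intro uc_diff uc_mult uc_const uk u)+
   finally show ?thesis unfolding mean_scale[OF uk] mk by simp
  qed
  have 2: "norm (mean (%a. (k a - proj X k a) * \<Phi> w a)) <= e / 2"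
  proof -
   have uk': "uc (%a. k a - proj X k a)" by (intro uc_diff uk uc_proj X)
   have "energy (%a. cnj (\<Phi> w a)) <= Re (mean (%_. of_real (B\<^sup>2)))" unfolding ip_def
   proof (rule mean_mono[OF uc_ip uc_const])
    fix a assume "a \<in> carrier A"
    then have "(norm (\<Phi> w a))\<^sup>2 <= B\<^sup>2" using B[OF w] by (intro power_mono) auto
    then show "Re (cnj (\<Phi> w a) * cnj (cnj (\<Phi> w a))) <= Re (of_real (B\<^sup>2))"
     by (simp add: complex_norm_square[symmetric] mult.commute)
   qed (use u in \<open>auto intro: uc_cnj\<close>)
   then have "s\<^sup>2 * energy (%a. cnj (\<Phi> w a)) <= s\<^sup>2 * (1 + B\<^sup>2)" by (intro mult_left_mono) auto
   also have "\<dots> = s * (e / 2)"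
   proof -
    have "1 + B\<^sup>2 ~= 0" using zero_le_power2[of B] by linarith
    then have "s * (1 + B\<^sup>2) = e / 2" unfolding s_def times_divide_eq_left by (rule mult_divide_mult_cancel_right)
    then show ?thesis by (simp add: power2_eq_square mult.assoc)
   qed
   finally have "2 * s * norm (ip (%a. k a - proj X k a) (%a. cnj (\<Phi> w a))) <= s * e / 2 + s * (e / 2)"
    using ip_bound[OF uk' uc_cnj[OF u] s] close by linarith
   then have "s * (2 * norm (ip (%a. k a - proj X k a) (%a. cnj (\<Phi> w a)))) <= s * e" by (simp add: algebra_simps)
   then show ?thesis using s by (simp add: ip_def)
  qed
  have "mean (%a. k a * \<Phi> w a) - mean (%a. (k a - proj X k a) * \<Phi> w a) = mean (%a. k a * \<Phi> w a - (k a - proj X k a) * \<Phi> w a)"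
   using uk u uc_proj[OF X] by (simp add: mean_diff uc_mult uc_diff)
  also have "\<dots> = mean (%a. \<Sum>\<xi>\<in>X. ip k \<xi> * (\<xi> a * \<Phi> w a))"
   by (rule mean_cong) (simp add: proj_def algebra_simps sum_distrib_left)
  also have "\<dots> = (\<Sum>\<xi>\<in>X. ip k \<xi> * mean (%a. \<xi> a * \<Phi> w a))"
   using u X charD(1) by (simp add: mean_sum mean_scale uc_mult)
  finally have eq: "\<Phi> w \<one> - (\<Sum>\<xi>\<in>X. ip k \<xi> * mean (%a. \<xi> a * \<Phi> w a)) =
   (\<Phi> w \<one> - mean (%a. k a * \<Phi> w a)) + mean (%a. (k a - proj X k a) * \<Phi> w a)" by (simp add: algebra_simps)
  show "norm (\<Phi> w \<one> - (\<Sum>\<xi>\<in>X. ip k \<xi> * mean (%a. \<xi> a * \<Phi> w a))) <= e"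
   unfolding eq using norm_triangle_ineq[of "\<Phi> w \<one> - mean (%a. k a * \<Phi> w a)" "mean (%a. (k a - proj X k a) * \<Phi> w a)"] 1 2 by simp
 qed
qed

end

subsection \<open>Characters on the lower central series\<close>

lemma unit_near_one_root:
 assumes "m > 0"
 obtains e where "e > 0" "\<And>z::complex. z ^ m = 1 ==> norm (z - 1) < e ==> z = 1"
proof -
 let ?R = "{z::complex. z ^ m = 1} - {1}"
 have fin: "finite ?R" using finite_roots_unity[of m, where ?'a = complex] assms by simp
 show thesis
 proof (cases "?R = {}")
  case True
  then show thesis using that[of 1] by auto
 next
  case False
  let ?e = "Min ((%z. norm (z - 1)) ` ?R)"
  have "?e > 0" using fin False by (subst Min_gr_iff) auto
  moreover have "z = 1" if "z ^ m = 1" "norm (z - 1) < ?e" for z :: complex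
  proof (rule ccontr)
   assume "z ~= 1"
   then have "?e <= norm (z - 1)" using that(1) fin by (intro Min_le) auto
   then show False using that(2) by simp
  qed
  ultimately show thesis using that by blast
 qed
qed

text \<open>While \<open>w\<close> is within distance \<open>1\<close> of \<open>1\<close>,
  \<open>norm (w + 1) >= 3/2\<close>, so squaring increases the distance from \<open>1\<close> at
  least by that factor: the circle has no small subgroups.\<close>

lemma unit_powers_near_one:
 fixes z :: complex
 assumes "norm z = 1" "\<And>n::nat. norm (z ^ n - 1) < 1" shows "z = 1"
proof (rule ccontr)
 assume "z ~= 1"
 define s where "s = norm (z - 1)"
 have s: "s > 0" using \<open>z ~= 1\<close> by (simp add: s_def)
 have re: "Re w > 1/2" if "norm (w - 1) < 1" "norm w = 1" for w :: complex
 proof -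
  have "(Re w)\<^sup>2 + (Im w)\<^sup>2 = 1" using that(2) cmod_power2[of w] by simp
  then have "(norm (w - 1))\<^sup>2 = 2 - 2 * Re w" unfolding cmod_power2 by (simp add: power2_diff)
  moreover have "(norm (w - 1))\<^sup>2 < 1" using that(1) by (simp add: power_less_one_iff abs_square_less_1)
  ultimately show ?thesis by simp
 qed
 have grow: "(3/2) ^ n * s <= norm (z ^ (2 ^ n) - 1)" for n
 proof (induction n)
  case (Suc n)
  let ?w = "z ^ (2 ^ n)"
  have "norm ?w = 1" using assms(1) by (simp add: norm_power)
  then have "Re ?w > 1/2" using assms(2) by (intro re)
  then have "norm (?w + 1) >= 3/2" using complex_Re_le_cmod[of "?w + 1"] by simp
  moreover have "z ^ (2 ^ Suc n) = ?w * ?w" by (simp add: mult_2 power_add)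
  then have "z ^ (2 ^ Suc n) - 1 = (?w - 1) * (?w + 1)" by (simp add: algebra_simps)
  ultimately have "((3/2) ^ n * s) * (3/2) <= norm (z ^ (2 ^ Suc n) - 1)"
   using mult_mono[OF Suc.IH, of "3/2" "norm (?w + 1)"] by (simp add: norm_mult)
  then show ?case by simp
 qed (simp add: s_def)
 obtain n where "(3/2::real) ^ n > 1 / s" using real_arch_pow[of "3/2" "1/s"] by auto
 then have "(3/2) ^ n * s > 1" using s by (simp add: divide_less_eq)
 then show False using assms(2)[of "2 ^ n"] grow[of n] by linarith
qed

declare lower_central_series.simps(2) [simp del]

section \<open>Commutators and characters on the terms of the lower central series\<close>

text \<open>A base of neighbourhoods of the identity is all that is kept of the topology; the axioms
  pass to subgroups and to the square of the group.\<close>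

locale uniform_group = group G for G (structure) +
 fixes B :: "real => 'a set"
 assumes B_carrier: "B d \<subseteq> carrier G"
  and B_one: "d > 0 ==> \<one> \<in> B d"
  and B_mono: "d <= e ==> B d \<subseteq> B e"
  and B_inv: "d > 0 ==> \<exists>e>0. \<forall>u\<in>B e. inv u \<in> B d"
  and B_mult: "d > 0 ==> \<exists>e>0. \<forall>u\<in>B e. \<forall>v\<in>B e. u \<otimes> v \<in> B d"
  and B_conj: "d > 0 ==> g \<in> carrier G ==> \<exists>e>0. \<forall>u\<in>B e. g \<otimes> u \<otimes> inv g \<in> B d"
begin

abbreviation "L \<equiv> lower_central_series G"

definition comm :: "'a => 'a => 'a" where
 "comm g h = g \<otimes> h \<otimes> inv g \<otimes> inv h"

lemma comm_closed [simp]: "g \<in> carrier G ==> h \<in> carrier G ==> comm g h \<in> carrier G"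
 by (simp add: comm_def)

lemma B_in: "u \<in> B d ==> u \<in> carrier G"
 using B_carrier by blast

lemma L_Suc: "L (Suc k) = generate G (\<Union>g\<in>carrier G. \<Union>h\<in>L k. {comm g h})"
 by (simp add: comm_def lower_central_series.simps(2))

lemma L_facts: "subgroup (L k) G \<and> (\<forall>g\<in>carrier G. \<forall>x\<in>L k. g \<otimes> x \<otimes> inv g \<in> L k)"
proof (induction k)
 case 0
 then show ?case by (auto intro: subgroup_self)
next
 case (Suc k)
 interpret Lk: subgroup "L k" G using Suc by blast
 have c: "comm g h \<in> L k" if "g \<in> carrier G" "h \<in> L k" for g h
 proof -
  have "g \<otimes> h \<otimes> inv g \<in> L k" using Suc that by blast
  then show ?thesis unfolding comm_def using that by simp
 qed
 have sub: "L (Suc k) \<subseteq> L k"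
  unfolding L_Suc using c by (intro generate_subgroup_incl Lk.subgroup_axioms) auto
 have S: "subgroup (L (Suc k)) G"
  unfolding L_Suc using c Lk.subset by (intro generate_is_subgroup) auto
 moreover have "g \<otimes> x \<otimes> inv g \<in> L (Suc k)" if g: "g \<in> carrier G" and x: "x \<in> L (Suc k)" for g x
 proof -
  have xx: "x \<in> carrier G" "x \<in> L k" using x sub Lk.subset by auto
  have "comm g x \<in> L (Suc k)" unfolding L_Suc using g xx by (intro generate.incl) auto
  moreover have "g \<otimes> x \<otimes> inv g = comm g x \<otimes> x" unfolding comm_def using g xx by (simp add: m_assoc)
  ultimately show ?thesis using x subgroup.m_closed[OF S] by simp
 qed
 ultimately show ?case by blast
qed

lemma L_subgroup: "subgroup (L k) G" and L_conj: "g \<in> carrier G ==> x \<in> L k ==> g \<otimes> x \<otimes> inv g \<in> L k"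
 using L_facts by blast+

lemma L_carrier: "x \<in> L k ==> x \<in> carrier G" and L_mult: "x \<in> L k ==> y \<in> L k ==> x \<otimes> y \<in> L k"
 and L_one: "\<one> \<in> L k" and L_inv: "x \<in> L k ==> inv x \<in> L k"
 using subgroup.mem_carrier[OF L_subgroup] subgroup.m_closed[OF L_subgroup] subgroup.one_closed[OF L_subgroup]
  subgroup.m_inv_closed[OF L_subgroup] by blast+

lemma L_comm: "g \<in> carrier G ==> h \<in> L k ==> comm g h \<in> L (Suc k)"
 unfolding L_Suc by (intro generate.incl) auto

lemma L_antimono: "x \<in> L (Suc k) ==> x \<in> L k"
proof -
 have "comm g h \<in> L k" if "g \<in> carrier G" "h \<in> L k" for g h
  unfolding comm_def using that by (intro L_mult[OF L_conj L_inv])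
 then have "L (Suc k) \<subseteq> L k" unfolding L_Suc by (intro generate_subgroup_incl L_subgroup) auto
 then show "x \<in> L (Suc k) ==> x \<in> L k" by blast
qed

text \<open>When \<open>h\<close> is in a term of the series, the double commutator lies one term
  below the others, where a character of their level is trivial; so such a character makes
  \<open>comm\<close> multiplicative in this argument.\<close>

lemma comm_mult_left:
 assumes "g \<in> carrier G" "g' \<in> carrier G" "h \<in> carrier G"
 shows "comm (g \<otimes> g') h = comm g (comm g' h) \<otimes> comm g' h \<otimes> comm g h"
proof -
 have "comm (g \<otimes> g') h = g \<otimes> comm g' h \<otimes> inv g \<otimes> comm g h"
  unfolding comm_def using assms by (simp add: inv_mult_group m_assoc) (simp add: m_assoc[symmetric])
 also have "g \<otimes> comm g' h \<otimes> inv g = comm g (comm g' h) \<otimes> comm g' h"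
  unfolding comm_def[of g "comm g' h"] using assms by (simp add: m_assoc)
 finally show ?thesis .
qed

lemma comm_mult_right:
 assumes "g \<in> carrier G" "h \<in> carrier G" "h' \<in> carrier G"
 shows "comm g (h \<otimes> h') = comm g h \<otimes> comm h (comm g h') \<otimes> comm g h'"
proof -
 have "comm g (h \<otimes> h') = comm g h \<otimes> (h \<otimes> comm g h' \<otimes> inv h)"
  unfolding comm_def using assms by (simp add: inv_mult_group m_assoc) (simp add: m_assoc[symmetric])
 also have "h \<otimes> comm g h' \<otimes> inv h = comm h (comm g h') \<otimes> comm g h'"
  unfolding comm_def[of h "comm g h'"] using assms by (simp add: m_assoc)
 finally show ?thesis using assms by (simp add: m_assoc)
qed

text \<open>Unitary characters of the quotient \<open>L j / L (Suc j)\<close>; continuity is kept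
  apart, in \<open>cont_at_one\<close>.\<close>

definition level_char :: "nat => ('a => complex) => bool" where
 "level_char j \<rho> \<longleftrightarrow> (\<forall>x\<in>L j. \<forall>y\<in>L j. \<rho> (x \<otimes> y) = \<rho> x * \<rho> y) \<and> (\<forall>x\<in>L j. norm (\<rho> x) = 1) \<and> (\<forall>x\<in>L (Suc j). \<rho> x = 1)"

definition cont_at_one :: "nat => ('a => complex) => bool" where
 "cont_at_one j \<rho> \<longleftrightarrow> (\<forall>e>0. \<exists>d>0. \<forall>x\<in>L j \<inter> B d. norm (\<rho> x - 1) < e)"

definition trivial_near_one :: "nat => ('a => complex) => bool" where
 "trivial_near_one j \<rho> \<longleftrightarrow> (\<exists>d>0. \<forall>x\<in>L j \<inter> B d. \<rho> x = 1)"

lemma level_charD: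
 assumes "level_char j \<rho>"
 shows "x \<in> L j ==> y \<in> L j ==> \<rho> (x \<otimes> y) = \<rho> x * \<rho> y" "x \<in> L j ==> norm (\<rho> x) = 1" "x \<in> L (Suc j) ==> \<rho> x = 1"
 using assms unfolding level_char_def by auto

lemma level_char_one: "level_char j \<rho> ==> \<rho> \<one> = 1"
 using level_charD(3) L_one by blast

lemma level_char_inv: "level_char j \<rho> ==> x \<in> L j ==> \<rho> x = 1 ==> \<rho> (inv x) = 1"
 using level_charD(1)[of j \<rho> x "inv x"] L_inv level_char_one[of j \<rho>] L_carrier[of x j] by simp

lemma level_char_kernel:
 assumes "level_char j \<rho>" shows "subgroup {x\<in>L j. \<rho> x = 1} G"
 using assms by (intro subgroup.intro) (auto simp: L_carrier L_mult L_inv L_one level_charD level_char_one level_char_inv)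

lemma level_char_generate:
 assumes "level_char j \<rho>" "S \<subseteq> L j" "\<And>x. x \<in> S ==> \<rho> x = 1" "x \<in> generate G S" shows "\<rho> x = 1"
 using generate_subgroup_incl[OF _ level_char_kernel[OF assms(1)], of S] assms by blast

lemma level_char_Suc_trivial:
 assumes "level_char (Suc j) \<rho>" "\<And>g h. g \<in> carrier G ==> h \<in> L j ==> \<rho> (comm g h) = 1" "x \<in> L (Suc j)"
 shows "\<rho> x = 1"
 by (rule level_char_generate[OF assms(1) _ _ assms(3)[unfolded L_Suc]]) (use L_comm assms(2) in auto)

lemma level_char_0I:
 assumes "\<And>x y. x \<in> carrier G ==> y \<in> carrier G ==> \<rho> (x \<otimes> y) = \<rho> x * \<rho> y" "\<And>x. x \<in> carrier G ==> norm (\<rho> x) = 1"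
 shows "level_char 0 \<rho>"
proof -
 have nz: "\<rho> x ~= 0" if "x \<in> carrier G" for x using assms(2)[OF that] by auto
 have one: "\<rho> \<one> = 1" using assms(1)[of \<one> \<one>] nz[of \<one>] by simp
 have i: "\<rho> x * \<rho> (inv x) = 1" if "x \<in> carrier G" for x using assms(1)[of x "inv x"] that one by simp
 have c: "\<rho> (comm g h) = 1" if "g \<in> carrier G" "h \<in> carrier G" for g h
 proof -
  have "\<rho> (comm g h) = (\<rho> g * \<rho> (inv g)) * (\<rho> h * \<rho> (inv h))" using that by (simp add: comm_def assms(1))
  then show ?thesis using i that by simp
 qed
 have "subgroup {x\<in>carrier G. \<rho> x = 1} G"
 proof (rule subgroup.intro)
  fix x assume "x \<in> {x\<in>carrier G. \<rho> x = 1}"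
  then show "inv x \<in> {x\<in>carrier G. \<rho> x = 1}" using i[of x] by simp
 qed (auto simp: one assms(1))
 then have "L (Suc 0) \<subseteq> {x\<in>carrier G. \<rho> x = 1}"
  unfolding L_Suc using c by (intro generate_subgroup_incl) auto
 then show ?thesis using assms unfolding level_char_def by auto
qed

lemma level_char_comm_right:
 assumes "level_char (Suc j) \<rho>" "g \<in> carrier G" shows "level_char j (%h. \<rho> (comm g h))"
 unfolding level_char_def
proof (intro conjI ballI)
 fix x y assume xy: "x \<in> L j" "y \<in> L j"
 have c: "comm g x \<in> L (Suc j)" "comm g y \<in> L (Suc j)" "comm x (comm g y) \<in> L (Suc (Suc j))"
  using xy assms(2) by (auto intro!: L_comm L_carrier)
 show "\<rho> (comm g (x \<otimes> y)) = \<rho> (comm g x) * \<rho> (comm g y)"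
  unfolding comm_mult_right[OF assms(2) L_carrier[OF xy(1)] L_carrier[OF xy(2)]]
  using c L_antimono[OF c(3)] by (simp add: level_charD(1,3)[OF assms(1)] L_mult)
qed (use assms in \<open>auto intro!: level_charD[OF assms(1)] L_comm\<close>)

lemma level_char_comm_left:
 assumes "level_char (Suc j) \<rho>" "h \<in> L j" shows "level_char 0 (%g. \<rho> (comm g h))"
proof (rule level_char_0I)
 fix x y assume xy: "x \<in> carrier G" "y \<in> carrier G"
 have c: "comm x h \<in> L (Suc j)" "comm y h \<in> L (Suc j)" "comm x (comm y h) \<in> L (Suc (Suc j))"
  using xy assms(2) by (auto intro!: L_comm)
 show "\<rho> (comm (x \<otimes> y) h) = \<rho> (comm x h) * \<rho> (comm y h)"
  unfolding comm_mult_left[OF xy L_carrier[OF assms(2)]]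
  using c L_antimono[OF c(3)] by (simp add: level_charD(1,3)[OF assms(1)] L_mult)
qed (use assms L_comm level_charD(2) in blast)

lemma B_both: "e1 > 0 ==> e2 > 0 ==> \<exists>e>0. B e \<subseteq> B e1 \<and> B e \<subseteq> B e2"
 using B_mono[of "min e1 e2" e1] B_mono[of "min e1 e2" e2] by (intro exI[of _ "min e1 e2"]) simp

lemma small_mult_inv:
 assumes "d > 0" shows "\<exists>e>0. \<forall>u\<in>B e. \<forall>v\<in>B e. u \<otimes> v \<in> B d \<and> u \<otimes> inv v \<in> B d"
proof -
 obtain e1 where e1: "e1 > 0" "\<forall>u\<in>B e1. \<forall>v\<in>B e1. u \<otimes> v \<in> B d" using B_mult[OF assms] by blast
 obtain e2 where e2: "e2 > 0" "\<forall>u\<in>B e2. inv u \<in> B e1" using B_inv[OF e1(1)] by blast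
 obtain e where "e > 0" "B e \<subseteq> B e1" "B e \<subseteq> B e2" using B_both[OF e1(1) e2(1)] by blast
 then show ?thesis using e1(2) e2(2) by (intro exI[of _ e]) (simp add: subset_iff)
qed

lemma comm_small_right:
 assumes "d > 0" "g \<in> carrier G" shows "\<exists>e>0. \<forall>u\<in>B e. comm g u \<in> B d"
proof -
 obtain e1 where e1: "e1 > 0" "\<forall>u\<in>B e1. \<forall>v\<in>B e1. u \<otimes> v \<in> B d \<and> u \<otimes> inv v \<in> B d"
  using small_mult_inv[OF assms(1)] by blast
 obtain e2 where e2: "e2 > 0" "\<forall>u\<in>B e2. g \<otimes> u \<otimes> inv g \<in> B e1" using B_conj[OF e1(1) assms(2)] by blast
 obtain e where "e > 0" "B e \<subseteq> B e1" "B e \<subseteq> B e2" using B_both[OF e1(1) e2(1)] by blast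
 then show ?thesis using e1(2) e2(2) by (intro exI[of _ e]) (simp add: subset_iff comm_def)
qed

lemma comm_small_left:
 assumes "d > 0" "h \<in> carrier G" shows "\<exists>e>0. \<forall>u\<in>B e. comm u h \<in> B d"
proof -
 obtain e1 where e1: "e1 > 0" "\<forall>u\<in>B e1. \<forall>v\<in>B e1. u \<otimes> v \<in> B d \<and> u \<otimes> inv v \<in> B d"
  using small_mult_inv[OF assms(1)] by blast
 obtain e2 where e2: "e2 > 0" "\<forall>u\<in>B e2. h \<otimes> u \<otimes> inv h \<in> B e1" using B_conj[OF e1(1) assms(2)] by blast
 have c: "comm u h = u \<otimes> inv (h \<otimes> u \<otimes> inv h)" if "u \<in> carrier G" for u
  using that assms(2) by (simp add: comm_def inv_mult_group m_assoc)
 obtain e where "e > 0" "B e \<subseteq> B e1" "B e \<subseteq> B e2" using B_both[OF e1(1) e2(1)] by blast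
 then show ?thesis using e1(2) e2(2) c[OF B_in] by (intro exI[of _ e]) (simp add: subset_iff)
qed

lemma comm_small_both:
 assumes "d > 0" shows "\<exists>e>0. \<forall>u\<in>B e. \<forall>v\<in>B e. comm u v \<in> B d"
proof -
 obtain e1 where e1: "e1 > 0" "\<forall>u\<in>B e1. \<forall>v\<in>B e1. u \<otimes> v \<in> B d \<and> u \<otimes> inv v \<in> B d"
  using small_mult_inv[OF assms(1)] by blast
 obtain e2 where e2: "e2 > 0" "\<forall>u\<in>B e2. \<forall>v\<in>B e2. u \<otimes> v \<in> B e1 \<and> u \<otimes> inv v \<in> B e1"
  using small_mult_inv[OF e1(1)] by blast
 have c: "comm u v = (u \<otimes> v) \<otimes> inv (v \<otimes> u)" if "u \<in> carrier G" "v \<in> carrier G" for u v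
  using that by (simp add: comm_def inv_mult_group m_assoc)
 then show ?thesis using e1(2) e2 c[OF B_in B_in] by (intro exI[of _ e2]) simp
qed

lemma cont_at_oneD: "cont_at_one j \<rho> ==> e > 0 ==> \<exists>d>0. \<forall>x\<in>L j \<inter> B d. norm (\<rho> x - 1) < e"
 unfolding cont_at_one_def by blast

lemma cont_at_one_comm_right:
 assumes "cont_at_one (Suc j) \<rho>" "g \<in> carrier G" shows "cont_at_one j (%h. \<rho> (comm g h))"
 unfolding cont_at_one_def
proof (intro allI impI)
 fix e :: real assume "e > 0"
 then obtain d where d: "d > 0" "\<forall>x\<in>L (Suc j) \<inter> B d. norm (\<rho> x - 1) < e" using assms(1) unfolding cont_at_one_def by blast
 obtain d' where "d' > 0" "\<forall>u\<in>B d'. comm g u \<in> B d" using comm_small_right[OF d(1) assms(2)] by blast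
 then show "\<exists>d>0. \<forall>x\<in>L j \<inter> B d. norm (\<rho> (comm g x) - 1) < e" using d L_comm[OF assms(2)] by blast
qed

lemma trivial_near_one_comm_right:
 assumes "trivial_near_one (Suc j) \<rho>" "g \<in> carrier G" shows "trivial_near_one j (%h. \<rho> (comm g h))"
proof -
 obtain d where d: "d > 0" "\<forall>x\<in>L (Suc j) \<inter> B d. \<rho> x = 1" using assms(1) unfolding trivial_near_one_def by blast
 obtain d' where "d' > 0" "\<forall>u\<in>B d'. comm g u \<in> B d" using comm_small_right[OF d(1) assms(2)] by blast
 then show ?thesis unfolding trivial_near_one_def using d L_comm[OF assms(2)] by blast
qed

lemma trivial_near_one_comm_left:
 assumes "trivial_near_one (Suc j) \<rho>" "h \<in> L j" shows "trivial_near_one 0 (%g. \<rho> (comm g h))"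
proof -
 obtain d where d: "d > 0" "\<forall>x\<in>L (Suc j) \<inter> B d. \<rho> x = 1" using assms(1) unfolding trivial_near_one_def by blast
 obtain d' where "d' > 0" "\<forall>u\<in>B d'. comm u h \<in> B d" using comm_small_left[OF d(1) L_carrier[OF assms(2)]] by blast
 then show ?thesis unfolding trivial_near_one_def using d L_comm[OF _ assms(2)] B_in by blast
qed

text \<open>Right-normed iterated commutators. Lists of length \<open>Suc j\<close> give elements of
  \<open>L j\<close>, and by \<open>nest_trivial\<close> a character of level \<open>j\<close> is
  trivial once it is trivial on these.\<close>

fun nest :: "'a list => 'a" where
 "nest [] = \<one>"
| "nest [x] = x"
| "nest (x # y # zs) = comm x (nest (y # zs))"

lemma nest_Cons: "zs ~= [] ==> nest (x # zs) = comm x (nest zs)"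
 by (cases zs) auto

lemma nest_in_L: "set gs \<subseteq> carrier G ==> length gs = Suc j ==> nest gs \<in> L j"
proof (induction gs arbitrary: j rule: nest.induct)
 case (3 x y zs)
 then obtain i where j: "j = Suc i" by (cases j) auto
 have "nest (y # zs) \<in> L i" using 3 j by auto
 then show ?case using 3(2) unfolding j nest.simps by (intro L_comm) auto
qed auto

text \<open>Iterated commutators are multilinear modulo the next term of the series, so each single
  entry gives a character of the whole group.\<close>

lemma nest_level_char:
 assumes "level_char j \<rho>" "set pre \<subseteq> carrier G" "set suf \<subseteq> carrier G" "length pre + length suf = j"
 shows "level_char 0 (%y. \<rho> (nest (pre @ y # suf)))"
 using assms
proof (induction pre arbitrary: j \<rho>)
 case Nil
 show ?case
 proof (cases "suf = []")
  case True
  then show ?thesis using Nil by simp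
 next
  case False
  then obtain i where j: "j = Suc i" "length suf = Suc i" using Nil by (cases j) auto
  have "level_char 0 (%g. \<rho> (comm g (nest suf)))" using Nil j by (intro level_char_comm_left[of i] nest_in_L) auto
  then show ?thesis using False by (simp add: nest_Cons)
 qed
next
 case (Cons p pre)
 then obtain i where j: "j = Suc i" by (cases j) auto
 have "level_char i (%h. \<rho> (comm p h))" using Cons.prems unfolding j by (intro level_char_comm_right) auto
 from Cons.IH[OF this] Cons.prems j show ?case by (simp add: nest_Cons)
qed

lemma nest_small:
 assumes "set pre \<subseteq> carrier G" "set suf \<subseteq> carrier G" "d > 0"
 shows "\<exists>e>0. \<forall>u\<in>B e. nest (pre @ u # suf) \<in> B d"
 using assms
proof (induction pre arbitrary: d)
 case Nil
 show ?case
 proof (cases "suf = []")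
  case False
  have "nest suf \<in> carrier G" using Nil(2) nest_in_L[of suf "length suf - 1"] L_carrier False by auto
  from comm_small_left[OF Nil(3) this] show ?thesis using False by (simp add: nest_Cons)
 qed (use Nil in auto)
next
 case (Cons p pre)
 then obtain e where e: "e > 0" "\<forall>u\<in>B e. comm p u \<in> B d" using comm_small_right[OF Cons.prems(3), of p] by auto
 obtain e' where "e' > 0" "\<forall>u\<in>B e'. nest (pre @ u # suf) \<in> B e" using Cons.IH[OF _ _ e(1)] Cons.prems by auto
 then show ?case using e by (intro exI[of _ e']) (simp add: nest_Cons)
qed

lemma nest_trivial:
 assumes "level_char j \<rho>" "\<And>gs. set gs \<subseteq> carrier G ==> length gs = Suc j ==> \<rho> (nest gs) = 1" "x \<in> L j"
 shows "\<rho> x = 1"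
 using assms
proof (induction j arbitrary: \<rho> x)
 case 0
 then show ?case using 0(2)[of "[x]"] by simp
next
 case (Suc j)
 show ?case
 proof (rule level_char_Suc_trivial[OF Suc.prems(1) _ Suc.prems(3)])
  fix g h assume g: "g \<in> carrier G" and h: "h \<in> L j"
  have "\<rho> (comm g (nest gs)) = 1" if "set gs \<subseteq> carrier G" "length gs = Suc j" for gs
   using Suc.prems(2)[of "g # gs"] that g by (cases gs) auto
  then show "\<rho> (comm g h) = 1" by (intro Suc.IH[OF level_char_comm_right[OF Suc.prems(1) g] _ h])
 qed
qed

end

section \<open>Triviality criteria for characters\<close>

text \<open>\<open>cover\<close> expresses compactness of \<open>G / \<Gamma>\<close>.
  \<open>gen\<close> does the work of connectedness: a homomorphism that is trivial near the
  identity is determined by its value at \<open>\<tau>\<close>. \<open>dens\<close> does the work of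
  ergodicity: a continuous homomorphism to the circle that is trivial at \<open>\<tau>\<close> and
  on \<open>\<Gamma>\<close> is trivial.\<close>

locale good_group = uniform_group +
 fixes \<Gamma> :: "'a set" and \<tau> :: 'a
 assumes \<Gamma>: "subgroup \<Gamma> G" and \<tau>: "\<tau> \<in> carrier G"
  and cover: "d > 0 ==> \<exists>S. finite S \<and> S \<subseteq> carrier G \<and> (\<forall>g\<in>carrier G. \<exists>u\<in>B d. \<exists>s\<in>S. \<exists>\<gamma>\<in>\<Gamma>. g = u \<otimes> s \<otimes> \<gamma>)"
  and gen: "d > 0 ==> generate G (insert \<tau> (B d)) = carrier G"
  and dens: "d > 0 ==> g \<in> carrier G ==> \<exists>u\<in>B d. u \<otimes> g \<in> generate G (insert \<tau> (\<Gamma> \<union> lower_central_series G 1))"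
begin

lemma \<Gamma>_carrier: "x \<in> \<Gamma> ==> x \<in> carrier G"
 using subgroup.mem_carrier[OF \<Gamma>] .

text \<open>Level 0 is \<open>gen\<close>. Above it, \<open>\<rho> (comm \<tau> h)\<close> is a
  character of \<open>h\<close> one level lower, trivial by induction; the condition at
  \<open>\<tau>\<close> holds as \<open>\<tau>\<close> commutes with itself. Then, for fixed
  \<open>h\<close>, \<open>\<rho> (comm g h)\<close> is a character of \<open>g\<close> that is
  trivial near the identity and at \<open>\<tau>\<close>.\<close>

lemma trivial_near_one_imp_trivial:
 assumes "level_char j \<rho>" "trivial_near_one j \<rho>" "j = 0 ==> \<rho> \<tau> = 1" "x \<in> L j"
 shows "\<rho> x = 1"
 using assms
proof (induction j arbitrary: \<rho> x)
 case 0
 then obtain d where d: "d > 0" "\<forall>x\<in>L 0 \<inter> B d. \<rho> x = 1" unfolding trivial_near_one_def by blast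
 show ?case
  by (rule level_char_generate[OF 0(1), of "insert \<tau> (B d)"]) (use 0 d \<tau> B_in gen[OF d(1)] in auto)
next
 case (Suc j)
 have zero: "\<rho> x = 1" if "level_char 0 \<rho>" "trivial_near_one 0 \<rho>" "\<rho> \<tau> = 1" "x \<in> carrier G" for \<rho> x
 proof -
  obtain d where d: "d > 0" "\<forall>x\<in>L 0 \<inter> B d. \<rho> x = 1" using \<open>trivial_near_one 0 \<rho>\<close> unfolding trivial_near_one_def by blast
  show ?thesis
   by (rule level_char_generate[OF that(1), of "insert \<tau> (B d)"]) (use that d \<tau> B_in gen[OF d(1)] in auto)
 qed
 have "\<rho> (comm \<tau> h) = 1" if "h \<in> L j" for h
 proof (rule Suc.IH[OF level_char_comm_right[OF Suc.prems(1) \<tau>] trivial_near_one_comm_right[OF Suc.prems(2) \<tau>] _ that])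
  show "\<rho> (comm \<tau> \<tau>) = 1" using \<tau> level_char_one[OF Suc.prems(1)] by (simp add: comm_def m_assoc)
 qed
 then show ?case
  using zero[OF level_char_comm_left[OF Suc.prems(1)] trivial_near_one_comm_left[OF Suc.prems(2)]]
  by (intro level_char_Suc_trivial[OF Suc.prems(1) _ Suc.prems(4)]) auto
qed

lemma level_char_0_trivial:
 assumes f: "level_char 0 f" "cont_at_one 0 f" "f \<tau> = 1" "\<And>g. g \<in> \<Gamma> ==> f g = 1" and x: "x \<in> carrier G"
 shows "f x = 1"
proof -
 have sub: "insert \<tau> (\<Gamma> \<union> L 1) \<subseteq> L 0" using \<tau> \<Gamma>_carrier L_carrier by auto
 have P: "f g = 1" if "g \<in> generate G (insert \<tau> (\<Gamma> \<union> L 1))" for g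
  by (rule level_char_generate[OF f(1) sub _ that]) (use f level_charD(3)[OF f(1)] in auto)
 have "norm (f x - 1) <= 0 + e" if e: "e > 0" for e
 proof -
  obtain d where d: "d > 0" "\<forall>u\<in>L 0 \<inter> B d. norm (f u - 1) < e" using cont_at_oneD[OF f(2) e] by blast
  obtain u where u: "u \<in> B d" "u \<otimes> x \<in> generate G (insert \<tau> (\<Gamma> \<union> L 1))" using dens[OF d(1) x] by auto
  have uc: "u \<in> carrier G" using u B_in by blast
  have "f u * f x = 1" using P[OF u(2)] level_charD(1)[OF f(1), of u x] uc x by simp
  then have "f x - 1 = - (f u - 1) * f x" by (simp add: algebra_simps)
  moreover have "norm (f x) = 1" using level_charD(2)[OF f(1)] x by simp
  ultimately have "norm (f x - 1) = norm (f u - 1)" by (simp only: norm_mult norm_minus_cancel mult_1_right)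
  then show ?thesis using d u uc by (auto intro: less_imp_le)
 qed
 then have "norm (f x - 1) <= 0" by (rule field_le_epsilon)
 then show ?thesis by simp
qed

text \<open>Near the identity \<open>\<rho>\<close> takes values near \<open>1\<close>, and
  \<open>1\<close> is isolated among the \<open>m\<close>-th roots of unity. At level 0 the value at
  \<open>\<tau>\<close> obstructs this; that case produces the periodic sequences.\<close>

lemma torsion_trivial:
 assumes \<rho>: "level_char (Suc j) \<rho>" "cont_at_one (Suc j) \<rho>" and m: "m > 0" "\<And>x. x \<in> L (Suc j) ==> \<rho> x ^ m = 1"
  and x: "x \<in> L (Suc j)"
 shows "\<rho> x = 1"
proof (rule trivial_near_one_imp_trivial[OF \<rho>(1) _ _ x])
 obtain e where e: "e > 0" "\<And>z::complex. z ^ m = 1 ==> norm (z - 1) < e ==> z = 1" using unit_near_one_root[OF m(1)] by blast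
 then show "trivial_near_one (Suc j) \<rho>" using \<rho>(2) m(2) unfolding trivial_near_one_def cont_at_one_def by (metis IntD1)
qed auto

text \<open>Modulo \<open>\<Gamma>\<close> the second argument ranges over finitely many small
  pieces, so for small \<open>u\<close> all values \<open>\<beta> u y\<close> are within
  \<open>1\<close> of \<open>1\<close>. With \<open>\<beta> u y\<close> all its powers are such
  values, so it is \<open>1\<close>; the first argument is then settled by
  \<open>trivial_near_one_imp_trivial\<close>.\<close>

lemma bicharacter_trivial:
 assumes left: "\<And>y. y \<in> carrier G ==> level_char 0 (%x. \<beta> x y)"
  and right: "\<And>x. x \<in> carrier G ==> level_char 0 (\<beta> x)"
  and cl: "\<And>y. y \<in> carrier G ==> cont_at_one 0 (%x. \<beta> x y)"
  and joint: "\<And>e. e > 0 ==> \<exists>d>0. \<forall>x\<in>B d. \<forall>y\<in>B d. norm (\<beta> x y - 1) < e"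
  and t: "\<And>y. y \<in> carrier G ==> \<beta> \<tau> y = 1" and \<gamma>: "\<And>x y. x \<in> carrier G ==> y \<in> \<Gamma> ==> \<beta> x y = 1"
  and xy: "x \<in> carrier G" "y \<in> carrier G"
 shows "\<beta> x y = 1"
proof -
 obtain d where d: "d > 0" "\<forall>x\<in>B d. \<forall>y\<in>B d. norm (\<beta> x y - 1) < 1/2" using joint[of "1/2"] by auto
 obtain S where S: "finite S" "S \<subseteq> carrier G" "\<forall>g\<in>carrier G. \<exists>u\<in>B d. \<exists>s\<in>S. \<exists>\<gamma>\<in>\<Gamma>. g = u \<otimes> s \<otimes> \<gamma>" using cover[OF d(1)] by blast
 have "\<forall>s\<in>S. \<exists>d'>0. \<forall>x\<in>B d'. norm (\<beta> x s - 1) < 1/2"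
 proof
  fix s assume "s \<in> S"
  then have "cont_at_one 0 (%x. \<beta> x s)" using cl S by blast
  then obtain d' where "d' > 0" "\<forall>x\<in>L 0 \<inter> B d'. norm (\<beta> x s - 1) < 1/2" using cont_at_oneD[of 0 _ "1/2"] by auto
  then show "\<exists>d'>0. \<forall>x\<in>B d'. norm (\<beta> x s - 1) < 1/2" using B_in by auto
 qed
 from bchoice[OF this] obtain f where "\<forall>s\<in>S. f s > 0 \<and> (\<forall>x\<in>B (f s). norm (\<beta> x s - 1) < 1/2)" by blast
 then have f: "\<And>s. s \<in> S ==> f s > 0" "\<And>s x. s \<in> S ==> x \<in> B (f s) ==> norm (\<beta> x s - 1) < 1/2" by auto
 define d1 where "d1 = Min (insert d (f ` S))"
 have d1: "d1 > 0" "d1 <= d" "\<And>s. s \<in> S ==> d1 <= f s" unfolding d1_def using d(1) f(1) S(1) by auto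
 have triv: "\<beta> u y = 1" if u: "u \<in> B d1" and y: "y \<in> carrier G" for u y
 proof (rule unit_powers_near_one)
  have uc: "u \<in> carrier G" using u B_in by blast
  note r = level_charD[OF right[OF uc]]
  show "norm (\<beta> u y) = 1" using r(2) y by simp
  have near: "norm (\<beta> u y - 1) < 1" if yc: "y \<in> carrier G" for y
  proof -
   obtain b s \<gamma> where *: "b \<in> B d" "s \<in> S" "\<gamma> \<in> \<Gamma>" "y = b \<otimes> s \<otimes> \<gamma>" using bspec[OF S(3) yc] by blast
   have c: "b \<in> carrier G" "s \<in> carrier G" "\<gamma> \<in> carrier G" using * B_in S \<Gamma>_carrier by auto
   have "\<beta> u y = \<beta> u b * \<beta> u s" using * c r(1) \<gamma>[OF uc] by simp
   then have eq: "\<beta> u y - 1 = (\<beta> u b - 1) * \<beta> u s + (\<beta> u s - 1)" by (simp add: algebra_simps)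
   moreover have "norm (\<beta> u s) = 1" using r(2) c by simp
   moreover have "norm (\<beta> u b - 1) < 1/2" using d(2) u * B_mono[OF d1(2)] by blast
   moreover have "norm (\<beta> u s - 1) < 1/2" using f(2) u * B_mono[OF d1(3)] by blast
   ultimately show ?thesis unfolding eq using norm_triangle_ineq[of "(\<beta> u b - 1) * \<beta> u s" "\<beta> u s - 1"] by (simp add: norm_mult)
  qed
  fix n :: nat
  have "\<beta> u (y [^] n) = \<beta> u y ^ n"
  proof (induction n)
   case 0
   then show ?case using level_char_one[OF right[OF uc]] by simp
  next
   case (Suc n)
   then show ?case using r(1)[of "y [^] n" y] y by simp
  qed
  then show "norm (\<beta> u y ^ n - 1) < 1" using near[of "y [^] n"] y by simp
 qed
 show ?thesis
  by (rule trivial_near_one_imp_trivial[OF left[OF xy(2)]]) (use triv d1(1) t xy in \<open>auto simp: trivial_near_one_def\<close>)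
qed

text \<open>The value of \<open>\<rho>\<close> at iterated commutators is found by turning their
  entries, from the right end, into elements of \<open>\<Gamma>\<close>. The hypothesis
  \<open>near\<close> makes commutators with outermost entry \<open>\<tau>\<close> trivial under
  \<open>\<rho>\<close>.\<close>

theorem level_char_trivial:
 assumes \<rho>: "level_char (Suc j) \<rho>" "cont_at_one (Suc j) \<rho>"
  and \<Gamma>1: "\<And>x. x \<in> \<Gamma> ==> x \<in> L (Suc j) ==> \<rho> x = 1"
  and near: "trivial_near_one j (%h. \<rho> (comm \<tau> h))" and x: "x \<in> L (Suc j)"
 shows "\<rho> x = 1"
proof -
 have t: "\<rho> (comm \<tau> h) = 1" if "h \<in> L j" for h
 proof (rule trivial_near_one_imp_trivial[OF level_char_comm_right[OF \<rho>(1) \<tau>] near _ that])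
  show "\<rho> (comm \<tau> \<tau>) = 1" using \<tau> level_char_one[OF \<rho>(1)] by (simp add: comm_def m_assoc)
 qed
 have cont: "\<exists>d>0. \<forall>u\<in>B d. norm (\<rho> (nest (pre @ u # suf)) - 1) < e"
  if pre: "set pre \<subseteq> carrier G" and suf: "set suf \<subseteq> carrier G" and len: "length pre + length suf = Suc j" and e: "e > 0" for pre suf e
 proof -
  obtain d where d: "d > 0" "\<forall>x\<in>L (Suc j) \<inter> B d. norm (\<rho> x - 1) < e" using \<rho>(2) e unfolding cont_at_one_def by blast
  obtain d' where d': "d' > 0" "\<forall>u\<in>B d'. nest (pre @ u # suf) \<in> B d" using nest_small[OF pre suf d(1)] by blast
  have "nest (pre @ u # suf) \<in> L (Suc j)" if "u \<in> B d'" for u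
   using that B_in pre suf len by (intro nest_in_L) auto
  then show ?thesis using d d' by blast
 qed
 have nest\<Gamma>: "nest gs \<in> \<Gamma>" if "set gs \<subseteq> \<Gamma>" for gs using that
 proof (induction gs rule: nest.induct)
  case (3 x y zs)
  then show ?case using \<Gamma> by (auto simp: comm_def intro!: subgroup.m_closed[OF \<Gamma>] subgroup.m_inv_closed[OF \<Gamma>])
 qed (use subgroup.one_closed[OF \<Gamma>] in auto)
 \<comment> \<open>Induction on the number of entries that are not yet known to lie in
   \<open>\<Gamma>\<close>.\<close>
 have P: "\<rho> (nest (gs @ \<gamma>s)) = 1" if "set gs \<subseteq> carrier G" "set \<gamma>s \<subseteq> \<Gamma>" "length gs + length \<gamma>s = Suc (Suc j)" for gs \<gamma>s
  using that
 proof (induction gs arbitrary: \<gamma>s rule: length_induct)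
  case (1 gs)
  have \<gamma>c: "set \<gamma>s \<subseteq> carrier G" using "1.prems" \<Gamma>_carrier by blast
  consider "gs = []" | x where "gs = [x]" | x m y where "gs = x # m @ [y]"
   by (cases gs; cases "tl gs" rule: rev_cases) auto
  then show ?case
  proof cases
   case 1
   then show ?thesis using nest\<Gamma>[of \<gamma>s] nest_in_L[of \<gamma>s "Suc j"] \<Gamma>1 "1.prems" \<gamma>c by auto
  next
   \<comment> \<open>Only the outermost entry is free: it gives a character of the group that is
     trivial at \<open>\<tau>\<close> and on \<open>\<Gamma>\<close>. As there are at least two
     entries, \<open>\<gamma>s\<close> is not empty and \<open>t\<close> applies.\<close>
   case (2 x)
   have lc: "level_char 0 (%u. \<rho> (nest ([] @ u # \<gamma>s)))" using "1.prems" \<gamma>c 2 by (intro nest_level_char[OF \<rho>(1)]) auto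
   define f where "f = (%u. \<rho> (nest (u # \<gamma>s)))"
   have lf: "level_char 0 f" using lc by (simp add: f_def)
   have ne: "\<gamma>s ~= []" using "1.prems" 2 by auto
   have f\<tau>: "f \<tau> = 1" unfolding f_def using ne t[OF nest_in_L[of \<gamma>s j]] \<gamma>c "1.prems" 2 by (simp add: nest_Cons)
   have f\<Gamma>: "f g = 1" if "g \<in> \<Gamma>" for g
    unfolding f_def using nest\<Gamma>[of "g # \<gamma>s"] nest_in_L[of "g # \<gamma>s" "Suc j"] \<Gamma>1 "1.prems" \<gamma>c 2 that \<Gamma>_carrier by auto
   have "cont_at_one 0 f" unfolding cont_at_one_def
   proof (intro allI impI)
    fix e :: real assume "e > 0"
    then obtain d where "d > 0" "\<forall>u\<in>B d. norm (f u - 1) < e" using cont[of "[]" \<gamma>s e] \<gamma>c "1.prems" 2 by (auto simp: f_def)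
    then show "\<exists>d>0. \<forall>x\<in>L 0 \<inter> B d. norm (f x - 1) < e" by blast
   qed
   from level_char_0_trivial[OF lf this f\<tau> f\<Gamma>, of x] show ?thesis using 2 "1.prems" by (simp add: f_def)
  next
   \<comment> \<open>In the first and the last free entry this is a bicharacter. It is trivial for
     \<open>x = \<tau>\<close>; for \<open>y\<close> in \<open>\<Gamma>\<close> the induction
     hypothesis applies.\<close>
   case (3 x m y)
   have c: "x \<in> carrier G" "y \<in> carrier G" "set m \<subseteq> carrier G" using "1.prems" 3 by auto
   define \<beta> where "\<beta> = (%x y. \<rho> (nest (x # m @ y # \<gamma>s)))"
   have l: "length m + length \<gamma>s = j" using "1.prems" 3 by simp
   have "\<beta> x y = 1"
   proof (rule bicharacter_trivial[of \<beta>])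
    fix y assume y: "y \<in> carrier G"
    show "level_char 0 (%x. \<beta> x y)"
     using nest_level_char[OF \<rho>(1), of "[]" "m @ y # \<gamma>s"] y c \<gamma>c l by (simp add: \<beta>_def)
    show "cont_at_one 0 (%x. \<beta> x y)" unfolding cont_at_one_def
    proof (intro allI impI)
     fix e :: real assume "e > 0"
     then obtain d where "d > 0" "\<forall>u\<in>B d. norm (\<beta> u y - 1) < e"
      using cont[of "[]" "m @ y # \<gamma>s" e] y c \<gamma>c l by (auto simp: \<beta>_def)
     then show "\<exists>d>0. \<forall>x\<in>L 0 \<inter> B d. norm (\<beta> x y - 1) < e" by blast
    qed
    show "\<beta> \<tau> y = 1" using t[OF nest_in_L[of "m @ y # \<gamma>s" j]] y c \<gamma>c l by (simp add: \<beta>_def nest_Cons)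
   next
    fix x assume x: "x \<in> carrier G"
    show "level_char 0 (\<beta> x)"
     using nest_level_char[OF \<rho>(1), of "x # m" \<gamma>s] x c \<gamma>c l by (simp add: \<beta>_def)
    fix y assume y: "y \<in> \<Gamma>"
    show "\<beta> x y = 1"
     using "1.IH"[rule_format, of "x # m" "y # \<gamma>s"] "1.prems" 3 x y c l by (simp add: \<beta>_def)
   next
    fix e :: real assume e: "e > 0"
    obtain d where d: "d > 0" "\<forall>x\<in>L (Suc j) \<inter> B d. norm (\<rho> x - 1) < e" using \<rho>(2) e unfolding cont_at_one_def by blast
    obtain d1 where d1: "d1 > 0" "\<forall>u\<in>B d1. \<forall>v\<in>B d1. comm u v \<in> B d" using comm_small_both[OF d(1)] by blast
    obtain d2 where d2: "d2 > 0" "\<forall>u\<in>B d2. nest (m @ u # \<gamma>s) \<in> B d1" using nest_small[OF c(3) \<gamma>c d1(1)] by blast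
    show "\<exists>d>0. \<forall>x\<in>B d. \<forall>y\<in>B d. norm (\<beta> x y - 1) < e"
    proof (intro exI[of _ "min d1 d2"] conjI ballI)
     fix u v assume uv: "u \<in> B (min d1 d2)" "v \<in> B (min d1 d2)"
     then have "u \<in> B d1" "v \<in> B d2" using B_mono[of "min d1 d2" d1] B_mono[of "min d1 d2" d2] by auto
     then have "nest (u # m @ v # \<gamma>s) \<in> B d" using d1 d2 by (simp add: nest_Cons)
     moreover have "nest (u # m @ v # \<gamma>s) \<in> L (Suc j)" using B_in uv c \<gamma>c l by (intro nest_in_L) auto
     ultimately show "norm (\<beta> u v - 1) < e" unfolding \<beta>_def using d by blast
    qed (use d1 d2 in auto)
   qed (use c in auto)
   then show ?thesis using 3 by (simp add: \<beta>_def)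
  qed
 qed
 show ?thesis using nest_trivial[OF \<rho>(1) _ x] P[of _ "[]"] by simp
qed

end

subsection \<open>Decomposition into eigenfunctions\<close>

text \<open>Values are rounded to a grid of mesh \<open>e/2\<close> and one element of
  \<open>Z\<close> is kept per rounding pattern, so that the net lies in \<open>Z\<close>
  itself.\<close>

lemma finite_net_functions:
 fixes \<phi> :: "'c => 's => complex"
 assumes "finite S" "e > 0" "\<And>c s. c \<in> Z ==> s \<in> S ==> norm (\<phi> c s) <= C"
 shows "\<exists>N. finite N \<and> N \<subseteq> Z \<and> (\<forall>c\<in>Z. \<exists>n\<in>N. \<forall>s\<in>S. norm (\<phi> c s - \<phi> n s) < e)"
proof -
 define g where "g = (%c. restrict (%s. (\<lfloor>2 * Re (\<phi> c s) / e\<rfloor>, \<lfloor>2 * Im (\<phi> c s) / e\<rfloor>)) S)"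
 let ?I = "{\<lfloor>- 2 * C / e\<rfloor>..\<lfloor>2 * C / e\<rfloor>}"
 have "g ` Z \<subseteq> PiE S (%_. ?I \<times> ?I)"
 proof (rule image_subsetI, unfold g_def, rule restrict_PiE_iff[THEN iffD2], rule ballI)
  fix c s assume *: "c \<in> Z" "s \<in> S"
  have b: "\<bar>Re (\<phi> c s)\<bar> <= C" "\<bar>Im (\<phi> c s)\<bar> <= C"
   using assms(3)[OF *] abs_Re_le_cmod[of "\<phi> c s"] abs_Im_le_cmod[of "\<phi> c s"] by linarith+
  have "\<lfloor>2 * x / e\<rfloor> \<in> ?I" if "\<bar>x\<bar> <= C" for x
  proof -
   have "- 2 * C / e <= 2 * x / e" "2 * x / e <= 2 * C / e" using that assms(2) by (intro divide_right_mono; simp)+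
   then show ?thesis by (simp add: floor_mono)
  qed
  then show "(\<lfloor>2 * Re (\<phi> c s) / e\<rfloor>, \<lfloor>2 * Im (\<phi> c s) / e\<rfloor>) \<in> ?I \<times> ?I" using b by blast
 qed
 then have "finite (g ` Z)" by (rule finite_subset) (intro finite_PiE assms; simp)
 then obtain N where N: "N \<subseteq> Z" "finite N" "g ` Z = g ` N" using finite_subset_image[of "g ` Z" g Z] by auto
 have fl: "\<bar>x - y\<bar> < e/2" if "\<lfloor>2 * x / e\<rfloor> = \<lfloor>2 * y / e\<rfloor>" for x y
 proof -
  have "\<bar>2 * x / e - 2 * y / e\<bar> < 1" using that by linarith
  then have "\<bar>2 * x - 2 * y\<bar> < e" using assms(2) by (simp add: diff_divide_distrib[symmetric] abs_divide divide_less_eq)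
  then show ?thesis by linarith
 qed
 show ?thesis
 proof (intro exI[of _ N] conjI ballI N)
  fix c assume "c \<in> Z"
  then obtain n where n: "n \<in> N" "g c = g n" using N(3) by (metis imageE imageI)
  have "norm (\<phi> c s - \<phi> n s) < e" if "s \<in> S" for s
  proof -
   have "g c s = g n s" using n by simp
   then have "\<lfloor>2 * Re (\<phi> c s) / e\<rfloor> = \<lfloor>2 * Re (\<phi> n s) / e\<rfloor>" "\<lfloor>2 * Im (\<phi> c s) / e\<rfloor> = \<lfloor>2 * Im (\<phi> n s) / e\<rfloor>"
    using that by (auto simp: g_def)
   then show ?thesis using fl[of "Re (\<phi> c s)" "Re (\<phi> n s)"] fl[of "Im (\<phi> c s)" "Im (\<phi> n s)"] cmod_le[of "\<phi> c s - \<phi> n s"] by simp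
  qed
  then show "\<exists>n\<in>N. \<forall>s\<in>S. norm (\<phi> c s - \<phi> n s) < e" using n by blast
 qed
qed

locale cocompact = uniform_group +
 fixes \<Gamma> :: "'a set"
 assumes \<Gamma>: "subgroup \<Gamma> G"
  and cover: "d > 0 ==> \<exists>S. finite S \<and> S \<subseteq> carrier G \<and> (\<forall>g\<in>carrier G. \<exists>u\<in>B d. \<exists>s\<in>S. \<exists>\<gamma>\<in>\<Gamma>. g = u \<otimes> s \<otimes> \<gamma>)"
begin

text \<open>Lifts of continuous functions on \<open>G / \<Gamma>\<close>; with
  \<open>N = L j\<close> they come from a quotient group of step at most \<open>j\<close>, and
  \<open>N = {}\<close> imposes nothing.\<close>

definition nice :: "'a set => ('a => complex) => bool" where
 "nice N f \<longleftrightarrow> (\<exists>C. \<forall>w\<in>carrier G. norm (f w) <= C) \<and>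
   (\<forall>e>0. \<exists>d>0. \<forall>u\<in>B d. \<forall>w\<in>carrier G. norm (f (u \<otimes> w) - f w) < e) \<and>
   (\<forall>w\<in>carrier G. \<forall>\<gamma>\<in>\<Gamma>. f (w \<otimes> \<gamma>) = f w) \<and>
   (\<forall>w\<in>carrier G. \<forall>n\<in>N. f (n \<otimes> w) = f w)"

lemma niceD:
 assumes "nice N f"
 shows "\<exists>C>0. \<forall>w\<in>carrier G. norm (f w) <= C"
  "e > 0 ==> \<exists>d>0. \<forall>u\<in>B d. \<forall>w\<in>carrier G. norm (f (u \<otimes> w) - f w) < e"
  "w \<in> carrier G ==> \<gamma> \<in> \<Gamma> ==> f (w \<otimes> \<gamma>) = f w"
  "w \<in> carrier G ==> n \<in> N ==> f (n \<otimes> w) = f w"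
proof -
 obtain C where "\<forall>w\<in>carrier G. norm (f w) <= C" using assms unfolding nice_def by blast
 then have "\<forall>w\<in>carrier G. norm (f w) <= max C 1" by (meson max.coboundedI1)
 then show "\<exists>C>0. \<forall>w\<in>carrier G. norm (f w) <= C" by (intro exI[of _ "max C 1"]) simp
qed (use assms in \<open>auto simp: nice_def\<close>)

lemma niceI:
 assumes "nice {} f" "\<And>w n. w \<in> carrier G ==> n \<in> N ==> f (n \<otimes> w) = f w" shows "nice N f"
 using assms unfolding nice_def by auto

lemma nice_mult_cnj:
 assumes f: "nice M f" and g: "nice N g" shows "nice {} (%w. f w * cnj (g w))"
 unfolding nice_def
proof (intro conjI allI impI)
 obtain C where C: "C > 0" "\<forall>w\<in>carrier G. norm (f w) <= C" using niceD(1)[OF f] by blast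
 obtain C' where C': "C' > 0" "\<forall>w\<in>carrier G. norm (g w) <= C'" using niceD(1)[OF g] by blast
 have "norm (f w * cnj (g w)) <= C * C'" if "w \<in> carrier G" for w
  unfolding norm_mult complex_mod_cnj using C C' that by (intro mult_mono) auto
 then show "\<exists>C. \<forall>w\<in>carrier G. norm (f w * cnj (g w)) <= C" by blast
 fix e :: real assume "e > 0"
 then have e: "e / (2 * C) > 0" "e / (2 * C') > 0" using C C' by auto
 obtain d where d: "d > 0" "\<forall>u\<in>B d. \<forall>w\<in>carrier G. norm (f (u \<otimes> w) - f w) < e / (2 * C')" using niceD(2)[OF f e(2)] by blast
 obtain d' where d': "d' > 0" "\<forall>u\<in>B d'. \<forall>w\<in>carrier G. norm (g (u \<otimes> w) - g w) < e / (2 * C)" using niceD(2)[OF g e(1)] by blast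
 have "norm (f (u \<otimes> w) * cnj (g (u \<otimes> w)) - f w * cnj (g w)) < e" if u: "u \<in> B (min d d')" and w: "w \<in> carrier G" for u w
 proof -
  have u': "u \<in> B d" "u \<in> B d'" using u B_mono[of "min d d'" d] B_mono[of "min d d'" d'] by auto
  then have uw: "u \<otimes> w \<in> carrier G" using w B_carrier by blast
  let ?P = "f (u \<otimes> w)" and ?Q = "g (u \<otimes> w)" and ?R = "f w" and ?S = "g w"
  have "norm (?P * cnj ?Q - ?R * cnj ?S) = norm ((?P - ?R) * cnj ?Q + ?R * cnj (?Q - ?S))" by (simp add: algebra_simps)
  also have "\<dots> <= norm (?P - ?R) * norm ?Q + norm ?R * norm (?Q - ?S)" by (metis norm_mult complex_mod_cnj norm_triangle_ineq)
  also have "\<dots> <= norm (?P - ?R) * C' + C * norm (?Q - ?S)" using bspec[OF C(2) w] bspec[OF C'(2) uw] by (intro add_mono mult_left_mono mult_right_mono) auto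
  also have "\<dots> < e / (2 * C') * C' + C * (e / (2 * C))"
   using u' d(2) d'(2) w C(1) C'(1) by (intro add_strict_mono mult_strict_left_mono mult_strict_right_mono) auto
  also have "\<dots> = e" using C C' by simp
  finally show ?thesis .
 qed
 then show "\<exists>d>0. \<forall>u\<in>B d. \<forall>w\<in>carrier G. norm (f (u \<otimes> w) * cnj (g (u \<otimes> w)) - f w * cnj (g w)) < e"
  using d(1) d'(1) by (intro exI[of _ "min d d'"]) simp
qed (use niceD(3)[OF f] niceD(3)[OF g] in simp_all)

definition eigenfunction :: "'a set => ('a => complex) => ('a => complex) => bool" where
 "eigenfunction Z \<omega> f \<longleftrightarrow> (\<forall>c\<in>Z. \<forall>w\<in>carrier G. f (c \<otimes> w) = \<omega> c * f w) \<and>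
   (\<forall>c\<in>Z. norm (\<omega> c) = 1) \<and> (\<forall>c\<in>Z. \<forall>c'\<in>Z. \<omega> (c \<otimes> c') = \<omega> c * \<omega> c')"

end

section \<open>Eigenfunctions of a central action\<close>

text \<open>\<open>Z\<close> is central modulo \<open>N\<close> and acts on functions by left
  translation. The sup distance between \<open>f\<close> and its translates is an invariant
  pseudometric on \<open>A = Z / N\<close>, and the expansion into characters is applied to this
  group.\<close>

locale central_action = cocompact +
 fixes Z N :: "'a set" and f :: "'a => complex"
 assumes Z: "subgroup Z G" and N: "subgroup N G" and NZ: "N \<subseteq> Z"
  and central: "\<And>g z. g \<in> carrier G ==> z \<in> Z ==> comm g z \<in> N"
  and f: "nice N f"
begin

lemma Z_carrier: "c \<in> Z ==> c \<in> carrier G" and N_carrier: "c \<in> N ==> c \<in> carrier G"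
 using subgroup.mem_carrier[OF Z] subgroup.mem_carrier[OF N] by blast+

abbreviation "GZ \<equiv> G\<lparr>carrier := Z\<rparr>"
definition "A = GZ Mod N"

lemma GZ_group: "group GZ" using subgroup_imp_group[OF Z] .

lemma central': "c \<in> Z ==> g \<in> carrier G ==> comm c g \<in> N"
proof -
 assume *: "c \<in> Z" "g \<in> carrier G"
 have "comm c g = inv (comm g c)" using * Z_carrier by (simp add: comm_def inv_mult_group m_assoc)
 then show ?thesis using subgroup.m_inv_closed[OF N central] * by simp
qed

lemma N_normal: "N \<lhd> GZ"
proof (rule group.normal_invI[OF GZ_group])
 show "subgroup N GZ" using subgroup_incl[OF N Z NZ] .
 fix x h assume *: "x \<in> carrier GZ" "h \<in> N"
 have "x \<otimes> h \<otimes> inv x = comm x h \<otimes> h" using * Z_carrier N_carrier by (simp add: comm_def m_assoc)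
 then have "x \<otimes> h \<otimes> inv x \<in> N" using central[of x h] * Z_carrier NZ subgroup.m_closed[OF N] by auto
 then show "x \<otimes>\<^bsub>GZ\<^esub> h \<otimes>\<^bsub>GZ\<^esub> inv\<^bsub>GZ\<^esub> x \<in> N" using * m_inv_consistent[OF Z] by simp
qed

definition cos :: "'a => 'a set" where "cos c = N #>\<^bsub>GZ\<^esub> c"

lemma carrier_A: "carrier A = cos ` Z"
 by (auto simp: A_def FactGroup_def RCOSETS_def cos_def)

lemma cos_mult: "c \<in> Z ==> c' \<in> Z ==> cos c \<otimes>\<^bsub>A\<^esub> cos c' = cos (c \<otimes> c')"
 using normal.rcos_sum[OF N_normal, of c c'] by (simp add: A_def cos_def FactGroup_def)

lemma one_A: "\<one>\<^bsub>A\<^esub> = cos \<one>"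
 using group.coset_join2[OF GZ_group, of "\<one>" N] subgroup.one_closed[OF Z] subgroup.one_closed[OF N] subgroup_incl[OF N Z NZ]
 by (simp add: A_def cos_def FactGroup_def)

lemma cos_self: "c \<in> Z ==> c \<in> cos c"
 using group.rcos_self[OF GZ_group, of c N] subgroup_incl[OF N Z NZ] by (simp add: cos_def)

lemma in_cos: "x \<in> cos c ==> \<exists>n\<in>N. x = n \<otimes> c"
 by (auto simp: cos_def r_coset_def)

lemma cos_eq: "n \<in> N ==> c \<in> Z ==> cos (n \<otimes> c) = cos c"
proof -
 assume *: "n \<in> N" "c \<in> Z"
 have "n \<otimes> c \<in> N #>\<^bsub>GZ\<^esub> c" using * by (auto simp: r_coset_def)
 then show ?thesis using group.repr_independence[OF GZ_group, of "n \<otimes> c" N c] * subgroup_incl[OF N Z NZ] by (simp add: cos_def)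
qed

lemma A_group: "comm_group A"
proof (rule group.group_comm_groupI[OF normal.factorgroup_is_group[OF N_normal, folded A_def]])
 fix x y assume "x \<in> carrier A" "y \<in> carrier A"
 then obtain c c' where *: "x = cos c" "y = cos c'" "c \<in> Z" "c' \<in> Z" by (auto simp: carrier_A)
 have cc: "c \<in> carrier G" "c' \<in> carrier G" using * Z_carrier by auto
 have "comm c c' \<otimes> (c' \<otimes> c) = c \<otimes> c' \<otimes> inv c \<otimes> (inv c' \<otimes> c') \<otimes> c"
  using cc by (simp only: comm_def m_assoc m_closed inv_closed)
 also have "\<dots> = c \<otimes> c'" using cc by (simp add: m_assoc)
 finally have "c \<otimes> c' = comm c c' \<otimes> (c' \<otimes> c)" ..
 then have "cos (c \<otimes> c') = cos (c' \<otimes> c)" using cos_eq[of "comm c c'" "c' \<otimes> c"] central[of c c'] * Z_carrier subgroup.m_closed[OF Z] by simp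
 then show "x \<otimes>\<^bsub>A\<^esub> y = y \<otimes>\<^bsub>A\<^esub> x" using * by (simp add: cos_mult)
qed

lemma inv_A: "c \<in> Z ==> inv\<^bsub>A\<^esub> (cos c) = cos (inv c)"
proof -
 assume c: "c \<in> Z"
 interpret A: comm_group A by (rule A_group)
 show ?thesis
  by (rule A.inv_equality) (use c Z_carrier subgroup.m_inv_closed[OF Z] in \<open>auto simp: carrier_A cos_mult one_A\<close>)
qed

text \<open>A representative of the coset is chosen; by invariance under \<open>N\<close> every
  choice gives the same value, see \<open>\<Phi>_cos\<close>.\<close>

definition \<Phi> :: "'a => 'a set => complex" where "\<Phi> w K = f ((SOME c. c \<in> K) \<otimes> w)"

lemma \<Phi>_cos: assumes "c \<in> Z" "w \<in> carrier G" shows "\<Phi> w (cos c) = f (c \<otimes> w)"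
proof -
 have "(SOME x. x \<in> cos c) \<in> cos c" using cos_self[OF assms(1)] by (rule someI)
 then obtain n where "n \<in> N" "(SOME x. x \<in> cos c) = n \<otimes> c" using in_cos by blast
 then show ?thesis using niceD(4)[OF f, of "c \<otimes> w" n] assms Z_carrier N_carrier by (simp add: \<Phi>_def m_assoc)
qed

definition D :: "'a set => real" where "D K = (SUP w\<in>carrier G. norm (\<Phi> w K - f w))"

lemma D_upper: assumes "c \<in> Z" "w \<in> carrier G" shows "norm (f (c \<otimes> w) - f w) <= D (cos c)"
proof -
 obtain C where C: "\<forall>w\<in>carrier G. norm (f w) <= C" using niceD(1)[OF f] by blast
 have "norm (\<Phi> v (cos c) - f v) <= C + C" if "v \<in> carrier G" for v
  unfolding \<Phi>_cos[OF assms(1) that] using C that assms Z_carrier by (intro order.trans[OF norm_triangle_ineq4] add_mono) auto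
 then have "bdd_above ((%w. norm (\<Phi> w (cos c) - f w)) ` carrier G)" by (intro bdd_aboveI[of _ "C + C"]) auto
 then have "norm (\<Phi> w (cos c) - f w) <= D (cos c)" unfolding D_def using assms(2) by (rule cSUP_upper[rotated])
 then show ?thesis using \<Phi>_cos[OF assms] by simp
qed

lemma D_least: assumes "c \<in> Z" "\<And>w. w \<in> carrier G ==> norm (f (c \<otimes> w) - f w) <= x" shows "D (cos c) <= x"
 unfolding D_def using assms \<Phi>_cos by (intro cSUP_least) auto

text \<open>Left translation by \<open>c\<close> commutes with that by \<open>u\<close> up to an
  element of \<open>N\<close>, which \<open>f\<close> does not see; so the modulus of continuity of
  \<open>f\<close> serves all its translates under \<open>Z\<close>.\<close>

lemma equicontinuous:
 assumes "e > 0" shows "\<exists>d>0. \<forall>u\<in>B d. \<forall>c\<in>Z. \<forall>w\<in>carrier G. norm (f (c \<otimes> (u \<otimes> w)) - f (c \<otimes> w)) < e"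
proof -
 obtain d where d: "d > 0" "\<forall>u\<in>B d. \<forall>w\<in>carrier G. norm (f (u \<otimes> w) - f w) < e" using niceD(2)[OF f assms] by blast
 have "f (c \<otimes> (u \<otimes> w)) = f (u \<otimes> (c \<otimes> w))" if "u \<in> B d" "c \<in> Z" "w \<in> carrier G" for u c w
 proof -
  have uc: "u \<in> carrier G" "c \<in> carrier G" using that B_in Z_carrier by auto
  have "c \<otimes> (u \<otimes> w) = comm c u \<otimes> (u \<otimes> (c \<otimes> w))" using that uc by (simp add: comm_def m_assoc)
    (simp add: m_assoc[symmetric])
  then show ?thesis using niceD(4)[OF f, of "u \<otimes> (c \<otimes> w)" "comm c u"] central'[of c u] that uc by simp
 qed
 then show ?thesis using d Z_carrier by (intro exI[of _ d]) auto
qed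

lemma A_tb: "tb_group A D"
proof -
 interpret A: comm_group A by (rule A_group)
 show ?thesis
 proof (unfold_locales, goal_cases)
  case 1
  have "D (cos \<one>) <= 0" using subgroup.one_closed[OF Z] by (intro D_least) auto
  moreover have "0 <= D (cos \<one>)" using D_upper[of \<one> \<one>] subgroup.one_closed[OF Z] by simp
  ultimately show ?case unfolding one_A by simp
 next
  case (2 a)
  then obtain c where c: "a = cos c" "c \<in> Z" by (auto simp: carrier_A)
  have le: "D (cos (inv c)) <= D (cos c)" if c: "c \<in> Z" for c
  proof (rule D_least)
   fix w assume w: "w \<in> carrier G"
   show "norm (f (inv c \<otimes> w) - f w) <= D (cos c)"
    using D_upper[OF c, of "inv c \<otimes> w"] w Z_carrier[OF c] by (simp add: m_assoc[symmetric] norm_minus_commute)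
  qed (use c subgroup.m_inv_closed[OF Z] in auto)
  show ?case using le[OF c(2)] le[OF subgroup.m_inv_closed[OF Z c(2)]] c Z_carrier by (simp add: inv_A)
 next
  case (3 a b)
  then obtain c c' where c: "a = cos c" "c \<in> Z" "b = cos c'" "c' \<in> Z" by (auto simp: carrier_A)
  have "D (cos (c \<otimes> c')) <= D (cos c) + D (cos c')"
  proof (rule D_least)
   fix w assume w: "w \<in> carrier G"
   have "norm (f (c \<otimes> (c' \<otimes> w)) - f w) <= norm (f (c \<otimes> (c' \<otimes> w)) - f (c' \<otimes> w)) + norm (f (c' \<otimes> w) - f w)"
    using norm_triangle_ineq[of "f (c \<otimes> (c' \<otimes> w)) - f (c' \<otimes> w)" "f (c' \<otimes> w) - f w"] by simp
   then show "norm (f (c \<otimes> c' \<otimes> w) - f w) <= D (cos c) + D (cos c')"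
    using D_upper[OF c(2), of "c' \<otimes> w"] D_upper[OF c(4) w] w c Z_carrier by (simp add: m_assoc)
  qed (use c subgroup.m_closed[OF Z] in auto)
  then show ?case using c by (simp add: cos_mult)
 next
  case (4 e)
  obtain C where C: "\<forall>w\<in>carrier G. norm (f w) <= C" using niceD(1)[OF f] by blast
  obtain d where d: "d > 0" "\<forall>u\<in>B d. \<forall>c\<in>Z. \<forall>w\<in>carrier G. norm (f (c \<otimes> (u \<otimes> w)) - f (c \<otimes> w)) < e/4"
   using equicontinuous[of "e/4"] 4 by auto
  obtain S where S: "finite S" "S \<subseteq> carrier G" "\<forall>g\<in>carrier G. \<exists>u\<in>B d. \<exists>s\<in>S. \<exists>\<gamma>\<in>\<Gamma>. g = u \<otimes> s \<otimes> \<gamma>" using cover[OF d(1)] by blast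
  \<comment> \<open>By \<open>cover\<close> and \<open>equicontinuous\<close> a translate of
    \<open>f\<close> is known up to a small error from its values on the finite set
    \<open>S\<close>.\<close>
  have "\<exists>M. finite M \<and> M \<subseteq> Z \<and> (\<forall>c\<in>Z. \<exists>n\<in>M. \<forall>s\<in>S. norm (f (c \<otimes> s) - f (n \<otimes> s)) < e/4)"
   by (rule finite_net_functions[OF S(1), of _ _ "%c s. f (c \<otimes> s)" C]) (use 4 C S(2) Z_carrier in auto)
  then obtain M where M: "finite M" "M \<subseteq> Z" "\<forall>c\<in>Z. \<exists>n\<in>M. \<forall>s\<in>S. norm (f (c \<otimes> s) - f (n \<otimes> s)) < e/4" by blast
  show ?case
  proof (intro exI[of _ "cos ` M"] conjI ballI)
   fix a assume "a \<in> carrier A"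
   then obtain c where c: "a = cos c" "c \<in> Z" by (auto simp: carrier_A)
   obtain n where n: "n \<in> M" "\<forall>s\<in>S. norm (f (c \<otimes> s) - f (n \<otimes> s)) < e/4" using M(3) c by blast
   have nz: "n \<in> Z" "inv n \<in> Z" using n M subgroup.m_inv_closed[OF Z] by auto
   have "D (cos (c \<otimes> inv n)) <= 3 * e / 4"
   proof (rule D_least)
    show "c \<otimes> inv n \<in> Z" using c nz subgroup.m_closed[OF Z] by auto
    fix w assume w: "w \<in> carrier G"
    \<comment> \<open>Substituting \<open>w = n \<otimes> ?v\<close> turns the distance of
      \<open>c \<otimes> inv n\<close> from the identity into a difference of the translates by
      \<open>c\<close> and by \<open>n\<close>.\<close>
    let ?v = "inv n \<otimes> w"
    have v: "?v \<in> carrier G" using w nz Z_carrier by auto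
    then obtain u s \<gamma> where *: "u \<in> B d" "s \<in> S" "\<gamma> \<in> \<Gamma>" "?v = u \<otimes> s \<otimes> \<gamma>" using S(3) by blast
    have cc: "u \<in> carrier G" "s \<in> carrier G" "\<gamma> \<in> carrier G" "c \<in> carrier G" "n \<in> carrier G"
     using * B_in S subgroup.mem_carrier[OF \<Gamma>] c nz Z_carrier by auto
    have red: "f (x \<otimes> ?v) = f (x \<otimes> (u \<otimes> s))" if "x \<in> carrier G" for x
     using niceD(3)[OF f, of "x \<otimes> (u \<otimes> s)" \<gamma>] * cc that by (simp add: m_assoc)
    have "norm (f (c \<otimes> (u \<otimes> s)) - f (c \<otimes> s)) < e/4" "norm (f (n \<otimes> (u \<otimes> s)) - f (n \<otimes> s)) < e/4" "norm (f (c \<otimes> s) - f (n \<otimes> s)) < e/4"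
     using d(2) * cc c nz n(2) by auto
    moreover have eq: "f (c \<otimes> ?v) - f (n \<otimes> ?v) = ((f (c \<otimes> (u \<otimes> s)) - f (c \<otimes> s)) + (f (c \<otimes> s) - f (n \<otimes> s))) - (f (n \<otimes> (u \<otimes> s)) - f (n \<otimes> s))"
     using red cc by simp
    ultimately have "norm (f (c \<otimes> ?v) - f (n \<otimes> ?v)) <= 3 * e / 4"
     unfolding eq using norm_triangle_ineq4[of "(f (c \<otimes> (u \<otimes> s)) - f (c \<otimes> s)) + (f (c \<otimes> s) - f (n \<otimes> s))" "f (n \<otimes> (u \<otimes> s)) - f (n \<otimes> s)"]
      norm_triangle_ineq[of "f (c \<otimes> (u \<otimes> s)) - f (c \<otimes> s)" "f (c \<otimes> s) - f (n \<otimes> s)"] by linarith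
    moreover have "n \<otimes> ?v = w" "c \<otimes> inv n \<otimes> w = c \<otimes> ?v" using cc w by (simp_all add: m_assoc[symmetric])
    ultimately show "norm (f (c \<otimes> inv n \<otimes> w) - f w) <= 3 * e / 4" by simp
   qed
   then show "\<exists>k\<in>cos ` M. D (a \<otimes>\<^bsub>A\<^esub> inv\<^bsub>A\<^esub> k) < e"
    using n c nz 4 by (intro bexI[of _ "cos n"]) (auto simp: inv_A cos_mult)
  qed (use M in \<open>auto simp: carrier_A\<close>)
 qed
qed

sublocale T: tb_group A D by (rule A_tb)

lemma uc_\<Phi>: assumes "w \<in> carrier G" shows "T.uc (\<Phi> w)"
proof (rule T.ucI)
 fix e :: real assume e: "e > 0"
 have "norm (\<Phi> w a - \<Phi> w b) < e" if ab: "a \<in> carrier A" "b \<in> carrier A" "D (a \<otimes>\<^bsub>A\<^esub> inv\<^bsub>A\<^esub> b) < e" for a b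
 proof -
  obtain c c' where c: "a = cos c" "c \<in> Z" "b = cos c'" "c' \<in> Z" using ab by (auto simp: carrier_A)
  have cz: "c \<in> carrier G" "c' \<in> carrier G" "inv c' \<in> Z" "c \<otimes> inv c' \<in> Z" using c Z_carrier subgroup.m_inv_closed[OF Z] subgroup.m_closed[OF Z] by auto
  have "norm (f (c \<otimes> inv c' \<otimes> (c' \<otimes> w)) - f (c' \<otimes> w)) <= D (cos (c \<otimes> inv c'))" using cz assms by (intro D_upper) auto
  moreover have "c \<otimes> inv c' \<otimes> (c' \<otimes> w) = c \<otimes> w" using cz assms by (simp add: m_assoc) (simp add: m_assoc[symmetric])
  ultimately show ?thesis using ab(3) c cz assms by (simp add: \<Phi>_cos inv_A cos_mult)
 qed
 then show "\<exists>d>0. \<forall>a\<in>carrier A. \<forall>b\<in>carrier A. D (a \<otimes>\<^bsub>A\<^esub> inv\<^bsub>A\<^esub> b) < d --> norm (\<Phi> w a - \<Phi> w b) < e"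
  using e by blast
qed

text \<open>\<open>character_expansion\<close> is applied to the family of all
  \<open>\<Phi> w\<close>, with the same characters and coefficients for every \<open>w\<close>.
  Each term is an eigenfunction because translating \<open>w\<close> by \<open>c\<close> translates
  the argument of \<open>\<Phi> w\<close>; the eigenvalue is the conjugate of the character.\<close>

theorem eigen_decomposition:
 assumes e: "e > 0"
 obtains X F \<omega> where "finite X" "\<And>i. i \<in> X ==> nice N (F i)" "\<And>i. i \<in> X ==> eigenfunction Z (\<omega> i) (F i)"
  "\<And>w. w \<in> carrier G ==> norm (f w - (\<Sum>i\<in>(X :: ('a set => complex) set). F i w)) <= e"
proof -
 obtain C where C: "\<forall>w\<in>carrier G. norm (f w) <= C" using niceD(1)[OF f] by blast
 have \<Phi>_bound: "norm (\<Phi> w a) <= C" if "w \<in> carrier G" "a \<in> carrier A" for w a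
  using that C Z_carrier by (auto simp: carrier_A \<Phi>_cos)
 have \<Phi>_one: "\<Phi> w \<one>\<^bsub>A\<^esub> = f w" if "w \<in> carrier G" for w
  unfolding one_A using that subgroup.one_closed[OF Z] by (simp add: \<Phi>_cos)
 obtain X z where X: "finite X" "\<And>\<xi>. \<xi> \<in> X ==> T.char \<xi>"
  and appr: "\<And>w. w \<in> carrier G ==> norm (\<Phi> w \<one>\<^bsub>A\<^esub> - (\<Sum>\<xi>\<in>X. z \<xi> * T.mean (%a. \<xi> a * \<Phi> w a))) <= e"
 proof (rule T.character_expansion[of "carrier G" \<Phi> C e])
  fix w a assume *: "w \<in> carrier G" "a \<in> carrier A"
  then obtain c where "a = cos c" "c \<in> Z" by (auto simp: carrier_A)
  then show "norm (\<Phi> w a - \<Phi> w \<one>\<^bsub>A\<^esub>) <= D a" using * D_upper[of c w] by (simp add: \<Phi>_cos \<Phi>_one)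
 qed (use uc_\<Phi> \<Phi>_bound e in auto)
 define F where "F = (%\<xi> w. z \<xi> * T.mean (%a. \<xi> a * \<Phi> w a))"
 have u: "T.uc (%a. \<xi> a * \<Phi> w a)" if "\<xi> \<in> X" "w \<in> carrier G" for \<xi> w
  using T.charD(1)[OF X(2)] that uc_\<Phi> by (intro T.uc_mult) auto
 show thesis
 proof (rule that[OF X(1), of F "%\<xi> c. cnj (\<xi> (cos c))"])
  show "norm (f w - (\<Sum>i\<in>X. F i w)) <= e" if "w \<in> carrier G" for w using appr[OF that] \<Phi>_one[OF that] by (simp add: F_def)
 next
  fix \<xi> assume \<xi>: "\<xi> \<in> X"
  note x = T.charD[OF X(2)[OF \<xi>]]
  have eq: "F \<xi> w' = F \<xi> w" if "w \<in> carrier G" "w' \<in> carrier G" "\<And>c. c \<in> Z ==> f (c \<otimes> w') = f (c \<otimes> w)" for w w'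
  proof -
   have "T.mean (%a. \<xi> a * \<Phi> w' a) = T.mean (%a. \<xi> a * \<Phi> w a)"
    by (rule T.mean_cong) (use that in \<open>auto simp: carrier_A \<Phi>_cos\<close>)
   then show ?thesis by (simp add: F_def)
  qed
  show "nice N (F \<xi>)" unfolding nice_def
  proof (intro conjI allI impI)
   have "norm (F \<xi> w) <= norm (z \<xi>) * C" if w: "w \<in> carrier G" for w
   proof -
    have "norm (T.mean (%a. \<xi> a * \<Phi> w a)) <= C"
     using w x(3) \<Phi>_bound by (intro T.norm_mean_le u \<xi>) (simp_all add: norm_mult)
    then show ?thesis unfolding F_def norm_mult by (rule mult_left_mono) simp
   qed
   then show "\<exists>C. \<forall>w\<in>carrier G. norm (F \<xi> w) <= C" by blast
   show "\<forall>w\<in>carrier G. \<forall>\<gamma>\<in>\<Gamma>. F \<xi> (w \<otimes> \<gamma>) = F \<xi> w"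
   proof (intro ballI eq)
    fix w \<gamma> assume w: "w \<in> carrier G" and g: "\<gamma> \<in> \<Gamma>"
    have gc: "\<gamma> \<in> carrier G" using g subgroup.mem_carrier[OF \<Gamma>] by blast
    then show "w \<otimes> \<gamma> \<in> carrier G" using w by simp
    show "f (c \<otimes> (w \<otimes> \<gamma>)) = f (c \<otimes> w)" if "c \<in> Z" for c
     using niceD(3)[OF f, of "c \<otimes> w" \<gamma>] g that w gc Z_carrier by (simp add: m_assoc)
   qed
   show "\<forall>w\<in>carrier G. \<forall>n\<in>N. F \<xi> (n \<otimes> w) = F \<xi> w"
   proof (intro ballI eq)
    fix w n assume w: "w \<in> carrier G" and n: "n \<in> N"
    show "n \<otimes> w \<in> carrier G" using w N_carrier[OF n] by simp
    fix c assume c: "c \<in> Z"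
    have cc: "c \<in> carrier G" "n \<in> carrier G" using c n Z_carrier N_carrier by auto
    have "comm c n \<otimes> n \<in> N" using central'[OF c cc(2)] n subgroup.m_closed[OF N] by blast
    moreover have "c \<otimes> (n \<otimes> w) = (comm c n \<otimes> n) \<otimes> (c \<otimes> w)" using cc w by (simp add: comm_def m_assoc) (simp add: m_assoc[symmetric])
    ultimately show "f (c \<otimes> (n \<otimes> w)) = f (c \<otimes> w)" using niceD(4)[OF f, of "c \<otimes> w" "comm c n \<otimes> n"] cc w by simp
   qed
   fix e :: real assume e: "e > 0"
   define K where "K = 1 + norm (z \<xi>)"
   have K: "K > 0" unfolding K_def by (simp add: add_pos_nonneg)
   define e' where "e' = e / (2 * K)"
   have e': "e' > 0" using e K by (simp add: e'_def)
   obtain d where d: "d > 0" "\<forall>u\<in>B d. \<forall>c\<in>Z. \<forall>w\<in>carrier G. norm (f (c \<otimes> (u \<otimes> w)) - f (c \<otimes> w)) < e'"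
    using equicontinuous[OF e'] by blast
   show "\<exists>d>0. \<forall>u\<in>B d. \<forall>w\<in>carrier G. norm (F \<xi> (u \<otimes> w) - F \<xi> w) < e"
   proof (intro exI[of _ d] conjI ballI d(1))
    fix g w assume g: "g \<in> B d" and w: "w \<in> carrier G"
    have gw: "g \<otimes> w \<in> carrier G" using g w B_in by simp
    have "norm (T.mean (%a. \<xi> a * \<Phi> (g \<otimes> w) a - \<xi> a * \<Phi> w a)) <= e'"
    proof (rule T.norm_mean_le)
     fix a assume a: "a \<in> carrier A"
     then obtain c where c: "a = cos c" "c \<in> Z" by (auto simp: carrier_A)
     have "norm (\<xi> a * \<Phi> (g \<otimes> w) a - \<xi> a * \<Phi> w a) = norm (f (c \<otimes> (g \<otimes> w)) - f (c \<otimes> w))"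
      using x(3)[OF a] c gw w by (simp add: \<Phi>_cos right_diff_distrib[symmetric] norm_mult)
     then show "norm (\<xi> a * \<Phi> (g \<otimes> w) a - \<xi> a * \<Phi> w a) <= e'" using d(2) g c w by (simp add: less_imp_le)
    qed (intro T.uc_diff u \<xi> gw w)
    then have m: "norm (T.mean (%a. \<xi> a * \<Phi> (g \<otimes> w) a) - T.mean (%a. \<xi> a * \<Phi> w a)) <= e'"
     using u[OF \<xi>] gw w by (simp add: T.mean_diff)
    have "norm (F \<xi> (g \<otimes> w) - F \<xi> w) <= norm (z \<xi>) * e'"
     unfolding F_def right_diff_distrib[symmetric] norm_mult by (intro mult_left_mono m) simp
    also have "\<dots> < K * e'" using e' by (simp add: K_def)
    also have "\<dots> <= e" using e K by (simp add: e'_def)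
    finally show "norm (F \<xi> (g \<otimes> w) - F \<xi> w) < e" .
   qed
  qed
  show "eigenfunction Z (%c. cnj (\<xi> (cos c))) (F \<xi>)" unfolding eigenfunction_def
  proof (intro conjI ballI)
   fix c assume c: "c \<in> Z"
   have cA: "cos c \<in> carrier A" using c by (auto simp: carrier_A)
   show "norm (cnj (\<xi> (cos c))) = 1" using x(3)[OF cA] by simp
   show "cnj (\<xi> (cos (c \<otimes> c'))) = cnj (\<xi> (cos c)) * cnj (\<xi> (cos c'))" if "c' \<in> Z" for c'
    using x(2)[OF cA, of "cos c'"] that c by (auto simp: carrier_A cos_mult)
   fix w assume w: "w \<in> carrier G"
   have cw: "c \<otimes> w \<in> carrier G" using c w Z_carrier by simp
   have "T.mean (%a. \<xi> a * \<Phi> w a) = T.mean (%a. \<xi> (cos c \<otimes>\<^bsub>A\<^esub> a) * \<Phi> w (cos c \<otimes>\<^bsub>A\<^esub> a))"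
    by (rule T.mean_translate[symmetric, OF u[OF \<xi> w] cA])
   also have "\<dots> = T.mean (%a. \<xi> (cos c) * (\<xi> a * \<Phi> (c \<otimes> w) a))"
   proof (rule T.mean_cong)
    fix a assume a: "a \<in> carrier A"
    then obtain b where b: "a = cos b" "b \<in> Z" by (auto simp: carrier_A)
    have "cos c \<otimes>\<^bsub>A\<^esub> a = cos (b \<otimes> c)" using T.m_comm[OF cA a] b c by (simp add: cos_mult)
    then have "\<Phi> w (cos c \<otimes>\<^bsub>A\<^esub> a) = \<Phi> (c \<otimes> w) a"
     using b c w cw Z_carrier subgroup.m_closed[OF Z] by (simp add: \<Phi>_cos m_assoc)
    then show "\<xi> (cos c \<otimes>\<^bsub>A\<^esub> a) * \<Phi> w (cos c \<otimes>\<^bsub>A\<^esub> a) = \<xi> (cos c) * (\<xi> a * \<Phi> (c \<otimes> w) a)"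
     using x(2)[OF cA a] by simp
   qed
   also have "\<dots> = \<xi> (cos c) * T.mean (%a. \<xi> a * \<Phi> (c \<otimes> w) a)" by (rule T.mean_scale[OF u[OF \<xi> cw]])
   finally have "cnj (\<xi> (cos c)) * F \<xi> w = (\<xi> (cos c) * cnj (\<xi> (cos c))) * F \<xi> (c \<otimes> w)" by (simp add: F_def)
   then show "F \<xi> (c \<otimes> w) = cnj (\<xi> (cos c)) * F \<xi> w" using x(4)[OF cA] by simp
  qed
 qed
qed

end

subsection \<open>The van der Corput inequality\<close>

lemma average_bound:
 assumes "\<And>n. n >= 1 ==> norm (u n) <= C" "C >= 0" shows "norm (average u N) <= C"
proof (cases "N = 0")
 case False
 have "norm (\<Sum>n=1..N. u n) <= (\<Sum>n=1..N. C)" using assms by (intro sum_norm_le) auto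
 then show ?thesis using False by (simp add: average_def norm_divide divide_le_eq mult.commute)
qed (use assms in \<open>simp add: average_def\<close>)

lemma average_add: "average (%n. u n + v n) N = average u N + average v N"
 and average_diff: "average (%n. u n - v n) N = average u N - average v N"
 and average_scale: "average (%n. c * u n) N = c * average u N"
 by (simp_all add: average_def sum.distrib sum_subtractf distrib_left right_diff_distrib sum_distrib_left mult.left_commute)

lemma average_divide: "average (%n. u n / c) N = average u N / c"
 by (simp add: average_def sum_divide_distrib mult.commute)

lemma average_sum: "average (%n. \<Sum>i\<in>I. u i n) N = (\<Sum>i\<in>I. average (u i) N)"
 unfolding average_def by (subst sum.swap) (simp add: sum_distrib_left)

lemma average_shift:
 assumes "\<And>n. n >= 1 ==> norm (u n) <= C" "C >= 0"
 shows "norm (average (%n. u (n + m)) N - average u N) <= 2 * m * C / N"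
proof -
 have "(\<Sum>n=1..N. u (n + m)) - (\<Sum>n=1..N. u n) = (\<Sum>n=1..m. u (n + N)) - (\<Sum>n=1..m. u n)"
 proof -
  have "(\<Sum>n=1..a + b. u n) = (\<Sum>n=1..a. u n) + (\<Sum>n=1..b. u (n + a))" for a b
  proof -
   have "(\<Sum>n=1..a + b. u n) = (\<Sum>n=1..a. u n) + (\<Sum>n=Suc a..a + b. u n)"
    by (subst sum.ub_add_nat) auto
   also have "(\<Sum>n=Suc a..a + b. u n) = (\<Sum>n=1..b. u (n + a))"
    using sum.shift_bounds_cl_nat_ivl[of u 1 a b] by (simp add: add.commute)
   finally show ?thesis .
  qed
  from this[of m N] this[of N m] show ?thesis by (simp add: add.commute algebra_simps)
 qed
 moreover have "norm ((\<Sum>n=1..m. u (n + N)) - (\<Sum>n=1..m. u n)) <= (\<Sum>n=1..m. C) + (\<Sum>n=1..m. C)"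
  using assms by (intro order.trans[OF norm_triangle_ineq4] add_mono sum_norm_le) auto
 ultimately have "norm ((\<Sum>n=1..N. u (n + m)) - (\<Sum>n=1..N. u n)) <= 2 * m * C" by (simp add: mult_ac)
 then show ?thesis unfolding average_def right_diff_distrib[symmetric] norm_mult
  by (simp add: norm_divide divide_right_mono)
qed

lemma average_square:
 "(norm (average v N))\<^sup>2 <= Re (average (%n. v n * cnj (v n)) N)"
proof (cases "N = 0")
 case False
 have "norm (\<Sum>n=1..N. v n * 1) <= 1 * sqrt (real N * (\<Sum>n=1..N. (norm (v n))\<^sup>2))" by (rule sum_norm_le_sqrt) auto
 then have "(norm (\<Sum>n=1..N. v n))\<^sup>2 <= (sqrt (real N * (\<Sum>n=1..N. (norm (v n))\<^sup>2)))\<^sup>2" by (intro power_mono) auto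
 also have "\<dots> = real N * (\<Sum>n=1..N. (norm (v n))\<^sup>2)" by (simp add: sum_nonneg)
 finally have "(norm (average v N))\<^sup>2 <= (\<Sum>n=1..N. (norm (v n))\<^sup>2) / N"
  using False by (simp add: average_def norm_divide power_divide field_simps power2_eq_square)
 also have "\<dots> = Re (average (%n. v n * cnj (v n)) N)"
  by (simp add: average_def complex_norm_square[symmetric])
 finally show ?thesis .
qed (simp add: average_def)

text \<open>The sequence is averaged over shifts by \<open>t * l\<close> with \<open>l < H\<close>
  before Cauchy-Schwarz, so only correlations at lags \<open>t * d\<close> enter. The step
  \<open>t\<close> is left free since in \<open>eigen_null\<close> the lags have to be chosen so
  that these correlations can be controlled.\<close>

lemma van_der_corput:
 fixes u :: "nat => complex" and t H N :: nat and C \<delta> :: real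
 assumes C: "\<And>n. n >= 1 ==> norm (u n) <= C" "C >= 0" and H: "H > 0" and \<delta>: "\<delta> >= 0"
  and D: "\<And>d. 1 <= d ==> d < H ==> norm (average (%n. u (n + t * d) * cnj (u n)) N) <= \<delta>"
 shows "norm (average u N) <= 2 * t * H * C / N + sqrt (C\<^sup>2 / H + \<delta> + 2 * t * H * C\<^sup>2 / N)"
proof -
 define v where "v = (%n. (\<Sum>l<H. u (n + t * l)) / of_nat H)"
 define E where "E = \<delta> + 2 * t * H * C\<^sup>2 / N"
 have E: "E >= 0" unfolding E_def using \<delta> by simp
 have av: "average v N = (\<Sum>l<H. average (%n. u (n + t * l)) N) / of_nat H"
  unfolding v_def average_divide average_sum ..
 have one: "norm (average v N - average u N) <= 2 * t * H * C / N"
 proof -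
  have "average v N - average u N = (\<Sum>l<H. average (%n. u (n + t * l)) N - average u N) / of_nat H"
   unfolding av using H by (simp add: sum_subtractf diff_divide_distrib)
  moreover have "norm (\<Sum>l<H. average (%n. u (n + t * l)) N - average u N) <= (\<Sum>l<H. 2 * t * H * C / N)"
  proof (rule sum_norm_le)
   fix l assume "l \<in> {..<H}"
   have "norm (average (%n. u (n + t * l)) N - average u N) <= 2 * (t * l) * C / N" using average_shift[of u C "t * l" N] C by simp
   also have "\<dots> <= 2 * t * H * C / N" using \<open>l \<in> {..<H}\<close> C by (intro divide_right_mono mult_right_mono) (auto simp: mult_left_mono mult.assoc)
   finally show "norm (average (%n. u (n + t * l)) N - average u N) <= 2 * t * H * C / N" .
  qed
  ultimately show ?thesis using H by (simp add: norm_divide divide_le_eq mult.commute)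
 qed
 have pair: "norm (average (%n. u (n + t * l) * cnj (u (n + t * l'))) N) <= E" if "l' < l" "l < H" for l l'
 proof -
  have b: "norm (u (n + t * (l - l')) * cnj (u n)) <= C\<^sup>2" if "n >= 1" for n
   unfolding norm_mult complex_mod_cnj power2_eq_square using C that by (intro mult_mono) auto
  let ?X = "average (%n. u (n + t * l) * cnj (u (n + t * l'))) N" and ?Y = "average (%n. u (n + t * (l - l')) * cnj (u n)) N"
  have e: "t * l' + t * (l - l') = t * l" using that by (simp flip: distrib_left)
  have "norm (average (%n. u (n + t * l' + t * (l - l')) * cnj (u (n + t * l'))) N - average (%n. u (n + t * (l - l')) * cnj (u n)) N) <= 2 * (t * l') * C\<^sup>2 / N"
   using average_shift[of "%n. u (n + t * (l - l')) * cnj (u n)" "C\<^sup>2" "t * l'" N] b by simp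
  also have "\<dots> <= 2 * t * H * C\<^sup>2 / N" using that by (intro divide_right_mono mult_right_mono) (auto simp: mult_left_mono mult.assoc)
  finally have "norm (?X - ?Y) <= 2 * t * H * C\<^sup>2 / N" unfolding add.assoc e .
  moreover have "norm (average (%n. u (n + t * (l - l')) * cnj (u n)) N) <= \<delta>" using that by (intro D) auto
  ultimately show ?thesis unfolding E_def using norm_triangle_sub[of ?X ?Y] by linarith
 qed
 have "average (%n. v n * cnj (v n)) N = (\<Sum>l<H. \<Sum>l'<H. average (%n. u (n + t * l) * cnj (u (n + t * l'))) N) / (of_nat H)\<^sup>2"
  unfolding average_sum[symmetric] average_divide[symmetric] by (simp add: v_def sum_product power2_eq_square)
 then have "norm (average (%n. v n * cnj (v n)) N) = norm (\<Sum>l<H. \<Sum>l'<H. average (%n. u (n + t * l) * cnj (u (n + t * l'))) N) / (real H)\<^sup>2"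
  by (simp add: norm_divide norm_power)
 also have "norm (\<Sum>l<H. \<Sum>l'<H. average (%n. u (n + t * l) * cnj (u (n + t * l'))) N) <= (\<Sum>l<H. \<Sum>l'<H. (if l' = l then C\<^sup>2 else 0) + E)"
 proof (rule sum_norm_le, rule sum_norm_le)
  fix l l' assume *: "l \<in> {..<H}" "l' \<in> {..<H}"
  consider "l = l'" | "l' < l" | "l < l'" by linarith
  then show "norm (average (%n. u (n + t * l) * cnj (u (n + t * l'))) N) <= (if l' = l then C\<^sup>2 else 0) + E"
  proof cases
   case 1
   have "norm (average (%n. u (n + t * l) * cnj (u (n + t * l))) N) <= C\<^sup>2"
    by (rule average_bound) (auto simp: norm_mult power2_eq_square intro!: mult_mono C)
   then show ?thesis using 1 E by simp
  next
   case 2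
   then show ?thesis using pair * by simp
  next
   case 3
   have "cnj (average (%n. u (n + t * l') * cnj (u (n + t * l))) N) = average (%n. u (n + t * l) * cnj (u (n + t * l'))) N"
    by (simp add: average_def mult.commute)
   then have "norm (average (%n. u (n + t * l) * cnj (u (n + t * l'))) N) = norm (average (%n. u (n + t * l') * cnj (u (n + t * l))) N)"
    by (metis complex_mod_cnj)
   then show ?thesis using pair[OF 3] 3 * by simp
  qed
 qed
 also have "\<dots> = H * C\<^sup>2 + H * H * E" using H by (simp add: sum.distrib power2_eq_square algebra_simps)
 finally have "norm (average (%n. v n * cnj (v n)) N) <= (H * C\<^sup>2 + H * H * E) / (real H)\<^sup>2" by (simp add: divide_right_mono)
 also have "\<dots> = C\<^sup>2 / H + E" using H by (simp add: field_simps power2_eq_square)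
 finally have "(norm (average v N))\<^sup>2 <= C\<^sup>2 / H + E"
  using average_square[of v N] complex_Re_le_cmod[of "average (%n. v n * cnj (v n)) N"] by linarith
 then have "norm (average v N) <= sqrt (C\<^sup>2 / H + E)" by (rule real_le_rsqrt)
 then show ?thesis using one norm_triangle_sub[of "average u N" "average v N"] unfolding E_def by (simp add: norm_minus_commute add.assoc)
qed

text \<open>\<open>t\<close> is the first exponent at which \<open>z ^ t\<close> has distance at
  least \<open>1 / (2 * H)\<close> from \<open>1\<close>. As \<open>z\<close> is close to
  \<open>1\<close>, it overshoots little and the distance is at most \<open>1 / H\<close>; hence for
  \<open>l <= H\<close> the sum \<open>\<Sum>k<l. w ^ k\<close> with \<open>w = z ^ t\<close> has
  modulus at least \<open>l / 2\<close>, and the powers of \<open>w\<close> do not return to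
  \<open>1\<close>.\<close>

lemma power_spread:
 fixes z :: complex
 assumes H: "H > 0" and z: "norm z = 1" "z ~= 1" "norm (z - 1) <= 1 / (2 * real H)"
 obtains t where "\<And>l. 1 <= l ==> l <= H ==> 1 / (4 * real H) <= norm (z ^ (t * l) - 1)"
proof -
 have "\<exists>n. norm (z ^ n - 1) >= 1" using unit_powers_near_one[of z] z by (meson not_le)
 moreover have "1 / (2 * real H) <= 1" using H by simp
 ultimately have ex: "\<exists>n. norm (z ^ n - 1) >= 1 / (2 * real H)" by (meson order.trans)
 define t where "t = (LEAST n. norm (z ^ n - 1) >= 1 / (2 * real H))"
 define r where "r = norm (z ^ t - 1)"
 have t: "1 / (2 * real H) <= r" unfolding t_def r_def using LeastI_ex[OF ex] .
 then obtain s where s: "t = Suc s" using H by (cases t) (auto simp: r_def)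
 have "norm (z ^ s - 1) < 1 / (2 * real H)" using not_less_Least[of s "%n. norm (z ^ n - 1) >= 1 / (2 * real H)"] s unfolding t_def by simp
 moreover have eq: "z ^ t - 1 = z * (z ^ s - 1) + (z - 1)" by (simp add: s algebra_simps)
 have "r <= norm (z ^ s - 1) + norm (z - 1)" unfolding r_def eq using z(1) norm_triangle_ineq[of "z * (z ^ s - 1)" "z - 1"] by (simp add: norm_mult)
 ultimately have r: "r <= 1 / real H" using z(3) by simp
 define w where "w = z ^ t"
 have w: "norm w = 1" using z(1) by (simp add: w_def norm_power)
 have lin: "norm (w ^ k - 1) <= k * r" for k
 proof (induction k)
  case (Suc k)
  have eq: "w ^ Suc k - 1 = w * (w ^ k - 1) + (w - 1)" by (simp add: algebra_simps)
  have "norm (w ^ Suc k - 1) <= norm (w ^ k - 1) + r"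
   unfolding eq using norm_triangle_ineq[of "w * (w ^ k - 1)" "w - 1"] w by (simp add: norm_mult r_def w_def)
  then show ?case using Suc by (simp add: algebra_simps)
 qed simp
 show thesis
 proof (rule that[of t])
  fix l assume l: "1 <= l" "l <= H"
  have "(\<Sum>k<l. w ^ k) = of_nat l + (\<Sum>k<l. w ^ k - 1)" by (simp add: sum_subtractf)
  then have "real l - norm (\<Sum>k<l. w ^ k - 1) <= norm (\<Sum>k<l. w ^ k)"
   using norm_diff_ineq[of "of_nat l :: complex" "\<Sum>k<l. w ^ k - 1"] by simp
  moreover have "norm (\<Sum>k<l. w ^ k - 1) <= (\<Sum>k<l. real k / H)"
  proof (rule sum_norm_le)
   fix k
   have "real k * r <= real k * (1 / H)" using r by (intro mult_left_mono) auto
   then show "norm (w ^ k - 1) <= real k / H" using lin[of k] by simp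
  qed
  moreover have "(\<Sum>k<l. real k / H) <= real l / 2"
  proof -
   have "(\<Sum>k<l. real k) = real l * (real l - 1) / 2" by (induction l) (auto simp: field_simps)
   then have "(\<Sum>k<l. real k / H) = real l * (real l - 1) / 2 / H" unfolding sum_divide_distrib[symmetric] by (rule arg_cong)
   also have "\<dots> <= real l * real H / 2 / H" using l by (intro divide_right_mono mult_left_mono) auto
   finally show ?thesis using H by simp
  qed
  ultimately have "1/2 <= norm (\<Sum>k<l. w ^ k)" using l by simp
  then have "1 / (2 * real H) * (1/2) <= norm (w - 1) * norm (\<Sum>k<l. w ^ k)" using t H unfolding w_def r_def by (intro mult_mono) auto
  also have "\<dots> = norm (w ^ l - 1)" by (simp add: power_diff_1_eq norm_mult)
  finally show "1 / (4 * real H) <= norm (z ^ (t * l) - 1)" by (simp add: w_def power_mult)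
 qed
qed

lemma average_geometric:
 fixes z :: complex
 assumes "norm z = 1" "z ~= 1" shows "norm (average (%n. z ^ n) N) <= 2 / norm (z - 1) / N"
proof -
 have "(\<Sum>n=1..N. z ^ n) = z * (\<Sum>n<N. z ^ n)"
  by (simp add: sum_distrib_left sum.atLeast1_atMost_eq)
 also have "\<dots> = z * ((z ^ N - 1) / (z - 1))" using assms(2) by (simp add: geometric_sum)
 finally have "norm (\<Sum>n=1..N. z ^ n) = norm (z ^ N - 1) / norm (z - 1)" using assms(1) by (simp add: norm_mult norm_divide)
 also have "\<dots> <= 2 / norm (z - 1)" using assms(1) norm_triangle_ineq4[of "z ^ N" 1] by (intro divide_right_mono) (auto simp: norm_power)
 finally have "norm (\<Sum>n=1..N. z ^ n) / N <= 2 / norm (z - 1) / N" by (rule divide_right_mono) simp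
 then show ?thesis by (simp add: average_def norm_divide)
qed

subsection \<open>Uniform convergence of the averages along two multiples of \<open>\<tau>\<close>\<close>

context uniform_group
begin

lemma level_char_times: "level_char j \<alpha> ==> level_char j \<beta> ==> level_char j (%x. \<alpha> x * \<beta> x)"
 unfolding level_char_def by (simp add: norm_mult)

lemma level_char_power: "level_char j \<alpha> ==> level_char j (%x. \<alpha> x ^ n)"
 unfolding level_char_def by (simp add: norm_power power_mult_distrib)

lemma level_char_cnj: "level_char j \<alpha> ==> level_char j (%x. cnj (\<alpha> x))"
 unfolding level_char_def by simp

lemma level_char_pow: "level_char j \<alpha> ==> x \<in> L j ==> x [^] (n::nat) \<in> L j \<and> \<alpha> (x [^] n) = \<alpha> x ^ n"
 by (induction n) (auto simp: L_one L_mult level_char_one level_charD(1))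

lemma cont_at_one_times:
 assumes "level_char j \<beta>" "cont_at_one j \<alpha>" "cont_at_one j \<beta>" shows "cont_at_one j (%x. \<alpha> x * \<beta> x)"
 unfolding cont_at_one_def
proof (intro allI impI)
 fix e :: real assume "e > 0"
 obtain d1 where d1: "d1 > 0" "\<forall>x\<in>L j \<inter> B d1. norm (\<alpha> x - 1) < e/2" using cont_at_oneD[OF assms(2), of "e/2"] \<open>e > 0\<close> by auto
 obtain d2 where d2: "d2 > 0" "\<forall>x\<in>L j \<inter> B d2. norm (\<beta> x - 1) < e/2" using cont_at_oneD[OF assms(3), of "e/2"] \<open>e > 0\<close> by auto
 obtain d where d: "d > 0" "B d \<subseteq> B d1" "B d \<subseteq> B d2" using B_both[OF d1(1) d2(1)] by blast
 have "norm (\<alpha> x * \<beta> x - 1) < e" if x: "x \<in> L j \<inter> B d" for x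
 proof -
  have b: "norm (\<beta> x) = 1" "norm (\<alpha> x - 1) < e/2" "norm (\<beta> x - 1) < e/2" using level_charD(2)[OF assms(1)] d d1 d2 x by auto
  have eq: "\<alpha> x * \<beta> x - 1 = (\<alpha> x - 1) * \<beta> x + (\<beta> x - 1)" by (simp add: algebra_simps)
  have "norm (\<alpha> x * \<beta> x - 1) <= norm (\<alpha> x - 1) + norm (\<beta> x - 1)"
   unfolding eq using norm_triangle_ineq[of "(\<alpha> x - 1) * \<beta> x" "\<beta> x - 1"] b(1) by (simp add: norm_mult)
  then show ?thesis using b by simp
 qed
 then show "\<exists>d>0. \<forall>x\<in>L j \<inter> B d. norm (\<alpha> x * \<beta> x - 1) < e" using d(1) by blast
qed

lemma cont_at_one_power: "level_char j \<alpha> ==> cont_at_one j \<alpha> ==> cont_at_one j (%x. \<alpha> x ^ n)"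
proof (induction n)
 case 0
 then show ?case by (auto simp: cont_at_one_def intro: exI[of _ 1])
next
 case (Suc n)
 then show ?case using cont_at_one_times[OF level_char_power, of j \<alpha> \<alpha> n] by simp
qed

lemma cont_at_one_cnj: "cont_at_one j \<alpha> ==> cont_at_one j (%x. cnj (\<alpha> x))"
 unfolding cont_at_one_def by (metis complex_cnj_diff complex_cnj_one complex_mod_cnj)

lemma B_pow: "d > 0 ==> \<exists>e>0. \<forall>u\<in>B e. u [^] (n::nat) \<in> B d"
proof (induction n arbitrary: d)
 case 0
 then show ?case using B_one by (auto intro: exI[of _ 1])
next
 case (Suc n)
 obtain e1 where e1: "e1 > 0" "\<forall>u\<in>B e1. \<forall>v\<in>B e1. u \<otimes> v \<in> B d" using B_mult[OF Suc.prems] by blast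
 obtain e2 where e2: "e2 > 0" "\<forall>u\<in>B e2. u [^] n \<in> B e1" using Suc.IH[OF e1(1)] by blast
 obtain e where "e > 0" "B e \<subseteq> B e1" "B e \<subseteq> B e2" using B_both[OF e1(1) e2(1)] by blast
 then show ?case using e1(2) e2(2) by (intro exI[of _ e]) (auto simp: subset_iff)
qed

lemma char_comm_pow:
 assumes "level_char (Suc i) \<alpha>" "a \<in> carrier G" "g \<in> L i"
 shows "\<alpha> (comm (a [^] (m::nat)) (g [^] (n::nat))) = \<alpha> (comm a g) ^ (m * n)"
proof -
 have gn: "g [^] n \<in> L i" using assms(3) by (induction n) (auto simp: L_one L_mult)
 have "\<alpha> (comm (a [^] m) (g [^] n)) = \<alpha> (comm a (g [^] n)) ^ m"
  using level_char_pow[OF level_char_comm_left[OF assms(1) gn], of a m] assms(2) by simp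
 also have "\<alpha> (comm a (g [^] n)) = \<alpha> (comm a g) ^ n"
  using level_char_pow[OF level_char_comm_right[OF assms(1,2)] assms(3), of n] by simp
 finally show ?thesis by (simp add: power_mult[symmetric] mult.commute)
qed

end

text \<open>Correlations along \<open>p\<close> and \<open>q\<close> will be averages on the square
  of the group, along the powers of \<open>(\<tau>^p, \<tau>^q)\<close>.\<close>

lemma (in uniform_group) square_uniform: "uniform_group (G \<times>\<times> G) (%d. B d \<times> B d)"
proof -
 interpret P: group "G \<times>\<times> G" by (rule DirProd_group[OF is_group is_group])
 show ?thesis
 proof (unfold_locales, goal_cases)
  case (1 d) then show ?case using B_carrier by auto
 next
  case (2 d) then show ?case using B_one by simp
 next
  case (3 d e) then show ?case using B_mono by blast
 next
  case (4 d)
  from B_inv[OF 4] obtain e where "e > 0" "\<forall>u\<in>B e. inv u \<in> B d" by blast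
  then show ?case using B_in by (intro exI[of _ e]) auto
 next
  case (5 d)
  from B_mult[OF 5] obtain e where "e > 0" "\<forall>u\<in>B e. \<forall>v\<in>B e. u \<otimes> v \<in> B d" by blast
  then show ?case by (intro exI[of _ e]) auto
 next
  case (6 d g)
  obtain g1 g2 where g: "g = (g1, g2)" "g1 \<in> carrier G" "g2 \<in> carrier G" using 6 by auto
  obtain e1 where e1: "e1 > 0" "\<forall>u\<in>B e1. g1 \<otimes> u \<otimes> inv g1 \<in> B d" using B_conj 6 g by blast
  obtain e2 where e2: "e2 > 0" "\<forall>u\<in>B e2. g2 \<otimes> u \<otimes> inv g2 \<in> B d" using B_conj 6 g by blast
  obtain e where "e > 0" "B e \<subseteq> B e1" "B e \<subseteq> B e2" using B_both[OF e1(1) e2(1)] by blast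
  then show ?case using e1(2) e2(2) g by (intro exI[of _ e]) auto
 qed
qed

lemma (in cocompact) square_cocompact: "cocompact (G \<times>\<times> G) (%d. B d \<times> B d) (\<Gamma> \<times> \<Gamma>)"
proof -
 interpret P: uniform_group "G \<times>\<times> G" "%d. B d \<times> B d" by (rule square_uniform)
 show ?thesis
 proof (intro cocompact.intro cocompact_axioms.intro P.uniform_group_axioms, goal_cases)
  case 1 then show ?case using DirProd_subgroups[OF is_group \<Gamma> is_group \<Gamma>] .
 next
  case (2 d)
  obtain S where S: "finite S" "S \<subseteq> carrier G" "\<forall>g\<in>carrier G. \<exists>u\<in>B d. \<exists>s\<in>S. \<exists>\<gamma>\<in>\<Gamma>. g = u \<otimes> s \<otimes> \<gamma>" using cover[OF 2] by blast
  have "\<exists>u\<in>B d \<times> B d. \<exists>s\<in>S \<times> S. \<exists>\<gamma>\<in>\<Gamma> \<times> \<Gamma>. g = u \<otimes>\<^bsub>G \<times>\<times> G\<^esub> s \<otimes>\<^bsub>G \<times>\<times> G\<^esub> \<gamma>" if "g \<in> carrier (G \<times>\<times> G)" for g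
  proof -
   obtain g1 g2 where g: "g = (g1, g2)" "g1 \<in> carrier G" "g2 \<in> carrier G" using \<open>g \<in> carrier (G \<times>\<times> G)\<close> by auto
   obtain u s \<gamma> where 1: "u \<in> B d" "s \<in> S" "\<gamma> \<in> \<Gamma>" "g1 = u \<otimes> s \<otimes> \<gamma>" using S(3) g by blast
   obtain u' s' \<gamma>' where 2: "u' \<in> B d" "s' \<in> S" "\<gamma>' \<in> \<Gamma>" "g2 = u' \<otimes> s' \<otimes> \<gamma>'" using S(3) g by blast
   show ?thesis using 1 2 g by (intro bexI[of _ "(u, u')"] bexI[of _ "(s, s')"] bexI[of _ "(\<gamma>, \<gamma>')"]) auto
  qed
  then show ?case using S by (intro exI[of _ "S \<times> S"]) auto
 qed
qed

lemma norm_unit_combination: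
 fixes z a b c d :: complex
 assumes "norm z = 1" shows "norm (z * (a * cnj b + c * cnj d)) <= norm a * norm b + norm c * norm d"
proof -
 have "norm (z * (a * cnj b + c * cnj d)) = norm (a * cnj b + c * cnj d)" using assms by (simp add: norm_mult)
 also have "\<dots> <= norm (a * cnj b) + norm (c * cnj d)" by (rule norm_triangle_ineq)
 finally show ?thesis by (simp add: norm_mult)
qed

text \<open>At a point \<open>w\<close> where \<open>F\<close> does not vanish, the eigenvalue
  inherits invariance and continuity from \<open>F\<close>. For \<open>c\<close> in
  \<open>\<Gamma>\<close>, right translation by \<open>c\<close> is left translation by
  \<open>c\<close> up to a commutator in \<open>N\<close>.\<close>

lemma (in cocompact) eigenfunction_char:
 assumes Z: "subgroup Z G" and NZ: "N \<subseteq> Z" and central: "\<And>g z. g \<in> carrier G ==> z \<in> Z ==> comm g z \<in> N"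
  and F: "nice N F" "eigenfunction Z \<omega> F" and w: "w \<in> carrier G" "F w ~= 0"
 shows "c \<in> N ==> \<omega> c = 1" "c \<in> Z ==> c \<in> \<Gamma> ==> \<omega> c = 1"
  "e > 0 ==> \<exists>d>0. \<forall>u\<in>B d \<inter> Z. norm (\<omega> u - 1) < e"
proof -
 have eq: "F (c \<otimes> w) = \<omega> c * F w" if "c \<in> Z" for c using F(2) that w(1) unfolding eigenfunction_def by blast
 show "c \<in> N ==> \<omega> c = 1" using eq[of c] niceD(4)[OF F(1) w(1), of c] NZ w(2) by auto
 show "\<omega> c = 1" if c: "c \<in> Z" "c \<in> \<Gamma>"
 proof -
  have cc: "c \<in> carrier G" using subgroup.mem_carrier[OF Z c(1)] .
  have "w \<otimes> c = comm w c \<otimes> (c \<otimes> w)"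
  proof -
   have "comm w c \<otimes> (c \<otimes> w) = w \<otimes> c \<otimes> inv w \<otimes> (inv c \<otimes> c) \<otimes> w" using cc w(1) by (simp only: comm_def m_assoc m_closed inv_closed)
   then show ?thesis using cc w(1) by (simp add: m_assoc)
  qed
  then have "F w = F (c \<otimes> w)"
   using niceD(3)[OF F(1) w(1) c(2)] niceD(4)[OF F(1), of "c \<otimes> w" "comm w c"] central[OF w(1) c(1)] cc w(1) by simp
  then show ?thesis using eq[OF c(1)] w(2) by simp
 qed
 show "\<exists>d>0. \<forall>u\<in>B d \<inter> Z. norm (\<omega> u - 1) < e" if e: "e > 0"
 proof -
  obtain d where d: "d > 0" "\<forall>u\<in>B d. \<forall>v\<in>carrier G. norm (F (u \<otimes> v) - F v) < e * norm (F w)"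
   using niceD(2)[OF F(1), of "e * norm (F w)"] e w(2) by auto
  have "norm (\<omega> u - 1) < e" if u: "u \<in> B d \<inter> Z" for u
  proof -
   have "norm (\<omega> u - 1) * norm (F w) = norm (F (u \<otimes> w) - F w)" using eq[of u] u by (simp add: norm_mult[symmetric] left_diff_distrib)
   also have "\<dots> < e * norm (F w)" using d(2) u w(1) by blast
   finally show ?thesis using w(2) by simp
  qed
  then show ?thesis using d(1) by blast
 qed
qed

context good_group
begin

sublocale co: cocompact G B \<Gamma>
 by (intro cocompact.intro cocompact_axioms.intro uniform_group_axioms \<Gamma> cover)

abbreviation "GG \<equiv> G \<times>\<times> G"

sublocale H: cocompact "GG" "%d. B d \<times> B d" "\<Gamma> \<times> \<Gamma>"
 by (rule co.square_cocompact)

abbreviation "LL j \<equiv> L j \<times> L j"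

lemma H_comm: "g \<in> carrier G ==> g' \<in> carrier G ==> z \<in> carrier G ==> z' \<in> carrier G ==> H.comm (g, g') (z, z') = (comm g z, comm g' z')"
 by (simp add: H.comm_def comm_def)

lemma LL_facts:
 shows "subgroup (LL j) GG" "LL (Suc j) \<subseteq> LL j"
  "g \<in> carrier GG ==> z \<in> LL j ==> H.comm g z \<in> LL (Suc j)"
 using DirProd_subgroups[OF is_group L_subgroup is_group L_subgroup] L_antimono L_comm
 by (auto simp: H_comm L_carrier)

text \<open>No relation between \<open>\<alpha>\<close> and \<open>\<beta>\<close> is imposed: the
  case aimed at is a character and its conjugate, but the decomposition in
  \<open>dilate_invariance\<close> produces other pairs.\<close>

definition eigen2 :: "nat => ('a => complex) => ('a => complex) => ('a \<times> 'a => complex) => bool" where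
 "eigen2 j \<alpha> \<beta> F \<longleftrightarrow> H.nice (LL (Suc j)) F \<and>
   level_char j \<alpha> \<and> cont_at_one j \<alpha> \<and> (\<forall>x\<in>\<Gamma> \<inter> L j. \<alpha> x = 1) \<and>
   level_char j \<beta> \<and> cont_at_one j \<beta> \<and> (\<forall>x\<in>\<Gamma> \<inter> L j. \<beta> x = 1) \<and>
   (\<forall>c\<in>L j. \<forall>c'\<in>L j. \<forall>w\<in>carrier G. \<forall>w'\<in>carrier G. F (c \<otimes> w, c' \<otimes> w') = \<alpha> c * \<beta> c' * F (w, w'))"

lemma eigen2D:
 assumes "eigen2 j \<alpha> \<beta> F"
 shows "H.nice (LL (Suc j)) F" "level_char j \<alpha>" "cont_at_one j \<alpha>" "level_char j \<beta>" "cont_at_one j \<beta>"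
  "x \<in> \<Gamma> ==> x \<in> L j ==> \<alpha> x = 1" "x \<in> \<Gamma> ==> x \<in> L j ==> \<beta> x = 1"
  "c \<in> L j ==> c' \<in> L j ==> w \<in> carrier G ==> w' \<in> carrier G ==> F (c \<otimes> w, c' \<otimes> w') = \<alpha> c * \<beta> c' * F (w, w')"
 using assms unfolding eigen2_def by blast+

lemma eigen2_exists:
 assumes F: "H.nice (LL (Suc j)) F" "H.eigenfunction (LL j) \<omega> F" and w: "w \<in> carrier GG" "F w ~= 0"
 shows "\<exists>\<alpha> \<beta>. eigen2 j \<alpha> \<beta> F"
proof -
 have ch: "c \<in> LL (Suc j) ==> \<omega> c = 1" "c \<in> LL j ==> c \<in> \<Gamma> \<times> \<Gamma> ==> \<omega> c = 1"
  "e > 0 ==> \<exists>d>0. \<forall>u\<in>B d \<times> B d \<inter> LL j. norm (\<omega> u - 1) < e" for c e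
  using H.eigenfunction_char[OF LL_facts(1,2) _ F w] LL_facts(3) by auto
 note one = L_one[of j] L_one[of "Suc j"] subgroup.one_closed[OF \<Gamma>]
 have om: "\<omega> (c \<otimes> d, c' \<otimes> d') = \<omega> (c, c') * \<omega> (d, d')" if "c \<in> L j" "c' \<in> L j" "d \<in> L j" "d' \<in> L j" for c c' d d'
  using F(2) that unfolding H.eigenfunction_def by force
 have n1: "norm (\<omega> (c, c')) = 1" if "c \<in> L j" "c' \<in> L j" for c c' using F(2) that unfolding H.eigenfunction_def by blast
 have cont: "\<exists>d>0. \<forall>x\<in>L j \<inter> B d. norm (\<omega> (x, \<one>) - 1) < e \<and> norm (\<omega> (\<one>, x) - 1) < e" if e: "e > 0" for e
 proof -
  obtain d where "d > 0" "\<forall>u\<in>B d \<times> B d \<inter> LL j. norm (\<omega> u - 1) < e" using ch(3)[OF e] by blast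
  then show ?thesis using one B_one by (intro exI[of _ d]) auto
 qed
 have "eigen2 j (%c. \<omega> (c, \<one>)) (%c. \<omega> (\<one>, c)) F"
  unfolding eigen2_def
 proof (intro conjI ballI)
  show "level_char j (%c. \<omega> (c, \<one>))" "level_char j (%c. \<omega> (\<one>, c))"
   unfolding level_char_def using om[of _ \<one> _ \<one>] om[of \<one> _ \<one> _] n1 ch(1) one by auto
  show "cont_at_one j (%c. \<omega> (c, \<one>))" "cont_at_one j (%c. \<omega> (\<one>, c))"
   unfolding cont_at_one_def using cont by meson+
  show "\<omega> (x, \<one>) = 1" "\<omega> (\<one>, x) = 1" if "x \<in> \<Gamma> \<inter> L j" for x using ch(2) that one by auto
  fix c c' w w' assume *: "c \<in> L j" "c' \<in> L j" "w \<in> carrier G" "w' \<in> carrier G"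
  have "F ((c, c') \<otimes>\<^bsub>GG\<^esub> (w, w')) = \<omega> (c, c') * F (w, w')" using F(2) * unfolding H.eigenfunction_def by force
  moreover have "\<omega> (c, c') = \<omega> (c, \<one>) * \<omega> (\<one>, c')" using om[of c \<one> \<one> c'] * one L_carrier by auto
  ultimately show "F (c \<otimes> w, c' \<otimes> w') = \<omega> (c, \<one>) * \<omega> (\<one>, c') * F (w, w')" by simp
 qed (rule F(1))
 then show ?thesis by blast
qed

definition unif_null :: "(nat => 'a \<times> 'a => complex) => bool" where
 "unif_null y \<longleftrightarrow> (\<forall>e>0. \<exists>N0. \<forall>N\<ge>N0. \<forall>w\<in>carrier GG. norm (y N w) <= e)"

lemma unif_null_mult:
 assumes "unif_null y" shows "unif_null (%N w. c * y N w)"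
 unfolding unif_null_def
proof (intro allI impI)
 fix e :: real assume "e > 0"
 define K where "K = 1 + norm c"
 have K: "K > 0" unfolding K_def by (simp add: add_pos_nonneg)
 obtain N0 where N0: "\<forall>N\<ge>N0. \<forall>w\<in>carrier GG. norm (y N w) <= e / K"
  using assms K \<open>e > 0\<close> unfolding unif_null_def by (meson divide_pos_pos)
 have "norm (c * y N w) <= e" if "N >= N0" "w \<in> carrier GG" for N w
 proof -
  have "norm (c * y N w) <= K * (e / K)" unfolding norm_mult using N0 that K by (intro mult_mono) (auto simp: K_def)
  then show ?thesis using K by simp
 qed
 then show "\<exists>N0. \<forall>N\<ge>N0. \<forall>w\<in>carrier GG. norm (c * y N w) <= e" by blast
qed

lemma unif_null_sum:
 assumes "finite I" "\<And>i. i \<in> I ==> unif_null (y i)" shows "unif_null (%N w. \<Sum>i\<in>I. y i N w)"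
 using assms
proof (induction I rule: finite_induct)
 case (insert i I)
 show ?case unfolding unif_null_def
 proof (intro allI impI)
  fix e :: real assume "e > 0"
  then have e2: "e/2 > 0" by simp
  obtain N1 where N1: "\<forall>N\<ge>N1. \<forall>w\<in>carrier GG. norm (y i N w) <= e/2"
   using insert.prems[of i] e2 unfolding unif_null_def by blast
  have "unif_null (%N w. \<Sum>i\<in>I. y i N w)" using insert by blast
  then obtain N2 where N2: "\<forall>N\<ge>N2. \<forall>w\<in>carrier GG. norm (\<Sum>i\<in>I. y i N w) <= e/2"
   using e2 unfolding unif_null_def by blast
  have "norm (\<Sum>i\<in>insert i I. y i N w) <= e" if "N >= max N1 N2" "w \<in> carrier GG" for N w
  proof -
   have "norm (y i N w) <= e/2" "norm (\<Sum>i\<in>I. y i N w) <= e/2" using N1 N2 that by auto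
   then show ?thesis using insert.hyps norm_triangle_ineq[of "y i N w" "\<Sum>i\<in>I. y i N w"] by simp
  qed
  then show "\<exists>N0. \<forall>N\<ge>N0. \<forall>w\<in>carrier GG. norm (\<Sum>i\<in>insert i I. y i N w) <= e" by blast
 qed
qed (simp add: unif_null_def)

context
 fixes p q :: nat
begin

definition shift :: "nat => 'a \<times> 'a => 'a \<times> 'a" where
 "shift n w = (\<tau> [^] (p * n) \<otimes> fst w, \<tau> [^] (q * n) \<otimes> snd w)"

text \<open>With these exponents, exchanging \<open>dilate j\<close> and \<open>shift m\<close>
  produces powers of \<open>[\<tau>, c]\<close> with exponents \<open>p ^ Suc j * m\<close> and
  \<open>q ^ Suc j * m\<close>: the exponents belonging to the next level.\<close>

definition dilate :: "nat => 'a => 'a \<times> 'a => 'a \<times> 'a" where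
 "dilate j c w = (c [^] (p ^ j) \<otimes> fst w, c [^] (q ^ j) \<otimes> snd w)"

definition mean_along :: "('a \<times> 'a => complex) => nat => 'a \<times> 'a => complex" where
 "mean_along F N w = average (%n. F (shift n w)) N"

lemma shift_closed [simp]: "w \<in> carrier GG ==> shift n w \<in> carrier GG"
 and dilate_closed [simp]: "w \<in> carrier GG ==> c \<in> carrier G ==> dilate j c w \<in> carrier GG"
 using \<tau> by (auto simp: shift_def dilate_def)

lemma shift_add: "w \<in> carrier GG ==> shift (m + n) w = shift m (shift n w)"
 using \<tau> by (auto simp: shift_def distrib_left nat_pow_mult[symmetric] m_assoc)

text \<open>Modulo \<open>L (i + 2)\<close>, moving \<open>shift m\<close> past the dilation of \<open>g \<in> L i\<close> costs a power of \<open>[\<tau>, g]\<close>.\<close>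

lemma eigen2_dilate:
 assumes F: "eigen2 (Suc i) \<alpha> \<beta> F" and g: "g \<in> L i" and w: "w \<in> carrier GG"
 shows "F (shift m (dilate (Suc i) g w)) = (\<alpha> (comm \<tau> g) ^ (p ^ (Suc (Suc i))) * \<beta> (comm \<tau> g) ^ (q ^ (Suc (Suc i)))) ^ m * F (dilate (Suc i) g (shift m w))"
proof -
 note f = eigen2D[OF F]
 have gc: "g \<in> carrier G" using L_carrier[OF g] .
 have gn: "g [^] (n::nat) \<in> L i" for n using g by (induction n) (auto simp: L_one L_mult)
 have swap: "\<tau> [^] a \<otimes> (g [^] b \<otimes> x) = comm (\<tau> [^] a) (g [^] b) \<otimes> (g [^] b \<otimes> (\<tau> [^] a \<otimes> x))" if "x \<in> carrier G" for a b :: nat and x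
 proof -
  let ?a = "\<tau> [^] a" and ?b = "g [^] b"
  have c: "?a \<in> carrier G" "?b \<in> carrier G" using \<tau> gc by auto
  have "comm ?a ?b \<otimes> (?b \<otimes> (?a \<otimes> x)) = ?a \<otimes> ?b \<otimes> inv ?a \<otimes> (inv ?b \<otimes> ?b) \<otimes> ?a \<otimes> x" using c that by (simp only: comm_def m_assoc m_closed inv_closed)
  also have "\<dots> = ?a \<otimes> ?b \<otimes> (inv ?a \<otimes> ?a) \<otimes> x" using c that by (simp only: l_inv r_one m_assoc m_closed inv_closed one_closed l_one)
  also have "\<dots> = ?a \<otimes> (?b \<otimes> x)" using c that by (simp add: m_assoc)
  finally show ?thesis ..
 qed
 have cl: "comm (\<tau> [^] a) (g [^] b) \<in> L (Suc i)" for a b :: nat using \<tau> gn by (intro L_comm) auto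
 obtain x y where xy: "w = (x, y)" "x \<in> carrier G" "y \<in> carrier G" using w by auto
 have "F (shift m (dilate (Suc i) g w)) = \<alpha> (comm (\<tau> [^] (p * m)) (g [^] (p ^ Suc i))) * \<beta> (comm (\<tau> [^] (q * m)) (g [^] (q ^ Suc i))) * F (dilate (Suc i) g (shift m w))"
  unfolding xy shift_def dilate_def fst_conv snd_conv swap[OF xy(2)] swap[OF xy(3)]
  using f(8)[OF cl cl] xy \<tau> gc by simp
 also have "\<alpha> (comm (\<tau> [^] (p * m)) (g [^] (p ^ Suc i))) = (\<alpha> (comm \<tau> g) ^ (p ^ Suc (Suc i))) ^ m"
  unfolding char_comm_pow[OF f(2) \<tau> g] by (simp add: power_mult[symmetric] mult_ac)
 also have "\<beta> (comm (\<tau> [^] (q * m)) (g [^] (q ^ Suc i))) = (\<beta> (comm \<tau> g) ^ (q ^ Suc (Suc i))) ^ m"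
  unfolding char_comm_pow[OF f(4) \<tau> g] by (simp add: power_mult[symmetric] mult_ac)
 finally show ?thesis by (simp add: power_mult_distrib)
qed

lemma level_char_conj:
 assumes "level_char j \<xi>" "c \<in> L j" "a \<in> carrier G" shows "\<xi> (a \<otimes> c \<otimes> inv a) = \<xi> c"
proof -
 have "a \<otimes> c \<otimes> inv a = comm a c \<otimes> c" using assms L_carrier by (simp add: comm_def m_assoc)
 moreover have "comm a c \<in> L (Suc j)" using assms by (intro L_comm)
 ultimately show ?thesis using level_charD[OF assms(1)] L_antimono assms(2) by simp
qed

lemma eigen2_dilate_same:
 assumes F: "eigen2 j \<alpha> \<beta> F" and c: "c \<in> L j" and w: "w \<in> carrier GG"
 shows "F (shift n (dilate (Suc j) c w)) = (\<alpha> c ^ (p ^ Suc j) * \<beta> c ^ (q ^ Suc j)) * F (shift n w)"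
proof -
 note f = eigen2D[OF F]
 have cc: "c \<in> carrier G" using L_carrier[OF c] .
 have cn: "c [^] (n::nat) \<in> L j" for n using c by (induction n) (auto simp: L_one L_mult)
 obtain x y where xy: "w = (x, y)" "x \<in> carrier G" "y \<in> carrier G" using w by auto
 have swap: "\<tau> [^] a \<otimes> (c [^] b \<otimes> x) = (\<tau> [^] a \<otimes> c [^] b \<otimes> inv (\<tau> [^] a)) \<otimes> (\<tau> [^] a \<otimes> x)" if "x \<in> carrier G" for a b :: nat and x
  using that \<tau> cc by (simp add: m_assoc) (simp add: m_assoc[symmetric])
 have conj: "\<tau> [^] a \<otimes> c [^] b \<otimes> inv (\<tau> [^] a) \<in> L j" for a b :: nat using \<tau> cn by (intro L_conj) auto
 have val: "\<xi> (\<tau> [^] a \<otimes> c [^] b \<otimes> inv (\<tau> [^] a)) = \<xi> c ^ b" if "level_char j \<xi>" for \<xi> and a b :: nat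
  using level_char_conj[OF that cn] level_char_pow[OF that c] \<tau> by simp
 show ?thesis
  unfolding xy shift_def dilate_def fst_conv snd_conv swap[OF xy(2)] swap[OF xy(3)]
  using f(8)[OF conj conj] xy \<tau> by (simp add: val f)
qed

text \<open>Decompose \<open>\<Phi>\<close> into eigenfunctions of \<open>LL j\<close>. Dilation by
  \<open>c\<close> multiplies the average of each by a constant; if this is not \<open>1\<close>,
  \<open>IH\<close> makes the average itself tend to \<open>0\<close>.\<close>

lemma dilate_invariance:
 assumes IH: "\<And>\<alpha> \<beta> F c. eigen2 j \<alpha> \<beta> F ==> c \<in> L j ==> \<alpha> c ^ (p ^ Suc j) * \<beta> c ^ (q ^ Suc j) ~= 1 ==> unif_null (mean_along F)"
  and \<Phi>: "H.nice (LL (Suc j)) \<Phi>" and c: "c \<in> L j"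
 shows "unif_null (%N w. mean_along \<Phi> N (dilate (Suc j) c w) - mean_along \<Phi> N w)"
 unfolding unif_null_def
proof (intro allI impI)
 fix e :: real assume e: "e > 0"
 interpret CA: central_action "GG" "%d. B d \<times> B d" "\<Gamma> \<times> \<Gamma>" "LL j" "LL (Suc j)" \<Phi>
  using LL_facts(3) by (intro central_action.intro central_action_axioms.intro H.cocompact_axioms LL_facts \<Phi>) auto
 obtain X F \<omega> where X: "finite X" "\<And>i. i \<in> X ==> H.nice (LL (Suc j)) (F i)" "\<And>i. i \<in> X ==> H.eigenfunction (LL j) (\<omega> i) (F i)"
  and appr: "\<And>w. w \<in> carrier GG ==> norm (\<Phi> w - (\<Sum>i\<in>(X :: (('a \<times> 'a) set => complex) set). F i w)) <= e/4"
  using CA.eigen_decomposition[of "e/4"] e by auto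
 have cc: "c \<in> carrier G" using L_carrier[OF c] .
 define y where "y = (%i N w. mean_along (F i) N (dilate (Suc j) c w) - mean_along (F i) N w)"
 have "unif_null (y i)" if i: "i \<in> X" for i
 proof (cases "\<forall>w\<in>carrier GG. F i w = 0")
  case True
  have z: "mean_along (F i) N w = 0" if "w \<in> carrier GG" for N w
  proof -
   have "F i (shift n w) = 0" for n using bspec[OF True shift_closed[OF that]] .
   then show ?thesis by (simp add: mean_along_def average_def)
  qed
  have "y i N w = 0" if "w \<in> carrier GG" for N w
   unfolding y_def z[OF that] z[OF dilate_closed[OF that cc]] by simp
  then show ?thesis unfolding unif_null_def by (metis less_imp_le norm_zero)
 next
  case False
  then obtain \<alpha> \<beta> where ab: "eigen2 j \<alpha> \<beta> (F i)" using eigen2_exists X(2,3) i by blast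
  let ?r = "\<alpha> c ^ (p ^ Suc j) * \<beta> c ^ (q ^ Suc j)"
  have y: "y i N w = (?r - 1) * mean_along (F i) N w" if "w \<in> carrier GG" for N w
   unfolding y_def mean_along_def eigen2_dilate_same[OF ab c that] average_scale by (simp add: left_diff_distrib)
  have "unif_null (%N w. (?r - 1) * mean_along (F i) N w)"
  proof (cases "?r = 1")
   case False
   then show ?thesis using IH[OF ab c] unif_null_mult by blast
  qed (simp add: unif_null_def)
  then show ?thesis unfolding unif_null_def using y by simp
 qed
 then have "unif_null (%N w. \<Sum>i\<in>X. y i N w)" using X(1) by (intro unif_null_sum) auto
 then obtain N0 where N0: "\<forall>N\<ge>N0. \<forall>w\<in>carrier GG. norm (\<Sum>i\<in>X. y i N w) <= e/2" using e unfolding unif_null_def by (meson half_gt_zero)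
 show "\<exists>N0. \<forall>N\<ge>N0. \<forall>w\<in>carrier GG. norm (mean_along \<Phi> N (dilate (Suc j) c w) - mean_along \<Phi> N w) <= e"
 proof (intro exI allI impI ballI)
  fix N w assume N: "N >= N0" and w: "w \<in> carrier GG"
  have cl: "norm (mean_along \<Phi> N w - (\<Sum>i\<in>X. mean_along (F i) N w)) <= e/4" if "w \<in> carrier GG" for w
   unfolding mean_along_def average_sum[symmetric] average_diff[symmetric] using appr[OF shift_closed[OF that]] e by (intro average_bound) auto
  let ?a = "mean_along \<Phi> N (dilate (Suc j) c w) - (\<Sum>i\<in>X. mean_along (F i) N (dilate (Suc j) c w))"
  let ?b = "\<Sum>i\<in>X. y i N w" and ?c = "mean_along \<Phi> N w - (\<Sum>i\<in>X. mean_along (F i) N w)"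
  have "norm ?a <= e/4" "norm ?b <= e/2" "norm ?c <= e/4" using cl[OF w] cl[OF dilate_closed[OF w cc]] N0 N w by blast+
  then have "norm ((?a + ?b) - ?c) <= e" using norm_triangle_ineq4[of "?a + ?b" ?c] norm_triangle_ineq[of ?a ?b] by linarith
  moreover have eq: "mean_along \<Phi> N (dilate (Suc j) c w) - mean_along \<Phi> N w = (?a + ?b) - ?c" by (simp add: y_def sum_subtractf)
  ultimately show "norm (mean_along \<Phi> N (dilate (Suc j) c w) - mean_along \<Phi> N w) <= e" by (simp only: eq)
 qed
qed

text \<open>Conjugation by powers of \<open>\<tau>\<close> does not affect the eigenvalues, and they
  cancel against their conjugates; so the correlations in van der Corput's inequality live one level
  below \<open>F\<close>.\<close>

lemma nice_correlation:
 assumes F: "eigen2 (Suc i) \<alpha> \<beta> F"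
 shows "H.nice (LL (Suc i)) (%w. F (shift h w) * cnj (F w))"
proof -
 note f = eigen2D[OF F]
 let ?a = "\<tau> [^] (p * h)" and ?b = "\<tau> [^] (q * h)"
 have ab: "?a \<in> carrier G" "?b \<in> carrier G" using \<tau> by auto
 have sh: "shift h (c \<otimes> x, c' \<otimes> y) = (?a \<otimes> c \<otimes> inv ?a, ?b \<otimes> c' \<otimes> inv ?b) \<otimes>\<^bsub>GG\<^esub> shift h (x, y)"
  if "c \<in> carrier G" "c' \<in> carrier G" "x \<in> carrier G" "y \<in> carrier G" for c c' x y
  using that ab by (simp add: shift_def m_assoc) (simp add: m_assoc[symmetric])
 have nice: "H.nice {} (%w. F (shift h w))" unfolding H.nice_def
 proof (intro conjI allI impI)
  show "\<exists>C. \<forall>w\<in>carrier GG. norm (F (shift h w)) <= C" using H.niceD(1)[OF f(1)] shift_closed by blast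
  fix e :: real assume "e > 0"
  then obtain d where d: "d > 0" "\<forall>u\<in>B d \<times> B d. \<forall>w\<in>carrier GG. norm (F (u \<otimes>\<^bsub>GG\<^esub> w) - F w) < e"
   using H.niceD(2)[OF f(1)] by blast
  obtain d1 where d1: "d1 > 0" "\<forall>u\<in>B d1. ?a \<otimes> u \<otimes> inv ?a \<in> B d" using B_conj[OF d(1) ab(1)] by blast
  obtain d2 where d2: "d2 > 0" "\<forall>u\<in>B d2. ?b \<otimes> u \<otimes> inv ?b \<in> B d" using B_conj[OF d(1) ab(2)] by blast
  obtain d3 where d3: "d3 > 0" "B d3 \<subseteq> B d1" "B d3 \<subseteq> B d2" using B_both[OF d1(1) d2(1)] by blast
  have "norm (F (shift h (u \<otimes>\<^bsub>GG\<^esub> w)) - F (shift h w)) < e" if u: "u \<in> B d3 \<times> B d3" and w: "w \<in> carrier GG" for u w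
  proof -
   obtain x y c c' where xy: "w = (x, y)" "x \<in> carrier G" "y \<in> carrier G" "u = (c, c')" "c \<in> B d3" "c' \<in> B d3" using u w by auto
   have "(?a \<otimes> c \<otimes> inv ?a, ?b \<otimes> c' \<otimes> inv ?b) \<in> B d \<times> B d" using xy d1 d2 d3 by blast
   then have "norm (F ((?a \<otimes> c \<otimes> inv ?a, ?b \<otimes> c' \<otimes> inv ?b) \<otimes>\<^bsub>GG\<^esub> shift h w) - F (shift h w)) < e"
    using d(2) shift_closed[OF w] by blast
   then show ?thesis using sh[of c c' x y] B_in xy by simp
  qed
  then show "\<exists>d>0. \<forall>u\<in>B d \<times> B d. \<forall>w\<in>carrier GG. norm (F (shift h (u \<otimes>\<^bsub>GG\<^esub> w)) - F (shift h w)) < e" using d3(1) by blast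
 next
  show "\<forall>w\<in>carrier GG. \<forall>\<gamma>\<in>\<Gamma> \<times> \<Gamma>. F (shift h (w \<otimes>\<^bsub>GG\<^esub> \<gamma>)) = F (shift h w)"
  proof (intro ballI)
   fix w \<gamma> assume w: "w \<in> carrier GG" and g: "\<gamma> \<in> \<Gamma> \<times> \<Gamma>"
   have "shift h (w \<otimes>\<^bsub>GG\<^esub> \<gamma>) = shift h w \<otimes>\<^bsub>GG\<^esub> \<gamma>" using w g \<Gamma>_carrier ab by (auto simp: shift_def m_assoc)
   then show "F (shift h (w \<otimes>\<^bsub>GG\<^esub> \<gamma>)) = F (shift h w)" using H.niceD(3)[OF f(1) shift_closed[OF w] g] by simp
  qed
 qed simp
 show ?thesis
 proof (rule H.niceI[OF H.nice_mult_cnj[OF nice f(1)]])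
  fix w n assume w: "w \<in> carrier GG" and n: "n \<in> LL (Suc i)"
  obtain x y c c' where xy: "w = (x, y)" "x \<in> carrier G" "y \<in> carrier G" "n = (c, c')" "c \<in> L (Suc i)" "c' \<in> L (Suc i)" using n w by auto
  have cc: "c \<in> carrier G" "c' \<in> carrier G" using xy L_carrier by auto
  have cj: "?a \<otimes> c \<otimes> inv ?a \<in> L (Suc i)" "?b \<otimes> c' \<otimes> inv ?b \<in> L (Suc i)" using L_conj xy ab by auto
  have u: "\<alpha> c * cnj (\<alpha> c) = 1" "\<beta> c' * cnj (\<beta> c') = 1" using level_charD(2)[OF f(2)] level_charD(2)[OF f(4)] xy by (simp_all add: complex_norm_square[symmetric])
  have "F (shift h (n \<otimes>\<^bsub>GG\<^esub> w)) = \<alpha> c * \<beta> c' * F (shift h w)"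
   using sh[OF cc xy(2,3)] f(8)[OF cj] xy ab by (simp add: shift_def level_char_conj[OF f(2)] level_char_conj[OF f(4)])
  moreover have "F (n \<otimes>\<^bsub>GG\<^esub> w) = \<alpha> c * \<beta> c' * F w" using f(8) xy by simp
  ultimately have "F (shift h (n \<otimes>\<^bsub>GG\<^esub> w)) * cnj (F (n \<otimes>\<^bsub>GG\<^esub> w)) = (\<alpha> c * cnj (\<alpha> c)) * (\<beta> c' * cnj (\<beta> c')) * (F (shift h w) * cnj (F w))"
   by (simp add: mult_ac)
  then show "F (shift h (n \<otimes>\<^bsub>GG\<^esub> w)) * cnj (F (n \<otimes>\<^bsub>GG\<^esub> w)) = F (shift h w) * cnj (F w)" unfolding u by simp
 qed
qed

text \<open>At level 0 the orbit gives a geometric progression with ratio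
  \<open>\<rho> \<tau>\<close>. Above it, let \<open>\<Lambda> = \<rho> (comm \<tau> g)\<close>:
  dilation by a small \<open>g\<close> multiplies the correlation of \<open>F\<close> at lag
  \<open>h\<close> by about \<open>\<Lambda> ^ h\<close>, yet by \<open>dilate_invariance\<close> it
  does not change the average of this correlation asymptotically. So the average is small at every
  lag for which \<open>\<Lambda> ^ h\<close> is away from \<open>1\<close>.\<close>

theorem eigen_null:
 assumes "eigen2 j \<alpha> \<beta> F" "c \<in> L j" "\<alpha> c ^ (p ^ Suc j) * \<beta> c ^ (q ^ Suc j) ~= 1"
 shows "unif_null (mean_along F)"
 using assms
proof (induction j arbitrary: \<alpha> \<beta> F c)
 case (0 \<alpha> \<beta> F c)
 note f = eigen2D[OF 0(1)]
 define \<rho> where "\<rho> = (%x. \<alpha> x ^ p * \<beta> x ^ q)"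
 have \<rho>: "level_char 0 \<rho>" "cont_at_one 0 \<rho>"
  unfolding \<rho>_def using f by (auto intro!: level_char_times cont_at_one_times level_char_power cont_at_one_power)
 have z: "\<rho> \<tau> ~= 1"
  using level_char_0_trivial[OF \<rho>, of c] 0(2,3) f(6,7) \<Gamma>_carrier by (auto simp: \<rho>_def)
 have z1: "norm (\<rho> \<tau>) = 1" using level_charD(2)[OF \<rho>(1)] \<tau> by simp
 obtain C where C: "C > 0" "\<forall>w\<in>carrier GG. norm (F w) <= C" using H.niceD(1)[OF f(1)] by blast
 have Fs: "F (shift n w) = F w * \<rho> \<tau> ^ n" if w: "w \<in> carrier GG" for n w
 proof -
  obtain x y where xy: "w = (x, y)" "x \<in> carrier G" "y \<in> carrier G" using w by auto
  have "\<alpha> (\<tau> [^] (p * n)) = (\<alpha> \<tau> ^ p) ^ n" "\<beta> (\<tau> [^] (q * n)) = (\<beta> \<tau> ^ q) ^ n"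
   using level_char_pow[OF f(2), of \<tau>] level_char_pow[OF f(4), of \<tau>] \<tau> by (simp_all add: power_mult)
  then show ?thesis using f(8)[of "\<tau> [^] (p * n)" "\<tau> [^] (q * n)" x y] xy \<tau> by (simp add: shift_def \<rho>_def power_mult_distrib)
 qed
 show ?case unfolding unif_null_def
 proof (intro allI impI)
  fix e :: real assume e: "e > 0"
  define K where "K = C * (2 / norm (\<rho> \<tau> - 1))"
  have "norm (mean_along F N w) <= e" if N: "N >= nat \<lceil>K / e\<rceil> + 1" and w: "w \<in> carrier GG" for N w
  proof -
   have N0: "real N > 0" "K / e <= real N" using N by linarith+
   have "norm (mean_along F N w) = norm (F w) * norm (average (%n. \<rho> \<tau> ^ n) N)"
    unfolding mean_along_def Fs[OF w] average_scale norm_mult ..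
   also have "\<dots> <= C * (2 / norm (\<rho> \<tau> - 1) / N)"
    using C(1) bspec[OF C(2) w] average_geometric[OF z1 z] by (intro mult_mono) auto
   also have "\<dots> = K / N" by (simp add: K_def)
   also have "\<dots> <= e" using N0 e by (simp add: field_simps)
   finally show ?thesis .
  qed
  then show "\<exists>N0. \<forall>N\<ge>N0. \<forall>w\<in>carrier GG. norm (mean_along F N w) <= e" by blast
 qed
next
 case (Suc i \<alpha> \<beta> F c)
 note f = eigen2D[OF Suc.prems(1)]
 define \<rho> where "\<rho> = (%x. \<alpha> x ^ (p ^ Suc (Suc i)) * \<beta> x ^ (q ^ Suc (Suc i)))"
 have \<rho>: "level_char (Suc i) \<rho>" "cont_at_one (Suc i) \<rho>"
  unfolding \<rho>_def using f by (auto intro!: level_char_times cont_at_one_times level_char_power cont_at_one_power simp del: power_Suc)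
 \<comment> \<open>Otherwise \<open>level_char_trivial\<close> would make \<open>\<rho>\<close>
   trivial at \<open>c\<close>.\<close>
 have nontriv: "\<not> trivial_near_one i (%h. \<rho> (comm \<tau> h))"
  using level_char_trivial[OF \<rho>, of c] Suc.prems f(6,7) by (auto simp: \<rho>_def)
 obtain C where C: "C > 0" "\<forall>w\<in>carrier GG. norm (F w) <= C" using H.niceD(1)[OF f(1)] by blast
 show ?case unfolding unif_null_def
 proof (intro allI impI)
  fix e :: real assume e: "e > 0"
  \<comment> \<open>Under the root in the van der Corput bound there will be three terms of size at
    most \<open>\<delta>\<close>, and \<open>3 * \<delta> = (e / 2)\<^sup>2\<close>.\<close>
  define \<delta> where "\<delta> = e\<^sup>2 / 12"
  have \<delta>: "\<delta> > 0" using e by (simp add: \<delta>_def)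
  define H where "H = nat \<lceil>C\<^sup>2 / \<delta>\<rceil> + 1"
  have "C\<^sup>2 / \<delta> <= real H" "H > 0" unfolding H_def by linarith+
  then have H: "H > 0" "C\<^sup>2 / H <= \<delta>" using \<delta> by (simp_all add: field_simps)
  \<comment> \<open>\<open>\<Lambda> ^ h\<close> will have distance at least
    \<open>1 / (4 * H)\<close> from \<open>1\<close>, and an error of \<open>2 * \<eta>\<close>
    divided by this is \<open>\<delta>\<close>.\<close>
  define \<eta> where "\<eta> = \<delta> / (8 * real H)"
  have \<eta>: "\<eta> > 0" using \<delta> H by (simp add: \<eta>_def)
  \<comment> \<open>\<open>g\<close> is taken near the identity so that \<open>F\<close> hardly
    feels the dilation and \<open>\<rho> (comm \<tau> g)\<close> is near \<open>1\<close>, as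
    \<open>power_spread\<close> requires; \<open>nontriv\<close> supplies arbitrarily small
    \<open>g\<close> at which the value is not \<open>1\<close>.\<close>
  have small: "\<exists>g\<in>L i. \<rho> (comm \<tau> g) ~= 1 \<and> norm (\<rho> (comm \<tau> g) - 1) <= 1 / (2 * real H) \<and>
   (\<forall>w\<in>carrier GG. norm (F (dilate (Suc i) g w) - F w) <= \<eta> / (2 * C))"
  proof -
   have "\<eta> / (2 * C) > 0" using \<eta> C by simp
   from H.niceD(2)[OF f(1) this] obtain d0 where d0: "d0 > 0" "\<forall>u\<in>B d0 \<times> B d0. \<forall>w\<in>carrier GG. norm (F (u \<otimes>\<^bsub>GG\<^esub> w) - F w) < \<eta> / (2 * C)" by blast
   obtain d1 where d1: "d1 > 0" "\<forall>u\<in>B d1. u [^] (p ^ Suc i) \<in> B d0" using B_pow[OF d0(1)] by blast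
   obtain d2 where d2: "d2 > 0" "\<forall>u\<in>B d2. u [^] (q ^ Suc i) \<in> B d0" using B_pow[OF d0(1)] by blast
   obtain d3 where d3: "d3 > 0" "\<forall>x\<in>L i \<inter> B d3. norm (\<rho> (comm \<tau> x) - 1) < 1 / (2 * real H)"
    using cont_at_oneD[OF cont_at_one_comm_right[OF \<rho>(2) \<tau>], of "1 / (2 * real H)"] H by auto
   obtain d4 where d4: "d4 > 0" "B d4 \<subseteq> B d1" "B d4 \<subseteq> B d2" using B_both[OF d1(1) d2(1)] by blast
   obtain d where d: "d > 0" "B d \<subseteq> B d4" "B d \<subseteq> B d3" using B_both[OF d4(1) d3(1)] by blast
   obtain g where g: "g \<in> L i" "g \<in> B d" "\<rho> (comm \<tau> g) ~= 1" using nontriv d(1) unfolding trivial_near_one_def by blast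
   have "norm (F (dilate (Suc i) g w) - F w) <= \<eta> / (2 * C)" if w: "w \<in> carrier GG" for w
   proof -
    have "(g [^] (p ^ Suc i), g [^] (q ^ Suc i)) \<in> B d0 \<times> B d0" using g(2) d d4 d1 d2 by blast
    moreover have "dilate (Suc i) g w = (g [^] (p ^ Suc i), g [^] (q ^ Suc i)) \<otimes>\<^bsub>GG\<^esub> w" by (cases w) (simp add: dilate_def)
    ultimately show ?thesis using d0(2) w by (metis less_imp_le)
   qed
   moreover have "norm (\<rho> (comm \<tau> g) - 1) < 1 / (2 * real H)" using d3(2) g d(3) by blast
   ultimately show ?thesis using g(1,3) by (meson less_imp_le)
  qed
  then obtain g where g: "g \<in> L i" "\<rho> (comm \<tau> g) ~= 1" "norm (\<rho> (comm \<tau> g) - 1) <= 1 / (2 * real H)"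
   and gF: "\<forall>w\<in>carrier GG. norm (F (dilate (Suc i) g w) - F w) <= \<eta> / (2 * C)" by blast
  have gc: "g \<in> carrier G" using L_carrier[OF g(1)] .
  define \<Lambda> where "\<Lambda> = \<rho> (comm \<tau> g)"
  have \<Lambda>1: "norm \<Lambda> = 1" unfolding \<Lambda>_def using level_charD(2)[OF \<rho>(1) L_comm[OF \<tau> g(1)]] .
  obtain t where t: "\<And>l. 1 <= l ==> l <= H ==> 1 / (4 * real H) <= norm (\<Lambda> ^ (t * l) - 1)"
   using power_spread[OF H(1) \<Lambda>1] g(2,3) unfolding \<Lambda>_def by blast
  define D where "D = (%h w. F (shift h w) * cnj (F w))"
  have Fd: "F (shift m (dilate (Suc i) g w)) = \<Lambda> ^ m * F (dilate (Suc i) g (shift m w))" if "w \<in> carrier GG" for m w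
   unfolding \<Lambda>_def \<rho>_def by (rule eigen2_dilate[OF Suc.prems(1) g(1) that])
  have Dd: "norm (D h (shift n (dilate (Suc i) g w)) - \<Lambda> ^ h * D h (shift n w)) <= \<eta>" if w: "w \<in> carrier GG" for h n w
  proof -
   have dw: "dilate (Suc i) g w \<in> carrier GG" using dilate_closed[OF w gc] .
   let ?P = "F (dilate (Suc i) g (shift (h + n) w))" and ?Q = "F (dilate (Suc i) g (shift n w))" and ?R = "F (shift (h + n) w)" and ?S = "F (shift n w)"
   have "D h (shift n (dilate (Suc i) g w)) = (\<Lambda> ^ (h + n) * ?P) * cnj (\<Lambda> ^ n * ?Q)"
    unfolding D_def shift_add[OF dw, symmetric] Fd[OF w] ..
   also have "\<dots> = \<Lambda> ^ h * (\<Lambda> ^ n * cnj (\<Lambda> ^ n)) * (?P * cnj ?Q)" by (simp add: power_add)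
   also have "\<Lambda> ^ n * cnj (\<Lambda> ^ n) = 1" using \<Lambda>1 by (simp only: complex_norm_square[symmetric] norm_power) simp
   finally have "D h (shift n (dilate (Suc i) g w)) - \<Lambda> ^ h * D h (shift n w) = \<Lambda> ^ h * ((?P - ?R) * cnj ?Q + ?R * cnj (?Q - ?S))"
    unfolding D_def shift_add[OF w, symmetric] by (simp add: algebra_simps)
   also have "norm \<dots> <= norm (?P - ?R) * norm ?Q + norm ?R * norm (?Q - ?S)"
    by (rule norm_unit_combination) (simp add: \<Lambda>1 norm_power)
   also have "\<dots> <= \<eta> / (2 * C) * C + C * (\<eta> / (2 * C))"
    using bspec[OF gF shift_closed[OF w]] bspec[OF C(2) shift_closed[OF w]] bspec[OF C(2) dilate_closed[OF shift_closed[OF w] gc]] C(1) \<eta>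
    by (intro add_mono mult_mono) auto
   also have "\<dots> = \<eta>" using C by simp
   finally show ?thesis .
  qed
  have D_small: "\<forall>\<^sub>F N in sequentially. \<forall>w\<in>carrier GG. norm (mean_along (D (t * d)) N w) <= \<delta>" if d: "1 <= d" "d < H" for d
  proof -
   let ?h = "t * d"
   have "unif_null (%N w. mean_along (D ?h) N (dilate (Suc i) g w) - mean_along (D ?h) N w)"
    unfolding D_def by (rule dilate_invariance[OF Suc.IH nice_correlation[OF Suc.prems(1)] g(1)])
   then obtain N0 where N0: "\<forall>N\<ge>N0. \<forall>w\<in>carrier GG. norm (mean_along (D ?h) N (dilate (Suc i) g w) - mean_along (D ?h) N w) <= \<eta>"
    using \<eta> unfolding unif_null_def by blast
   have "norm (mean_along (D ?h) N w) <= \<delta>" if N: "N >= N0" and w: "w \<in> carrier GG" for N w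
   proof -
    let ?m = "mean_along (D ?h) N w" and ?m' = "mean_along (D ?h) N (dilate (Suc i) g w)"
    have "norm (?m' - \<Lambda> ^ ?h * ?m) <= \<eta>"
     unfolding mean_along_def average_scale[symmetric] average_diff[symmetric] using Dd[OF w] \<eta> by (intro average_bound) auto
    moreover have "norm (?m' - ?m) <= \<eta>" using N0 N w by blast
    moreover have "(\<Lambda> ^ ?h - 1) * ?m = (?m' - ?m) - (?m' - \<Lambda> ^ ?h * ?m)" by (simp add: algebra_simps)
    ultimately have "norm (\<Lambda> ^ ?h - 1) * norm ?m <= 2 * \<eta>"
     using norm_triangle_ineq4[of "?m' - ?m" "?m' - \<Lambda> ^ ?h * ?m"] by (simp only: norm_mult[symmetric])
    moreover have "1 / (4 * real H) * norm ?m <= norm (\<Lambda> ^ ?h - 1) * norm ?m" using t[of d] d by (intro mult_right_mono) auto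
    ultimately have "1 / (4 * real H) * norm ?m <= 2 * \<eta>" by linarith
    then show ?thesis using H(1) by (simp add: \<eta>_def field_simps)
   qed
   then show ?thesis unfolding eventually_sequentially by blast
  qed
  have "\<forall>\<^sub>F N in sequentially. \<forall>d\<in>{1..<H}. \<forall>w\<in>carrier GG. norm (mean_along (D (t * d)) N w) <= \<delta>"
   by (intro eventually_ball_finite) (use D_small in auto)
  moreover have lim: "(%N. 2 * t * H * C / real N) \<longlonglongrightarrow> 0" "(%N. 2 * t * H * C\<^sup>2 / real N) \<longlonglongrightarrow> 0"
   by (rule tendsto_divide_0[OF tendsto_const filterlim_at_top_imp_at_infinity[OF filterlim_real_sequentially]])+
  have "\<forall>\<^sub>F N in sequentially. 2 * t * H * C / real N < e / 2" "\<forall>\<^sub>F N in sequentially. 2 * t * H * C\<^sup>2 / real N < \<delta>"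
   by (rule order_tendstoD(2)[OF lim(1)], simp add: e) (rule order_tendstoD(2)[OF lim(2) \<delta>])
  ultimately have "\<forall>\<^sub>F N in sequentially. \<forall>w\<in>carrier GG. norm (mean_along F N w) <= e"
  proof eventually_elim
   case (elim N)
   show ?case
   proof
    fix w assume w: "w \<in> carrier GG"
    have "norm (mean_along F N w) <= 2 * t * H * C / N + sqrt (C\<^sup>2 / H + \<delta> + 2 * t * H * C\<^sup>2 / N)"
     unfolding mean_along_def
    proof (rule van_der_corput)
     fix d :: nat assume d: "1 <= d" "d < H"
     have "average (%n. F (shift (n + t * d) w) * cnj (F (shift n w))) N = mean_along (D (t * d)) N w"
      unfolding mean_along_def D_def shift_add[OF w, symmetric] by (simp add: add.commute)
     then show "norm (average (%n. F (shift (n + t * d) w) * cnj (F (shift n w))) N) <= \<delta>" using bspec[OF bspec[OF elim(1), of d] w] d by simp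
    qed (use C \<delta> H bspec[OF C(2) shift_closed[OF w]] in auto)
    also have "\<dots> <= e / 2 + sqrt (\<delta> + \<delta> + \<delta>)" using elim H(2) by (intro add_mono real_sqrt_le_mono) auto
    also have "\<delta> + \<delta> + \<delta> = (e / 2)\<^sup>2" by (simp add: \<delta>_def power_divide)
    finally show "norm (mean_along F N w) <= e" using e by simp
   qed
  qed
  then show "\<exists>N0. \<forall>N\<ge>N0. \<forall>w\<in>carrier GG. norm (mean_along F N w) <= e" unfolding eventually_sequentially .
 qed
qed

end

end

section \<open>Orbit sequences as periodic sequences plus sequences of Katai type\<close>

definition katai_good :: "(nat => complex) => bool" where
 "katai_good c \<longleftrightarrow> (\<exists>C. \<forall>n\<ge>1. norm (c n) <= C) \<and>
   (\<forall>p q. prime p --> prime q --> p ~= q --> average (%n. c (p * n) * cnj (c (q * n))) \<longlonglongrightarrow> 0)"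

definition structured :: "(nat => complex) => bool" where
 "structured u \<longleftrightarrow> (\<forall>e>0. \<exists>P cs. periodic_sequence P \<and> (\<forall>c\<in>set cs. katai_good c) \<and>
   (\<forall>n\<ge>1. norm (u n - (P n + (\<Sum>c\<leftarrow>cs. c n))) <= e))"

lemma periodic_sequence_mult:
 fixes P :: "nat => complex" and m n k :: nat
 assumes "\<forall>n\<ge>1. P (n + m) = P n" "n >= 1" shows "P (n + m * k) = P n"
proof (induction k)
 case (Suc k)
 have "P (n + m * Suc k) = P ((n + m * k) + m)" by (simp add: algebra_simps)
 also have "\<dots> = P (n + m * k)" using assms by simp
 finally show ?case using Suc by simp
qed simp

lemma periodic_sequence_add:
 assumes "periodic_sequence P" "periodic_sequence Q" shows "periodic_sequence (%n. P n + Q n)"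
proof -
 obtain m k where m: "m >= 1" "\<forall>n\<ge>1. P (n + m) = P n" and k: "k >= 1" "\<forall>n\<ge>1. Q (n + k) = Q n"
  using assms unfolding periodic_sequence_def by blast
 have "P (n + m * k) + Q (n + m * k) = P n + Q n" if "n >= 1" for n
  using periodic_sequence_mult[OF m(2) that, of k] periodic_sequence_mult[OF k(2) that, of m] by (simp add: mult.commute)
 then show ?thesis unfolding periodic_sequence_def using m(1) k(1) by (intro exI[of _ "m * k"]) simp
qed

lemma structured_periodic: "periodic_sequence P ==> structured P"
 unfolding structured_def by (auto intro!: exI[of _ P] exI[of _ "[]"])

lemma structured_katai_good: "katai_good c ==> structured c"
 unfolding structured_def periodic_sequence_def by (auto intro!: exI[of _ "%_. 0"] exI[of _ "[c]"] exI[of _ 1])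

lemma structured_add:
 assumes "structured u" "structured v" shows "structured (%n. u n + v n)"
 unfolding structured_def
proof (intro allI impI)
 fix e :: real assume "e > 0"
 then have e: "e/2 > 0" by simp
 obtain P cs where 1: "periodic_sequence P" "\<forall>c\<in>set cs. katai_good c" "\<forall>n\<ge>1. norm (u n - (P n + (\<Sum>c\<leftarrow>cs. c n))) <= e/2"
  using assms(1) e unfolding structured_def by blast
 obtain Q ds where 2: "periodic_sequence Q" "\<forall>c\<in>set ds. katai_good c" "\<forall>n\<ge>1. norm (v n - (Q n + (\<Sum>c\<leftarrow>ds. c n))) <= e/2"
  using assms(2) e unfolding structured_def by blast
 have "norm (u n + v n - (P n + Q n + (\<Sum>c\<leftarrow>cs @ ds. c n))) <= e" if "n >= 1" for n
 proof -
  have "u n + v n - (P n + Q n + (\<Sum>c\<leftarrow>cs @ ds. c n)) = (u n - (P n + (\<Sum>c\<leftarrow>cs. c n))) + (v n - (Q n + (\<Sum>c\<leftarrow>ds. c n)))" by simp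
  also have "norm \<dots> <= e/2 + e/2" using 1(3) 2(3) that by (intro order.trans[OF norm_triangle_ineq] add_mono) auto
  finally show ?thesis by simp
 qed
 then show "\<exists>P cs. periodic_sequence P \<and> (\<forall>c\<in>set cs. katai_good c) \<and> (\<forall>n\<ge>1. norm (u n + v n - (P n + (\<Sum>c\<leftarrow>cs. c n))) <= e)"
  using periodic_sequence_add[OF 1(1) 2(1)] 1(2) 2(2) by (intro exI[of _ "%n. P n + Q n"] exI[of _ "cs @ ds"]) auto
qed

lemma structured_sum:
 assumes "finite I" "\<And>i. i \<in> I ==> structured (u i)" shows "structured (%n. \<Sum>i\<in>I. u i n)"
 using assms
proof (induction I rule: finite_induct)
 case empty
 then show ?case by (auto intro!: structured_periodic simp: periodic_sequence_def)
next
 case (insert i I)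
 then have "structured (%n. u i n + (\<Sum>i\<in>I. u i n))" by (intro structured_add) auto
 then show ?case using insert.hyps by simp
qed

lemma structured_limit:
 assumes "\<And>e. e > 0 ==> \<exists>v. structured v \<and> (\<forall>n\<ge>1. norm (u n - v n) <= e)" shows "structured u"
 unfolding structured_def
proof (intro allI impI)
 fix e :: real assume "e > 0"
 then have e: "e/2 > 0" by simp
 obtain v where v: "structured v" "\<forall>n\<ge>1. norm (u n - v n) <= e/2" using assms[OF e] by blast
 obtain P cs where 1: "periodic_sequence P" "\<forall>c\<in>set cs. katai_good c" "\<forall>n\<ge>1. norm (v n - (P n + (\<Sum>c\<leftarrow>cs. c n))) <= e/2"
  using v(1) e unfolding structured_def by blast
 have "norm (u n - (P n + (\<Sum>c\<leftarrow>cs. c n))) <= e" if "n >= 1" for n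
 proof -
  have "u n - (P n + (\<Sum>c\<leftarrow>cs. c n)) = (u n - v n) + (v n - (P n + (\<Sum>c\<leftarrow>cs. c n)))" by simp
  also have "norm \<dots> <= e/2 + e/2" using 1(3) v(2) that by (intro order.trans[OF norm_triangle_ineq] add_mono) auto
  finally show ?thesis by simp
 qed
 then show "\<exists>P cs. periodic_sequence P \<and> (\<forall>c\<in>set cs. katai_good c) \<and> (\<forall>n\<ge>1. norm (u n - (P n + (\<Sum>c\<leftarrow>cs. c n))) <= e)"
  using 1 by blast
qed

lemma unit_power_cancel:
 fixes z :: complex
 assumes "norm z = 1" "z ^ a * cnj z ^ b = 1" "a ~= b" shows "\<exists>m\<ge>1. z ^ m = 1 \<and> m = (if a < b then b - a else a - b)"
proof -
 have zc: "z ^ k * cnj z ^ k = 1" for k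
  using assms(1) by (simp add: power_mult_distrib[symmetric] complex_norm_square[symmetric])
 have nz: "z ~= 0" using assms(1) by auto
 have eq: "z ^ a = z ^ b"
 proof -
  have "z ^ a = z ^ a * (z ^ b * cnj z ^ b)" by (simp add: zc)
  also have "\<dots> = (z ^ a * cnj z ^ b) * z ^ b" by (simp add: mult_ac)
  finally show ?thesis using assms(2) by simp
 qed
 show ?thesis
 proof (cases "a < b")
  case True
  have "z ^ a * z ^ (b - a) = z ^ (a + (b - a))" by (rule power_add[symmetric])
  also have "\<dots> = z ^ a * 1" using eq True by simp
  finally have "z ^ (b - a) = 1" using nz by (metis mult_left_cancel power_not_zero)
  then show ?thesis using True by simp
 next
  case False
  then have "b < a" using assms(3) by simp
  have "z ^ b * z ^ (a - b) = z ^ (b + (a - b))" by (rule power_add[symmetric])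
  also have "\<dots> = z ^ b * 1" using eq \<open>b < a\<close> by simp
  finally have "z ^ (a - b) = 1" using nz by (metis mult_left_cancel power_not_zero)
  then show ?thesis using \<open>b < a\<close> by simp
 qed
qed

context good_group
begin

text \<open>The correlation along \<open>p\<close> and \<open>q\<close> is
  \<open>mean_along p q F\<close> at the diagonal point \<open>(w, w)\<close>. The condition of
  \<open>eigen_null\<close> holds for some \<open>x\<close>: otherwise \<open>\<omega>\<close> would
  have finite order, dividing the difference of the two exponents, against
  \<open>torsion_trivial\<close>.\<close>

lemma eigen_katai_good:
 assumes f: "co.nice (L (Suc (Suc i))) f" "co.eigenfunction (L (Suc i)) \<omega> f"
  and c: "c \<in> L (Suc i)" "\<omega> c ~= 1" and w: "w \<in> carrier G"
 shows "katai_good (%n. f (\<tau> [^] n \<otimes> w))"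
proof -
 obtain C where C: "C > 0" "\<forall>w\<in>carrier G. norm (f w) <= C" using co.niceD(1)[OF f(1)] by blast
 have tw: "\<tau> [^] (n::nat) \<otimes> w \<in> carrier G" for n using \<tau> w by simp
 show ?thesis
 proof (cases "\<forall>v\<in>carrier G. f v = 0")
  \<comment> \<open>Without a point where \<open>f\<close> is nonzero \<open>\<omega>\<close> is not
    controlled, but then the sequence is \<open>0\<close>.\<close>
  case True
  moreover have "average (%n. 0) = (%N. 0)" by (simp add: average_def fun_eq_iff)
  ultimately show ?thesis using tw by (auto simp: katai_good_def intro: exI[of _ 0])
 next
  case False
  then obtain v where v: "v \<in> carrier G" "f v ~= 0" by blast
  have ch: "x \<in> L (Suc (Suc i)) ==> \<omega> x = 1" "x \<in> L (Suc i) ==> x \<in> \<Gamma> ==> \<omega> x = 1"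
   "e > 0 ==> \<exists>d>0. \<forall>u\<in>B d \<inter> L (Suc i). norm (\<omega> u - 1) < e" for x e
   using co.eigenfunction_char[OF L_subgroup subsetI[OF L_antimono] L_comm f v] by auto
  have \<omega>: "level_char (Suc i) \<omega>" "cont_at_one (Suc i) \<omega>"
   using f(2) ch(1) unfolding level_char_def co.eigenfunction_def apply blast
   using ch(3) unfolding cont_at_one_def by (auto simp: Int_commute)
  show ?thesis unfolding katai_good_def
  proof (intro conjI allI impI)
   show "\<exists>C. \<forall>n\<ge>(1::nat). norm (f (\<tau> [^] n \<otimes> w)) <= C" using C(2)[rule_format, OF tw] by (intro exI[of _ C]) simp
   fix p q :: nat assume pq: "prime p" "prime q" "p ~= q"
   let ?P = "p ^ Suc (Suc i)" and ?Q = "q ^ Suc (Suc i)"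
   have PQ: "?P ~= ?Q" using pq(3) power_eq_iff_eq_base[OF zero_less_Suc, of p q "Suc i"] by blast
   have "\<exists>x\<in>L (Suc i). \<omega> x ^ ?P * cnj (\<omega> x) ^ ?Q ~= 1"
   proof (rule ccontr)
    assume "\<not> ?thesis"
    then have all: "\<omega> x ^ ?P * cnj (\<omega> x) ^ ?Q = 1" if "x \<in> L (Suc i)" for x using that by blast
    define m where "m = (if ?P < ?Q then ?Q - ?P else ?P - ?Q)"
    have "m > 0" using PQ by (auto simp: m_def simp del: power_Suc)
    moreover have "\<omega> x ^ m = 1" if "x \<in> L (Suc i)" for x
     using unit_power_cancel[OF level_charD(2)[OF \<omega>(1) that] all[OF that] PQ] unfolding m_def by blast
    ultimately show False using torsion_trivial[OF \<omega> _ _ c(1)] c(2) by blast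
   qed
   then obtain x where x: "x \<in> L (Suc i)" "\<omega> x ^ ?P * cnj (\<omega> x) ^ ?Q ~= 1" by blast
   define F where "F = (%w::'a \<times> 'a. f (fst w) * cnj (f (snd w)))"
   have "eigen2 (Suc i) \<omega> (%x. cnj (\<omega> x)) F"
    unfolding eigen2_def
   proof (intro conjI ballI level_char_cnj cont_at_one_cnj \<omega>)
    show "\<omega> x = 1" "cnj (\<omega> x) = 1" if "x \<in> \<Gamma> \<inter> L (Suc i)" for x using ch(2) that by auto
    show "F (c \<otimes> w, c' \<otimes> w') = \<omega> c * cnj (\<omega> c') * F (w, w')" if "c \<in> L (Suc i)" "c' \<in> L (Suc i)" "w \<in> carrier G" "w' \<in> carrier G" for c c' w w'
     using f(2) that unfolding F_def co.eigenfunction_def by simp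
    have proj: "H.nice {} (%w. f (\<pi> w))" if hom: "\<And>a b. a \<in> carrier GG ==> b \<in> carrier GG ==> \<pi> (a \<otimes>\<^bsub>GG\<^esub> b) = \<pi> a \<otimes> \<pi> b"
     and mem: "\<And>A a. a \<in> A \<times> A ==> \<pi> a \<in> A" for \<pi> :: "'a \<times> 'a => 'a"
     unfolding H.nice_def
    proof (intro conjI allI impI)
     have c: "w \<in> carrier GG ==> \<pi> w \<in> carrier G" for w using mem by simp
     then show "\<exists>C. \<forall>w\<in>carrier GG. norm (f (\<pi> w)) <= C" using C(2) by blast
     show "\<forall>w\<in>carrier GG. \<forall>\<gamma>\<in>\<Gamma> \<times> \<Gamma>. f (\<pi> (w \<otimes>\<^bsub>GG\<^esub> \<gamma>)) = f (\<pi> w)"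
      using mem[of _ \<Gamma>] c \<Gamma>_carrier co.niceD(3)[OF f(1)] by (auto simp: hom)
     fix e :: real assume "e > 0"
     then obtain d where d: "d > 0" "\<forall>u\<in>B d. \<forall>w\<in>carrier G. norm (f (u \<otimes> w) - f w) < e" using co.niceD(2)[OF f(1)] by blast
     have "norm (f (\<pi> (u \<otimes>\<^bsub>GG\<^esub> w)) - f (\<pi> w)) < e" if u: "u \<in> B d \<times> B d" and w: "w \<in> carrier GG" for u w
     proof -
      have "u \<in> carrier GG" using u B_in by auto
      then show ?thesis using d(2) mem[OF u] c[OF w] hom w by simp
     qed
     then show "\<exists>d>0. \<forall>u\<in>B d \<times> B d. \<forall>w\<in>carrier GG. norm (f (\<pi> (u \<otimes>\<^bsub>GG\<^esub> w)) - f (\<pi> w)) < e" using d(1) by blast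
    qed simp
    have nice: "H.nice {} (%w. f (fst w))" "H.nice {} (%w. f (snd w))" by (rule proj; force)+
    show "H.nice (LL (Suc (Suc i))) F" unfolding F_def
     by (rule H.niceI[OF H.nice_mult_cnj[OF nice]]) (use co.niceD(4)[OF f(1)] in auto)
   qed
   from eigen_null[OF this x(1), of p q] x(2) have null: "unif_null (mean_along p q F)" by blast
   have eq: "mean_along p q F N (w, w) = average (%n. f (\<tau> [^] (p * n) \<otimes> w) * cnj (f (\<tau> [^] (q * n) \<otimes> w))) N" for N
    by (simp add: mean_along_def shift_def F_def)
   show "average (%n. f (\<tau> [^] (p * n) \<otimes> w) * cnj (f (\<tau> [^] (q * n) \<otimes> w))) \<longlonglongrightarrow> 0"
   proof (rule LIMSEQ_I)
    fix e :: real assume e: "e > 0"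
    then have "e / 2 > 0" by simp
    then obtain N0 where N0: "\<forall>N\<ge>N0. \<forall>w\<in>carrier GG. norm (mean_along p q F N w) <= e/2"
     using null unfolding unif_null_def by blast
    have ww: "(w, w) \<in> carrier GG" using w by simp
    have "norm (mean_along p q F N (w, w)) < e" if "N >= N0" for N using N0[rule_format, OF that ww] e by linarith
    then have "\<forall>N\<ge>N0. norm (average (%n. f (\<tau> [^] (p * n) \<otimes> w) * cnj (f (\<tau> [^] (q * n) \<otimes> w))) N - 0) < e"
     unfolding eq diff_zero by blast
    then show "\<exists>no. \<forall>n\<ge>no. norm (average (%n. f (\<tau> [^] (p * n) \<otimes> w) * cnj (f (\<tau> [^] (q * n) \<otimes> w))) n - 0) < e" ..
   qed
  qed
 qed
qed

text \<open>The origin of the periodic part: a root of unity \<open>z\<close> gives a periodic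
  sequence. For any other \<open>z\<close> and \<open>p ~= q\<close>,
  \<open>z ^ p * cnj z ^ q\<close> is not \<open>1\<close>, so the correlations are averages of a
  geometric progression.\<close>

lemma power_structured:
 fixes z a :: complex
 assumes "norm z = 1" shows "structured (%n. z ^ n * a)"
proof (cases "\<exists>m\<ge>1. z ^ m = 1")
 case True
 then obtain m where "m >= 1" "z ^ m = 1" by blast
 then have "periodic_sequence (%n. z ^ n * a)" unfolding periodic_sequence_def by (intro exI[of _ m]) (simp add: power_add)
 then show ?thesis by (rule structured_periodic)
next
 case False
 have "average (%n. (z ^ (p * n) * a) * cnj (z ^ (q * n) * a)) \<longlonglongrightarrow> 0" if "p ~= q" for p q :: nat
 proof -
  define \<zeta> where "\<zeta> = z ^ p * cnj z ^ q"
  have \<zeta>: "norm \<zeta> = 1" using assms by (simp add: \<zeta>_def norm_mult norm_power)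
  have \<zeta>1: "\<zeta> ~= 1" using unit_power_cancel[OF assms _ that] False unfolding \<zeta>_def by blast
  have "(%N. 2 / norm (\<zeta> - 1) / real N) \<longlonglongrightarrow> 0"
   by (rule tendsto_divide_0[OF tendsto_const filterlim_at_top_imp_at_infinity[OF filterlim_real_sequentially]])
  then have "average (%n. \<zeta> ^ n) \<longlonglongrightarrow> 0"
   by (rule Lim_null_comparison[OF eventuallyI[OF average_geometric[OF \<zeta> \<zeta>1]]])
  then have "(%N. average (%n. (a * cnj a) * \<zeta> ^ n) N) \<longlonglongrightarrow> 0" unfolding average_scale by (rule tendsto_mult_right_zero)
  moreover have "(z ^ (p * n) * a) * cnj (z ^ (q * n) * a) = (a * cnj a) * \<zeta> ^ n" for n
   unfolding \<zeta>_def power_mult_distrib power_mult[symmetric] complex_cnj_mult complex_cnj_power by (simp only: mult_ac)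
  ultimately show ?thesis by (simp only:)
 qed
 moreover have "norm (z ^ n * a) <= norm a" for n using assms by (simp add: norm_mult norm_power)
 ultimately have "katai_good (%n. z ^ n * a)" unfolding katai_good_def by blast
 then show ?thesis by (rule structured_katai_good)
qed

theorem orbit_structured:
 assumes "co.nice (L j) f" "w \<in> carrier G"
 shows "structured (%n. f (\<tau> [^] n \<otimes> w))"
 using assms(1)
proof (induction j arbitrary: f)
 case 0
 have "f (\<tau> [^] n \<otimes> w) = f w" for n :: nat using co.niceD(4)[OF 0 assms(2)] \<tau> by simp
 then show ?case by (intro structured_periodic) (auto simp: periodic_sequence_def)
next
 case (Suc j)
 show ?case
 proof (rule structured_limit)
  fix e :: real assume e: "e > 0"
  interpret CA: central_action G B \<Gamma> "L j" "L (Suc j)" f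
   using L_antimono L_comm by (intro central_action.intro central_action_axioms.intro co.cocompact_axioms L_subgroup Suc.prems) auto
  obtain X F \<omega> where X: "finite X" "\<And>i. i \<in> X ==> co.nice (L (Suc j)) (F i)" "\<And>i. i \<in> X ==> co.eigenfunction (L j) (\<omega> i) (F i)"
   and appr: "\<And>w. w \<in> carrier G ==> norm (f w - (\<Sum>i\<in>(X :: ('a set => complex) set). F i w)) <= e"
   using CA.eigen_decomposition[OF e] by blast
  have "structured (%n. F i (\<tau> [^] n \<otimes> w))" if i: "i \<in> X" for i
  proof (cases j)
   \<comment> \<open>An eigenfunction of the whole group runs through a geometric progression along
     the orbit.\<close>
   case 0
   have ef: "\<omega> i (a \<otimes> b) = \<omega> i a * \<omega> i b" "F i (a \<otimes> w) = \<omega> i a * F i w" "norm (\<omega> i a) = 1" if "a \<in> carrier G" "b \<in> carrier G" for a b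
    using X(3)[OF i] that assms(2) 0 unfolding co.eigenfunction_def by auto
   have "F i (\<tau> [^] n \<otimes> w) = \<omega> i \<tau> ^ n * F i w" for n :: nat
   proof -
    have "\<omega> i \<one> * \<omega> i \<one> = \<omega> i \<one>" "\<omega> i \<one> ~= 0" using ef(1)[of \<one> \<one>] ef(3)[of \<one> \<one>] by auto
    then have "\<omega> i \<one> = 1" by simp
    then have "\<omega> i (\<tau> [^] n) = \<omega> i \<tau> ^ n" using ef(1) \<tau> by (induction n) auto
    then show ?thesis using ef(2)[of "\<tau> [^] n" \<tau>] \<tau> by simp
   qed
   then show ?thesis using power_structured[of "\<omega> i \<tau>" "F i w"] ef(3)[of \<tau> \<tau>] \<tau> by simp
  next
   case (Suc k)
   show ?thesis
   proof (cases "\<exists>c\<in>L j. \<omega> i c ~= 1")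
    case True
    then show ?thesis using eigen_katai_good[of k "F i" "\<omega> i"] X(2,3)[OF i] assms(2) unfolding Suc by (blast intro: structured_katai_good)
   next
    case False
    then have "co.nice (L j) (F i)" using X(2,3)[OF i] unfolding co.nice_def co.eigenfunction_def by simp
    then show ?thesis by (rule Suc.IH)
   qed
  qed
  then have "structured (%n. \<Sum>i\<in>X. F i (\<tau> [^] n \<otimes> w))" using X(1) by (intro structured_sum) auto
  moreover have "norm (f (\<tau> [^] n \<otimes> w) - (\<Sum>i\<in>X. F i (\<tau> [^] n \<otimes> w))) <= e" for n :: nat using \<tau> assms(2) by (intro appr) auto
  ultimately show "\<exists>v. structured v \<and> (\<forall>n\<ge>1. norm (f (\<tau> [^] n \<otimes> w) - v n) <= e)" by blast
 qed
qed

end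

subsection \<open>Correlations of structured and multiplicative sequences\<close>

definition covariance :: "(nat => complex) => (nat => complex) => nat => complex" where
 "covariance a b N = average (%n. a n * cnj (b n)) N - average a N * average (%n. cnj (b n)) N"

lemma asymptotically_uncorrelated_covariance: "asymptotically_uncorrelated a b \<longleftrightarrow> covariance a b \<longlonglongrightarrow> 0"
 unfolding asymptotically_uncorrelated_def covariance_def[abs_def] average_def ..

lemma average_cnj: "average (%n. cnj (u n)) N = cnj (average u N)"
 by (simp add: average_def)

lemma covariance_cnj: "covariance b a N = cnj (covariance a b N)"
 by (simp add: covariance_def average_cnj[symmetric] mult.commute)

lemma covariance_add: "covariance (%n. u n + v n) b N = covariance u b N + covariance v b N"
 by (simp add: covariance_def average_add distrib_right)

lemma covariance_bound:
 assumes "\<And>n. n >= 1 ==> norm (u n) <= A" "\<And>n. n >= 1 ==> norm (b n) <= K" "A >= 0" "K >= 0"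
 shows "norm (covariance u b N) <= 2 * A * K"
proof -
 have "norm (average (%n. u n * cnj (b n)) N) <= A * K"
  using assms by (intro average_bound) (auto simp: norm_mult intro!: mult_mono)
 moreover have "norm (average u N * average (%n. cnj (b n)) N) <= A * K"
  unfolding norm_mult using assms by (intro mult_mono average_bound) auto
 ultimately show ?thesis unfolding covariance_def by (intro order.trans[OF norm_triangle_ineq4]) simp
qed

text \<open>\<open>s\<close> is the standard deviation of \<open>a\<close> on \<open>{1..N}\<close>.
  Both facts are tied to one \<open>s\<close> because \<open>structured_uncorrelated\<close> plays
  them against each other.\<close>

lemma covariance_le_deviation:
 "\<exists>s\<ge>0. covariance a a N = of_real (s\<^sup>2) \<and>
   (\<forall>b K. (\<forall>n\<ge>1. norm (b n) <= K) --> K >= 0 --> norm (covariance a b N) <= K * s)"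
proof (cases "N = 0")
 case True
 then have "average u N = 0" for u by (simp add: average_def)
 then show ?thesis by (intro exI[of _ 0]) (simp add: covariance_def)
next
 case False
 define v where "v = (%n. a n - average a N)"
 define s where "s = sqrt ((\<Sum>n=1..N. (norm (v n))\<^sup>2) / N)"
 have "average (%n. c) N = c" for c using False by (simp add: average_def)
 then have v0: "average v N = 0" by (simp add: v_def average_diff)
 have eq: "covariance a b N = average (%n. v n * cnj (b n)) N" for b
  by (simp add: covariance_def v_def left_diff_distrib average_diff average_scale)
 have s2: "s\<^sup>2 = (\<Sum>n=1..N. (norm (v n))\<^sup>2) / N" by (simp add: s_def sum_nonneg)
 have vc: "average (%n. v n * c) N = 0" for c using average_scale[of c v N] v0 by (simp add: mult.commute)
 show ?thesis
 proof (intro exI[of _ s] conjI allI impI)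
  show "s >= 0" by (simp add: s_def sum_nonneg)
  have "covariance a a N = average (%n. v n * cnj (v n + average a N)) N" unfolding eq by (simp add: v_def)
  also have "\<dots> = average (%n. of_real ((norm (v n))\<^sup>2)) N"
   by (simp only: complex_cnj_add distrib_left average_add vc complex_norm_square[symmetric] add_0_right of_real_power)
  also have "\<dots> = of_real (s\<^sup>2)" unfolding s2 by (simp add: average_def)
  finally show "covariance a a N = of_real (s\<^sup>2)" .
  fix b :: "nat => complex" and K :: real
  assume b: "\<forall>n\<ge>1. norm (b n) <= K" "K >= 0"
  have "norm (\<Sum>n=1..N. v n * cnj (b n)) <= K * sqrt (real N * (\<Sum>n=1..N. (norm (v n))\<^sup>2))"
   using b by (intro sum_norm_le_sqrt) auto
  also have "real N * (\<Sum>n=1..N. (norm (v n))\<^sup>2) = (real N * s)\<^sup>2" using False unfolding power_mult_distrib s2 by (simp add: power2_eq_square)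
  finally show "norm (covariance a b N) <= K * s"
   using False \<open>s >= 0\<close> unfolding eq by (simp add: average_def norm_divide divide_le_eq mult_ac)
 qed
qed

text \<open>Finitely generated multiplicative systems enter only through this property of the sequences \<open>g (S n y)\<close>.\<close>

definition dilation_finite :: "(nat => complex) => bool" where
 "dilation_finite b \<longleftrightarrow> (\<exists>B C. finite B \<and> b \<in> B \<and> (\<forall>b'\<in>B. \<forall>n\<ge>1. norm (b' n) <= C) \<and>
   (\<forall>p. prime p --> (\<exists>b'\<in>B. \<forall>n\<ge>1. b (p * n) = b' n)))"

lemma periodic_dilation_finite:
 assumes "periodic_sequence P" shows "dilation_finite P"
proof -
 obtain m where m: "m >= 1" "\<forall>n\<ge>1. P (n + m) = P n" using assms unfolding periodic_sequence_def by blast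
 have red: "P n = P (n mod m + m)" if "n >= 1" for n
 proof -
  have "P (n mod m + m) = P ((n mod m + m) + m * (n div m))" using m(1) by (intro periodic_sequence_mult[OF m(2), symmetric]) simp
  also have "(n mod m + m) + m * (n div m) = n + m" by simp
  finally show ?thesis using m(2) that by simp
 qed
 \<comment> \<open>Residues are represented by \<open>r + m\<close> instead of \<open>r\<close>:
   periodicity starts at \<open>1\<close>, and the value at \<open>0\<close> is arbitrary.\<close>
 define B where "B = insert P ((%r n. P ((r + m) * n)) ` {..<m})"
 have bd: "norm (P n) <= (\<Sum>r<m. norm (P (r + m)))" if "n >= 1" for n
 proof -
  have "norm (P (n mod m + m)) <= (\<Sum>r<m. norm (P (r + m)))"
   using m(1) by (intro member_le_sum[of "n mod m" "{..<m}" "%r. norm (P (r + m))"]) auto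
  then show ?thesis by (simp only: red[OF that, symmetric])
 qed
 show ?thesis unfolding dilation_finite_def
 proof (intro exI[of _ B] exI[of _ "\<Sum>r<m. norm (P (r + m))"] conjI ballI allI impI)
  show "finite B" "P \<in> B" unfolding B_def by auto
  show "norm (b' n) <= (\<Sum>r<m. norm (P (r + m)))" if b': "b' \<in> B" and n: "n >= 1" for b' n
  proof -
   consider "b' = P" | r where "b' = (%n. P ((r + m) * n))" using b' unfolding B_def by auto
   then show ?thesis
   proof cases
    case (2 r)
    have "(r + m) * n >= 1" using m(1) n by simp
    then show ?thesis using bd 2 by simp
   qed (use bd n in simp)
  qed
  fix p :: nat assume "prime p"
  have "P (p * n) = P ((p mod m + m) * n)" if "n >= 1" for n
  proof -
   have "(p * n) mod m = ((p mod m + m) * n) mod m" by (simp add: distrib_right mod_mult_left_eq)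
   moreover have "p * n >= 1" "(p mod m + m) * n >= 1" using that m(1) prime_gt_0_nat[OF \<open>prime p\<close>] by simp_all
   ultimately show ?thesis using red by metis
  qed
  moreover have "(%n. P ((p mod m + m) * n)) \<in> B"
   unfolding B_def using m(1) by (intro insertI2 image_eqI[of _ _ "p mod m"]) simp_all
  ultimately show "\<exists>b'\<in>B. \<forall>n\<ge>1. P (p * n) = b' n" by (intro bexI[of _ "%n. P ((p mod m + m) * n)"] allI impI)
 qed
qed

lemma katai_good_uncorrelated:
 assumes c: "katai_good c" and b: "dilation_finite b"
 shows "covariance c b \<longlonglongrightarrow> 0"
proof -
 obtain C where C: "\<forall>n\<ge>1. norm (c n) <= C" using c unfolding katai_good_def by blast
 have orth: "prime p ==> prime q ==> p ~= q ==> average (%n. c (p * n) * cnj (c (q * n))) \<longlonglongrightarrow> 0" for p q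
  using c unfolding katai_good_def by blast
 have lim: "average (%n. c n * cnj (b n)) \<longlonglongrightarrow> 0" if df: "dilation_finite b" for b
 proof -
  obtain B D where B: "finite B" "b \<in> B" "\<forall>b'\<in>B. \<forall>n\<ge>1. norm (b' n) <= D"
   "\<forall>p. prime p --> (\<exists>b'\<in>B. \<forall>n\<ge>1. b (p * n) = b' n)" using df unfolding dilation_finite_def by blast
  show ?thesis
  proof (rule katai_criterion[of B b "max C D"])
   show "norm (b' n) <= max C D" if "b' \<in> insert b B" "n >= 1" for b' n
    using B(2,3) that by (intro max.coboundedI2) auto
   show "norm (c n) <= max C D" if "n >= 1" for n using C that by (intro max.coboundedI1) simp
  qed (use B(1,4) orth in auto)
 qed
 \<comment> \<open>Applied to the constant sequence, the criterion makes the averages of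
   \<open>c\<close> itself tend to \<open>0\<close>.\<close>
 have "dilation_finite (%n. 1)" by (intro periodic_dilation_finite) (auto simp: periodic_sequence_def)
 from lim[OF this] have c0: "average c \<longlonglongrightarrow> 0" by simp
 obtain D where D: "\<forall>n\<ge>1. norm (b n) <= D" using b unfolding dilation_finite_def by blast
 have "0 <= norm (b 1)" "norm (b 1) <= D" using D by simp_all
 then have "D >= 0" by linarith
 have "(%N. average c N * average (%n. cnj (b n)) N) \<longlonglongrightarrow> 0"
 proof (rule Lim_null_comparison[of _ "%N. norm (average c N) * D"])
  have "norm (average (%n. cnj (b n)) N) <= D" for N using D \<open>D >= 0\<close> by (intro average_bound) auto
  then show "\<forall>\<^sub>F N in sequentially. norm (average c N * average (%n. cnj (b n)) N) <= norm (average c N) * D"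
   by (intro always_eventually allI) (simp add: norm_mult mult_left_mono)
  show "(%N. norm (average c N) * D) \<longlonglongrightarrow> 0" using tendsto_mult_left_zero[OF tendsto_norm_zero[OF c0]] .
 qed
 from tendsto_diff[OF lim[OF b] this] show ?thesis unfolding covariance_def[abs_def] by simp
qed

lemma katai_good_sum_uncorrelated:
 assumes "\<forall>c\<in>set cs. katai_good c" and b: "dilation_finite b"
 shows "covariance (%n. \<Sum>c\<leftarrow>cs. c n) b \<longlonglongrightarrow> 0"
 using assms(1)
proof (induction cs)
 case Nil
 have "covariance (%n. 0) b N = 0" for N by (simp add: covariance_def average_def)
 then show ?case by simp
next
 case (Cons c cs)
 then have "(%N. covariance c b N + covariance (%n. \<Sum>c\<leftarrow>cs. c n) b N) \<longlonglongrightarrow> 0 + 0"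
  using katai_good_uncorrelated[OF _ b, of c] by (intro tendsto_add) auto
 then show ?case by (simp add: covariance_add[symmetric])
qed

text \<open>Write \<open>u = P + c + v\<close>. If periodic sequences are uncorrelated with
  \<open>u\<close>, the covariances of \<open>P\<close> with \<open>u\<close> and with
  \<open>c\<close> tend to \<open>0\<close>, and that with \<open>v\<close> is at most
  \<open>e\<close> times the deviation \<open>s\<close> of \<open>P\<close>; hence
  \<open>s\<^sup>2 <= e\<^sup>2 + e * s\<close>, so \<open>s <= 2 * e\<close>. If they are
  uncorrelated with \<open>b\<close>, the contribution of \<open>P\<close> vanishes in the
  limit.\<close>

theorem structured_uncorrelated:
 assumes u: "structured u" and b: "dilation_finite b"
  and per: "(\<forall>P. periodic_sequence P --> asymptotically_uncorrelated P u) \<or> (\<forall>P. periodic_sequence P --> asymptotically_uncorrelated P b)"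
 shows "asymptotically_uncorrelated u b"
 unfolding asymptotically_uncorrelated_covariance
proof (rule LIMSEQ_I)
 fix r :: real assume r: "r > 0"
 obtain K0 where K0: "\<forall>n\<ge>1. norm (b n) <= K0" using b unfolding dilation_finite_def by blast
 define K where "K = max K0 0"
 have K: "K >= 0" "\<And>n. n >= 1 ==> norm (b n) <= K" using K0 unfolding K_def by (auto intro: max.coboundedI1)
 \<comment> \<open>In the end \<open>P\<close> contributes at most \<open>(2 * K + 1) * e\<close>,
   \<open>c\<close> at most \<open>e\<close> and \<open>v\<close> at most \<open>2 * K * e\<close>;
   one \<open>e\<close> is slack.\<close>
 define e where "e = r / (4 * K + 3)"
 have e: "e > 0" "(4 * K + 3) * e = r" using r K(1) by (simp_all add: e_def)
 obtain P cs where P: "periodic_sequence P" and cs: "\<forall>c\<in>set cs. katai_good c"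
  and appr: "\<forall>n\<ge>1. norm (u n - (P n + (\<Sum>c\<leftarrow>cs. c n))) <= e" using u e(1) unfolding structured_def by blast
 define c where "c = (%n. \<Sum>c\<leftarrow>cs. c n)"
 define v where "v = (%n. u n - (P n + c n))"
 have v: "norm (v n) <= e" if "n >= 1" for n using appr that unfolding v_def c_def by simp
 have u_eq: "u = (%n. (P n + c n) + v n)" by (simp add: v_def)
 have split: "covariance u x N = covariance P x N + covariance c x N + covariance v x N" for x N
  by (subst u_eq) (simp only: covariance_add)
 have small: "\<forall>\<^sub>F N in sequentially. norm (f N) < d" if "f \<longlonglongrightarrow> 0" "d > 0" for f :: "nat => complex" and d
  using order_tendstoD(2)[OF tendsto_norm_zero[OF that(1)] that(2)] .
 have cb: "covariance c b \<longlonglongrightarrow> 0" and cP: "covariance c P \<longlonglongrightarrow> 0"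
  unfolding c_def by (intro katai_good_sum_uncorrelated cs b periodic_dilation_finite P)+
 have "\<forall>\<^sub>F N in sequentially. norm (covariance P b N) <= 2 * K * e + e"
  using per
 proof
  assume "\<forall>P. periodic_sequence P --> asymptotically_uncorrelated P u"
  then have Pu: "covariance P u \<longlonglongrightarrow> 0" using P unfolding asymptotically_uncorrelated_covariance by blast
  have ee: "e\<^sup>2 / 2 > 0" using e(1) by simp
  from small[OF Pu ee] small[OF cP ee] show ?thesis
  proof eventually_elim
   case (elim N)
   obtain s where s: "s >= 0" "covariance P P N = of_real (s\<^sup>2)"
    "\<And>b K. (\<forall>n\<ge>1. norm (b n) <= K) ==> K >= 0 ==> norm (covariance P b N) <= K * s"
    using covariance_le_deviation[of P N] by blast
   have "covariance P P N = cnj (covariance P u N) - covariance c P N - cnj (covariance P v N)"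
    using split[of P N] covariance_cnj[of u P N] covariance_cnj[of v P N] by simp
   then have "norm (covariance P P N) <= norm (covariance P u N) + norm (covariance c P N) + norm (covariance P v N)"
    using norm_triangle_ineq4[of "cnj (covariance P u N) - covariance c P N" "cnj (covariance P v N)"]
     norm_triangle_ineq4[of "cnj (covariance P u N)" "covariance c P N"] by simp
   moreover have "norm (covariance P v N) <= e * s" using v e(1) by (intro s(3)) auto
   ultimately have "s * s <= e * e + e * s" using elim unfolding s(2) norm_of_real by (simp add: power2_eq_square)
   have "s <= 2 * e"
   proof (rule ccontr)
    assume "\<not> s <= 2 * e"
    then have "2 * e * s < s * s" "e * e < e * s" using e(1) by (auto intro!: mult_strict_right_mono mult_strict_left_mono)
    then show False using \<open>s * s <= e * e + e * s\<close> by simp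
   qed
   have "norm (covariance P b N) <= K * s" using K by (intro s(3)) auto
   also have "\<dots> <= K * (2 * e)" using \<open>s <= 2 * e\<close> K(1) by (rule mult_left_mono)
   finally show ?case using e(1) by simp
  qed
 next
  assume "\<forall>P. periodic_sequence P --> asymptotically_uncorrelated P b"
  then have "covariance P b \<longlonglongrightarrow> 0" using P unfolding asymptotically_uncorrelated_covariance by blast
  from small[OF this e(1)] show ?thesis
  proof eventually_elim
   case (elim N)
   have "0 <= 2 * K * e" using e(1) K(1) by simp
   then show ?case using elim by linarith
  qed
 qed
 with small[OF cb e(1)] have "\<forall>\<^sub>F N in sequentially. norm (covariance u b N) < r"
 proof eventually_elim
  case (elim N)
  have "norm (covariance v b N) <= 2 * e * K" using v K e(1) by (intro covariance_bound) auto
  moreover have "norm (covariance u b N) <= norm (covariance P b N) + norm (covariance c b N) + norm (covariance v b N)"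
   unfolding split by (intro order.trans[OF norm_triangle_ineq] add_right_mono norm_triangle_ineq)
  ultimately have "norm (covariance u b N) < (2 * K * e + e) + e + 2 * e * K + e" using elim e(1) by linarith
  also have "\<dots> = (4 * K + 3) * e" by (simp add: algebra_simps)
  finally show ?case unfolding e(2) .
 qed
 then show "\<exists>N0. \<forall>N\<ge>N0. norm (covariance u b N - 0) < r" unfolding eventually_sequentially by simp
qed

text \<open>\<open>S (p * n) y = S p (S n y)\<close>, and \<open>S p\<close> acts as one of finitely
  many maps; the identity map in \<open>B\<close> stands for the sequence itself.\<close>

lemma multiplicative_dilation_finite:
 assumes Y: "multiplicative_tds Y S" "finitely_generated Y S" and y: "y \<in> topspace Y" and g: "continuous_map Y euclidean g"
 shows "dilation_finite (%n. g (S n y) :: complex)"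
proof -
 have Sc: "continuous_map Y Y (S n)" if "n >= 1" for n using Y(1) that unfolding multiplicative_tds_def by blast
 have Sm: "S (p * n) y = S p (S n y)" if "p >= 1" "n >= 1" for p n using Y(1) that y unfolding multiplicative_tds_def by blast
 have Sy: "S n z \<in> topspace Y" if "n >= 1" "z \<in> topspace Y" for n z using continuous_map_image_subset_topspace[OF Sc[OF that(1)]] that(2) by blast
 obtain R where R: "finite R" "\<forall>r\<in>R. continuous_map Y Y r" "\<forall>p. prime p --> (\<exists>r\<in>R. \<forall>y\<in>topspace Y. S p y = r y)"
  using Y(2) unfolding finitely_generated_def by blast
 have "compactin euclidean (g ` topspace Y)"
  using Y(1) unfolding multiplicative_tds_def compact_space_def by (intro image_compactin[OF _ g]) auto
 then have "bounded (g ` topspace Y)" by (simp add: compact_imp_bounded)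
 then obtain C where C: "\<forall>z\<in>topspace Y. norm (g z) <= C" unfolding bounded_iff by auto
 define B where "B = (%r n. g (r (S n y))) ` (insert (%z. z) R)"
 have "norm (b' n) <= C" if b': "b' \<in> B" and n: "n >= 1" for b' n
 proof -
  obtain r where r: "r \<in> insert (%z. z) R" "b' = (%n. g (r (S n y)))" using b' unfolding B_def by blast
  have "r z \<in> topspace Y" if "z \<in> topspace Y" for z
   using r(1) R(2) that continuous_map_image_subset_topspace[of Y Y r] by auto
  then show ?thesis using C Sy[OF n y] unfolding r(2) by blast
 qed
 moreover have "\<exists>b'\<in>B. \<forall>n\<ge>1. g (S (p * n) y) = b' n" if p: "prime p" for p
 proof -
  obtain r where r: "r \<in> R" "\<forall>y\<in>topspace Y. S p y = r y" using R(3) p by blast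
  have "g (S (p * n) y) = g (r (S n y))" if "n >= 1" for n
   using Sm[OF _ that] prime_gt_0_nat[OF p] r(2) Sy[OF that y] by simp
  then show ?thesis using r(1) unfolding B_def by (intro bexI[of _ "%n. g (r (S n y))"]) auto
 qed
 moreover have "finite B" "(%n. g (S n y)) \<in> B" using R(1) unfolding B_def by simp_all
 ultimately show ?thesis unfolding dilation_finite_def
  by (intro exI[of _ B] exI[of _ C] conjI allI impI ballI) assumption+
qed

subsection \<open>Minimal cocompact subgroups\<close>

context uniform_group
begin

definition closed_subgroup :: "'a set => bool" where
 "closed_subgroup K \<longleftrightarrow> subgroup K G \<and> (\<forall>g\<in>carrier G. (\<forall>d>0. \<exists>u\<in>B d. u \<otimes> g \<in> K) --> g \<in> K)"

definition clos :: "'a set => 'a set" where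
 "clos K = {g \<in> carrier G. \<forall>d>0. \<exists>u\<in>B d. u \<otimes> g \<in> K}"

lemma clos_incl: "K \<subseteq> carrier G ==> K \<subseteq> clos K"
proof
 fix g assume "K \<subseteq> carrier G" "g \<in> K"
 then have "g \<in> carrier G" "\<one> \<otimes> g \<in> K" by auto
 then show "g \<in> clos K" unfolding clos_def using B_one by blast
qed

lemma clos_least: "closed_subgroup H ==> K \<subseteq> H ==> clos K \<subseteq> H"
 unfolding closed_subgroup_def clos_def by blast

lemma closed_subgroup_clos:
 assumes K: "subgroup K G" shows "closed_subgroup (clos K)"
 unfolding closed_subgroup_def
proof (intro conjI ballI impI)
 show "subgroup (clos K) G"
 proof (rule subgroupI)
  show "clos K \<subseteq> carrier G" unfolding clos_def by blast
  show "clos K ~= {}" using clos_incl[OF subgroup.subset[OF K]] subgroup.one_closed[OF K] by blast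
 next
  fix g assume "g \<in> clos K"
  then have g: "g \<in> carrier G" "\<forall>d>0. \<exists>u\<in>B d. u \<otimes> g \<in> K" unfolding clos_def by auto
  have "\<exists>u\<in>B d. u \<otimes> inv g \<in> K" if d: "d > 0" for d
  proof -
   obtain d1 where d1: "d1 > 0" "\<forall>u\<in>B d1. inv u \<in> B d" using B_inv[OF d] by blast
   obtain d2 where d2: "d2 > 0" "\<forall>u\<in>B d2. inv g \<otimes> u \<otimes> inv (inv g) \<in> B d1" using B_conj[OF d1(1), of "inv g"] g(1) by auto
   obtain u where u: "u \<in> B d2" "u \<otimes> g \<in> K" using g(2) d2(1) by blast
   have uc: "u \<in> carrier G" using B_in u(1) .
   have "inv (inv g \<otimes> u \<otimes> inv (inv g)) \<in> B d" using d1(2) d2(2) u(1) by blast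
   moreover have "inv (inv g \<otimes> u \<otimes> inv (inv g)) \<otimes> inv g = inv (u \<otimes> g)" using uc g(1) by (simp add: inv_mult_group m_assoc)
   ultimately show ?thesis using subgroup.m_inv_closed[OF K u(2)] by (metis (no_types))
  qed
  then show "inv g \<in> clos K" using g(1) unfolding clos_def by simp
 next
  fix g h assume "g \<in> clos K" "h \<in> clos K"
  then have g: "g \<in> carrier G" "\<forall>d>0. \<exists>u\<in>B d. u \<otimes> g \<in> K" and h: "h \<in> carrier G" "\<forall>d>0. \<exists>u\<in>B d. u \<otimes> h \<in> K" unfolding clos_def by auto
  have "\<exists>u\<in>B d. u \<otimes> (g \<otimes> h) \<in> K" if d: "d > 0" for d
  proof -
   obtain d1 where d1: "d1 > 0" "\<forall>u\<in>B d1. \<forall>v\<in>B d1. u \<otimes> v \<in> B d" using B_mult[OF d] by blast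
   obtain d2 where d2: "d2 > 0" "\<forall>u\<in>B d2. g \<otimes> u \<otimes> inv g \<in> B d1" using B_conj[OF d1(1) g(1)] by blast
   obtain u where u: "u \<in> B d1" "u \<otimes> g \<in> K" using g(2) d1(1) by blast
   obtain v where v: "v \<in> B d2" "v \<otimes> h \<in> K" using h(2) d2(1) by blast
   have "u \<in> carrier G" "v \<in> carrier G" using B_in u(1) v(1) by auto
   then have "(u \<otimes> (g \<otimes> v \<otimes> inv g)) \<otimes> (g \<otimes> h) = (u \<otimes> g) \<otimes> (v \<otimes> h)" using g(1) h(1)
    by (simp add: m_assoc inv_solve_left')
   moreover have "u \<otimes> (g \<otimes> v \<otimes> inv g) \<in> B d" using d1(2) d2(2) u(1) v(1) by blast
   ultimately show ?thesis using subgroup.m_closed[OF K u(2) v(2)] by (metis (no_types))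
  qed
  then show "g \<otimes> h \<in> clos K" using g(1) h(1) unfolding clos_def by simp
 qed
 fix g assume g: "g \<in> carrier G" and near: "\<forall>d>0. \<exists>u\<in>B d. u \<otimes> g \<in> clos K"
 have "\<exists>u\<in>B d. u \<otimes> g \<in> K" if d: "d > 0" for d
 proof -
  obtain d1 where d1: "d1 > 0" "\<forall>u\<in>B d1. \<forall>v\<in>B d1. u \<otimes> v \<in> B d" using B_mult[OF d] by blast
  obtain u where u: "u \<in> B d1" "u \<otimes> g \<in> clos K" using near d1(1) by blast
  obtain v where v: "v \<in> B d1" "v \<otimes> (u \<otimes> g) \<in> K" using u(2) d1(1) unfolding clos_def by blast
  have "v \<otimes> u \<in> B d" "(v \<otimes> u) \<otimes> g \<in> K" using d1(2) u v g B_in by (auto simp: m_assoc)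
  then show ?thesis by blast
 qed
 then show "g \<in> clos K" using g unfolding clos_def by simp
qed

text \<open>If \<open>u \<otimes> g\<close> lies in \<open>H'\<close> with \<open>u\<close> small,
  then \<open>g\<close> and with it \<open>u\<close> lies in \<open>H\<close>, hence
  \<open>u\<close> in \<open>H'\<close>: an open subgroup is closed.\<close>

lemma closed_subgroup_open:
 assumes "closed_subgroup H" "subgroup H' G" "H' \<subseteq> H" "d > 0" "H \<inter> B d \<subseteq> H'"
 shows "closed_subgroup H'"
 unfolding closed_subgroup_def
proof (intro conjI ballI impI assms(2))
 fix g assume g: "g \<in> carrier G" and near: "\<forall>d>0. \<exists>u\<in>B d. u \<otimes> g \<in> H'"
 have H: "subgroup H G" using assms(1) unfolding closed_subgroup_def by blast
 have "g \<in> H" using assms(1,3) g near unfolding closed_subgroup_def by blast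
 obtain u where u: "u \<in> B d" "u \<otimes> g \<in> H'" using near assms(4) by blast
 have uc: "u \<in> carrier G" using B_in u(1) .
 have "(u \<otimes> g) \<otimes> inv g \<in> H" using u(2) assms(3) \<open>g \<in> H\<close> subgroup.m_closed[OF H] subgroup.m_inv_closed[OF H] by blast
 then have "u \<in> H" using uc g by (simp add: m_assoc)
 then have "inv u \<otimes> (u \<otimes> g) \<in> H'" using u assms(5) subgroup.m_closed[OF assms(2)] subgroup.m_inv_closed[OF assms(2)] by blast
 then show "g \<in> H'" using uc g by (simp add: m_assoc[symmetric])
qed

end

context cocompact
begin

text \<open>Total boundedness of \<open>H / (\<Gamma> \<inter> H)\<close> with all witnesses inside
  \<open>H\<close>; an arbitrary subgroup does not inherit it from \<open>cover\<close>.\<close>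

definition covered :: "'a set => bool" where
 "covered H \<longleftrightarrow> (\<forall>d>0. \<exists>S. finite S \<and> S \<subseteq> H \<and> (\<forall>g\<in>H. \<exists>u\<in>B d \<inter> H. \<exists>s\<in>S. \<exists>\<gamma>\<in>\<Gamma> \<inter> H. g = u \<otimes> s \<otimes> \<gamma>))"

text \<open>A representative \<open>s\<close> whose coset meets \<open>H'\<close> is moved into
  \<open>H'\<close> by an element of \<open>\<Gamma> \<inter> H\<close> on the right; small elements
  of \<open>H\<close> lie in \<open>H'\<close> anyway.\<close>

lemma covered_open:
 assumes H: "covered H" "subgroup H G" and H': "subgroup H' G" "H' \<subseteq> H" and d0: "d0 > 0" "H \<inter> B d0 \<subseteq> H'"
 shows "covered H'"
 unfolding covered_def
proof (intro allI impI)
 fix d :: real assume "d > 0"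
 then obtain e where e: "e > 0" "B e \<subseteq> B d" "B e \<subseteq> B d0" using B_both[OF _ d0(1)] by blast
 obtain S where S: "finite S" "S \<subseteq> H" "\<forall>g\<in>H. \<exists>u\<in>B e \<inter> H. \<exists>s\<in>S. \<exists>\<gamma>\<in>\<Gamma> \<inter> H. g = u \<otimes> s \<otimes> \<gamma>"
  using H(1)[unfolded covered_def, rule_format, OF e(1)] by blast
 note c = subgroup.mem_carrier[OF H(2)] subgroup.mem_carrier[OF H'(1)]
 define good where "good = (%s h. h \<in> H' \<and> (\<exists>\<gamma>\<in>\<Gamma> \<inter> H. s = h \<otimes> \<gamma>))"
 define pick where "pick = (%s. SOME h. good s h)"
 define S' where "S' = pick ` {s \<in> S. \<exists>h. good s h}"
 have good: "good s (pick s)" if "\<exists>h. good s h" for s using someI_ex[OF that] unfolding pick_def .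
 have "\<exists>u\<in>B d \<inter> H'. \<exists>s\<in>S'. \<exists>\<gamma>\<in>\<Gamma> \<inter> H'. g = u \<otimes> s \<otimes> \<gamma>" if g: "g \<in> H'" for g
 proof -
  obtain u s \<gamma> where *: "u \<in> B e" "u \<in> H" "s \<in> S" "\<gamma> \<in> \<Gamma>" "\<gamma> \<in> H" "g = u \<otimes> s \<otimes> \<gamma>" using S(3) g H'(2) by blast
  have uH: "u \<in> H'" using * e(3) d0(2) by blast
  have cc: "u \<in> carrier G" "s \<in> carrier G" "\<gamma> \<in> carrier G" "g \<in> carrier G" using * S(2) c g by auto
  have "s = (inv u \<otimes> g) \<otimes> inv \<gamma>" using cc unfolding *(6) by (simp add: m_assoc inv_solve_left)
  moreover have "inv u \<otimes> g \<in> H'" using uH g subgroup.m_closed[OF H'(1)] subgroup.m_inv_closed[OF H'(1)] by blast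
  moreover have "inv \<gamma> \<in> \<Gamma> \<inter> H" using *(4,5) subgroup.m_inv_closed[OF H(2)] subgroup.m_inv_closed[OF \<Gamma>] by blast
  ultimately have ex: "\<exists>h. good s h" unfolding good_def by blast
  define h where "h = pick s"
  have hS: "h \<in> S'" unfolding h_def S'_def using *(3) ex by blast
  obtain \<delta> where h: "h \<in> H'" "\<delta> \<in> \<Gamma>" "\<delta> \<in> H" "s = h \<otimes> \<delta>" using good[OF ex] unfolding h_def[symmetric] good_def by blast
  have hc: "h \<in> carrier G" "\<delta> \<in> carrier G" using h c by auto
  have eq: "g = u \<otimes> h \<otimes> (\<delta> \<otimes> \<gamma>)" using cc hc unfolding *(6) h(4) by (simp add: m_assoc)
  then have "\<delta> \<otimes> \<gamma> = inv (u \<otimes> h) \<otimes> g" using cc hc by (simp add: inv_solve_left)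
  moreover have "inv (u \<otimes> h) \<otimes> g \<in> H'" using uH h(1) g subgroup.m_closed[OF H'(1)] subgroup.m_inv_closed[OF H'(1)] by blast
  ultimately have "\<delta> \<otimes> \<gamma> \<in> H'" by simp
  then have "\<delta> \<otimes> \<gamma> \<in> \<Gamma> \<inter> H'" using subgroup.m_closed[OF \<Gamma> h(2) *(4)] by blast
  then show ?thesis using eq hS uH *(1) e(2) by blast
 qed
 moreover have "finite S'" "S' \<subseteq> H'" using S(1) good unfolding S'_def good_def by auto
 ultimately show "\<exists>S. finite S \<and> S \<subseteq> H' \<and> (\<forall>g\<in>H'. \<exists>u\<in>B d \<inter> H'. \<exists>s\<in>S. \<exists>\<gamma>\<in>\<Gamma> \<inter> H'. g = u \<otimes> s \<otimes> \<gamma>)"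
  by (intro exI[of _ S'] conjI ballI)
qed

text \<open>As \<open>\<gamma>\<close> lies in \<open>H'\<close>, so does
  \<open>u \<otimes> s\<close>; hence \<open>s\<close> is moved into \<open>H'\<close> by a small
  element on the left, and the factor \<open>u \<otimes> inv v\<close> is still small.\<close>

lemma covered_intermediate:
 assumes H: "covered H" "subgroup H G" and H': "subgroup H' G" "H' \<subseteq> H" "\<Gamma> \<inter> H \<subseteq> H'"
 shows "covered H'"
 unfolding covered_def
proof (intro allI impI)
 fix d :: real assume "d > 0"
 then obtain d1 where d1: "d1 > 0" "\<forall>u\<in>B d1. \<forall>v\<in>B d1. u \<otimes> v \<in> B d" using B_mult by blast
 obtain d2 where d2: "d2 > 0" "\<forall>u\<in>B d2. inv u \<in> B d1" using B_inv[OF d1(1)] by blast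
 obtain e where e: "e > 0" "B e \<subseteq> B d1" "B e \<subseteq> B d2" using B_both[OF d1(1) d2(1)] by blast
 obtain S where S: "finite S" "S \<subseteq> H" "\<forall>g\<in>H. \<exists>u\<in>B e \<inter> H. \<exists>s\<in>S. \<exists>\<gamma>\<in>\<Gamma> \<inter> H. g = u \<otimes> s \<otimes> \<gamma>"
  using H(1)[unfolded covered_def, rule_format, OF e(1)] by blast
 note c = subgroup.mem_carrier[OF H(2)] subgroup.mem_carrier[OF H'(1)]
 define good where "good = (%s h. h \<in> H' \<and> (\<exists>v\<in>B e \<inter> H. h = v \<otimes> s))"
 define pick where "pick = (%s. SOME h. good s h)"
 define S' where "S' = pick ` {s \<in> S. \<exists>h. good s h}"
 have good: "good s (pick s)" if "\<exists>h. good s h" for s using someI_ex[OF that] unfolding pick_def .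
 have "\<exists>u\<in>B d \<inter> H'. \<exists>s\<in>S'. \<exists>\<gamma>\<in>\<Gamma> \<inter> H'. g = u \<otimes> s \<otimes> \<gamma>" if g: "g \<in> H'" for g
 proof -
  obtain u s \<gamma> where *: "u \<in> B e" "u \<in> H" "s \<in> S" "\<gamma> \<in> \<Gamma>" "\<gamma> \<in> H" "g = u \<otimes> s \<otimes> \<gamma>" using S(3) g H'(2) by blast
  have gH: "\<gamma> \<in> H'" using * H'(3) by blast
  have cc: "u \<in> carrier G" "s \<in> carrier G" "\<gamma> \<in> carrier G" "g \<in> carrier G" using * S(2) c g by auto
  have "u \<otimes> s = g \<otimes> inv \<gamma>" using cc unfolding *(6) by (simp add: m_assoc)
  then have us: "u \<otimes> s \<in> H'" using gH g subgroup.m_closed[OF H'(1)] subgroup.m_inv_closed[OF H'(1)] by simp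
  then have ex: "\<exists>h. good s h" unfolding good_def using *(1,2) by blast
  define h where "h = pick s"
  have hS: "h \<in> S'" unfolding h_def S'_def using *(3) ex by blast
  obtain v where h: "h \<in> H'" "v \<in> B e" "v \<in> H" "h = v \<otimes> s" using good[OF ex] unfolding h_def[symmetric] good_def by blast
  have vc: "v \<in> carrier G" using h(3) c by auto
  have "inv v \<otimes> (v \<otimes> s) = s" using cc vc by (simp add: m_assoc[symmetric])
  then have eq1: "u \<otimes> s = (u \<otimes> inv v) \<otimes> h" unfolding h(4) using cc vc by (simp add: m_assoc)
  have "(u \<otimes> s) \<otimes> inv h = u \<otimes> inv v" unfolding eq1 using cc vc h(1) c(2) by (simp add: m_assoc)
  then have "u \<otimes> inv v \<in> H'" using us h(1) subgroup.m_closed[OF H'(1)] subgroup.m_inv_closed[OF H'(1)] by metis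
  moreover have "u \<otimes> inv v \<in> B d" using d1(2) d2(2) *(1) h(2) e(2,3) by blast
  moreover have "g = (u \<otimes> inv v) \<otimes> h \<otimes> \<gamma>" unfolding *(6) eq1 ..
  ultimately show ?thesis using hS gH *(4) by blast
 qed
 moreover have "finite S'" "S' \<subseteq> H'" using S(1) good unfolding S'_def good_def by auto
 ultimately show "\<exists>S. finite S \<and> S \<subseteq> H' \<and> (\<forall>g\<in>H'. \<exists>u\<in>B d \<inter> H'. \<exists>s\<in>S. \<exists>\<gamma>\<in>\<Gamma> \<inter> H'. g = u \<otimes> s \<otimes> \<gamma>)"
  by (intro exI[of _ S'] conjI ballI)
qed

context
 fixes \<tau> :: 'a
 assumes \<tau>: "\<tau> \<in> carrier G"
begin

definition admissible :: "'a set => bool" where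
 "admissible H \<longleftrightarrow> closed_subgroup H \<and> covered H \<and> \<tau> \<in> H"

lemma admissibleD:
 assumes "admissible H" shows "subgroup H G" "closed_subgroup H" "covered H" "\<tau> \<in> H"
 using assms unfolding admissible_def closed_subgroup_def by auto

lemma admissible_generate_small:
 assumes H: "admissible H" and d: "d > 0"
 defines "H' \<equiv> generate G (insert \<tau> (H \<inter> B d))"
 shows "admissible H'" "H' \<subseteq> H"
proof -
 have sub: "insert \<tau> (H \<inter> B d) \<subseteq> H" using admissibleD[OF H] by blast
 then have S: "subgroup H' G" unfolding H'_def using subgroup.subset[OF admissibleD(1)[OF H]] by (intro generate_is_subgroup) blast
 show le: "H' \<subseteq> H" unfolding H'_def using generate_subgroup_incl[OF sub admissibleD(1)[OF H]] .
 have small: "\<tau> \<in> H'" "H \<inter> B d \<subseteq> H'" unfolding H'_def by (auto intro: generate.incl)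
 show "admissible H'"
  unfolding admissible_def using closed_subgroup_open[OF admissibleD(2)[OF H] S le d small(2)]
   covered_open[OF admissibleD(3,1)[OF H] S le d small(2)] small(1) by blast
qed

lemma admissible_clos:
 assumes H: "admissible H" and A: "A \<subseteq> H" "\<tau> \<in> A" "\<Gamma> \<inter> H \<subseteq> A"
 shows "admissible (clos (generate G A))" "clos (generate G A) \<subseteq> H"
proof -
 have Ac: "A \<subseteq> carrier G" using A(1) subgroup.subset[OF admissibleD(1)[OF H]] by blast
 have cl: "closed_subgroup (clos (generate G A))" by (rule closed_subgroup_clos[OF generate_is_subgroup[OF Ac]])
 show le: "clos (generate G A) \<subseteq> H"
  by (rule clos_least[OF admissibleD(2)[OF H] generate_subgroup_incl[OF A(1) admissibleD(1)[OF H]]])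
 have "A \<subseteq> generate G A" using generate.incl by fast
 then have AA: "A \<subseteq> clos (generate G A)" using clos_incl[OF generate_incl[OF Ac]] by blast
 then have "covered (clos (generate G A))"
  using cl A le unfolding closed_subgroup_def by (intro covered_intermediate[OF admissibleD(3,1)[OF H]]) auto
 then show "admissible (clos (generate G A))" unfolding admissible_def using cl A(2) AA by blast
qed

definition minimal_admissible :: "'a set => bool" where
 "minimal_admissible H \<longleftrightarrow> admissible H \<and> (\<forall>H'. admissible H' --> H' \<subseteq> H --> H' = H)"

lemma lower_central_series_subgroup:
 assumes "subgroup H G" shows "lower_central_series (G\<lparr>carrier := H\<rparr>) k \<subseteq> L k"
  "lower_central_series (G\<lparr>carrier := H\<rparr>) k \<subseteq> H"
proof (induction k)
 case 0
 case 1 show ?case using subgroup.subset[OF assms] by simp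
 case 2 show ?case by simp
next
 case (Suc k)
 let ?Lk = "lower_central_series (G\<lparr>carrier := H\<rparr>) k"
 let ?A = "\<Union>g\<in>H. \<Union>h\<in>?Lk. {comm g h}"
 have AH: "?A \<subseteq> H" using Suc(2) subgroup.m_closed[OF assms] subgroup.m_inv_closed[OF assms] by (fastforce simp: comm_def)
 have inv: "h \<in> ?Lk ==> inv\<^bsub>G\<lparr>carrier := H\<rparr>\<^esub> h = inv h" for h using Suc(2) m_inv_consistent[OF assms] by blast
 have "lower_central_series (G\<lparr>carrier := H\<rparr>) (Suc k) = generate (G\<lparr>carrier := H\<rparr>) ?A"
  unfolding lower_central_series.simps(2) comm_def using m_inv_consistent[OF assms] inv by (intro arg_cong[where f="generate (G\<lparr>carrier := H\<rparr>)"] SUP_cong) simp_all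
 also have "\<dots> = generate G ?A" by (rule generate_consistent[OF AH assms])
 finally have eq: "lower_central_series (G\<lparr>carrier := H\<rparr>) (Suc k) = generate G ?A" .
 case 1 show ?case unfolding eq L_Suc using Suc(1) subgroup.subset[OF assms] by (intro mono_generate) blast
 case 2 show ?case unfolding eq by (rule generate_subgroup_incl[OF AH assms])
qed

text \<open>Minimality is used twice. The subgroup generated by \<open>\<tau>\<close> and
  \<open>H \<inter> B d\<close> is open in \<open>H\<close>, and the closure of the one generated by
  \<open>\<tau>\<close>, \<open>\<Gamma> \<inter> H\<close> and the commutators contains
  \<open>\<Gamma> \<inter> H\<close>; both are admissible, hence equal to \<open>H\<close>.\<close>

theorem minimal_admissible_good_group:
 assumes "minimal_admissible H"
 shows "good_group (G\<lparr>carrier := H\<rparr>) (%d. B d \<inter> H) (\<Gamma> \<inter> H) \<tau>"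
proof -
 have H: "admissible H" and minimal: "\<And>H'. admissible H' ==> H' \<subseteq> H ==> H' = H"
  using assms unfolding minimal_admissible_def by auto
 note D = admissibleD[OF H]
 note sub = subgroup.mem_carrier[OF D(1)] subgroup.m_closed[OF D(1)] subgroup.m_inv_closed[OF D(1)] subgroup.one_closed[OF D(1)]
 have inv: "h \<in> H ==> inv\<^bsub>G\<lparr>carrier := H\<rparr>\<^esub> h = inv h" for h using m_inv_consistent[OF D(1)] .
 interpret HH: group "G\<lparr>carrier := H\<rparr>" using subgroup.subgroup_is_group[OF D(1) is_group] .
 show ?thesis
 proof (intro good_group.intro uniform_group.intro uniform_group_axioms.intro good_group_axioms.intro HH.is_group)
  show "B d \<inter> H \<subseteq> carrier (G\<lparr>carrier := H\<rparr>)" for d by simp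
  show "\<one>\<^bsub>G\<lparr>carrier := H\<rparr>\<^esub> \<in> B d \<inter> H" if "d > 0" for d using B_one[OF that] sub(4) by simp
  show "B d \<inter> H \<subseteq> B e \<inter> H" if "d <= e" for d e using B_mono[OF that] by blast
  show "\<exists>e>0. \<forall>u\<in>B e \<inter> H. inv\<^bsub>G\<lparr>carrier := H\<rparr>\<^esub> u \<in> B d \<inter> H" if "d > 0" for d
   using B_inv[OF that] inv sub(3) by fastforce
  show "\<exists>e>0. \<forall>u\<in>B e \<inter> H. \<forall>v\<in>B e \<inter> H. u \<otimes>\<^bsub>G\<lparr>carrier := H\<rparr>\<^esub> v \<in> B d \<inter> H" if "d > 0" for d
   using B_mult[OF that] sub(2) by fastforce
  show "\<exists>e>0. \<forall>u\<in>B e \<inter> H. g \<otimes>\<^bsub>G\<lparr>carrier := H\<rparr>\<^esub> u \<otimes>\<^bsub>G\<lparr>carrier := H\<rparr>\<^esub> inv\<^bsub>G\<lparr>carrier := H\<rparr>\<^esub> g \<in> B d \<inter> H"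
   if d: "d > 0" and gH: "g \<in> carrier (G\<lparr>carrier := H\<rparr>)" for d g
  proof -
   have g: "g \<in> H" "g \<in> carrier G" using gH sub(1) by auto
   obtain e where "e > 0" "\<forall>u\<in>B e. g \<otimes> u \<otimes> inv g \<in> B d" using B_conj[OF d g(2)] by blast
   then show ?thesis using sub(2,3) g(1) inv by (intro exI[of _ e]) auto
  qed
  show "subgroup (\<Gamma> \<inter> H) (G\<lparr>carrier := H\<rparr>)"
   using subgroups_Inter_pair[OF \<Gamma> D(1)] subgroup_incl[OF _ D(1)] by blast
  show "\<tau> \<in> carrier (G\<lparr>carrier := H\<rparr>)" using D(4) by simp
  show "\<exists>S. finite S \<and> S \<subseteq> carrier (G\<lparr>carrier := H\<rparr>) \<and> (\<forall>g\<in>carrier (G\<lparr>carrier := H\<rparr>). \<exists>u\<in>B d \<inter> H. \<exists>s\<in>S. \<exists>\<gamma>\<in>\<Gamma> \<inter> H. g = u \<otimes>\<^bsub>G\<lparr>carrier := H\<rparr>\<^esub> s \<otimes>\<^bsub>G\<lparr>carrier := H\<rparr>\<^esub> \<gamma>)"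
   if "d > 0" for d using D(3) that unfolding covered_def by simp
  show "generate (G\<lparr>carrier := H\<rparr>) (insert \<tau> (B d \<inter> H)) = carrier (G\<lparr>carrier := H\<rparr>)" if "d > 0" for d
  proof -
   have "generate G (insert \<tau> (H \<inter> B d)) = H" using minimal admissible_generate_small[OF H that] .
   then show ?thesis using generate_consistent[of "insert \<tau> (B d \<inter> H)" H] D(1,4) by (simp add: Int_commute)
  qed
  show "\<exists>u\<in>B d \<inter> H. u \<otimes>\<^bsub>G\<lparr>carrier := H\<rparr>\<^esub> g \<in> generate (G\<lparr>carrier := H\<rparr>) (insert \<tau> ((\<Gamma> \<inter> H) \<union> lower_central_series (G\<lparr>carrier := H\<rparr>) 1))"
   if d: "d > 0" and gH: "g \<in> carrier (G\<lparr>carrier := H\<rparr>)" for d g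
  proof -
   let ?A = "insert \<tau> ((\<Gamma> \<inter> H) \<union> lower_central_series (G\<lparr>carrier := H\<rparr>) 1)"
   have A: "?A \<subseteq> H" using D(4) lower_central_series_subgroup(2)[OF D(1)] by blast
   have "clos (generate G ?A) = H" using admissible_clos[OF H A] by (intro minimal) auto
   then have "g \<in> clos (generate G ?A)" using gH by simp
   then obtain u where u: "u \<in> B d" "u \<otimes> g \<in> generate G ?A" using d unfolding clos_def by blast
   have "(u \<otimes> g) \<otimes> inv g \<in> H" using generate_subgroup_incl[OF A D(1)] u(2) gH sub(2,3) by auto
   moreover have "(u \<otimes> g) \<otimes> inv g = u" using B_in[OF u(1)] gH sub(1) by (simp add: m_assoc)
   ultimately show ?thesis using u generate_consistent[OF A D(1)] by auto
  qed
 qed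
qed

text \<open>If every admissible \<open>H\<close> had, for each \<open>r > 0\<close>, an admissible
  subgroup that misses a point of \<open>H \<inter> B r\<close>, dependent choice would build a
  sequence that \<open>chain\<close> excludes. So for some \<open>H\<close> and \<open>r\<close>
  every admissible subgroup of \<open>H\<close> contains \<open>H \<inter> B r\<close>, and the
  group generated by this set and \<open>\<tau>\<close> is minimal.\<close>

theorem minimal_admissible_exists:
 assumes chain: "\<And>K u. (\<And>i. closed_subgroup (K i) \<and> K (Suc i) \<subseteq> K i \<and> u i \<in> K i - K (Suc i)) ==>
  \<exists>d>0. \<forall>i0. \<exists>i\<ge>i0. u i \<notin> B d"
 shows "\<exists>H. minimal_admissible H"
proof -
 have G: "admissible (carrier G)"
  unfolding admissible_def closed_subgroup_def covered_def using \<tau> cover B_carrier \<Gamma>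
  by (auto simp: Int_absorb2 subgroup.subset subgroup_self)
 have "\<exists>H r. admissible H \<and> r > 0 \<and> (\<forall>H'. admissible H' --> H' \<subseteq> H --> H \<inter> B r \<subseteq> H')"
 proof (rule ccontr)
  assume "\<not> ?thesis"
  then have step: "\<exists>H'. admissible H' \<and> H' \<subseteq> H \<and> (\<exists>u\<in>H \<inter> B (1 / Suc i). u \<notin> H')" if "admissible H" for H and i :: nat
   using that by (metis subsetI divide_pos_pos of_nat_0_less_iff zero_less_Suc zero_less_one)
  obtain K where K: "\<And>i. admissible (K i) \<and> K (Suc i) \<subseteq> K i \<and> (\<exists>u\<in>K i \<inter> B (1 / Suc i). u \<notin> K (Suc i))"
   using dependent_nat_choice[of "%_. admissible" "%i H H'. H' \<subseteq> H \<and> (\<exists>u\<in>H \<inter> B (1 / Suc i). u \<notin> H')"] G step by metis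
  then obtain u where u: "\<And>i. u i \<in> K i \<inter> B (1 / Suc i) \<and> u i \<notin> K (Suc i)" by metis
  obtain d where d: "d > 0" "\<forall>i0. \<exists>i\<ge>i0. u i \<notin> B d" using chain[of K u] K u admissibleD(2) by blast
  obtain i0 :: nat where i0: "inverse (Suc i0) < d" using reals_Archimedean[OF d(1)] by blast
  have "u i \<in> B d" if "i >= i0" for i
  proof -
   have "1 / real (Suc i) <= d" using i0 that frac_le[of 1 1 "real (Suc i0)" "real (Suc i)"] by (simp add: inverse_eq_divide)
   then show ?thesis using u[of i] B_mono by blast
  qed
  then show False using d(2) by blast
 qed
 then obtain H r where H: "admissible H" "r > 0" "\<And>H'. admissible H' ==> H' \<subseteq> H ==> H \<inter> B r \<subseteq> H'" by blast
 let ?H = "generate G (insert \<tau> (H \<inter> B r))"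
 have "H' = ?H" if H': "admissible H'" "H' \<subseteq> ?H" for H'
 proof -
  have "insert \<tau> (H \<inter> B r) \<subseteq> H'" using H(3)[OF H'(1)] H'(2) admissible_generate_small(2)[OF H(1,2)] admissibleD(4)[OF H'(1)] by blast
  then show ?thesis using generate_subgroup_incl[OF _ admissibleD(1)[OF H'(1)]] H'(2) by blast
 qed
 then show ?thesis unfolding minimal_admissible_def using admissible_generate_small(1)[OF H(1,2)] by blast
qed

end

end

subsection \<open>Almost additive coordinates\<close>

text \<open>The inserted \<open>0\<close> is for \<open>n = 0\<close>.\<close>

definition coord_norm :: "nat => (nat => real) => real" where
 "coord_norm n x = Max (insert 0 ((%i. \<bar>x i\<bar>) ` {..<n}))"

lemma coord_norm_nonneg: "0 <= coord_norm n x"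
 and coord_norm_ge: "i < n ==> \<bar>x i\<bar> <= coord_norm n x"
 and coord_norm_le: "(\<And>i. i < n ==> \<bar>x i\<bar> <= c) ==> 0 <= c ==> coord_norm n x <= c"
 and coord_norm_less: "d > 0 ==> coord_norm n x < d \<longleftrightarrow> (\<forall>i<n. \<bar>x i\<bar> < d)"
 unfolding coord_norm_def by auto

text \<open>\<open>additive\<close> is first-order information on the product: the error is small
  relative to the second factor alone, however small that is compared with the first.\<close>

locale additive_chart = uniform_group +
 fixes U :: "'a set" and \<nu> :: "'a => nat => real" and n :: nat
 assumes B_chart: "B d = {u \<in> U. \<forall>i<n. \<bar>\<nu> u i\<bar> < d}"
  and chart_one: "\<nu> \<one> i = 0"
  and additive: "e > 0 ==> \<exists>d>0. \<forall>u\<in>B d. \<forall>v\<in>B d. u \<otimes> v \<in> U \<and> (\<forall>i<n. \<bar>\<nu> (u \<otimes> v) i - \<nu> u i - \<nu> v i\<bar> <= e * coord_norm n (\<nu> v))"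
begin

abbreviation "N u \<equiv> coord_norm n (\<nu> u)"

lemma B_iff: "d > 0 ==> u \<in> B d \<longleftrightarrow> u \<in> U \<and> N u < d"
 unfolding B_chart by (simp add: coord_norm_less)

lemma U_carrier: "u \<in> U ==> u \<in> carrier G"
 using B_iff[of "N u + 1" u] B_in[of u "N u + 1"] coord_norm_nonneg[of n "\<nu> u"] by simp

text \<open>As \<open>K\<close> is closed and \<open>u\<close> is not in it, the norms of the points
  \<open>u \<otimes> w\<close> inside the chart are bounded away from \<open>0\<close>. Their
  infimum need not be attained, hence the factor \<open>2\<close>.\<close>

lemma almost_nearest:
 assumes K: "closed_subgroup K" and u: "u \<in> U" "u \<notin> K"
 shows "\<exists>w\<in>K. u \<otimes> w \<in> U \<and> N (u \<otimes> w) > 0 \<and> N (u \<otimes> w) <= 2 * N u \<and>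
  (\<forall>w'\<in>K. u \<otimes> w \<otimes> w' \<in> U --> N (u \<otimes> w) <= 2 * N (u \<otimes> w \<otimes> w'))"
proof -
 have S: "subgroup K G" and cl: "\<And>g. g \<in> carrier G ==> \<forall>d>0. \<exists>u\<in>B d. u \<otimes> g \<in> K ==> g \<in> K"
  using K unfolding closed_subgroup_def by auto
 have uc: "u \<in> carrier G" using U_carrier u(1) .
 have "\<exists>d>0. \<forall>w\<in>K. u \<otimes> w \<notin> B d"
 proof (rule ccontr)
  assume "\<not> ?thesis"
  then have near: "\<And>d. d > 0 ==> \<exists>w\<in>K. u \<otimes> w \<in> B d" by blast
  have "\<exists>x\<in>B d. x \<otimes> u \<in> K" if d: "d > 0" for d
  proof -
   obtain e where e: "e > 0" "\<forall>u\<in>B e. inv u \<in> B d" using B_inv[OF d] by blast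
   obtain w where w: "w \<in> K" "u \<otimes> w \<in> B e" using near[OF e(1)] by blast
   have wc: "w \<in> carrier G" using subgroup.mem_carrier[OF S w(1)] .
   have "inv (u \<otimes> w) \<otimes> u = inv w" using uc wc by (simp add: inv_mult_group m_assoc)
   then show ?thesis using e(2) w(2) subgroup.m_inv_closed[OF S w(1)] by (intro bexI[of _ "inv (u \<otimes> w)"]) auto
  qed
  then show False using cl[OF uc] u(2) by blast
 qed
 then obtain d where d: "d > 0" "\<forall>w\<in>K. u \<otimes> w \<notin> B d" by blast
 define V where "V = {N (u \<otimes> w) | w. w \<in> K \<and> u \<otimes> w \<in> U}"
 have V: "d <= x" if "x \<in> V" for x using that d B_iff[OF d(1)] unfolding V_def by fastforce
 have Nu: "N u \<in> V" unfolding V_def using u(1) uc subgroup.one_closed[OF S] by (auto intro!: exI[of _ \<one>])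
 have bdd: "bdd_below V" using V by (rule bdd_belowI)
 have inf: "d <= Inf V" using Nu V by (intro cInf_greatest) auto
 then have "Inf V < 2 * Inf V" using d(1) by simp
 then obtain x where x: "x \<in> V" "x < 2 * Inf V" using cInf_lessD[of V] Nu by blast
 then obtain w where w: "x = N (u \<otimes> w)" "w \<in> K" "u \<otimes> w \<in> U" unfolding V_def by blast
 have low: "N (u \<otimes> w) <= 2 * y" if "y \<in> V" for y using cInf_lower[OF that bdd] x(2) unfolding w(1) by simp
 have "N (u \<otimes> w) <= 2 * N (u \<otimes> w \<otimes> w')" if "w' \<in> K" "u \<otimes> w \<otimes> w' \<in> U" for w'
 proof -
  have eq: "u \<otimes> w \<otimes> w' = u \<otimes> (w \<otimes> w')" using uc w(2) that(1) subgroup.mem_carrier[OF S] by (simp add: m_assoc)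
  have "N (u \<otimes> w \<otimes> w') \<in> V" unfolding V_def mem_Collect_eq
   using that(2) subgroup.m_closed[OF S w(2) that(1)] unfolding eq by (intro exI[of _ "w \<otimes> w'"]) simp
  then show ?thesis by (rule low)
 qed
 moreover have "N (u \<otimes> w) > 0" using V[OF x(1)] d(1) w(1) by simp
 ultimately show ?thesis using w(2,3) low[OF Nu] by blast
qed

text \<open>Each further factor adds the coordinates of \<open>v\<close> with an error of at most
  \<open>e * N v\<close>; the hypothesis on \<open>l\<close> keeps all intermediate powers in the
  ball.\<close>

lemma power_coordinates:
 assumes d: "\<forall>u\<in>B d. \<forall>v\<in>B d. u \<otimes> v \<in> U \<and> (\<forall>i<n. \<bar>\<nu> (u \<otimes> v) i - \<nu> u i - \<nu> v i\<bar> <= e * N v)" "d > 0" "e >= 0"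
  and v: "v \<in> B d" and l: "(1 + e) * (real l * N v) < d"
 shows "v [^] l \<in> B d \<and> (\<forall>i<n. \<bar>\<nu> (v [^] l) i - real l * \<nu> v i\<bar> <= e * (real l * N v))"
 using l
proof (induction l)
 case 0
 then show ?case using d(2) chart_one B_one by simp
next
 case (Suc l)
 have "real l * N v <= real (Suc l) * N v" by (intro mult_right_mono coord_norm_nonneg) simp
 then have "(1 + e) * (real l * N v) <= (1 + e) * (real (Suc l) * N v)" using d(3) by (intro mult_left_mono) simp_all
 then have IH: "v [^] l \<in> B d" "\<And>i. i < n ==> \<bar>\<nu> (v [^] l) i - real l * \<nu> v i\<bar> <= e * (real l * N v)" using Suc by auto
 have step: "v [^] Suc l \<in> U" "\<And>i. i < n ==> \<bar>\<nu> (v [^] Suc l) i - \<nu> (v [^] l) i - \<nu> v i\<bar> <= e * N v"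
  using d(1) IH(1) v by auto
 have close: "\<bar>\<nu> (v [^] Suc l) i - real (Suc l) * \<nu> v i\<bar> <= e * (real (Suc l) * N v)" if "i < n" for i
  using IH(2)[OF that] step(2)[OF that] by (simp add: algebra_simps)
 have "N (v [^] Suc l) <= (1 + e) * (real (Suc l) * N v)"
 proof (rule coord_norm_le)
  fix i assume i: "i < n"
  have "\<bar>real (Suc l) * \<nu> v i\<bar> <= real (Suc l) * N v" using coord_norm_ge[OF i, of "\<nu> v"] by (simp add: abs_mult mult_left_mono)
  then show "\<bar>\<nu> (v [^] Suc l) i\<bar> <= (1 + e) * (real (Suc l) * N v)" using close[OF i] by (simp only: distrib_right mult_1_left)
 qed (use d(3) coord_norm_nonneg in simp)
 then show ?case using B_iff[OF d(2)] step(1) close Suc.prems by auto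
qed

text \<open>If \<open>u\<close> and a much smaller \<open>v\<close> point in almost the same direction, then multiplying \<open>u\<close> by a power of
 \<open>inv v\<close> brings it considerably closer to the identity. So almost nearest points of a decreasing chain of
 closed subgroups cannot have accumulating directions.\<close>

theorem no_small_chain:
 assumes K: "\<And>i. closed_subgroup (K i) \<and> K (Suc i) \<subseteq> K i \<and> u i \<in> K i - K (Suc i)"
 shows "\<exists>d>0. \<forall>i0. \<exists>i\<ge>i0. u i \<notin> B d"
proof (rule ccontr)
 assume "\<not> ?thesis"
 then have small: "\<And>d. d > 0 ==> \<exists>i0. \<forall>i\<ge>i0. u i \<in> B d" by blast
 obtain i1 where "\<forall>i\<ge>i1. u i \<in> B 1" using small[of 1] by auto
 then have uU: "u i \<in> U" if "i >= i1" for i using that B_iff[of 1] by simp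
 have S: "subgroup (K i) G" for i using K unfolding closed_subgroup_def by blast
 have Kd: "K (Suc i) \<subseteq> K i" for i using K by blast
 have anti: "K j \<subseteq> K (Suc i)" if "i < j" for i j
  using lift_Suc_antimono_le[of K, OF Kd, of "Suc i" j] that by simp
 have "\<exists>w\<in>K (Suc i). u i \<otimes> w \<in> U \<and> N (u i \<otimes> w) > 0 \<and> N (u i \<otimes> w) <= 2 * N (u i) \<and>
  (\<forall>w'\<in>K (Suc i). u i \<otimes> w \<otimes> w' \<in> U --> N (u i \<otimes> w) <= 2 * N (u i \<otimes> w \<otimes> w'))" if "i >= i1" for i
  using K[of i] K[of "Suc i"] uU[OF that] by (intro almost_nearest) auto
 then obtain w where w: "\<And>i. i >= i1 ==> w i \<in> K (Suc i) \<and> u i \<otimes> w i \<in> U \<and> N (u i \<otimes> w i) > 0 \<and> N (u i \<otimes> w i) <= 2 * N (u i) \<and>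
  (\<forall>w'\<in>K (Suc i). u i \<otimes> w i \<otimes> w' \<in> U --> N (u i \<otimes> w i) <= 2 * N (u i \<otimes> w i \<otimes> w'))" by metis
 define v where "v = (%i. u i \<otimes> w i)"
 have vU: "v i \<in> U" "N (v i) > 0" if "i >= i1" for i using w[OF that] unfolding v_def by auto
 have vK: "v i \<in> K i" if "i >= i1" for i using w[OF that] K[of i] subgroup.m_closed[OF S] unfolding v_def by blast
 have vmin: "N (v i) <= 2 * N (v i \<otimes> w')" if "i >= i1" "w' \<in> K (Suc i)" "v i \<otimes> w' \<in> U" for i w' using w[OF that(1)] that unfolding v_def by blast
 have vsmall: "\<exists>i0. \<forall>i\<ge>i0. N (v i) < d" if d: "d > 0" for d
 proof -
  obtain i0 where i0: "\<forall>i\<ge>i0. u i \<in> B (d / 2)" using small[of "d / 2"] d by auto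
  have "N (v i) < d" if "i >= max i0 i1" for i
  proof -
   have "N (u i) < d / 2" using i0 that d B_iff[of "d / 2"] by simp
   then show ?thesis using w[of i] that unfolding v_def by simp
  qed
  then show ?thesis by blast
 qed
 \<comment> \<open>The direction of \<open>v i\<close>, rounded to tenths; there are finitely many
   cells, so one occurs infinitely often.\<close>
 define cell where "cell = (%i. \<lambda>k\<in>{..<n}. \<lfloor>10 * (\<nu> (v i) k / N (v i))\<rfloor>)"
 have "cell ` {i1..} \<subseteq> {..<n} \<rightarrow>\<^sub>E {-10..10}"
 proof (rule image_subsetI)
  fix i assume "i \<in> {i1..}"
  then have "N (v i) > 0" using vU by simp
  then have "\<bar>\<nu> (v i) k / N (v i)\<bar> <= 1" if "k < n" for k using coord_norm_ge[OF that, of "\<nu> (v i)"] by (simp add: abs_divide)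
  then have "\<nu> (v i) k / N (v i) <= 1 \<and> - 1 <= \<nu> (v i) k / N (v i)" if "k < n" for k using that by (metis abs_le_iff minus_le_iff)
  then have "-10 <= \<lfloor>10 * (\<nu> (v i) k / N (v i))\<rfloor> \<and> \<lfloor>10 * (\<nu> (v i) k / N (v i))\<rfloor> <= 10" if "k < n" for k
   using that by (force simp: le_floor_iff floor_le_iff)
  then show "cell i \<in> {..<n} \<rightarrow>\<^sub>E {-10..10}" unfolding cell_def by simp
 qed
 then have "finite (cell ` {i1..})" by (rule finite_subset) (intro finite_PiE; simp)
 then obtain a where a: "infinite {i \<in> {i1..}. cell i = cell a}" using pigeonhole_infinite[of "{i1..}" cell] infinite_Ici by blast
 have often: "\<exists>j>i. j >= i1 \<and> cell j = cell a" for i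
  using a unfolding infinite_nat_iff_unbounded by (metis (mono_tags, lifting) atLeast_iff mem_Collect_eq)
 obtain d where d: "d > 0" "\<forall>u\<in>B d. \<forall>v\<in>B d. u \<otimes> v \<in> U \<and> (\<forall>i<n. \<bar>\<nu> (u \<otimes> v) i - \<nu> u i - \<nu> v i\<bar> <= 1/10 * N v)"
  using additive[of "1/10"] by auto
 obtain d1 where d1: "d1 > 0" "\<forall>u\<in>B d1. \<forall>v\<in>B d1. u \<otimes> v \<in> B d \<and> u \<otimes> inv v \<in> B d" using small_mult_inv[OF d(1)] by blast
 define d2 where "d2 = min d d1"
 have d2: "d2 > 0" "B d2 \<subseteq> B d" "B d2 \<subseteq> B d1" using d(1) d1(1) B_mono unfolding d2_def by auto
 have d2': "\<forall>u\<in>B d2. \<forall>v\<in>B d2. u \<otimes> v \<in> U \<and> (\<forall>i<n. \<bar>\<nu> (u \<otimes> v) i - \<nu> u i - \<nu> v i\<bar> <= 1/10 * N v)" using d(2) d2(2) by blast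
 obtain i0 where i0: "\<forall>i\<ge>i0. N (v i) < d2 / 2" using vsmall[of "d2 / 2"] d2(1) by auto
 obtain i where i: "i > i0" "i >= i1" "cell i = cell a" using often by blast
 have Ni: "N (v i) > 0" "N (v i) < d2 / 2" using vU[OF i(2)] i0 i(1) by auto
 obtain j0 where j0: "\<forall>j\<ge>j0. N (v j) < N (v i) / 10" using vsmall[of "N (v i) / 10"] Ni(1) by auto
 obtain j where j: "j > max i j0" "j >= i1" "cell j = cell a" using often by blast
 have Nj: "N (v j) > 0" "N (v j) < N (v i) / 10" using vU[OF j(2)] j0 j(1) by auto
 \<comment> \<open>\<open>m\<close> copies of \<open>v j\<close> have about the length of
   \<open>v i\<close>; as \<open>v j\<close> is more than ten times shorter, the rounding costs less
   than a tenth.\<close>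
 define m where "m = nat \<lfloor>N (v i) / N (v j)\<rfloor>"
 have "0 <= \<lfloor>N (v i) / N (v j)\<rfloor>" using Ni Nj by simp
 then have "real m <= N (v i) / N (v j)" "N (v i) / N (v j) < real m + 1" unfolding m_def by linarith+
 then have m: "real m * N (v j) <= N (v i)" "N (v i) < real m * N (v j) + N (v j)" using Nj(1) by (simp_all add: field_simps)
 have vB: "v i \<in> B d2" "v j \<in> B d2" using B_iff[OF d2(1)] vU(1)[OF i(2)] vU(1)[OF j(2)] Ni Nj d2(1) by simp_all
 define p where "p = v j [^] m"
 have pw: "p \<in> B d2 \<and> (\<forall>k<n. \<bar>\<nu> p k - real m * \<nu> (v j) k\<bar> <= 1/10 * (real m * N (v j)))"
  unfolding p_def using d2' d2(1) vB(2) m(1) Ni(2) by (intro power_coordinates) auto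
 \<comment> \<open>So \<open>inv p\<close> lies in the subgroup over which \<open>v i\<close> is
   almost minimal.\<close>
 have pK: "p \<in> K (Suc i)"
 proof -
  have "v j \<in> K (Suc i)" using vK[OF j(2)] anti[of i j] j(1) by auto
  then show ?thesis unfolding p_def
   by (induction m) (simp_all add: subgroup.one_closed[OF S] subgroup.m_closed[OF S])
 qed
 define x where "x = v i \<otimes> inv p"
 have xB: "x \<in> B d" unfolding x_def using d1(2) vB(1) pw d2(3) by blast
 have xU: "x \<in> U" using xB B_iff[OF d(1)] by blast
 have "v i = x \<otimes> p" unfolding x_def using U_carrier[OF vU(1)[OF i(2)]] B_in[of p d2] pw by (simp add: m_assoc)
 then have ad: "\<bar>\<nu> (v i) k - \<nu> x k - \<nu> p k\<bar> <= 1/10 * N p" if "k < n" for k using d(2) xB pw d2(2) that by auto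
 have Np: "N p <= 11/10 * N (v i)"
 proof (rule coord_norm_le)
  fix k assume k: "k < n"
  have "real m * \<bar>\<nu> (v j) k\<bar> <= real m * N (v j)" using coord_norm_ge[OF k, of "\<nu> (v j)"] by (intro mult_left_mono) auto
  then have "\<bar>real m * \<nu> (v j) k\<bar> <= real m * N (v j)" by (simp add: abs_mult)
  moreover have "\<bar>\<nu> p k - real m * \<nu> (v j) k\<bar> <= 1/10 * (real m * N (v j))" using pw k by blast
  ultimately show "\<bar>\<nu> p k\<bar> <= 11/10 * N (v i)" using m(1) by linarith
 qed (use Ni in simp)
 \<comment> \<open>\<open>2/10\<close> for comparing \<open>v i\<close> with \<open>m\<close> times
   \<open>v j\<close> in direction and length, \<open>1/10\<close> for the power and
   \<open>11/100\<close> for the product: less than one half, against \<open>vmin\<close>.\<close>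
 have "N x <= 41/100 * N (v i)"
 proof (rule coord_norm_le)
  fix k assume k: "k < n"
  define s t where "s = \<nu> (v i) k / N (v i)" and "t = \<nu> (v j) k / N (v j)"
  have st: "\<nu> (v i) k = N (v i) * s" "\<nu> (v j) k = N (v j) * t" using Ni Nj by (simp_all add: s_def t_def)
  have "\<lfloor>10 * s\<rfloor> = \<lfloor>10 * t\<rfloor>" using fun_cong[OF trans[OF i(3) j(3)[symmetric]], of k] k unfolding cell_def s_def t_def by simp
  then have "\<bar>s - t\<bar> <= 1/10" by linarith
  then have 1: "\<bar>N (v i) * (s - t)\<bar> <= N (v i) * (1/10)" using Ni(1) by (simp add: abs_mult)
  have "\<bar>t\<bar> <= 1" using coord_norm_ge[OF k, of "\<nu> (v j)"] Nj(1) by (simp add: t_def abs_divide)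
  then have "\<bar>N (v i) - real m * N (v j)\<bar> * \<bar>t\<bar> <= N (v j) * 1" using m by (intro mult_mono) auto
  then have 2: "\<bar>(N (v i) - real m * N (v j)) * t\<bar> <= N (v j)" by (simp add: abs_mult)
  have "\<nu> (v i) k - real m * \<nu> (v j) k = N (v i) * (s - t) + (N (v i) - real m * N (v j)) * t" unfolding st by (simp add: algebra_simps)
  then have "\<bar>\<nu> (v i) k - real m * \<nu> (v j) k\<bar> <= 2/10 * N (v i)" using 1 2 Nj(2) by linarith
  moreover have "\<bar>\<nu> p k - real m * \<nu> (v j) k\<bar> <= 1/10 * (real m * N (v j))" using pw k by blast
  ultimately show "\<bar>\<nu> x k\<bar> <= 41/100 * N (v i)" using ad[OF k] Np m(1) by linarith
 qed (use Ni in simp)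
 moreover have "N (v i) <= 2 * N x" unfolding x_def
  using i(2) xU subgroup.m_inv_closed[OF S pK] by (intro vmin) (auto simp: x_def)
 ultimately show False using Ni(1) by linarith
qed

end

subsection \<open>Charts of a Lie group at the identity\<close>

definition Euclidean_box :: "nat => (nat => real) => real => (nat => real) set" where
 "Euclidean_box m p d = {x \<in> topspace (Euclidean_space m). \<forall>i<m. \<bar>x i - p i\<bar> < d}"

lemma Euclidean_box_mono: "d <= e ==> Euclidean_box m p d \<subseteq> Euclidean_box m p e"
 unfolding Euclidean_box_def by force

lemma Euclidean_box_exists:
 assumes "openin (Euclidean_space m) V" "p \<in> V"
 shows "\<exists>d>0. Euclidean_box m p d \<subseteq> V"
proof -
 obtain S where S: "openin (powertop_real UNIV) S" "V = S \<inter> {x. \<forall>i\<ge>m. x i = 0}"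
  using assms(1) unfolding Euclidean_space_def openin_subtopology by blast
 then have p: "p \<in> S" "\<And>i. i >= m ==> p i = 0" using assms(2) by auto
 obtain Y where Y: "\<And>i. openin euclideanreal (Y i)" "p \<in> Pi\<^sub>E UNIV Y" "Pi\<^sub>E UNIV Y \<subseteq> S"
  using S(1)[unfolded openin_product_topology_alt, rule_format, OF p(1)] by auto
 have ex: "\<exists>e>0. \<forall>t. \<bar>t - p i\<bar> < e --> t \<in> Y i" for i
 proof -
  have "open (Y i)" "p i \<in> Y i" using Y(1)[of i, unfolded open_openin[symmetric]] PiE_mem[OF Y(2) UNIV_I] .
  then have "\<exists>e>0. \<forall>t. dist t (p i) < e --> t \<in> Y i" unfolding open_dist by (rule bspec)
  then show ?thesis unfolding dist_real_def .
 qed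
 obtain e where e: "\<And>i. e i > 0" "\<And>i t. \<bar>t - p i\<bar> < e i ==> t \<in> Y i" using ex by metis
 \<comment> \<open>Finitely many radii suffice: the coordinates from \<open>m\<close> on vanish at
   \<open>p\<close> and at all points of the space.\<close>
 define d where "d = Min (insert 1 (e ` {..<m}))"
 have d: "d > 0" "\<And>i. i < m ==> d <= e i" using e(1) by (auto simp: d_def)
 have "x \<in> V" if x: "x \<in> Euclidean_box m p d" for x
 proof -
  have x0: "x i = 0" if "i >= m" for i using x that unfolding Euclidean_box_def topspace_Euclidean_space by simp
  have "x i \<in> Y i" for i
  proof (cases "i < m")
   case True
   then have "\<bar>x i - p i\<bar> < d" using x unfolding Euclidean_box_def by simp
   then show ?thesis using e(2)[of "x i" i] d(2)[OF True] by simp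
  next
   case False
   then show ?thesis using x0[of i] p(2)[of i] e(1)[of i] e(2)[of "x i" i] by simp
  qed
  then show ?thesis using Y(3) x0 unfolding S(2) by auto
 qed
 then show ?thesis using d(1) by blast
qed

text \<open>The mean value theorem, one coordinate at a time, for \<open>F\<close> minus its linear
  part at \<open>p\<close>.\<close>

lemma C1_increment:
 fixes F :: "(nat => real) => real" and g :: "nat => (nat => real) => real"
 assumes der: "\<And>x k. x \<in> Euclidean_box m p d ==> k < m ==> ((%t. F (x(k := t))) has_real_derivative g k x) (at (x k))"
  and bd: "\<And>x k. x \<in> Euclidean_box m p d ==> k < m ==> \<bar>g k x - g k p\<bar> <= e"
  and z: "z \<in> Euclidean_box m p d" and z': "z' \<in> Euclidean_box m p d"
 shows "\<bar>F z - F z' - (\<Sum>k<m. g k p * (z k - z' k))\<bar> <= e * (\<Sum>k<m. \<bar>z k - z' k\<bar>)"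
proof -
 \<comment> \<open>\<open>h k\<close> has the first \<open>k\<close> coordinates of \<open>z\<close>
   and the others of \<open>z'\<close>, so consecutive points differ in one coordinate only.\<close>
 define h where "h = (%k i. if i < k then z i else z' i)"
 have upd: "(h k)(k := t) \<in> Euclidean_box m p d" if "k < m" "\<bar>t - p k\<bar> < d" for k t
  using z z' that unfolding Euclidean_box_def topspace_Euclidean_space h_def by auto
 have "\<bar>F (h (Suc k)) - F (h k) - g k p * (z k - z' k)\<bar> <= e * \<bar>z k - z' k\<bar>" if k: "k < m" for k
 proof -
  let ?G = "%t. F ((h k)(k := t)) - g k p * t"
  have hk: "h (Suc k) = (h k)(k := z k)" "h k = (h k)(k := z' k)" unfolding h_def by (auto simp: fun_eq_iff)
  have "norm (?G (z k) - ?G (z' k)) <= e * norm (z k - z' k)"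
  proof (rule field_differentiable_bound[of "{p k - d<..<p k + d}" ?G "%t. g k ((h k)(k := t)) - g k p"])
   fix t assume t: "t \<in> {p k - d<..<p k + d}"
   then have box: "(h k)(k := t) \<in> Euclidean_box m p d" using upd[OF k] by (simp add: abs_less_iff)
   have "((%t. F ((h k)(k := t))) has_real_derivative g k ((h k)(k := t))) (at t)" using der[OF box k] by simp
   then have "(?G has_real_derivative (g k ((h k)(k := t)) - g k p)) (at t)" by (auto intro!: derivative_eq_intros)
   then show "(?G has_real_derivative (g k ((h k)(k := t)) - g k p)) (at t within {p k - d<..<p k + d})" by (rule DERIV_subset) simp
   show "norm (g k ((h k)(k := t)) - g k p) <= e" using bd[OF box k] by simp
  qed (use z z' k in \<open>auto simp: Euclidean_box_def abs_less_iff\<close>)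
  then show ?thesis unfolding hk(1) using hk(2) by (simp add: algebra_simps)
 qed
 then have "(\<Sum>k<m. \<bar>F (h (Suc k)) - F (h k) - g k p * (z k - z' k)\<bar>) <= (\<Sum>k<m. e * \<bar>z k - z' k\<bar>)" by (intro sum_mono) auto
 moreover have "(\<Sum>k<m. F (h (Suc k)) - F (h k)) = F (h m) - F (h 0)" by (rule sum_lessThan_telescope)
 moreover have "h m = z" "h 0 = z'"
  using z z' unfolding h_def Euclidean_box_def topspace_Euclidean_space by (auto simp: fun_eq_iff)
 ultimately show ?thesis
  using sum_abs[of "%k. F (h (Suc k)) - F (h k) - g k p * (z k - z' k)" "{..<m}"]
  by (simp add: sum_subtractf sum_distrib_left)
qed

definition chart_ball :: "'a chart => nat => 'a => real => 'a set" where
 "chart_ball c n p d = {u \<in> fst c. \<forall>i<n. \<bar>snd c u i - snd c p i\<bar> < d}"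

lemma is_chart_facts:
 assumes c: "is_chart M n (U, \<phi>)"
 shows "openin M U" "inj_on \<phi> U" "u \<in> U ==> \<phi> u \<in> topspace (Euclidean_space n)"
  "openin M W ==> openin (Euclidean_space n) (\<phi> ` (U \<inter> W))" "openin M (chart_ball (U, \<phi>) n p d)"
  "openin M W ==> p \<in> U ==> p \<in> W ==> \<exists>d>0. Euclidean_box n (\<phi> p) d \<subseteq> \<phi> ` (U \<inter> W)"
  "openin M W ==> p \<in> U ==> p \<in> W ==> \<exists>d>0. chart_ball (U, \<phi>) n p d \<subseteq> W"
proof -
 show U: "openin M U" using c unfolding is_chart_def by auto
 have o: "openin (Euclidean_space n) (\<phi> ` U)" using c unfolding is_chart_def by auto
 have hom: "homeomorphic_map (subtopology M U) (subtopology (Euclidean_space n) (\<phi> ` U)) \<phi>" using c unfolding is_chart_def by auto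
 have tU: "topspace (subtopology M U) = U" using openin_subset[OF U] by auto
 show inj: "inj_on \<phi> U" using homeomorphic_imp_injective_map[OF hom] tU by simp
 show tE: "\<phi> u \<in> topspace (Euclidean_space n)" if "u \<in> U" for u using openin_subset[OF o] that by blast
 show im: "openin (Euclidean_space n) (\<phi> ` (U \<inter> W))" if "openin M W" for W
 proof -
  have "openin (subtopology M U) (U \<inter> W)" using that by (rule openin_subtopology_Int2)
  then have "openin (subtopology (Euclidean_space n) (\<phi> ` U)) (\<phi> ` (U \<inter> W))"
   using homeomorphic_imp_open_map[OF hom] unfolding open_map_def by blast
  then show ?thesis using o by (rule openin_trans_full)
 qed
 have "continuous_map (subtopology M U) (Euclidean_space n) \<phi>"
  using homeomorphic_imp_continuous_map[OF hom] continuous_map_in_subtopology by blast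
 then have cont: "continuous_map (subtopology M U) euclideanreal (%u. \<phi> u i)" for i
  unfolding Euclidean_space_def continuous_map_in_subtopology continuous_map_componentwise_UNIV by blast
 have "openin (subtopology M U) {u \<in> U. \<forall>i<m. \<bar>\<phi> u i - \<phi> p i\<bar> < d}" for m
 proof (induction m)
  case 0
  then show ?case using openin_topspace[of "subtopology M U"] tU by simp
 next
  case (Suc m)
  have "openin (subtopology M U) {u \<in> topspace (subtopology M U). \<phi> u m \<in> {\<phi> p m - d<..<\<phi> p m + d}}"
   by (intro openin_continuous_map_preimage[OF cont]) simp
  moreover have "{u \<in> U. \<forall>i<Suc m. \<bar>\<phi> u i - \<phi> p i\<bar> < d} =
   {u \<in> U. \<forall>i<m. \<bar>\<phi> u i - \<phi> p i\<bar> < d} \<inter> {u \<in> topspace (subtopology M U). \<phi> u m \<in> {\<phi> p m - d<..<\<phi> p m + d}}"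
   unfolding tU by (auto simp: less_Suc_eq abs_less_iff)
  ultimately show ?case using openin_Int[OF Suc] by simp
 qed
 then show "openin M (chart_ball (U, \<phi>) n p d)" unfolding chart_ball_def fst_conv snd_conv using U by (rule openin_trans_full)
 show box: "\<exists>d>0. Euclidean_box n (\<phi> p) d \<subseteq> \<phi> ` (U \<inter> W)" if "openin M W" "p \<in> U" "p \<in> W" for W
  using that by (intro Euclidean_box_exists im) auto
 assume W: "openin M W" "p \<in> U" "p \<in> W"
 then obtain d where d: "d > 0" "Euclidean_box n (\<phi> p) d \<subseteq> \<phi> ` (U \<inter> W)" using box by blast
 have "u \<in> W" if u: "u \<in> chart_ball (U, \<phi>) n p d" for u
 proof -
  have "u \<in> U" "\<phi> u \<in> Euclidean_box n (\<phi> p) d" using u tE unfolding chart_ball_def Euclidean_box_def by auto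
  then obtain w where "w \<in> U" "w \<in> W" "\<phi> u = \<phi> w" using d(2) by blast
  then show ?thesis using inj \<open>u \<in> U\<close> by (metis inj_onD)
 qed
 then show "\<exists>d>0. chart_ball (U, \<phi>) n p d \<subseteq> W" using d(1) by blast
qed

lemma C_k_on_derivatives:
 assumes "C_k_on m (Suc 0) V F"
 shows "\<exists>g. \<forall>i<m. (\<forall>x\<in>V. ((%t. F (x(i := t))) has_real_derivative g i x) (at (x i))) \<and>
  continuous_map (subtopology (Euclidean_space m) V) euclideanreal (g i)"
 using assms unfolding C_k_on.simps by metis

text \<open>In coordinates, the increments of the product from \<open>(u, \<one>)\<close> to
  \<open>(u, v)\<close> and from \<open>(\<one>, \<one>)\<close> to \<open>(\<one>, v)\<close> are
  the same linear expression in the coordinates of \<open>v\<close>, up to a small multiple of their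
  size, since the partial derivatives are continuous. Subtracting removes this expression without
  computing any derivative.\<close>

theorem lie_group_additive_chart:
 fixes G (structure)
 assumes lie: "lie_group G M n A"
 obtains B U \<nu> where "additive_chart G B U \<nu> n" "\<And>d. openin M (B d)"
  "\<And>W. openin M W ==> \<one> \<in> W ==> \<exists>d>0. B d \<subseteq> W"
proof -
 interpret group G using lie unfolding lie_group_def by blast
 note [simp] = is_group
 have tM: "topspace M = carrier G" and man: "smooth_manifold M n A"
  and sm: "smooth_map (prod_topology M M) (n + n) (prod_atlas n A A) M n A (\<lambda>(x, y). x \<otimes> y)"
  and si: "smooth_map M n A M n A (%x. inv x)" using lie unfolding lie_group_def by auto
 have cm: "continuous_map (prod_topology M M) M (\<lambda>(x, y). x \<otimes> y)" using sm unfolding smooth_map_def by blast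
 have ci: "continuous_map M M (%x. inv x)" using si unfolding smooth_map_def by blast
 have atlas: "\<And>c. c \<in> A ==> is_chart M n c" "(\<Union>(U, \<phi>)\<in>A. U) = carrier G"
  using man tM unfolding smooth_manifold_def smooth_atlas_def by auto
 obtain U \<phi> where A: "(U, \<phi>) \<in> A" "\<one> \<in> U" using atlas(2) one_closed by blast
 note ch = is_chart_facts[OF atlas(1)[OF A(1)]]
 define B where "B = chart_ball (U, \<phi>) n \<one>"
 define \<nu> where "\<nu> = (%u i. \<phi> u i - \<phi> \<one> i)"
 have B_eq: "B d = {u \<in> U. \<forall>i<n. \<bar>\<nu> u i\<bar> < d}" for d unfolding B_def chart_ball_def \<nu>_def by simp
 have Bo: "openin M (B d)" for d unfolding B_def by (rule ch(5))
 have Bn: "\<exists>d>0. B d \<subseteq> W" if "openin M W" "\<one> \<in> W" for W unfolding B_def using ch(7)[OF that(1) A(2) that(2)] .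
 have B1: "\<one> \<in> B d" if "d > 0" for d using that A(2) unfolding B_eq \<nu>_def by simp
 have mult: "\<exists>e>0. \<forall>u\<in>B e. \<forall>v\<in>B e. u \<otimes> v \<in> W" if W: "openin M W" "\<one> \<in> W" for W
 proof -
  define Q where "Q = {z \<in> topspace (prod_topology M M). (case z of (x, y) => x \<otimes> y) \<in> W}"
  have "openin (prod_topology M M) Q" unfolding Q_def by (rule openin_continuous_map_preimage[OF cm W(1)])
  moreover have "(\<one>, \<one>) \<in> Q" using W(2) tM by (simp add: Q_def)
  ultimately obtain V1 V2 where V: "openin M V1" "openin M V2" "\<one> \<in> V1" "\<one> \<in> V2" "V1 \<times> V2 \<subseteq> Q"
   unfolding openin_prod_topology_alt by metis
  obtain e where "e > 0" "B e \<subseteq> V1 \<inter> V2" using Bn[of "V1 \<inter> V2"] V by (auto intro: openin_Int)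
  then show ?thesis using V(5) unfolding Q_def by fast
 qed
 interpret uniform_group G B
 proof
  show "B d \<subseteq> carrier G" for d using openin_subset[OF Bo] tM by simp
  show "\<one> \<in> B d" if "d > 0" for d using B1 that .
  show "B d \<subseteq> B e" if "d <= e" for d e using that unfolding B_eq by force
  show "\<exists>e>0. \<forall>u\<in>B e. inv u \<in> B d" if d: "d > 0" for d
  proof -
   have "openin M {u \<in> topspace M. inv u \<in> B d}" by (rule openin_continuous_map_preimage[OF ci Bo])
   then show ?thesis using Bn[of "{u \<in> topspace M. inv u \<in> B d}"] B1[OF d] tM by auto
  qed
  show "\<exists>e>0. \<forall>u\<in>B e. \<forall>v\<in>B e. u \<otimes> v \<in> B d" if "d > 0" for d using mult[OF Bo B1[OF that]] .
  show "\<exists>e>0. \<forall>u\<in>B e. g \<otimes> u \<otimes> inv g \<in> B d" if d: "d > 0" and g: "g \<in> carrier G" for d g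
  proof -
   have "continuous_map M M (%u. (\<lambda>(x, y). x \<otimes> y) (g, u))" using g tM by (intro continuous_map_compose[OF _ cm, unfolded o_def]) (simp add: continuous_map_pairwise o_def)
   then have "continuous_map M M (%u. (\<lambda>(x, y). x \<otimes> y) (g \<otimes> u, inv g))" using g tM by (intro continuous_map_compose[OF _ cm, unfolded o_def]) (simp add: continuous_map_pairwise o_def)
   then have "openin M {u \<in> topspace M. g \<otimes> u \<otimes> inv g \<in> B d}" using openin_continuous_map_preimage[OF _ Bo] by fastforce
   then show ?thesis using Bn[of "{u \<in> topspace M. g \<otimes> u \<otimes> inv g \<in> B d}"] B1[OF d] tM g by auto
  qed
 qed
 define \<psi> where "\<psi> = (%x y i. if i < n then x i else y (i - n) :: real)"
 define P where "P = (\<lambda>(x, y). \<psi> (\<phi> x) (\<phi> y))"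
 have "(U \<times> U, P) \<in> prod_atlas n A A"
  unfolding prod_atlas_def prod_chart_def P_def \<psi>_def using A(1) by (force simp: case_prod_unfold)
 define V where "V = P ` {z \<in> U \<times> U. (case z of (x, y) => x \<otimes> y) \<in> U}"
 define F where "F = (%i z. (\<phi> \<circ> (\<lambda>(x, y). x \<otimes> y) \<circ> inv_into (U \<times> U) P) z i)"
 have F_smooth: "C_k_on (n + n) (Suc 0) V (F i)" if "i < n" for i
  using sm \<open>(U \<times> U, P) \<in> prod_atlas n A A\<close> A(1) that unfolding smooth_map_def smooth_between_def V_def F_def by fast
 have \<phi>0: "\<phi> u i = 0" if "u \<in> U" "i >= n" for u i using ch(3)[OF that(1)] that(2) unfolding topspace_Euclidean_space by simp
 have \<psi>1: "\<psi> x y i = x i" if "i < n" for x y i using that by (simp add: \<psi>_def)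
 have \<psi>2: "\<psi> x y (n + i) = y i" for x y i by (simp add: \<psi>_def)
 have Pinj: "inj_on P (U \<times> U)"
 proof (rule inj_onI, clarify)
  fix x y x' y' assume *: "x \<in> U" "y \<in> U" "x' \<in> U" "y' \<in> U" "P (x, y) = P (x', y')"
  have "\<phi> x i = \<phi> x' i" for i using fun_cong[OF *(5), of i] \<phi>0[of x i] \<phi>0[of x' i] * unfolding P_def \<psi>_def by (cases "i < n") auto
  moreover have "\<phi> y i = \<phi> y' i" for i using fun_cong[OF *(5), of "n + i"] unfolding P_def \<psi>_def by simp
  ultimately show "x = x' \<and> y = y'" using * inj_onD[OF ch(2)] by blast
 qed
 have F_eq: "F i (\<psi> (\<phi> u) (\<phi> v)) = \<phi> (u \<otimes> v) i" if "u \<in> U" "v \<in> U" for u v i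
  using inv_into_f_f[OF Pinj, of "(u, v)"] that unfolding F_def P_def by simp
 define p where "p = \<psi> (\<phi> \<one>) (\<phi> \<one>)"
 obtain e0 where e0: "e0 > 0" "\<forall>u\<in>B e0. \<forall>v\<in>B e0. u \<otimes> v \<in> U" using mult[OF ch(1) A(2)] by blast
 obtain e1 where e1: "e1 > 0" "Euclidean_box n (\<phi> \<one>) e1 \<subseteq> \<phi> ` (U \<inter> B e0)" using ch(6)[OF Bo A(2) B1[OF e0(1)]] by blast
 \<comment> \<open>Partial derivatives are given on \<open>V\<close> only; \<open>V\<close> contains
   a box because products of points near the identity stay in the chart.\<close>
 have boxV: "Euclidean_box (n + n) p e1 \<subseteq> V"
 proof
  fix z assume z: "z \<in> Euclidean_box (n + n) p e1"
  define x y where "x = (%i. if i < n then z i else 0)" and "y = (%i. z (n + i))"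
  have zp: "\<bar>z i - p i\<bar> < e1" if "i < n + n" for i using z that unfolding Euclidean_box_def by simp
  have "\<bar>x i - \<phi> \<one> i\<bar> < e1" "\<bar>y i - \<phi> \<one> i\<bar> < e1" if "i < n" for i
   using zp[of i] zp[of "n + i"] that by (simp_all add: x_def y_def p_def \<psi>1 \<psi>2)
  moreover have "y i = 0" if "i >= n" for i using z that unfolding Euclidean_box_def topspace_Euclidean_space y_def by simp
  ultimately have "x \<in> Euclidean_box n (\<phi> \<one>) e1" "y \<in> Euclidean_box n (\<phi> \<one>) e1"
   unfolding Euclidean_box_def topspace_Euclidean_space by (simp_all add: x_def)
  then obtain u v where uv: "u \<in> U" "v \<in> U" "u \<in> B e0" "v \<in> B e0" "x = \<phi> u" "y = \<phi> v" using e1(2) by blast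
  have "z = P (u, v)" unfolding P_def prod.case uv(5,6)[symmetric] by (auto simp: \<psi>_def x_def y_def fun_eq_iff)
  then show "z \<in> V" unfolding V_def using uv(1-4) e0(2) by auto
 qed
 have add: "\<exists>d>0. \<forall>u\<in>B d. \<forall>v\<in>B d. \<bar>\<nu> (u \<otimes> v) i - \<nu> u i - \<nu> v i\<bar> <= e * coord_norm n (\<nu> v)" if i: "i < n" and e: "e > 0" for i e
 proof -
  \<comment> \<open>There are two increments, each with an error summed over \<open>n\<close>
    coordinates.\<close>
  define e' where "e' = e / (2 * real n)"
  have e': "e' > 0" using e i by (simp add: e'_def)
  obtain g where g: "\<And>k x. k < n + n ==> x \<in> V ==> ((%t. F i (x(k := t))) has_real_derivative g k x) (at (x k))"
   "\<And>k. k < n + n ==> continuous_map (subtopology (Euclidean_space (n + n)) V) euclideanreal (g k)"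
   using C_k_on_derivatives[OF F_smooth[OF i]] by blast
  have pE: "p \<in> Euclidean_box (n + n) p e1" using e1(1) \<phi>0[OF A(2)] unfolding Euclidean_box_def topspace_Euclidean_space p_def \<psi>_def by auto
  then have pV: "p \<in> topspace (subtopology (Euclidean_space (n + n)) V)" using boxV unfolding Euclidean_box_def by auto
  have "\<exists>d>0. \<forall>x\<in>Euclidean_box (n + n) p d \<inter> V. \<bar>g k x - g k p\<bar> < e'" if k: "k < n + n" for k
  proof -
   define Q where "Q = {x \<in> topspace (subtopology (Euclidean_space (n + n)) V). g k x \<in> {g k p - e'<..<g k p + e'}}"
   have "openin (subtopology (Euclidean_space (n + n)) V) Q"
    unfolding Q_def by (intro openin_continuous_map_preimage[OF g(2)[OF k]]) simp
   then obtain S where S: "openin (Euclidean_space (n + n)) S" "Q = S \<inter> V" unfolding openin_subtopology by blast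
   have "p \<in> Q" using pV e' unfolding Q_def by simp
   then obtain d where d: "d > 0" "Euclidean_box (n + n) p d \<subseteq> S" using Euclidean_box_exists[OF S(1)] S(2) by blast
   have "\<bar>g k x - g k p\<bar> < e'" if "x \<in> Euclidean_box (n + n) p d \<inter> V" for x
   proof -
    have "x \<in> Q" using S(2) d(2) that by blast
    then show ?thesis unfolding Q_def by (auto simp: abs_less_iff)
   qed
   then show ?thesis using d(1) by blast
  qed
  then obtain D where D: "\<And>k. k < n + n ==> D k > 0" "\<And>k x. k < n + n ==> x \<in> Euclidean_box (n + n) p (D k) ==> x \<in> V ==> \<bar>g k x - g k p\<bar> < e'" by (metis IntI)
  define d where "d = Min (insert e1 (D ` {..<n + n}))"
  have d: "d > 0" "d <= e1" "\<And>k. k < n + n ==> d <= D k" using D(1) e1(1) by (auto simp: d_def)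
  have dV: "x \<in> V" if "x \<in> Euclidean_box (n + n) p d" for x using that boxV Euclidean_box_mono[OF d(2)] by blast
  have inc: "\<bar>F i z - F i z' - (\<Sum>k<n + n. g k p * (z k - z' k))\<bar> <= e' * (\<Sum>k<n + n. \<bar>z k - z' k\<bar>)"
   if z: "z \<in> Euclidean_box (n + n) p d" "z' \<in> Euclidean_box (n + n) p d" for z z'
  proof (rule C1_increment[OF _ _ z])
   fix x k assume x: "x \<in> Euclidean_box (n + n) p d" "k < n + n"
   show "((%t. F i (x(k := t))) has_real_derivative g k x) (at (x k))" by (rule g(1)[OF x(2) dV[OF x(1)]])
   show "\<bar>g k x - g k p\<bar> <= e'" using D(2)[OF x(2) _ dV[OF x(1)]] x(1) Euclidean_box_mono[OF d(3)[OF x(2)]] by (meson less_imp_le subsetD)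
  qed
  have "\<bar>\<nu> (u \<otimes> v) i - \<nu> u i - \<nu> v i\<bar> <= e * coord_norm n (\<nu> v)" if uv: "u \<in> B d" "v \<in> B d" for u v
  proof -
   have U: "u \<in> U" "v \<in> U" and c: "u \<in> carrier G" "v \<in> carrier G" using uv B_in unfolding B_eq by auto
   have box: "\<psi> (\<phi> u) (\<phi> v) \<in> Euclidean_box (n + n) p d" if "u \<in> B d" "v \<in> B d" for u v
    using that \<phi>0[of v] unfolding Euclidean_box_def topspace_Euclidean_space p_def B_eq \<nu>_def \<psi>_def by auto
   \<comment> \<open>The two points share the first \<open>n\<close> coordinates, so only the last
     \<open>n\<close> contribute.\<close>
   have split: "(\<Sum>k<n + n. f k (\<psi> x y k - \<psi> x y' k)) = (\<Sum>k<n. f (n + k) (y k - y' k))"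
    if f: "\<And>k. f k 0 = 0" for f :: "nat => real => real" and x y y'
   proof -
    have "(\<Sum>k<n + n. f k (\<psi> x y k - \<psi> x y' k)) = (\<Sum>k<n. f k (\<psi> x y k - \<psi> x y' k)) + (\<Sum>k<n. f (n + k) (\<psi> x y (n + k) - \<psi> x y' (n + k)))"
     by (simp add: lessThan_atLeast0 sum.atLeastLessThan_concat[of 0 n "n + n", symmetric] sum.shift_bounds_nat_ivl[of _ 0 n n, simplified] add.commute)
    also have "(\<Sum>k<n. f k (\<psi> x y k - \<psi> x y' k)) = 0" using f by (intro sum.neutral) (simp add: \<psi>1)
    finally show ?thesis by (simp add: \<psi>2)
   qed
   have half: "\<bar>\<phi> (w \<otimes> v) i - \<phi> w i - (\<Sum>k<n. g (n + k) p * \<nu> v k)\<bar> <= e' * (\<Sum>k<n. \<bar>\<nu> v k\<bar>)" if w: "w \<in> B d" for w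
   proof -
    have wU: "w \<in> U" "w \<in> carrier G" using w B_in unfolding B_eq by auto
    from inc[OF box[OF w uv(2)] box[OF w B1[OF d(1)]]]
    have "\<bar>\<phi> (w \<otimes> v) i - \<phi> (w \<otimes> \<one>) i - (\<Sum>k<n. g (n + k) p * (\<phi> v k - \<phi> \<one> k))\<bar> <= e' * (\<Sum>k<n. \<bar>\<phi> v k - \<phi> \<one> k\<bar>)"
     unfolding F_eq[OF wU(1) U(2)] F_eq[OF wU(1) A(2)]
     using split[of "%k t. g k p * t" "\<phi> w" "\<phi> v" "\<phi> \<one>"] split[of "%k t. \<bar>t\<bar>" "\<phi> w" "\<phi> v" "\<phi> \<one>"] by simp
    then show ?thesis using wU(2) unfolding \<nu>_def by simp
   qed
   have "\<bar>\<nu> (u \<otimes> v) i - \<nu> u i - \<nu> v i\<bar> <= 2 * (e' * (\<Sum>k<n. \<bar>\<nu> v k\<bar>))"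
    using half[OF uv(1)] half[OF B1[OF d(1)]] c unfolding \<nu>_def by simp
   also have "\<dots> <= 2 * (e' * (real n * coord_norm n (\<nu> v)))"
    using e' sum_bounded_above[of "{..<n}" "%k. \<bar>\<nu> v k\<bar>" "coord_norm n (\<nu> v)"] coord_norm_ge by (intro mult_left_mono) auto
   also have "\<dots> = e * coord_norm n (\<nu> v)" using i by (simp add: e'_def)
   finally show ?thesis .
  qed
  then show ?thesis using d(1) by blast
 qed
 have "additive_chart G B U \<nu> n"
 proof unfold_locales
  fix e :: real assume e: "e > 0"
  obtain D where D: "\<And>i. i < n ==> D i > 0" "\<And>i u v. i < n ==> u \<in> B (D i) ==> v \<in> B (D i) ==> \<bar>\<nu> (u \<otimes> v) i - \<nu> u i - \<nu> v i\<bar> <= e * coord_norm n (\<nu> v)"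
   using add[OF _ e] by metis
  define d where "d = Min (insert e0 (D ` {..<n}))"
  have d: "d > 0" "d <= e0" "\<And>k. k < n ==> d <= D k" using D(1) e0(1) by (auto simp: d_def)
  show "\<exists>d>0. \<forall>u\<in>B d. \<forall>v\<in>B d. u \<otimes> v \<in> U \<and> (\<forall>i<n. \<bar>\<nu> (u \<otimes> v) i - \<nu> u i - \<nu> v i\<bar> <= e * coord_norm n (\<nu> v))"
  proof (intro exI[of _ d] conjI ballI allI impI d(1))
   fix u v assume uv: "u \<in> B d" "v \<in> B d"
   show "u \<otimes> v \<in> U" using uv B_mono[OF d(2)] e0(2) by blast
   fix i assume i: "i < n"
   show "\<bar>\<nu> (u \<otimes> v) i - \<nu> u i - \<nu> v i\<bar> <= e * coord_norm n (\<nu> v)" using D(2)[OF i] uv B_mono[OF d(3)[OF i]] by blast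
  qed
 qed (simp_all add: B_eq \<nu>_def)
 then show thesis using that Bo Bn by blast
qed

subsection \<open>Nilsystems\<close>

text \<open>The saturation of an open set is a union of right translates by \<open>\<Gamma>\<close>,
  so the quotient map is open; compactness of \<open>X\<close> then yields finitely many
  \<open>W s\<close> that cover the group up to \<open>\<Gamma>\<close>.\<close>

lemma nilmanifold_finite_cover:
 fixes G (structure)
 assumes G: "group G" and tM: "topspace M = carrier G" and cm: "continuous_map (prod_topology M M) M (\<lambda>(x, y). x \<otimes> y)"
  and \<Gamma>: "subgroup \<Gamma> G" and X: "topspace X = lcosets \<Gamma>" "quotient_map M X (%g. g <#\<^bsub>G\<^esub> \<Gamma>)" "compact_space X"
  and W: "\<And>s. s \<in> carrier G ==> openin M (W s) \<and> s \<in> W s"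
 shows "\<exists>S. finite S \<and> S \<subseteq> carrier G \<and> (\<forall>g\<in>carrier G. \<exists>s\<in>S. \<exists>w\<in>W s. \<exists>\<gamma>\<in>\<Gamma>. g = w \<otimes> \<gamma>)"
proof -
 interpret group G by (rule G)
 define \<pi> where "\<pi> = (%g. g <#\<^bsub>G\<^esub> \<Gamma>)"
 have \<Gamma>c: "\<Gamma> \<subseteq> carrier G" using subgroup.subset[OF \<Gamma>] .
 have fib: "\<exists>\<gamma>\<in>\<Gamma>. g = w \<otimes> \<gamma>" if "\<pi> g = \<pi> w" "g \<in> carrier G" for g w
 proof -
  have "g \<otimes> \<one> \<in> \<pi> g" unfolding \<pi>_def l_coset_def using subgroup.one_closed[OF \<Gamma>] by blast
  then have "g \<in> \<pi> w" using that by simp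
  then show ?thesis unfolding \<pi>_def l_coset_def by blast
 qed
 have inv: "\<pi> (w \<otimes> \<gamma>) = \<pi> w" if "w \<in> carrier G" "\<gamma> \<in> \<Gamma>" for w \<gamma>
  using lcos_m_assoc[OF \<Gamma>c that(1), of \<gamma>] that \<Gamma>c coset_join3[of \<gamma> \<Gamma>] \<Gamma> by (auto simp: \<pi>_def)
 have opn: "openin X (\<pi> ` V)" if V: "openin M V" for V
 proof -
  have VM: "V \<subseteq> carrier G" using openin_subset[OF V] tM by simp
  have "openin M {g \<in> topspace M. g \<otimes> \<gamma> \<in> V}" if "\<gamma> \<in> \<Gamma>" for \<gamma>
  proof -
   have "continuous_map M M (%g. (\<lambda>(x, y). x \<otimes> y) (g, \<gamma>))" using that \<Gamma>c tM by (intro continuous_map_compose[OF _ cm, unfolded o_def]) (auto simp add: continuous_map_pairwise o_def)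
   then show ?thesis using openin_continuous_map_preimage[OF _ V] by simp
  qed
  then have "openin M (\<Union>\<gamma>\<in>\<Gamma>. {g \<in> topspace M. g \<otimes> \<gamma> \<in> V})" by (intro openin_Union) auto
  moreover have "(\<Union>\<gamma>\<in>\<Gamma>. {g \<in> topspace M. g \<otimes> \<gamma> \<in> V}) = {g \<in> topspace M. \<pi> g \<in> \<pi> ` V}"
  proof (intro Set.set_eqI iffI)
   fix g assume "g \<in> (\<Union>\<gamma>\<in>\<Gamma>. {g \<in> topspace M. g \<otimes> \<gamma> \<in> V})"
   then obtain \<gamma> where "\<gamma> \<in> \<Gamma>" "g \<in> topspace M" "g \<otimes> \<gamma> \<in> V" by blast
   then show "g \<in> {g \<in> topspace M. \<pi> g \<in> \<pi> ` V}" using inv[of g \<gamma>] tM by (metis (mono_tags, lifting) image_eqI mem_Collect_eq)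
  next
   fix g assume "g \<in> {g \<in> topspace M. \<pi> g \<in> \<pi> ` V}"
   then obtain w where w: "g \<in> carrier G" "w \<in> V" "\<pi> w = \<pi> g" using tM by auto
   then obtain \<gamma> where "\<gamma> \<in> \<Gamma>" "w = g \<otimes> \<gamma>" using fib[of w g] VM by blast
   then show "g \<in> (\<Union>\<gamma>\<in>\<Gamma>. {g \<in> topspace M. g \<otimes> \<gamma> \<in> V})" using w tM by auto
  qed
  moreover have "\<pi> ` V \<subseteq> topspace X" unfolding X(1) \<pi>_def using VM by (auto simp: LCOSETS_def)
  ultimately show ?thesis using X(2) unfolding quotient_map_def \<pi>_def by auto
 qed
 have "\<exists>F. finite F \<and> F \<subseteq> (%s. \<pi> ` W s) ` carrier G \<and> topspace X \<subseteq> \<Union>F"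
 proof (rule compactinD[OF X(3)[unfolded compact_space_def]])
  show "openin X U" if "U \<in> (%s. \<pi> ` W s) ` carrier G" for U using that W opn by blast
  show "topspace X \<subseteq> \<Union>((%s. \<pi> ` W s) ` carrier G)" unfolding X(1) using W by (auto simp: LCOSETS_def \<pi>_def)
 qed
 then obtain S where S: "finite S" "S \<subseteq> carrier G" "topspace X \<subseteq> (\<Union>s\<in>S. \<pi> ` W s)" by (metis finite_subset_image)
 have "\<exists>s\<in>S. \<exists>w\<in>W s. \<exists>\<gamma>\<in>\<Gamma>. g = w \<otimes> \<gamma>" if g: "g \<in> carrier G" for g
 proof -
  have "\<pi> g \<in> topspace X" unfolding X(1) \<pi>_def using g by (auto simp: LCOSETS_def)
  then obtain s w where "s \<in> S" "w \<in> W s" "\<pi> g = \<pi> w" using S(3) by blast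
  then show ?thesis using fib g by blast
 qed
 then show ?thesis using S by blast
qed

lemma nilmanifold_orbit_structured:
 fixes G (structure) and f :: "'g set => complex"
 assumes lie: "lie_group G M n A" and nilp: "nilpotent_group G" and \<Gamma>: "subgroup \<Gamma> G"
  and X: "topspace X = lcosets \<Gamma>" "quotient_map M X (%g. g <#\<^bsub>G\<^esub> \<Gamma>)" "compact_space X"
  and a: "a \<in> carrier G" "\<forall>x\<in>topspace X. T x = a <#\<^bsub>G\<^esub> x"
  and x: "x \<in> topspace X" and f: "continuous_map X euclidean f"
 shows "structured (%n. f ((T ^^ n) x))"
proof -
 have G: "group G" and tM: "topspace M = carrier G" and cm: "continuous_map (prod_topology M M) M (\<lambda>(x, y). x \<otimes> y)"
  using lie unfolding lie_group_def smooth_map_def by auto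
 obtain B U \<nu> where ac: "additive_chart G B U \<nu> n" and Bo: "\<And>d. openin M (B d)"
  and Bn: "\<And>W. openin M W ==> \<one> \<in> W ==> \<exists>d>0. B d \<subseteq> W" using lie_group_additive_chart[OF lie] by blast
 interpret additive_chart G B U \<nu> n by (rule ac)
 note finite_cover = nilmanifold_finite_cover[OF G tM cm \<Gamma> X]
 have \<Gamma>c: "\<Gamma> \<subseteq> carrier G" using subgroup.subset[OF \<Gamma>] .
 have rt: "continuous_map M M (%g. g \<otimes> s)" if "s \<in> carrier G" for s
 proof -
  have "continuous_map M M (%g. (\<lambda>(x, y). x \<otimes> y) (g, s))" using that tM by (intro continuous_map_compose[OF _ cm, unfolded o_def]) (simp add: continuous_map_pairwise o_def)
  then show ?thesis by simp
 qed
 have nbhd: "openin M {g \<in> topspace M. g \<otimes> inv s \<in> B d} \<and> s \<in> {g \<in> topspace M. g \<otimes> inv s \<in> B d}"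
  if "s \<in> carrier G" "d > 0" for s d
  using openin_continuous_map_preimage[OF rt Bo, of "inv s"] that B_one tM by simp
 have split: "w = (w \<otimes> inv s) \<otimes> s" if "w \<in> carrier G" "s \<in> carrier G" for w s using that by (simp add: m_assoc)
 interpret cocompact G B \<Gamma>
 proof (intro cocompact.intro cocompact_axioms.intro uniform_group_axioms \<Gamma>)
  fix d :: real assume d: "d > 0"
  obtain S where S: "finite S" "S \<subseteq> carrier G" "\<forall>g\<in>carrier G. \<exists>s\<in>S. \<exists>w\<in>{g \<in> topspace M. g \<otimes> inv s \<in> B d}. \<exists>\<gamma>\<in>\<Gamma>. g = w \<otimes> \<gamma>"
   using finite_cover[OF nbhd[OF _ d]] by blast
  have "\<exists>u\<in>B d. \<exists>s\<in>S. \<exists>\<gamma>\<in>\<Gamma>. g = u \<otimes> s \<otimes> \<gamma>" if "g \<in> carrier G" for g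
  proof -
   obtain s w \<gamma> where "s \<in> S" "w \<in> carrier G" "w \<otimes> inv s \<in> B d" "\<gamma> \<in> \<Gamma>" "g = w \<otimes> \<gamma>" using S(3) \<open>g \<in> carrier G\<close> tM by blast
   then show ?thesis using split[of w s] S(2) by (intro bexI[of _ "w \<otimes> inv s"] bexI[of _ s] bexI[of _ \<gamma>]) auto
  qed
  then show "\<exists>S. finite S \<and> S \<subseteq> carrier G \<and> (\<forall>g\<in>carrier G. \<exists>u\<in>B d. \<exists>s\<in>S. \<exists>\<gamma>\<in>\<Gamma>. g = u \<otimes> s \<otimes> \<gamma>)" using S(1,2) by blast
 qed
 define F where "F = (%g. f (g <#\<^bsub>G\<^esub> \<Gamma>))"
 have Fc: "continuous_map M euclidean F"
  using continuous_map_compose[OF quotient_imp_continuous_map[OF X(2)] f] by (simp add: F_def o_def)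
 have F\<Gamma>: "F (w \<otimes> \<gamma>) = F w" if "w \<in> carrier G" "\<gamma> \<in> \<Gamma>" for w \<gamma>
  using lcos_m_assoc[OF \<Gamma>c that(1), of \<gamma>] that \<Gamma>c coset_join3[of \<gamma> \<Gamma>] \<Gamma> by (auto simp: F_def)
 have F_bound: "\<exists>C. \<forall>w\<in>carrier G. norm (F w) <= C"
 proof -
  have "compactin euclidean (f ` topspace X)" using X(3) unfolding compact_space_def by (intro image_compactin[OF _ f])
  then have "bounded (f ` topspace X)" by (simp add: compact_imp_bounded)
  then obtain C where "\<forall>z\<in>topspace X. norm (f z) <= C" unfolding bounded_iff by auto
  then show ?thesis unfolding X(1) F_def LCOSETS_def by auto
 qed
 have F_uniform: "\<exists>d>0. \<forall>u\<in>B d. \<forall>w\<in>carrier G. norm (F (u \<otimes> w) - F w) < e" if e: "e > 0" for e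
 proof -
  \<comment> \<open>Continuity at \<open>s\<close>, arranged for products of two small elements: one
    leads from \<open>s\<close> to \<open>w\<close>, the other is the increment to be
    controlled.\<close>
  have "\<exists>d>0. \<forall>u\<in>B d. norm (F (u \<otimes> s) - F s) < e/2 \<and> (\<forall>v\<in>B d. norm (F (u \<otimes> v \<otimes> s) - F s) < e/2)" if s: "s \<in> carrier G" for s
  proof -
   have "continuous_map M euclidean (%g. F (g \<otimes> s))" using continuous_map_compose[OF rt[OF s] Fc] by (simp add: o_def)
   then have "openin M {u \<in> topspace M. F (u \<otimes> s) \<in> ball (F s) (e/2)}" by (rule openin_continuous_map_preimage) simp
   then obtain d where d: "d > 0" "B d \<subseteq> {u \<in> topspace M. F (u \<otimes> s) \<in> ball (F s) (e/2)}"
    using Bn[of "{u \<in> topspace M. F (u \<otimes> s) \<in> ball (F s) (e/2)}"] s e tM by auto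
   then have near: "norm (F (u \<otimes> s) - F s) < e/2" if "u \<in> B d" for u using that by (auto simp: dist_norm norm_minus_commute)
   obtain d1 where d1: "d1 > 0" "\<forall>u\<in>B d1. \<forall>v\<in>B d1. u \<otimes> v \<in> B d" using B_mult[OF d(1)] by blast
   obtain d2 where "d2 > 0" "B d2 \<subseteq> B d" "B d2 \<subseteq> B d1" using B_both[OF d(1) d1(1)] by blast
   then show ?thesis using near d1(2) by (intro exI[of _ d2]) blast
  qed
  then obtain D where D: "\<And>s. s \<in> carrier G ==> D s > 0"
   "\<And>s u. s \<in> carrier G ==> u \<in> B (D s) ==> norm (F (u \<otimes> s) - F s) < e/2"
   "\<And>s u v. s \<in> carrier G ==> u \<in> B (D s) ==> v \<in> B (D s) ==> norm (F (u \<otimes> v \<otimes> s) - F s) < e/2" by metis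
  have nb: "openin M {g \<in> topspace M. g \<otimes> inv s \<in> B (D s)} \<and> s \<in> {g \<in> topspace M. g \<otimes> inv s \<in> B (D s)}"
   if "s \<in> carrier G" for s by (rule nbhd[OF that D(1)[OF that]])
  obtain S where S: "finite S" "S \<subseteq> carrier G" "\<forall>g\<in>carrier G. \<exists>s\<in>S. \<exists>w\<in>{g \<in> topspace M. g \<otimes> inv s \<in> B (D s)}. \<exists>\<gamma>\<in>\<Gamma>. g = w \<otimes> \<gamma>"
   using finite_cover[OF nb] by blast
  define d where "d = Min (insert 1 (D ` S))"
  have d: "d > 0" "\<And>s. s \<in> S ==> d <= D s" using S(1,2) D(1) by (auto simp: d_def)
  have "norm (F (u \<otimes> g) - F g) < e" if u: "u \<in> B d" and g: "g \<in> carrier G" for u g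
  proof -
   obtain s w \<gamma> where s: "s \<in> S" "w \<in> carrier G" "w \<otimes> inv s \<in> B (D s)" "\<gamma> \<in> \<Gamma>" "g = w \<otimes> \<gamma>" using S(3) g tM by blast
   define v where "v = w \<otimes> inv s"
   have c: "s \<in> carrier G" "u \<in> carrier G" "v \<in> carrier G" "\<gamma> \<in> carrier G" using s(1,4) S(2) u B_in s(3) \<Gamma>c unfolding v_def by auto
   have w: "w = v \<otimes> s" unfolding v_def using split[OF s(2) c(1)] .
   have "F g = F (v \<otimes> s)" unfolding s(5) using F\<Gamma>[OF s(2,4)] w by simp
   moreover have "F (u \<otimes> g) = F (u \<otimes> v \<otimes> s)" unfolding s(5) w using F\<Gamma>[of "u \<otimes> v \<otimes> s" \<gamma>] c s(4) by (simp add: m_assoc)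
   moreover have "norm (F (v \<otimes> s) - F s) < e/2" using D(2)[OF c(1)] s(3) unfolding v_def by blast
   moreover have "norm (F (u \<otimes> v \<otimes> s) - F s) < e/2" using D(3)[OF c(1)] s(3) u B_mono[OF d(2)[OF s(1)]] unfolding v_def by blast
   ultimately show ?thesis using norm_triangle_half_l[of "F (u \<otimes> v \<otimes> s)" "F s" e "F (v \<otimes> s)"] by (simp add: norm_minus_commute)
  qed
  then show ?thesis using d(1) by blast
 qed
 obtain h where h: "h \<in> carrier G" "x = h <#\<^bsub>G\<^esub> \<Gamma>" using x unfolding X(1) LCOSETS_def by auto
 \<comment> \<open>Conjugation by \<open>h\<close> moves the base point to the identity coset: the
   orbit becomes \<open>h \<otimes> \<tau> [^] m\<close> modulo \<open>\<Gamma>\<close>, and the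
   powers of \<open>\<tau>\<close> stay in any subgroup that contains \<open>\<tau>\<close>.\<close>
 define \<tau> where "\<tau> = inv h \<otimes> a \<otimes> h"
 have \<tau>: "\<tau> \<in> carrier G" "a \<otimes> h = h \<otimes> \<tau>" unfolding \<tau>_def using a(1) h(1) by (simp_all add: m_assoc[symmetric])
 have orbit: "(T ^^ m) x = (h \<otimes> \<tau> [^] m) <#\<^bsub>G\<^esub> \<Gamma>" for m
 proof (induction m)
  case (Suc m)
  have c: "h \<otimes> \<tau> [^] m \<in> carrier G" using h(1) \<tau>(1) by simp
  then have "(h \<otimes> \<tau> [^] m) <#\<^bsub>G\<^esub> \<Gamma> \<in> topspace X" unfolding X(1) LCOSETS_def by auto
  then have "(T ^^ Suc m) x = a <#\<^bsub>G\<^esub> ((h \<otimes> \<tau> [^] m) <#\<^bsub>G\<^esub> \<Gamma>)" using a(2) Suc by simp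
  also have "\<dots> = (a \<otimes> (h \<otimes> \<tau> [^] m)) <#\<^bsub>G\<^esub> \<Gamma>" using lcos_m_assoc[OF \<Gamma>c a(1) c] .
  also have "a \<otimes> (h \<otimes> \<tau> [^] m) = (a \<otimes> h) \<otimes> \<tau> [^] m" using a(1) h(1) \<tau>(1) by (simp add: m_assoc)
  also have "\<dots> = h \<otimes> (\<tau> \<otimes> \<tau> [^] m)" unfolding \<tau>(2) using h(1) \<tau>(1) by (simp add: m_assoc)
  also have "\<tau> \<otimes> \<tau> [^] m = \<tau> [^] Suc m" using nat_pow_Suc2[OF \<tau>(1), of m] by simp
  finally show ?case .
 qed (use h in simp)
 have "\<exists>H. minimal_admissible \<tau> H"
 proof (rule minimal_admissible_exists[OF \<tau>(1)])
  fix K u assume *: "\<And>i. closed_subgroup (K i) \<and> K (Suc i) \<subseteq> K i \<and> u i \<in> K i - K (Suc i)"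
  show "\<exists>d>0. \<forall>i0. \<exists>i\<ge>i0. u i \<notin> B d" by (rule no_small_chain[of K u, OF *])
 qed
 then obtain H where H: "minimal_admissible \<tau> H" by blast
 let ?H = "G\<lparr>carrier := H\<rparr>"
 interpret H: good_group ?H "%d. B d \<inter> H" "\<Gamma> \<inter> H" \<tau> by (rule minimal_admissible_good_group[OF \<tau>(1) H])
 have SH: "subgroup H G" using H unfolding minimal_admissible_def[OF \<tau>(1)] by (blast intro: admissibleD(1)[OF \<tau>(1)])
 have Hc: "w \<in> H ==> w \<in> carrier G" for w using subgroup.mem_carrier[OF SH] .
 obtain k where k: "lower_central_series G k = {\<one>}" using nilp unfolding nilpotent_group_def by blast
 \<comment> \<open>Invariance under the \<open>k\<close>-th term costs nothing: the series of
   \<open>H\<close> lies inside that of \<open>G\<close>, so this term is trivial.\<close>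
 have "H.co.nice (lower_central_series ?H k) (%w. F (h \<otimes> w))"
  unfolding H.co.nice_def
 proof (intro conjI allI impI)
  show "\<exists>C. \<forall>w\<in>carrier ?H. norm (F (h \<otimes> w)) <= C" using F_bound h(1) Hc by force
  show "\<forall>w\<in>carrier ?H. \<forall>\<gamma>\<in>\<Gamma> \<inter> H. F (h \<otimes> (w \<otimes>\<^bsub>?H\<^esub> \<gamma>)) = F (h \<otimes> w)"
   using F\<Gamma>[of "h \<otimes> _"] h(1) Hc by (auto simp: m_assoc[symmetric])
  show "\<forall>w\<in>carrier ?H. \<forall>m\<in>lower_central_series ?H k. F (h \<otimes> (m \<otimes>\<^bsub>?H\<^esub> w)) = F (h \<otimes> w)"
   using lower_central_series_subgroup(1)[OF \<tau>(1) SH, of k] k Hc by force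
  fix e :: real assume "e > 0"
  then obtain d where d: "d > 0" "\<forall>u\<in>B d. \<forall>w\<in>carrier G. norm (F (u \<otimes> w) - F w) < e" using F_uniform by blast
  obtain d' where d': "d' > 0" "\<forall>u\<in>B d'. h \<otimes> u \<otimes> inv h \<in> B d" using B_conj[OF d(1) h(1)] by blast
  have "norm (F (h \<otimes> (u \<otimes> w)) - F (h \<otimes> w)) < e" if u: "u \<in> B d'" and w: "w \<in> H" for u w
  proof -
   have "u \<in> carrier G" "w \<in> carrier G" using B_in[OF u] Hc[OF w] by auto
   moreover from this have "inv h \<otimes> (h \<otimes> w) = w" using h(1) by (simp add: m_assoc[symmetric])
   ultimately have "h \<otimes> (u \<otimes> w) = (h \<otimes> u \<otimes> inv h) \<otimes> (h \<otimes> w)" "h \<otimes> w \<in> carrier G"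
    using h(1) by (simp_all add: m_assoc)
   then show ?thesis using d(2) d'(2) u by simp
  qed
  then show "\<exists>d>0. \<forall>u\<in>B d \<inter> H. \<forall>w\<in>carrier ?H. norm (F (h \<otimes> (u \<otimes>\<^bsub>?H\<^esub> w)) - F (h \<otimes> w)) < e"
   using d'(1) by (intro exI[of _ d']) auto
 qed
 from H.orbit_structured[OF this, of "\<one>"]
 have "structured (%m. F (h \<otimes> (\<tau> [^]\<^bsub>?H\<^esub> m \<otimes> \<one>)))" using subgroup.one_closed[OF SH] by simp
 then show ?thesis unfolding orbit F_def using nat_pow_consistent[of \<tau> _ H, symmetric] \<tau>(1) by simp
qed

theorem nilsystem_orbit_structured:
 fixes f :: "'g set => complex"
 assumes "nilsystem X T" "x \<in> topspace X" "continuous_map X euclidean f"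
 shows "structured (%n. f ((T ^^ n) x))"
 using assms(1) nilmanifold_orbit_structured[OF _ _ _ _ _ _ _ _ assms(2,3)] unfolding nilsystem_def by blast

theorem theoremC:
  fixes X :: "'g set topology" and T :: "'g set \<Rightarrow> 'g set"
    and Y :: "'y topology" and S :: "nat \<Rightarrow> 'y \<Rightarrow> 'y"
  assumes "multiplicative_tds Y S"
    and "finitely_generated Y S"
    and "nilsystem X T"
    and "additive_aperiodic X T \<or> multiplicative_aperiodic Y S"
  shows "disjoint_systems X T Y S"
  unfolding disjoint_systems_def
proof (intro ballI allI impI)
  fix x :: "'g set" and f :: "'g set \<Rightarrow> complex" and y :: 'y and g :: "'y \<Rightarrow> complex"
  assume x: "x \<in> topspace X" "continuous_map X euclidean f" and y: "y \<in> topspace Y" "continuous_map Y euclidean g"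
  show "asymptotically_uncorrelated (\<lambda>n. f ((T ^^ n) x)) (\<lambda>n. g (S n y))"
  proof (rule structured_uncorrelated)
    show "structured (\<lambda>n. f ((T ^^ n) x))" by (rule nilsystem_orbit_structured[OF assms(3) x])
    show "dilation_finite (\<lambda>n. g (S n y))" by (rule multiplicative_dilation_finite[OF assms(1,2) y])
    show "(\<forall>P. periodic_sequence P \<longrightarrow> asymptotically_uncorrelated P (\<lambda>n. f ((T ^^ n) x))) \<or>
      (\<forall>P. periodic_sequence P \<longrightarrow> asymptotically_uncorrelated P (\<lambda>n. g (S n y)))"
      using assms(4) x y unfolding additive_aperiodic_def multiplicative_aperiodic_def by blast
  qed
qed

end
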